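(* Let $a=(a_1,a_2)\in\mathbb C^2$ and $r>0$, let $B_1=\{z\in\mathbb C^2:|z_1|^2+|z_2|^2<1\}$ and $B_2=\{z\in\mathbb C^2:|z_1-a_1|^2+|z_2-a_2|^2<r^2\}$ have boundaries with nonempty, real transversal intersection, and let $\Omega=B_1\cap B_2$. Let $q$ be a complex tangent point of $\partial B_1\cap\partial B_2$, let $p$ be the other one, and let $\theta\in(-\pi,\pi)\setminus\{0\}$ be defined by $p-a=re^{i\theta}p$. With $F_{j+1}$ ($j\ge0$) as in the context, let $h>0$ be such that $$F_{j+1}(-x-ih)\neq0\quad\text{for all }x\in\mathbb R,\ j\ge 0 .$$ For each $j\ge0$ let $\{\xi_{j,k}\}_k$ be an enumeration of the (distinct) zeros of $F_{j+1}$ in the strip $-h<\operatorname{Im}\xi<0$. Then there are polynomials $P_{j,k}$ in one variable, with $P_{j,k}$ of degree one less than the multiplicity of the zero $\xi_{j,k}$ of $F_{j+1}$, such that $$\begin{aligned}K_\Omega(z,\zeta)=\sum_{j\ge0}\sum_{k}\;&\frac{\langle z-q,{}^{T}a\rangle^{j}\;\overline{\langle\zeta-q,{}^{T}a\rangle}^{\,j}}{\langle z-q,a\rangle^{-\frac{i\xi_{j,k}}{2}+\frac{j+3}{2}}\;\overline{\langle\zeta-q,a\rangle}^{\,\frac{i\xi_{j,k}}{2}+\frac{j+3}{2}}}\\ &\cdot\big(\langle z-q,a\rangle-2ir\sin\theta\big)^{-\frac{i\xi_{j,k}}{2}-\frac{j+3}{2}}\;\overline{\big(\langle\zeta-q,a\rangle-2ir\sin\theta\big)}^{\,\frac{i\xi_{j,k}}{2}-\frac{j+3}{2}}\\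 &\cdot P_{j,k}\!\left(\log\frac{\langle z-q,a\rangle\;\overline{(\langle\zeta-q,a\rangle-2ir\sin\theta)}}{\overline{\langle\zeta-q,a\rangle}\;(\langle z-q,a\rangle-2ir\sin\theta)}\right)\\ &+O\!\left(|\langle z-q,a\rangle|^{\frac{h-3}{2}}\right)\end{aligned}$$ as $z\to q$ in $\Omega$, uniformly as $\zeta$ ranges over any compact subset of $\Omega$.
   Context: $K_\Omega(z,\zeta)$ is the Bergman kernel of $\Omega$: $\overline{K_\Omega(z,\cdot)}$ is holomorphic and square-integrable on $\Omega$ for all $z$, and $\int_\Omega K_\Omega(z,\zeta)f(\zeta)\,dV_\zeta=f(z)$ for all holomorphic square-integrable $f$ on $\Omega$. $\langle z,w\rangle=z_1\overline{w_1}+z_2\overline{w_2}$, and ${}^{T}a=(\overline{a_2},-\overline{a_1})$. A complex tangent point is a point of $\partial B_1\cap\partial B_2$ at which the maximal complex subspaces of the tangent spaces of the two spheres coincide. There are exactly two; with $\rho=|a|=\sqrt{|a_1|^2+|a_2|^2}$ they are $\frac{e^{\pm i\chi}}{\rho}a$, where $\cos\chi=\frac{1+\rho^2-r^2}{2\rho}\in(-1,1)$. For $r>0$ and $0<|\theta|<\pi$ let $$\psi_{r,\theta}(v)=\min\{\cos v,\ r\cos(v+\theta)\},\qquad J=\begin{cases}(-\frac\pi2,\frac\pi2-\theta),&\theta>0,\\(-\frac\pi2-\theta,\frac\pi2),&\theta<0,\end{cases}$$ and for $j=0,1,2,\dots$ define the entire function $$F_{j+1}(\xi)=\int_J e^{-v\xi}\,\psi_{r,\theta}(v)^{j+1}\,dv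 .$$ The functions $\langle z-q,a\rangle$ and $\langle z-q,a\rangle-2ir\sin\theta$ have no zeros on the convex set $\Omega$; the complex powers and the logarithm are formed with fixed holomorphic branches in $z\in\Omega$ (and anti-holomorphic branches in $\zeta\in\Omega$). Overlines act on the base only, i.e. $\overline{X}^{\,s}=(\overline X)^s$. The double sum has only finitely many terms. *)

theory Defs
  imports "HOL-Complex_Analysis.Complex_Analysis" "HOL-Computational_Algebra.Polynomial"
begin

definition herm :: "complex ^ 2 \<Rightarrow> complex ^ 2 \<Rightarrow> complex" where
  "herm z w = z $ 1 * cnj (w $ 1) + z $ 2 * cnj (w $ 2)"

definition tconj :: "complex ^ 2 \<Rightarrow> complex ^ 2" where
  "tconj a = vector [cnj (a $ 2), - cnj (a $ 1)]"

text \<open>Holomorphy on open subsets of complex 2-space: real differentiability with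
  complex linear derivative.\<close>

definition holomorphic2_on :: "(complex ^ 2 \<Rightarrow> complex) \<Rightarrow> (complex ^ 2) set \<Rightarrow> bool" where
  "holomorphic2_on f S \<longleftrightarrow>
     (\<forall>z\<in>S. \<exists>D. (f has_derivative D) (at z) \<and> (\<forall>c v. D (c *s v) = c * D v))"

definition antiholomorphic2_on :: "(complex ^ 2 \<Rightarrow> complex) \<Rightarrow> (complex ^ 2) set \<Rightarrow> bool" where
  "antiholomorphic2_on f S \<longleftrightarrow> holomorphic2_on (\<lambda>z. cnj (f z)) S"

definition bergman_space :: "(complex ^ 2) set \<Rightarrow> (complex ^ 2 \<Rightarrow> complex) set" where
  "bergman_space \<Omega> =
     {f. holomorphic2_on f \<Omega> \<and> set_integrable lborel \<Omega> (\<lambda>z. (norm (f z))\<^sup>2)}"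

text \<open>The values of \<open>K\<close> outside \<open>\<Omega> \<times> \<Omega>\<close> are irrelevant.\<close>

definition is_bergman_kernel ::
    "(complex ^ 2) set \<Rightarrow> (complex ^ 2 \<Rightarrow> complex ^ 2 \<Rightarrow> complex) \<Rightarrow> bool" where
  "is_bergman_kernel \<Omega> K \<longleftrightarrow>
     (\<forall>z\<in>\<Omega>. (\<lambda>\<zeta>. cnj (K z \<zeta>)) \<in> bergman_space \<Omega>) \<and>
     (\<forall>f\<in>bergman_space \<Omega>. \<forall>z\<in>\<Omega>. (LINT \<zeta>:\<Omega>|lborel. K z \<zeta> * f \<zeta>) = f z)"

text \<open>The real tangent space at \<open>x\<close> of the sphere with centre \<open>c\<close> through \<open>x\<close>: the kernel
  of the derivative of the defining function, the squared distance to \<open>c\<close>.\<close>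

definition tangent_space_sphere :: "complex ^ 2 \<Rightarrow> complex ^ 2 \<Rightarrow> (complex ^ 2) set" where
  "tangent_space_sphere c x = {v. frechet_derivative (\<lambda>y. (norm (y - c))\<^sup>2) (at x) v = 0}"

definition max_complex_subspace :: "(complex ^ 2) set \<Rightarrow> (complex ^ 2) set" where
  "max_complex_subspace T = {v \<in> T. \<i> *s v \<in> T}"

definition transversal_spheres :: "complex ^ 2 \<Rightarrow> real \<Rightarrow> complex ^ 2 \<Rightarrow> real \<Rightarrow> bool" where
  "transversal_spheres c s d t \<longleftrightarrow>
     (\<forall>x \<in> sphere c s \<inter> sphere d t.
        {u + v | u v. u \<in> tangent_space_sphere c x \<and> v \<in> tangent_space_sphere d x} = UNIV)"

definition complex_tangent_point ::
    "complex ^ 2 \<Rightarrow> real \<Rightarrow> complex ^ 2 \<Rightarrow> real \<Rightarrow> complex ^ 2 \<Rightarrow> bool" where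
  "complex_tangent_point c s d t x \<longleftrightarrow>
     x \<in> sphere c s \<inter> sphere d t \<and>
     max_complex_subspace (tangent_space_sphere c x) =
       max_complex_subspace (tangent_space_sphere d x)"

definition psi :: "real \<Rightarrow> real \<Rightarrow> real \<Rightarrow> real" where
  "psi r \<theta> v = min (cos v) (r * cos (v + \<theta>))"

definition Jint :: "real \<Rightarrow> real set" where
  "Jint \<theta> = (if \<theta> > 0 then {- pi / 2 <..< pi / 2 - \<theta>} else {- pi / 2 - \<theta> <..< pi / 2})"

definition F :: "real \<Rightarrow> real \<Rightarrow> nat \<Rightarrow> complex \<Rightarrow> complex" where
  "F r \<theta> n \<xi> =
     integral (Jint \<theta>) (\<lambda>v. exp (- (of_real v * \<xi>)) * of_real (psi r \<theta> v ^ n))"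

text \<open>The index set of the double sum: all pairs of some \<open>j\<close> and a zero of \<open>F r \<theta> (j + 1)\<close>
  in the strip. The zeros serve as their own labels.\<close>

definition strip_zeros :: "real \<Rightarrow> real \<Rightarrow> real \<Rightarrow> (nat \<times> complex) set" where
  "strip_zeros r \<theta> h = {(j, \<xi>). F r \<theta> (j + 1) \<xi> = 0 \<and> - h < Im \<xi> \<and> Im \<xi> < 0}"

definition hol_log_branch ::
    "(complex ^ 2) set \<Rightarrow> (complex ^ 2 \<Rightarrow> complex) \<Rightarrow> (complex ^ 2 \<Rightarrow> complex) \<Rightarrow> bool" where
  "hol_log_branch \<Omega> g L \<longleftrightarrow> holomorphic2_on L \<Omega> \<and> (\<forall>z\<in>\<Omega>. exp (L z) = g z)"

definition antihol_log_branch ::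
    "(complex ^ 2) set \<Rightarrow> (complex ^ 2 \<Rightarrow> complex) \<Rightarrow> (complex ^ 2 \<Rightarrow> complex) \<Rightarrow> bool" where
  "antihol_log_branch \<Omega> g L \<longleftrightarrow> antiholomorphic2_on L \<Omega> \<and> (\<forall>\<zeta>\<in>\<Omega>. exp (L \<zeta>) = g \<zeta>)"

text \<open>The power \<open>g z ^ s\<close> formed with the branch \<open>L\<close> of \<open>log g\<close>.\<close>

definition bpow :: "(complex ^ 2 \<Rightarrow> complex) \<Rightarrow> complex ^ 2 \<Rightarrow> complex \<Rightarrow> complex" where
  "bpow L z s = exp (s * L z)"

end

theory Submission
  imports Defs
begin

text \<open>
The expansion comes from a change of coordinates in which the lens domain becomes invariant under
a translation and a rotation, so that its Bergman kernel can be written down by Fourier analysis.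

Let \<open>q\<close> and \<open>p\<close> be the tangent points and put \<open>d = 1 - r exp (i \<theta>)\<close>, \<open>c = 2 i r sin \<theta>\<close>. Then \<open>a\<close> is
\<open>d\<close> times \<open>p\<close> and also the conjugate of \<open>d\<close> times \<open>q\<close>. In the coordinates \<open>x = \<langle>z - q, a\<rangle>\<close> and
\<open>w = \<langle>z - q, \<^sup>Ta\<rangle>\<close> the two balls become the two conditions \<open>|w|\<^sup>2 < Re (\<kappa> x cnj (x - c))\<close> and
\<open>|w|\<^sup>2 < Re (r exp (i \<theta>) \<kappa> x cnj (x - c))\<close> with a constant \<open>\<kappa>\<close>. The Moebius map \<open>x \<mapsto> \<kappa> x / (x - c)\<close> sends \<open>q\<close>
to \<open>0\<close> and \<open>p\<close> to infinity, and its logarithm \<open>s\<close> together with \<open>b = w / ((x - c) exp (s / 2))\<close> maps the lens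
onto the model domain \<open>|b|\<^sup>2 < \<psi> (Im s)\<close> over a horizontal strip; \<open>q\<close> is the end \<open>Re s \<rightarrow> - \<infinity>\<close>.

Expanding in powers of \<open>b\<close>, the \<open>j\<close>-th coefficient of a square integrable holomorphic function on the
model lies in a Bergman space of the strip with weight \<open>\<psi> ^ (j + 1)\<close>. Because the weight depends on
\<open>Im s\<close> only, the reproducing kernel of that space is, up to a constant, the Fourier integral of
\<open>exp (i \<xi> \<tau> / 2) / F\<^sub>j\<^sub>+\<^sub>1 (\<xi>)\<close> in \<open>\<tau> = s - cnj s\<^sub>0\<close> (\<open>strip_reproducing\<close>), and the Bergman kernel of the lens is the
sum of these over \<open>j\<close> (\<open>kernel_sums\<close>).

Moving the line of integration from \<open>Im \<xi> = 0\<close> to \<open>Im \<xi> = - h\<close> picks up the residues at the zeros of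
\<open>F\<^sub>j\<^sub>+\<^sub>1\<close> in between (\<open>kern_shift\<close>), and the shifted integral carries the factor \<open>exp (h Re \<tau> / 2)\<close>, which
is of the size of \<open>|x|\<close> to the power \<open>h / 2\<close>; the Jacobian of the coordinate change contributes \<open>|x|\<close> to the
power \<open>- 3 / 2\<close>. This gives the error term (\<open>kernel_remainder_bound\<close>, \<open>remainder_growth\<close>). That only finitely many residues occur and that
the shifted integrals can be summed over \<open>j\<close> rests on comparing \<open>F\<^sub>n (x - i y)\<close> with the positive
number \<open>F\<^sub>n (x)\<close>: by midpoint log-concavity of \<open>\<psi>\<close> the measures \<open>\<psi> (v) ^ n exp (- v x) dv\<close> concentrate as \<open>n\<close> grows, so
that for large \<open>n\<close> there is no cancellation (\<open>F_norm_ge_large_n\<close>, \<open>F_norm_ge_on_line_uniform\<close>).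

At a zero of order \<open>m\<close> the residue is \<open>exp (i \<xi> \<tau> / 2)\<close> times a polynomial of degree \<open>m - 1\<close> in \<open>\<tau>\<close>
(\<open>residue_exp_over_zero\<close>). Two branches of a logarithm on a connected set differ by a constant, so
passing from \<open>s\<close> to the given branches changes the polynomial by an affine substitution and a nonzero
factor (\<open>residue_term_branches\<close>).
\<close>

section \<open>Area and volume under holomorphic changes of variables\<close>

text \<open>The theorem on change of variables is about Euclidean spaces of vectors; this isometry carries it to the complex plane.\<close>

definition vec_to_complex :: "real ^ 2 \<Rightarrow> complex" where
  "vec_to_complex v = Complex (v $ 1) (v $ 2)"

definition complex_to_vec :: "complex \<Rightarrow> real ^ 2" where
  "complex_to_vec z = vector [Re z, Im z]"

lemma vec_to_complex_to_vec [simp]: "vec_to_complex (complex_to_vec z) = z"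
  by (simp add: vec_to_complex_def complex_to_vec_def)

lemma complex_to_vec_to_complex [simp]: "complex_to_vec (vec_to_complex v) = v"
  by (simp add: vec_to_complex_def complex_to_vec_def vec_eq_iff forall_2)

lemma bounded_linear_vec_to_complex: "bounded_linear vec_to_complex"
  by (rule linear_conv_bounded_linear[THEN iffD1], rule linearI)
     (auto simp: vec_to_complex_def complex_eq_iff)

lemma bounded_linear_complex_to_vec: "bounded_linear complex_to_vec"
  by (rule linear_conv_bounded_linear[THEN iffD1], rule linearI)
     (auto simp: complex_to_vec_def vec_eq_iff forall_2)

lemma borel_vec_to_complex [measurable]: "vec_to_complex \<in> borel_measurable borel"
  by (intro borel_measurable_continuous_onI linear_continuous_on bounded_linear_vec_to_complex)

lemma axis_in_Basis_real2: "(Basis :: (real^2) set) = {axis 1 1, axis 2 1}"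
  by (auto simp: Basis_vec_def UNIV_2)

lemma axis_1_neq_2: "axis (1::2) (1::real) \<noteq> axis 2 1"
  by (simp add: axis_eq_axis)

lemma lborel_complex_eq_distr: "lborel = distr lborel borel vec_to_complex"
proof (rule lborel_eqI)
  fix l u :: complex
  assume le: "\<And>b. b \<in> Basis \<Longrightarrow> l \<bullet> b \<le> u \<bullet> b"
  have eq: "vec_to_complex -` box l u = box (complex_to_vec l) (complex_to_vec u)"
    by (auto simp: vec_to_complex_def complex_to_vec_def mem_box axis_in_Basis_real2
        Basis_complex_def inner_axis)
  have le': "Re l \<le> Re u" "Im l \<le> Im u"
    using le[of 1] le[of \<i>] by (auto simp: Basis_complex_def)
  have "emeasure (distr lborel borel vec_to_complex) (box l u)
      = emeasure lborel (box (complex_to_vec l) (complex_to_vec u))"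
    by (subst emeasure_distr) (auto simp: eq)
  also have "\<dots> = (\<Prod>b\<in>Basis. (complex_to_vec u - complex_to_vec l) \<bullet> b)"
    by (rule emeasure_lborel_box)
      (use le' in \<open>auto simp: axis_in_Basis_real2 inner_axis complex_to_vec_def\<close>)
  also have "\<dots> = (\<Prod>b\<in>Basis. (u - l) \<bullet> b)"
    by (simp add: axis_in_Basis_real2 axis_1_neq_2 inner_axis complex_to_vec_def Basis_complex_def)
  finally show "emeasure (distr lborel borel vec_to_complex) (box l u)
      = (\<Prod>b\<in>Basis. (u - l) \<bullet> b)" .
qed simp

lemma nn_integral_complex_eq_vec:
  assumes "f \<in> borel_measurable borel"
  shows "(\<integral>\<^sup>+z. f z \<partial>lborel) = (\<integral>\<^sup>+v. f (vec_to_complex v) \<partial>lborel)"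
  by (subst lborel_complex_eq_distr, subst nn_integral_distr) (use assms in auto)

lemma emeasure_differentiable_image:
  fixes f :: "real^2 \<Rightarrow> real^2"
  assumes S: "S \<in> sets borel" and img: "f ` S \<in> sets borel"
    and der: "\<And>x. x \<in> S \<Longrightarrow> (f has_derivative f' x) (at x within S)"
    and inj: "inj_on f S"
    and meas: "(\<lambda>x. indicator S x * \<bar>det (matrix (f' x))\<bar>) \<in> borel_measurable borel"
  shows "emeasure lborel (f ` S) = (\<integral>\<^sup>+x. ennreal (indicator S x * \<bar>det (matrix (f' x))\<bar>) \<partial>lborel)"
    (is "_ = ?I")
proof -
  have SL: "S \<in> sets lebesgue" using S by (simp add: sets_completionI_sets)
  note key = has_measure_differentiable_image[OF SL der inj]
  show ?thesis
  proof (cases "?I")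
    case (real r)
    then have "((\<lambda>x. indicator S x * \<bar>det (matrix (f' x))\<bar>) has_integral r) UNIV"
      by (intro nn_integral_has_integral) (use meas in auto)
    then have "((\<lambda>x. if x \<in> S then \<bar>det (matrix (f' x))\<bar> else 0) has_integral r) UNIV"
      by (rule has_integral_eq[rotated]) (auto simp: indicator_def)
    then have "((\<lambda>x. \<bar>det (matrix (f' x))\<bar>) has_integral r) S"
      by (simp add: has_integral_restrict_UNIV)
    then have *: "f ` S \<in> lmeasurable" "measure lebesgue (f ` S) = r" using key by auto
    then have "emeasure lebesgue (f ` S) = ennreal r" by (simp add: emeasure_eq_measure2)
    then show ?thesis using real img by simp
  next
    case top
    have "emeasure lborel (f ` S) = \<infinity>"
    proof (rule ccontr)
      assume "emeasure lborel (f ` S) \<noteq> \<infinity>"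
      then have "f ` S \<in> lmeasurable" using img
        by (auto intro!: fmeasurableI simp: sets_completionI_sets top.not_eq_extremum)
      then have "((\<lambda>x. \<bar>det (matrix (f' x))\<bar>) has_integral measure lebesgue (f ` S)) S"
        using key by blast
      then have "(\<integral>\<^sup>+x. ennreal (indicator S x * \<bar>det (matrix (f' x))\<bar>) \<partial>lborel)
          = ennreal (measure lebesgue (f ` S))"
        by (intro nn_integral_has_integral_lebesgue) auto
      then show False using top by simp
    qed
    then show ?thesis using top by simp
  qed
qed

lemma det_complex_mult:
  "det (matrix (\<lambda>h. complex_to_vec (D * vec_to_complex h))) = (norm D)\<^sup>2"
  by (simp add: det_2 matrix_def complex_to_vec_def vec_to_complex_def axis_def cmod_power2)
    (simp add: power2_eq_square)

text \<open>The real Jacobian determinant of a holomorphic map is the squared modulus of its derivative.\<close>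

lemma emeasure_conformal_image:
  assumes S: "open S" and g: "g holomorphic_on S" and inj: "inj_on g S" and A: "A \<in> sets borel"
  shows "emeasure lborel (A \<inter> g ` S)
    = (\<integral>\<^sup>+z. indicator S z * indicator A (g z) * ennreal ((norm (deriv g z))\<^sup>2) \<partial>lborel)"
proof -
  define T where "T = vec_to_complex -` (S \<inter> g -` A)"
  define f where "f = (\<lambda>v. complex_to_vec (g (vec_to_complex v)))"
  have "open (g ` S)" using open_mapping_thm3 g S inj by blast
  have gc: "continuous_on S g" using g holomorphic_on_imp_continuous_on by blast
  have dc: "continuous_on S (deriv g)"
    using g S holomorphic_deriv holomorphic_on_imp_continuous_on by blast
  have SA: "S \<inter> g -` A \<in> sets borel"
  proof -
    have "(\<lambda>x. if x \<in> S then g x else 0) \<in> borel_measurable borel"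
      using S gc by (intro borel_measurable_continuous_on_if) auto
    from measurable_sets[OF this A] have "(\<lambda>x. if x \<in> S then g x else 0) -` A \<inter> S \<in> sets borel"
      using S by auto
    also have "(\<lambda>x. if x \<in> S then g x else 0) -` A \<inter> S = S \<inter> g -` A" by auto
    finally show ?thesis .
  qed
  have T: "T \<in> sets borel" unfolding T_def
    using measurable_sets[OF borel_vec_to_complex SA] by simp
  have im: "f ` T = vec_to_complex -` (A \<inter> g ` S)"
  proof (rule set_eqI)
    fix v
    show "v \<in> f ` T \<longleftrightarrow> v \<in> vec_to_complex -` (A \<inter> g ` S)"
    proof
      assume "v \<in> f ` T" then show "v \<in> vec_to_complex -` (A \<inter> g ` S)"
        by (auto simp: f_def T_def)
    next
      assume "v \<in> vec_to_complex -` (A \<inter> g ` S)"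
      then obtain s where "s \<in> S" "vec_to_complex v = g s" "g s \<in> A" by auto
      then have "complex_to_vec s \<in> T" "v = f (complex_to_vec s)"
        by (auto simp: T_def f_def) (metis complex_to_vec_to_complex)
      then show "v \<in> f ` T" by blast
    qed
  qed
  have imb: "f ` T \<in> sets borel" unfolding im
    using measurable_sets[OF borel_vec_to_complex, of "A \<inter> g ` S"] A \<open>open (g ` S)\<close> by simp
  have der: "(f has_derivative (\<lambda>h. complex_to_vec (deriv g (vec_to_complex v) * vec_to_complex h)))
      (at v within T)" if "v \<in> T" for v
  proof -
    have "vec_to_complex v \<in> S" using that by (auto simp: T_def)
    then have "(g has_derivative (*) (deriv g (vec_to_complex v))) (at (vec_to_complex v))"
      using g S holomorphic_derivI has_field_derivative_def by metis
    then have "((\<lambda>v. g (vec_to_complex v)) has_derivative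
        (\<lambda>h. deriv g (vec_to_complex v) * vec_to_complex h)) (at v)"
      using has_derivative_compose[OF bounded_linear_imp_has_derivative[OF bounded_linear_vec_to_complex]]
      by blast
    then have "(f has_derivative (\<lambda>h. complex_to_vec (deriv g (vec_to_complex v) * vec_to_complex h)))
      (at v)" unfolding f_def
      using bounded_linear.has_derivative[OF bounded_linear_complex_to_vec] by blast
    then show ?thesis by (rule has_derivative_at_withinI)
  qed
  have injf: "inj_on f T"
  proof (rule inj_onI)
    fix u v assume uv: "u \<in> T" "v \<in> T" "f u = f v"
    have "g (vec_to_complex u) = g (vec_to_complex v)"
      using uv(3) unfolding f_def by (metis vec_to_complex_to_vec)
    then have "vec_to_complex u = vec_to_complex v"
      using uv inj by (auto simp: T_def inj_on_def)
    then show "u = v" by (metis complex_to_vec_to_complex)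
  qed
  have m1: "(\<lambda>z. indicator S z *\<^sub>R deriv g z) \<in> borel_measurable borel"
    using S dc by (intro borel_measurable_continuous_on_indicator) auto
  have m2: "(\<lambda>z. indicator (S \<inter> g -` A) z * (norm (deriv g z))\<^sup>2) \<in> borel_measurable borel"
  proof -
    have "(\<lambda>z. indicator (S \<inter> g -` A) z * (norm (indicator S z *\<^sub>R deriv g z))\<^sup>2)
        \<in> borel_measurable borel" using m1 SA by measurable
    also have "(\<lambda>z. indicator (S \<inter> g -` A) z * (norm (indicator S z *\<^sub>R deriv g z))\<^sup>2)
      = (\<lambda>z. indicator (S \<inter> g -` A) z * (norm (deriv g z))\<^sup>2)"
      by (auto simp: indicator_def fun_eq_iff)
    finally show ?thesis .
  qed
  have m3: "(\<lambda>v. indicator T v * \<bar>det (matrix (\<lambda>h. complex_to_vec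
      (deriv g (vec_to_complex v) * vec_to_complex h)))\<bar>) \<in> borel_measurable borel"
  proof -
    have "(\<lambda>v. indicator (S \<inter> g -` A) (vec_to_complex v)
        * (norm (deriv g (vec_to_complex v)))\<^sup>2 :: real) \<in> borel_measurable borel"
      using measurable_compose[OF borel_vec_to_complex m2] by simp
    then show ?thesis by (simp add: det_complex_mult T_def indicator_def)
  qed
  have "emeasure lborel (A \<inter> g ` S) = emeasure lborel (f ` T)"
    unfolding im
    by (subst lborel_complex_eq_distr, subst emeasure_distr)
       (use A \<open>open (g ` S)\<close> in auto)
  also have "\<dots> = (\<integral>\<^sup>+v. ennreal (indicator T v * (norm (deriv g (vec_to_complex v)))\<^sup>2) \<partial>lborel)"
    using emeasure_differentiable_image[OF T imb der injf m3] by (simp add: det_complex_mult)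
  also have "\<dots> = (\<integral>\<^sup>+z. ennreal (indicator (S \<inter> g -` A) z * (norm (deriv g z))\<^sup>2) \<partial>lborel)"
    by (subst nn_integral_complex_eq_vec) (use m2 in \<open>auto simp: T_def indicator_def\<close>)
  also have "\<dots> = (\<integral>\<^sup>+z. indicator S z * indicator A (g z) * ennreal ((norm (deriv g z))\<^sup>2) \<partial>lborel)"
    by (intro nn_integral_cong) (auto simp: indicator_def)
  finally show ?thesis .
qed

lemma nn_integral_conformal_image:
  assumes S: "open S" and g: "g holomorphic_on S" and inj: "inj_on g S"
    and H: "H \<in> borel_measurable borel"
  shows "(\<integral>\<^sup>+z. indicator (g ` S) z * H z \<partial>lborel)
    = (\<integral>\<^sup>+z. indicator S z * (ennreal ((norm (deriv g z))\<^sup>2) * H (g z)) \<partial>lborel)"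
proof -
  define g0 where "g0 = (\<lambda>x. if x \<in> S then g x else 0)"
  define w where "w = (\<lambda>z. indicator S z * ennreal ((norm (deriv g z))\<^sup>2))"
  have og: "open (g ` S)" using open_mapping_thm3 g S inj by blast
  have gc: "continuous_on S g" using g holomorphic_on_imp_continuous_on by blast
  have dc: "continuous_on S (deriv g)"
    using g S holomorphic_deriv holomorphic_on_imp_continuous_on by blast
  have g0 [measurable]: "g0 \<in> borel_measurable borel" unfolding g0_def
    using S gc by (intro borel_measurable_continuous_on_if) auto
  have m1: "(\<lambda>z. indicator S z *\<^sub>R deriv g z) \<in> borel_measurable borel"
    using S dc by (intro borel_measurable_continuous_on_indicator) auto
  have w [measurable]: "w \<in> borel_measurable borel"
  proof -
    have "(\<lambda>z. ennreal ((norm (indicator S z *\<^sub>R deriv g z))\<^sup>2)) \<in> borel_measurable borel"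
      using m1 by measurable
    also have "(\<lambda>z. ennreal ((norm (indicator S z *\<^sub>R deriv g z))\<^sup>2)) = w"
      by (auto simp: w_def indicator_def fun_eq_iff)
    finally show ?thesis .
  qed
  have eq: "density lborel (indicator (g ` S)) = distr (density lborel w) borel g0"
  proof (rule measure_eqI)
    fix A assume "A \<in> sets (density lborel (indicator (g ` S)))"
    then have A: "A \<in> sets borel" by simp
    have "emeasure (density lborel (indicator (g ` S))) A = emeasure lborel (A \<inter> g ` S)"
    proof -
      have "(\<integral>\<^sup>+z. indicator (g ` S) z * indicator A z \<partial>lborel)
          = (\<integral>\<^sup>+z. indicator (A \<inter> g ` S) z \<partial>lborel)"
        by (intro nn_integral_cong) (auto simp: indicator_def)
      then show ?thesis using A og by (simp add: emeasure_density)
    qed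
    also have "\<dots> = (\<integral>\<^sup>+z. indicator S z * indicator A (g z) * ennreal ((norm (deriv g z))\<^sup>2) \<partial>lborel)"
      by (rule emeasure_conformal_image[OF S g inj A])
    also have "\<dots> = (\<integral>\<^sup>+z. w z * indicator (g0 -` A) z \<partial>lborel)"
      by (intro nn_integral_cong) (auto simp: w_def g0_def indicator_def)
    also have "\<dots> = emeasure (distr (density lborel w) borel g0) A"
      using A measurable_sets[OF g0 A] by (simp add: emeasure_distr emeasure_density)
    finally show "emeasure (density lborel (indicator (g ` S))) A
      = emeasure (distr (density lborel w) borel g0) A" .
  qed simp
  have "(\<integral>\<^sup>+z. indicator (g ` S) z * H z \<partial>lborel) = (\<integral>\<^sup>+z. H z \<partial>density lborel (indicator (g ` S)))"
    using og H by (subst nn_integral_density) auto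
  also have "\<dots> = (\<integral>\<^sup>+z. w z * H (g0 z) \<partial>lborel)"
    unfolding eq using H by (simp add: nn_integral_distr nn_integral_density)
  also have "\<dots> = (\<integral>\<^sup>+z. indicator S z * (ennreal ((norm (deriv g z))\<^sup>2) * H (g z)) \<partial>lborel)"
    by (intro nn_integral_cong) (auto simp: w_def g0_def indicator_def)
  finally show ?thesis .
qed

lemma nn_integral_complex_affine:
  fixes m t :: complex
  assumes m: "m \<noteq> 0" and H: "H \<in> borel_measurable borel"
  shows "(\<integral>\<^sup>+z. H z \<partial>lborel) = ennreal ((norm m)\<^sup>2) * (\<integral>\<^sup>+z. H (m * z + t) \<partial>lborel)"
proof -
  have inj: "inj_on (\<lambda>z. m * z + t) UNIV" using m by (auto simp: inj_on_def)
  have img: "range (\<lambda>z. m * z + t) = UNIV"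
  proof -
    have "w \<in> range (\<lambda>z. m * z + t)" for w
      by (rule image_eqI[of _ _ "(w - t) / m"]) (use m in auto)
    then show ?thesis by blast
  qed
  have d: "deriv (\<lambda>z. m * z + t) z = m" for z
    by (rule DERIV_imp_deriv) (auto intro!: derivative_eq_intros)
  have hol: "(\<lambda>z. m * z + t) holomorphic_on UNIV" by (intro holomorphic_intros)
  have "(\<integral>\<^sup>+z. H z \<partial>lborel) = (\<integral>\<^sup>+z. ennreal ((norm m)\<^sup>2) * H (m * z + t) \<partial>lborel)"
    using nn_integral_conformal_image[OF open_UNIV hol inj H] by (simp add: img d)
  also have "\<dots> = ennreal ((norm m)\<^sup>2) * (\<integral>\<^sup>+z. H (m * z + t) \<partial>lborel)"
  proof (rule nn_integral_cmult)
    have aff: "(\<lambda>z. m * z + t) \<in> borel_measurable borel"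
      by (intro borel_measurable_continuous_onI continuous_intros)
    show "(\<lambda>z. H (m * z + t)) \<in> borel_measurable lborel"
      using measurable_compose[OF aff H] by simp
  qed
  finally show ?thesis .
qed

definition pair_to_vec :: "complex \<times> complex \<Rightarrow> complex ^ 2" where
  "pair_to_vec p = vector [fst p, snd p]"

lemma bounded_linear_pair_to_vec: "bounded_linear pair_to_vec"
  by (rule linear_conv_bounded_linear[THEN iffD1], rule linearI)
     (auto simp: pair_to_vec_def vec_eq_iff forall_2)

lemma borel_pair_to_vec [measurable]: "pair_to_vec \<in> borel_measurable borel"
  by (intro borel_measurable_continuous_onI linear_continuous_on bounded_linear_pair_to_vec)

lemma Basis_complex2: "(Basis :: (complex^2) set) = {axis 1 1, axis 1 \<i>, axis 2 1, axis 2 \<i>}"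
  by (auto simp: Basis_vec_def UNIV_2 Basis_complex_def)

lemma Basis_complex_prod: "(Basis :: (complex \<times> complex) set) = {(1,0), (\<i>,0), (0,1), (0,\<i>)}"
  by (auto simp: Basis_prod_def Basis_complex_def)

lemma lborel_complex2_eq_distr: "lborel = distr lborel borel pair_to_vec"
proof (rule lborel_eqI)
  fix l u :: "complex^2"
  assume le: "\<And>b. b \<in> Basis \<Longrightarrow> l \<bullet> b \<le> u \<bullet> b"
  let ?c = "\<lambda>z::complex^2. (z $ 1, z $ 2)"
  have eq: "pair_to_vec -` box l u = box (?c l) (?c u)"
    by (auto simp: pair_to_vec_def mem_box Basis_complex2 Basis_complex_prod inner_axis)
  have le': "?c l \<bullet> b \<le> ?c u \<bullet> b" if "b \<in> Basis" for b
    using le[of "axis 1 1"] le[of "axis 1 \<i>"] le[of "axis 2 1"] le[of "axis 2 \<i>"] that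
    by (auto simp: Basis_complex2 Basis_complex_prod inner_axis)
  have "emeasure (distr lborel borel pair_to_vec) (box l u) = emeasure lborel (box (?c l) (?c u))"
    by (subst emeasure_distr) (auto simp: eq)
  also have "\<dots> = (\<Prod>b\<in>Basis. (?c u - ?c l) \<bullet> b)"
    by (rule emeasure_lborel_box) (rule le')
  also have "\<dots> = (\<Prod>b\<in>Basis. (u - l) \<bullet> b)"
    by (simp add: Basis_complex2 Basis_complex_prod inner_axis axis_eq_axis complex_eq_iff)
  finally show "emeasure (distr lborel borel pair_to_vec) (box l u)
      = (\<Prod>b\<in>Basis. (u - l) \<bullet> b)" .
qed simp

lemma nn_integral_complex2:
  fixes H :: "complex^2 \<Rightarrow> ennreal"
  assumes H: "H \<in> borel_measurable borel"
  shows "(\<integral>\<^sup>+z. H z \<partial>lborel) = (\<integral>\<^sup>+z1. \<integral>\<^sup>+z2. H (vector [z1, z2]) \<partial>lborel \<partial>lborel)"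
proof -
  have m: "(\<lambda>p. H (pair_to_vec p)) \<in> borel_measurable (lborel \<Otimes>\<^sub>M lborel)"
    using H unfolding lborel_prod by measurable
  have "(\<integral>\<^sup>+z. H z \<partial>lborel) = (\<integral>\<^sup>+p. H (pair_to_vec p) \<partial>lborel)"
    by (subst lborel_complex2_eq_distr, subst nn_integral_distr) (use H in auto)
  also have "\<dots> = (\<integral>\<^sup>+p. H (pair_to_vec p) \<partial>(lborel \<Otimes>\<^sub>M lborel))"
    by (simp only: lborel_prod)
  also have "\<dots> = (\<integral>\<^sup>+z1. \<integral>\<^sup>+z2. H (pair_to_vec (z1, z2)) \<partial>lborel \<partial>lborel)"
    using m by (subst lborel.nn_integral_fst[symmetric]) auto
  finally show ?thesis by (simp add: pair_to_vec_def)
qed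

section \<open>The weight on the arc\<close>

lemma cos_diff_le: "\<bar>cos x - cos y\<bar> \<le> \<bar>x - y\<bar>" for x y :: real
proof -
  have "norm (cos x - cos y) \<le> 1 * norm (x - y)"
    by (rule field_differentiable_bound[of UNIV cos "\<lambda>x. - sin x" 1])
       (auto intro!: derivative_eq_intros)
  then show ?thesis by simp
qed


text \<open>The one-dimensional data: everything about the functions \<open>F\<close> depends on the radius and the angle only.\<close>

locale lens_angle =
  fixes r \<theta> :: real
  assumes r_pos: "0 < r" and \<theta>_gt: "- pi < \<theta>" and \<theta>_lt: "\<theta> < pi" and \<theta>_nz: "\<theta> \<noteq> 0"
begin

definition lo :: real where "lo = (if \<theta> > 0 then - pi / 2 else - pi / 2 - \<theta>)"
definition hi :: real where "hi = (if \<theta> > 0 then pi / 2 - \<theta> else pi / 2)"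

abbreviation \<psi> :: "real \<Rightarrow> real" where "\<psi> \<equiv> psi r \<theta>"

lemma Jint_eq: "Jint \<theta> = {lo<..<hi}" by (simp add: Jint_def lo_def hi_def)

lemma lo_less_hi: "lo < hi" and hi_lo_less_pi: "hi - lo < pi"
  using \<theta>_gt \<theta>_lt \<theta>_nz by (auto simp: lo_def hi_def)

lemma closed_arc: assumes "lo \<le> v" "v \<le> hi"
  shows "- pi / 2 \<le> v" "v \<le> pi / 2" "- pi / 2 \<le> v + \<theta>" "v + \<theta> \<le> pi / 2"
  using assms \<theta>_gt \<theta>_lt \<theta>_nz by (auto simp: lo_def hi_def split: if_splits)

lemma cos_pos_arc: assumes "lo < v" "v < hi" shows "cos v > 0" "cos (v + \<theta>) > 0"
  using assms \<theta>_gt \<theta>_lt \<theta>_nz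
  by (auto simp: lo_def hi_def split: if_splits intro!: cos_gt_zero_pi)

lemma cos_nonneg_arc: assumes "lo \<le> v" "v \<le> hi" shows "cos v \<ge> 0" "cos (v + \<theta>) \<ge> 0"
  using closed_arc[OF assms] by (auto intro!: cos_ge_zero)

lemma psi_pos: "lo < v \<Longrightarrow> v < hi \<Longrightarrow> 0 < \<psi> v"
  using cos_pos_arc r_pos by (auto simp: psi_def)

lemma psi_nonneg: "lo \<le> v \<Longrightarrow> v \<le> hi \<Longrightarrow> 0 \<le> \<psi> v"
  using cos_nonneg_arc r_pos by (auto simp: psi_def)

lemma psi_lo: "\<psi> lo \<le> 0" and psi_hi: "\<psi> hi \<le> 0"
  by (auto simp: psi_def lo_def hi_def min_le_iff_disj)

lemma psi_le_1: "\<psi> v \<le> 1" by (simp add: psi_def min_le_iff_disj)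

text \<open>Where \<open>\<psi>\<close> is at least \<open>2 \<eta>\<close> it stays above \<open>\<eta>\<close> on a neighbourhood whose size depends on \<open>\<eta>\<close> and \<open>r\<close> only; this is what makes later constants independent of the point.\<close>

lemma psi_lipschitz: "\<bar>\<psi> u - \<psi> v\<bar> \<le> (1 + r) * \<bar>u - v\<bar>"
proof -
  have 1: "\<bar>cos u - cos v\<bar> \<le> (1 + r) * \<bar>u - v\<bar>"
  proof -
    have "0 \<le> r * \<bar>u - v\<bar>" using r_pos by simp
    then show ?thesis using cos_diff_le[of u v] by (simp add: distrib_right)
  qed
  have "\<bar>r * cos (u + \<theta>) - r * cos (v + \<theta>)\<bar> = r * \<bar>cos (u + \<theta>) - cos (v + \<theta>)\<bar>"
    using r_pos by (simp add: abs_mult flip: right_diff_distrib)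
  also have "\<dots> \<le> r * \<bar>u - v\<bar>"
    using cos_diff_le[of "u + \<theta>" "v + \<theta>"] r_pos by (intro mult_left_mono) auto
  also have "\<dots> \<le> (1 + r) * \<bar>u - v\<bar>" by (rule mult_right_mono) auto
  finally have 2: "\<bar>r * cos (u + \<theta>) - r * cos (v + \<theta>)\<bar> \<le> (1 + r) * \<bar>u - v\<bar>" .
  show ?thesis using 1 2 unfolding psi_def by (simp add: min_def abs_le_iff) 
qed

lemma continuous_psi [continuous_intros]:
  fixes f :: "'c::t2_space \<Rightarrow> real"
  shows "continuous_on S f \<Longrightarrow> continuous_on S (\<lambda>x. \<psi> (f x))"
  unfolding psi_def by (intro continuous_intros) 

lemma psi_midpoint_concave:
  assumes "lo \<le> u" "u \<le> hi" "lo \<le> v" "v \<le> hi"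
  shows "(\<psi> u + \<psi> v) / 2 \<le> \<psi> ((u + v) / 2)"
proof -
  have m: "lo \<le> (u + v) / 2" "(u + v) / 2 \<le> hi" using assms by auto
  have *: "(cos x + cos y) / 2 \<le> cos ((x + y) / 2)" if "cos ((x + y) / 2) \<ge> 0" for x y :: real
  proof -
    have "cos x + cos y = 2 * cos ((x + y) / 2) * cos ((x - y) / 2)"
      by (rule cos_plus_cos)
    also have "\<dots> \<le> 2 * cos ((x + y) / 2) * 1"
      using that by (intro mult_left_mono) auto
    finally show ?thesis by simp
  qed
  have e: "(u + v) / 2 + \<theta> = ((u + \<theta>) + (v + \<theta>)) / 2" by (simp add: field_simps)
  have 1: "(cos u + cos v) / 2 \<le> cos ((u + v) / 2)" by (rule *) (rule cos_nonneg_arc(1)[OF m])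
  have "(cos (u + \<theta>) + cos (v + \<theta>)) / 2 \<le> cos (((u + \<theta>) + (v + \<theta>)) / 2)"
    by (rule *) (use cos_nonneg_arc(2)[OF m] e in simp)
  then have 2: "(r * cos (u + \<theta>) + r * cos (v + \<theta>)) / 2 \<le> r * cos ((u + v) / 2 + \<theta>)"
    using r_pos unfolding e by (simp flip: distrib_left add: mult_left_mono)
  show ?thesis using 1 2 by (auto simp: psi_def min_def)
qed

text \<open>A quantitative log-concavity. For a single cosine,
  \<open>cos x cos y\<close> is at most the square of the arithmetic mean \<open>(cos x + cos y) / 2\<close>, which factors as
  \<open>cos ((x + y) / 2) cos ((x - y) / 2)\<close>. The gain \<open>cos ((u - v) / 2)\<close> over plain log-concavity is
  the source of the concentration of the powers of \<open>\<psi>\<close>.\<close>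

lemma psi_midpoint_log_concave:
  assumes "lo \<le> u" "u \<le> hi" "lo \<le> v" "v \<le> hi"
  shows "\<psi> u * \<psi> v \<le> (\<psi> ((u + v) / 2) * cos ((u - v) / 2))\<^sup>2"
proof -
  have *: "cos x * cos y \<le> (cos ((x + y) / 2) * cos ((x - y) / 2))\<^sup>2" for x y :: real
  proof -
    have e: "2 * (cos ((x + y) / 2) * cos ((x - y) / 2)) = cos x + cos y"
      using cos_plus_cos[of x y] by simp
    have "(2 * (cos ((x + y) / 2) * cos ((x - y) / 2)))\<^sup>2 - 4 * (cos x * cos y) = (cos x - cos y)\<^sup>2"
      unfolding e by (simp add: power2_eq_square algebra_simps)
    then have "(2 * (cos ((x + y) / 2) * cos ((x - y) / 2)))\<^sup>2 - 4 * (cos x * cos y) \<ge> 0"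
      by (metis zero_le_power2)
    then show ?thesis by (simp add: power_mult_distrib)
  qed
  have e: "(u + v) / 2 + \<theta> = ((u + \<theta>) + (v + \<theta>)) / 2" "(u - v) / 2 = ((u + \<theta>) - (v + \<theta>)) / 2"
    by (simp_all add: field_simps)
  have pu: "0 \<le> \<psi> u" "0 \<le> \<psi> v" using psi_nonneg assms by auto
  show ?thesis
  proof (cases "cos ((u + v) / 2) \<le> r * cos ((u + v) / 2 + \<theta>)")
    case True
    have "\<psi> u * \<psi> v \<le> cos u * cos v"
      using pu cos_nonneg_arc assms by (intro mult_mono) (auto simp: psi_def)
    also have "\<dots> \<le> (cos ((u + v) / 2) * cos ((u - v) / 2))\<^sup>2" by (rule *)
    finally show ?thesis using True by (simp add: psi_def min_def)
  next
    case False
    have "\<psi> u * \<psi> v \<le> (r * cos (u + \<theta>)) * (r * cos (v + \<theta>))"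
      using pu cos_nonneg_arc assms r_pos by (intro mult_mono) (auto simp: psi_def)
    also have "\<dots> = r\<^sup>2 * (cos (u + \<theta>) * cos (v + \<theta>))" by (simp add: power2_eq_square)
    also have "\<dots> \<le> r\<^sup>2 * (cos (((u + \<theta>) + (v + \<theta>)) / 2) * cos (((u + \<theta>) - (v + \<theta>)) / 2))\<^sup>2"
      by (intro mult_left_mono *) auto
    also have "\<dots> = (r * cos ((u + v) / 2 + \<theta>) * cos ((u - v) / 2))\<^sup>2"
      by (simp only: e power_mult_distrib mult.assoc)
    finally show ?thesis using False by (simp add: psi_def min_def)
  qed
qed

text \<open>Since \<open>\<psi>\<close> is not positive at the ends of the arc, a neighbourhood on which it is positive cannot cross them.\<close>

lemma arc_of_psi_pos:
  assumes v: "lo < v" "v < hi" and pos: "\<And>u. \<bar>u - v\<bar> \<le> e \<Longrightarrow> 0 < \<psi> u" and w: "\<bar>w - v\<bar> \<le> e"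
  shows "lo < w" "w < hi"
proof -
  show "lo < w"
  proof (rule ccontr)
    assume "\<not> lo < w" then have "\<bar>lo - v\<bar> \<le> e" using v w by auto
    then show False using pos psi_lo by (meson not_le)
  qed
  show "w < hi"
  proof (rule ccontr)
    assume "\<not> w < hi" then have "\<bar>hi - v\<bar> \<le> e" using v w by auto
    then show False using pos psi_hi by (meson not_le)
  qed
qed

definition wt :: "nat \<Rightarrow> real \<Rightarrow> real" where
  "wt n v = (if lo < v \<and> v < hi then \<psi> v ^ n else 0)"

text \<open>The values of \<open>F\<close> on the real axis, which are positive: they serve as the yardstick for \<open>F\<close> off the axis.\<close>

definition Fr :: "nat \<Rightarrow> real \<Rightarrow> real" where
  "Fr n x = (\<integral>v. wt n v * exp (- (v * x)) \<partial>lborel)"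

lemma wt_nonneg: "0 \<le> wt n v" by (auto simp: wt_def psi_nonneg)

lemma wt_le_1: "wt n v \<le> 1"
  unfolding wt_def by (auto intro!: power_le_one psi_le_1 psi_nonneg)

lemma wt_measurable [measurable]: "wt n \<in> borel_measurable borel"
proof -
  have "\<psi> \<in> borel_measurable borel"
    by (intro borel_measurable_continuous_onI continuous_psi continuous_intros)
  then show ?thesis unfolding wt_def by measurable
qed

lemma integrable_wt:
  fixes f :: "real \<Rightarrow> 'b :: {banach, second_countable_topology}"
  assumes "continuous_on UNIV f"
  shows "integrable lborel (\<lambda>v. wt n v *\<^sub>R f v)"
proof -
  have "set_integrable lborel {lo..hi} (\<lambda>v. \<psi> v ^ n *\<^sub>R f v)"
    by (intro borel_integrable_atLeastAtMost' continuous_intros continuous_on_subset[OF assms]) auto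
  then have "set_integrable lborel {lo<..<hi} (\<lambda>v. \<psi> v ^ n *\<^sub>R f v)"
    by (rule set_integrable_subset) auto
  moreover have "(\<lambda>v. indicator {lo<..<hi} v *\<^sub>R (\<psi> v ^ n *\<^sub>R f v)) = (\<lambda>v. wt n v *\<^sub>R f v)"
    by (auto simp: wt_def indicator_def)
  ultimately show ?thesis by (simp add: set_integrable_def)
qed

lemma integrable_wt_exp: "integrable lborel (\<lambda>v. wt n v * exp (- (v * x)))"
  using integrable_wt[of "\<lambda>v. exp (- (v * x))" n] by (simp add: continuous_intros)

lemma F_eq: "F r \<theta> n \<xi> = (\<integral>v. wt n v *\<^sub>R exp (- (of_real v * \<xi>)) \<partial>lborel)"
proof -
  have int: "integrable lborel (\<lambda>v. wt n v *\<^sub>R exp (- (of_real v * \<xi>)))"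
    by (intro integrable_wt continuous_intros)
  have e: "(\<lambda>v. wt n v *\<^sub>R exp (- (of_real v * \<xi>)))
    = (\<lambda>v. if v \<in> Jint \<theta> then exp (- (of_real v * \<xi>)) * of_real (\<psi> v ^ n) else 0)"
    by (auto simp: wt_def Jint_eq fun_eq_iff scaleR_conv_of_real)
  have "F r \<theta> n \<xi> = integral UNIV (\<lambda>v. wt n v *\<^sub>R exp (- (of_real v * \<xi>)))"
    unfolding F_def e by (simp only: integral_restrict_UNIV)
  also have "\<dots> = (\<integral>v. wt n v *\<^sub>R exp (- (of_real v * \<xi>)) \<partial>lborel)"
    using has_integral_integral_lborel[OF int] by (rule integral_unique)
  finally show ?thesis .
qed

lemma F_of_real: "F r \<theta> n (of_real x) = of_real (Fr n x)"
proof -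
  have "F r \<theta> n (of_real x) = (\<integral>v. complex_of_real (wt n v * exp (- (v * x))) \<partial>lborel)"
    unfolding F_eq
    by (intro Bochner_Integration.integral_cong refl)
       (simp add: scaleR_conv_of_real exp_of_real[symmetric])
  also have "\<dots> = of_real (Fr n x)" unfolding Fr_def by (rule integral_complex_of_real)
  finally show ?thesis .
qed

lemma Fr_ge:
  assumes ab: "a \<le> b" and sub: "\<And>u. a \<le> u \<Longrightarrow> u \<le> b \<Longrightarrow> lo < u \<and> u < hi"
    and c: "\<And>u. a \<le> u \<Longrightarrow> u \<le> b \<Longrightarrow> c \<le> \<psi> u ^ n * exp (- (u * x))"
  shows "(b - a) * c \<le> Fr n x"
proof -
  have "(b - a) * c = (\<integral>v. indicator {a..b} v * c \<partial>lborel)"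
    using ab by simp
  also have "\<dots> \<le> Fr n x" unfolding Fr_def
  proof (rule integral_mono)
    show "integrable lborel (\<lambda>v. indicator {a..b} v * c)" using ab by simp
    show "indicator {a..b} v * c \<le> wt n v * exp (- (v * x))" for v
      using sub[of v] c[of v] wt_nonneg[of n v] by (auto simp: indicator_def wt_def)
  qed (rule integrable_wt_exp)
  finally show ?thesis .
qed

lemma Fr_pos: "0 < Fr n x"
proof -
  define a b where "a = lo + (hi - lo) / 3" and "b = lo + 2 * (hi - lo) / 3"
  have ab: "lo < a" "a < b" "b < hi" using lo_less_hi by (auto simp: a_def b_def field_simps)
  have "continuous_on {a..b} (\<lambda>u. \<psi> u ^ n * exp (- (u * x)))" by (intro continuous_intros)
  then obtain m where m: "m \<in> {a..b}"
      "\<And>u. u \<in> {a..b} \<Longrightarrow> \<psi> m ^ n * exp (- (m * x)) \<le> \<psi> u ^ n * exp (- (u * x))"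
    using continuous_attains_inf[of "{a..b}" "\<lambda>u. \<psi> u ^ n * exp (- (u * x))"] ab by auto
  have "0 < (b - a) * (\<psi> m ^ n * exp (- (m * x)))"
    using ab m psi_pos[of m] by simp
  also have "\<dots> \<le> Fr n x" by (rule Fr_ge) (use ab m in auto)
  finally show ?thesis .
qed

text \<open>The exponential factor with the mean of \<open>v\<close> and \<open>v0\<close> is dominated by \<open>Fr\<close>, with a decay in \<open>x\<close> to spare and
  uniformly in \<open>j\<close>. The reason: \<open>\<psi> v * \<psi> w \<le> (\<psi> ((v + w) / 2))\<^sup>2\<close>, so for all \<open>w\<close> close to \<open>v0\<close> the
  integrand of \<open>Fr\<close> at the midpoint is, up to a constant, at least as large as the left hand side; integrating over those
  midpoints that lie on the side where the exponential is larger gives the decay.\<close>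

lemma kernel_weight_bound:
  assumes v: "lo < v" "v < hi" and v0: "lo < v0" "v0 < hi"
    and \<eta>: "0 < \<eta>" and \<eta>2: "2 * \<eta> \<le> \<psi> v0" and \<delta>: "\<delta> = \<eta> / (2 * (1 + r))"
  shows "exp (- (x * (v + v0) / 2)) * sqrt (\<psi> v * (\<psi> v0 - \<eta>)) ^ j
    \<le> 4 / (\<delta> * \<eta>) * exp (- (\<delta> * \<bar>x\<bar> / 2)) * Fr (Suc j) x"
proof -
  have \<delta>0: "\<delta> > 0" using \<delta> \<eta> r_pos by simp
  define m where "m = (v + v0) / 2"
  \<comment> \<open>An interval of midpoints at distance between \<open>\<delta> / 2\<close> and \<open>\<delta>\<close> from \<open>m\<close>, on the side where \<open>exp (- (u * x))\<close> exceeds its value at \<open>m\<close>.\<close>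
  define a where "a = (if x \<ge> 0 then m - \<delta> else m + \<delta> / 2)"
  define b where "b = (if x \<ge> 0 then m - \<delta> / 2 else m + \<delta>)"
  have ab: "a \<le> b" "b - a = \<delta> / 2" using \<delta>0 by (auto simp: a_def b_def)
  have near: "\<psi> v0 - \<eta> \<le> \<psi> w" if "\<bar>w - v0\<bar> \<le> 2 * \<delta>" for w
  proof -
    have "\<bar>\<psi> w - \<psi> v0\<bar> \<le> (1 + r) * (2 * \<delta>)"
      using psi_lipschitz[of w v0] that r_pos
      by (smt (verit) mult_left_mono)
    also have "\<dots> = \<eta>" using r_pos by (simp add: \<delta> field_simps)
    finally show ?thesis by linarith
  qed
  have pos: "0 < \<psi> w" if "\<bar>w - v0\<bar> \<le> 2 * \<delta>" for w using near[OF that] \<eta> \<eta>2 by linarith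
  have pv: "0 < \<psi> v" using psi_pos v by auto
  have u: "lo < u \<and> u < hi \<and> sqrt (\<psi> v * (\<psi> v0 - \<eta>)) ^ j * (\<eta> / 2) \<le> \<psi> u ^ Suc j
      \<and> exp (- (x * m) + \<delta> * \<bar>x\<bar> / 2) \<le> exp (- (u * x))"
    if "a \<le> u" "u \<le> b" for u
  proof -
    \<comment> \<open>The point whose midpoint with \<open>v\<close> is \<open>u\<close>.\<close>
    define w where "w = 2 * u - v"
    have w: "\<bar>w - v0\<bar> \<le> 2 * \<delta>" using that \<delta>0
      by (auto simp: w_def a_def b_def m_def abs_le_iff field_simps split: if_splits)
    have wa: "lo < w" "w < hi" using arc_of_psi_pos[OF v0 pos w] by auto
    have uw: "u = (v + w) / 2" by (simp add: w_def)
    have un: "lo < u" "u < hi" using wa v by (auto simp: uw)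
    have "\<psi> v * (\<psi> v0 - \<eta>) \<le> \<psi> v * \<psi> w" using pv near[OF w] by simp
    also have "\<dots> \<le> (\<psi> u * cos ((v - w) / 2))\<^sup>2"
      unfolding uw using v wa by (intro psi_midpoint_log_concave) auto
    also have "\<dots> = (\<psi> u)\<^sup>2 * (cos ((v - w) / 2))\<^sup>2" by (simp add: power_mult_distrib)
    also have "\<dots> \<le> (\<psi> u)\<^sup>2 * 1" by (intro mult_left_mono) (auto simp: abs_square_le_1)
    finally have s1: "sqrt (\<psi> v * (\<psi> v0 - \<eta>)) \<le> \<psi> u"
      using psi_pos[OF un] by (simp add: real_le_lsqrt)
    have "\<eta> / 2 \<le> (\<psi> v + \<psi> w) / 2" using near[OF w] \<eta>2 pv by simp
    also have "\<dots> \<le> \<psi> u" unfolding uw using v wa by (intro psi_midpoint_concave) auto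
    finally have s2: "\<eta> / 2 \<le> \<psi> u" .
    have s0: "0 \<le> \<psi> v * (\<psi> v0 - \<eta>)" using pv \<eta> \<eta>2 by simp
    have s3: "sqrt (\<psi> v * (\<psi> v0 - \<eta>)) ^ j * (\<eta> / 2) \<le> \<psi> u ^ j * \<psi> u"
      using s0 s1 s2 \<eta> psi_pos[OF un] by (intro mult_mono power_mono) auto
    have "x * u \<le> x * m - \<delta> * \<bar>x\<bar> / 2"
    proof (cases "x \<ge> 0")
      case True
      then have "u \<le> m - \<delta> / 2" using that by (simp add: b_def)
      then have "x * u \<le> x * (m - \<delta> / 2)" using True by (rule mult_left_mono)
      then show ?thesis using True by (simp add: algebra_simps)
    next
      case False
      then have "m + \<delta> / 2 \<le> u" using that by (simp add: a_def)
      then have "x * u \<le> x * (m + \<delta> / 2)" using False by (intro mult_left_mono_neg) auto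
      then show ?thesis using False by (simp add: algebra_simps)
    qed
    then show ?thesis using un s3 by (simp add: mult.commute)
  qed
  have "(b - a) * (sqrt (\<psi> v * (\<psi> v0 - \<eta>)) ^ j * (\<eta> / 2) * exp (- (x * m) + \<delta> * \<bar>x\<bar> / 2)) \<le> Fr (Suc j) x"
  proof (rule Fr_ge)
    fix w assume w: "a \<le> w" "w \<le> b"
    show "lo < w \<and> w < hi" using u[OF w] by blast
    show "sqrt (\<psi> v * (\<psi> v0 - \<eta>)) ^ j * (\<eta> / 2) * exp (- (x * m) + \<delta> * \<bar>x\<bar> / 2)
        \<le> \<psi> w ^ Suc j * exp (- (w * x))"
      using u[OF w] \<eta> by (intro mult_mono) (auto simp: psi_nonneg)
  qed (use ab in auto)
  then have "\<delta> * \<eta> / 4 * exp (\<delta> * \<bar>x\<bar> / 2) * (exp (- (x * m)) * sqrt (\<psi> v * (\<psi> v0 - \<eta>)) ^ j) \<le> Fr (Suc j) x"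
    unfolding ab(2) exp_add by (simp add: mult_ac)
  then have "exp (- (x * m)) * sqrt (\<psi> v * (\<psi> v0 - \<eta>)) ^ j \<le> Fr (Suc j) x / (\<delta> * \<eta> / 4 * exp (\<delta> * \<bar>x\<bar> / 2))"
    using \<delta>0 \<eta> by (simp add: pos_le_divide_eq mult.commute)
  then show ?thesis unfolding m_def by (simp add: exp_minus field_simps)
qed

end

section \<open>Lower bounds for F off the real axis\<close>

lemma norm_exp_i_diff_le: "norm (exp (\<i> * of_real a) - exp (\<i> * of_real b)) \<le> \<bar>a - b\<bar>" for a b :: real
proof -
  have "norm (exp (\<i> * of_real a) - exp (\<i> * of_real b))
      = norm (exp (\<i> * of_real b) * (exp (\<i> * of_real (a - b)) - 1))"
    by (simp add: algebra_simps exp_diff)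
  also have "\<dots> = 2 * \<bar>sin ((a - b) / 2)\<bar>"
    by (simp only: norm_mult norm_exp_i_times dist_exp_i_1 mult_1)
  also have "\<dots> \<le> 2 * \<bar>(a - b) / 2\<bar>"
    using abs_sin_x_le_abs_x[of "(a - b) / 2"] by linarith
  finally show ?thesis by simp
qed

context lens_angle
begin

text \<open>If the measure defining \<open>F\<close> has most of its mass near \<open>m\<close>, then on that mass the oscillating factor
  \<open>exp (i v y)\<close> is almost equal to its value at \<open>m\<close> and cannot cause cancellation.\<close>

lemma F_norm_ge_of_concentration:
  assumes tail: "(\<integral>v. indicator {v. D < \<bar>v - m\<bar>} v * (wt n v * exp (- (v * x))) \<partial>lborel) \<le> \<epsilon> * Fr n x"
    and y: "\<bar>y\<bar> \<le> Y" and D: "0 \<le> D"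
  shows "(1 - Y * D - 2 * \<epsilon>) * Fr n x \<le> norm (F r \<theta> n (of_real x - \<i> * of_real y))"
proof -
  define g where "g = (\<lambda>v. wt n v * exp (- (v * x)))"
  define T where "T = {v. D < \<bar>v - m\<bar>}"
  have Tm [measurable]: "T \<in> sets borel" unfolding T_def by measurable
  have g0: "0 \<le> g v" for v by (simp add: g_def wt_nonneg)
  have gi: "integrable lborel g" unfolding g_def by (rule integrable_wt_exp)
  have tgi: "integrable lborel (\<lambda>v. indicator T v * g v)"
    using integrable_mult_indicator[of T lborel g] gi by simp
  have e: "wt n v *\<^sub>R exp (- (of_real v * (of_real x - \<i> * of_real y)))
      = g v *\<^sub>R exp (\<i> * of_real (v * y))" for v
  proof -
    have "- (complex_of_real v * (of_real x - \<i> * of_real y)) = of_real (- (v * x)) + \<i> * of_real (v * y)"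
      by (simp add: algebra_simps)
    then show ?thesis
      by (simp only: exp_add exp_of_real g_def) (simp add: scaleR_conv_of_real)
  qed
  have FI: "integrable lborel (\<lambda>v. g v *\<^sub>R exp (\<i> * of_real (v * y)))"
    unfolding e[symmetric] by (intro integrable_wt continuous_intros)
  have CI: "integrable lborel (\<lambda>v. g v *\<^sub>R exp (\<i> * of_real (m * y)))"
    using gi by (intro integrable_scaleR_left) 
  have Feq: "F r \<theta> n (of_real x - \<i> * of_real y) = (\<integral>v. g v *\<^sub>R exp (\<i> * of_real (v * y)) \<partial>lborel)"
    unfolding F_eq e ..
  have Ceq: "(\<integral>v. g v *\<^sub>R exp (\<i> * of_real (m * y)) \<partial>lborel) = Fr n x *\<^sub>R exp (\<i> * of_real (m * y))"
    unfolding Fr_def g_def[symmetric] using gi by simp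
  have "norm (F r \<theta> n (of_real x - \<i> * of_real y) - Fr n x *\<^sub>R exp (\<i> * of_real (m * y)))
      = norm (\<integral>v. g v *\<^sub>R exp (\<i> * of_real (v * y)) - g v *\<^sub>R exp (\<i> * of_real (m * y)) \<partial>lborel)"
    by (simp only: Feq Ceq[symmetric] Bochner_Integration.integral_diff[OF FI CI])
  also have "\<dots> \<le> (\<integral>v. norm (g v *\<^sub>R exp (\<i> * of_real (v * y)) - g v *\<^sub>R exp (\<i> * of_real (m * y))) \<partial>lborel)"
    by (rule integral_norm_bound)
  also have "\<dots> \<le> (\<integral>v. (Y * D) * g v + 2 * (indicator T v * g v) \<partial>lborel)"
  proof (rule integral_mono)
    show "integrable lborel (\<lambda>v. norm (g v *\<^sub>R exp (\<i> * of_real (v * y)) - g v *\<^sub>R exp (\<i> * of_real (m * y))))"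
      using FI CI by (intro integrable_norm Bochner_Integration.integrable_diff)
    show "integrable lborel (\<lambda>v. (Y * D) * g v + 2 * (indicator T v * g v))"
      using gi tgi by (intro Bochner_Integration.integrable_add integrable_mult_right)
    fix v
    have "norm (g v *\<^sub>R exp (\<i> * of_real (v * y)) - g v *\<^sub>R exp (\<i> * of_real (m * y)))
        = g v * norm (exp (\<i> * of_real (v * y)) - exp (\<i> * of_real (m * y)))"
      using g0 by (simp flip: scaleR_right_diff_distrib)
    also have "\<dots> \<le> g v * (Y * D + 2 * indicator T v)"
    proof (rule mult_left_mono[OF _ g0])
      show "norm (exp (\<i> * of_real (v * y)) - exp (\<i> * of_real (m * y))) \<le> Y * D + 2 * indicator T v"
      proof (cases "v \<in> T")
        case True
        have "norm (exp (\<i> * of_real (v * y)) - exp (\<i> * of_real (m * y))) \<le> 1 + 1"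
          by (rule order_trans[OF norm_triangle_ineq4]) (simp only: norm_exp_i_times)
        then show ?thesis using True y D by (simp add: add_increasing)
      next
        case False
        have "norm (exp (\<i> * of_real (v * y)) - exp (\<i> * of_real (m * y))) \<le> \<bar>v * y - m * y\<bar>"
          by (rule norm_exp_i_diff_le)
        also have "\<dots> = \<bar>y\<bar> * \<bar>v - m\<bar>" by (simp add: abs_mult flip: left_diff_distrib)
        also have "\<dots> \<le> Y * D" using y False by (intro mult_mono) (auto simp: T_def)
        finally show ?thesis using False by simp
      qed
    qed
    finally show "norm (g v *\<^sub>R exp (\<i> * of_real (v * y)) - g v *\<^sub>R exp (\<i> * of_real (m * y)))
        \<le> (Y * D) * g v + 2 * (indicator T v * g v)" by (simp add: algebra_simps)
  qed
  also have "\<dots> = (Y * D) * Fr n x + 2 * (\<integral>v. indicator T v * g v \<partial>lborel)"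
    using gi tgi by (simp add: Fr_def g_def)
  also have "\<dots> \<le> (Y * D) * Fr n x + 2 * (\<epsilon> * Fr n x)"
    using tail by (simp add: T_def g_def)
  finally have *: "norm (F r \<theta> n (of_real x - \<i> * of_real y) - Fr n x *\<^sub>R exp (\<i> * of_real (m * y)))
      \<le> (Y * D) * Fr n x + 2 * (\<epsilon> * Fr n x)" .
  have "norm (Fr n x *\<^sub>R exp (\<i> * of_real (m * y))) = Fr n x"
    using Fr_pos[of n x] by (simp only: norm_scaleR norm_exp_i_times)
  then have "Fr n x \<le> norm (F r \<theta> n (of_real x - \<i> * of_real y))
     + norm (F r \<theta> n (of_real x - \<i> * of_real y) - Fr n x *\<^sub>R exp (\<i> * of_real (m * y)))"
    by (metis add.commute norm_triangle_sub norm_minus_commute)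
  moreover have "(1 - Y * D - 2 * \<epsilon>) * Fr n x = Fr n x - Y * D * Fr n x - 2 * (\<epsilon> * Fr n x)"
    by (simp add: algebra_simps)
  ultimately show ?thesis using * by linarith
qed

text \<open>The whole arc has length less than \<open>pi\<close>, so for small \<open>y\<close> the factor \<open>exp (i v y)\<close> varies little over all of it and the tail is empty.\<close>

lemma F_norm_ge_near_real:
  assumes "\<bar>y\<bar> \<le> 1 / 4"
  shows "Fr n x / 2 \<le> norm (F r \<theta> n (of_real x - \<i> * of_real y))"
proof -
  have z: "indicator {v. pi / 2 < \<bar>v - (lo + hi) / 2\<bar>} v * (wt n v * exp (- (v * x))) = 0" for v
  proof (cases "lo < v \<and> v < hi")
    case True
    then have "\<bar>v - (lo + hi) / 2\<bar> \<le> pi / 2" using hi_lo_less_pi by (simp add: abs_le_iff field_simps)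
    then show ?thesis by (simp add: indicator_def)
  qed (auto simp: wt_def)
  have "(1 - 1 / 4 * (pi / 2) - 2 * 0) * Fr n x \<le> norm (F r \<theta> n (of_real x - \<i> * of_real y))"
    by (rule F_norm_ge_of_concentration[where m = "(lo + hi) / 2" and D = "pi / 2"])
       (use assms in \<open>simp_all only: z\<close>, auto)
  moreover have "1 / 2 * Fr n x \<le> (1 - 1 / 4 * (pi / 2) - 2 * 0) * Fr n x"
    using Fr_pos[of n x] pi_less_4 by (intro mult_right_mono) auto
  ultimately show ?thesis by simp
qed

text \<open>Concentration around a maximum point \<open>m\<close> of the integrand: by log-concavity its value at \<open>v\<close> is at
  most its value at the midpoint of \<open>v\<close> and \<open>m\<close>, with the factor \<open>cos ((v - m) / 2) ^ n\<close> to spare. The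
  factor \<open>2\<close> is the Jacobian of \<open>v \<mapsto> (v + m) / 2\<close>.\<close>

lemma wt_tail_le:
  assumes D: "0 < D" "D \<le> 1"
  shows "\<exists>m. (\<integral>v. indicator {v. D < \<bar>v - m\<bar>} v * (wt n v * exp (- (v * x))) \<partial>lborel)
    \<le> 2 * cos (D / 2) ^ n * Fr n x"
proof -
  define g where "g = (\<lambda>v. \<psi> v ^ n * exp (- (v * x)))"
  define G where "G = (\<lambda>v. wt n v * exp (- (v * x)))"
  have "continuous_on {lo..hi} g" unfolding g_def by (intro continuous_intros)
  then obtain m where m: "m \<in> {lo..hi}" "\<And>u. u \<in> {lo..hi} \<Longrightarrow> g u \<le> g m"
    using continuous_attains_sup[of "{lo..hi}" g] lo_less_hi by auto
  have c0: "0 \<le> cos (D / 2)" using D pi_gt3 by (intro cos_ge_zero) auto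
  have G0: "0 \<le> G v" for v by (simp add: G_def wt_nonneg)
  have Gi: "integrable lborel G" unfolding G_def by (rule integrable_wt_exp)
  have Gi2: "integrable lborel (\<lambda>v. G (m / 2 + (1 / 2) * v))"
    by (rule lborel_integrable_real_affine[OF Gi]) simp
  have pt: "indicator {v. D < \<bar>v - m\<bar>} v * G v \<le> cos (D / 2) ^ n * G (m / 2 + (1 / 2) * v)" for v
  proof (cases "lo < v \<and> v < hi \<and> D < \<bar>v - m\<bar>")
    case False
    then have "indicator {v. D < \<bar>v - m\<bar>} v * G v = 0"
      by (auto simp: G_def wt_def indicator_def)
    moreover have "0 \<le> cos (D / 2) ^ n * G (m / 2 + (1 / 2) * v)"
      by (intro mult_nonneg_nonneg zero_le_power c0 G0)
    ultimately show ?thesis by linarith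
  next
    case True
    define M where "M = (v + m) / 2"
    have Min: "lo < M" "M < hi" using True m by (auto simp: M_def)
    have pv: "0 < \<psi> v" "0 < \<psi> M" "0 \<le> \<psi> m" using psi_pos psi_nonneg True Min m by auto
    have g0: "0 \<le> g u" if "u \<in> {lo..hi}" for u using psi_nonneg that by (auto simp: g_def)
    have cd: "0 \<le> cos ((v - m) / 2)" using True m hi_lo_less_pi by (intro cos_ge_zero) auto
    have "cos \<bar>(v - m) / 2\<bar> \<le> cos (D / 2)"
      using True m hi_lo_less_pi D by (intro cos_monotone_0_pi_le) auto
    then have cle: "cos ((v - m) / 2) \<le> cos (D / 2)" by (simp only: cos_abs_real)
    \<comment> \<open>Maximality of \<open>m\<close> turns a bound for \<open>g v * g m\<close> into one for \<open>g v\<close>.\<close>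
    have "(g v)\<^sup>2 \<le> g v * g m" using m(2)[of v] g0[of v] True
      by (simp add: power2_eq_square mult_left_mono)
    also have "\<dots> = (\<psi> v * \<psi> m) ^ n * (exp (- (M * x)))\<^sup>2"
    proof -
      have "exp (- (v * x)) * exp (- (m * x)) = (exp (- (M * x)))\<^sup>2"
        unfolding power2_eq_square by (simp only: exp_add[symmetric]) (simp add: M_def field_simps)
      moreover have "g v * g m = (\<psi> v * \<psi> m) ^ n * (exp (- (v * x)) * exp (- (m * x)))"
        by (simp only: g_def power_mult_distrib mult_ac)
      ultimately show ?thesis by simp
    qed
    also have "\<dots> \<le> ((\<psi> M * cos ((v - m) / 2))\<^sup>2) ^ n * (exp (- (M * x)))\<^sup>2"
      using True m pv unfolding M_def
      by (intro mult_right_mono power_mono psi_midpoint_log_concave) auto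
    also have "\<dots> = ((\<psi> M * cos ((v - m) / 2)) ^ n * exp (- (M * x)))\<^sup>2"
      by (simp only: power_mult_distrib power_mult[symmetric] mult.commute)
    finally have "g v \<le> (\<psi> M * cos ((v - m) / 2)) ^ n * exp (- (M * x))"
      by (rule power2_le_imp_le) (use pv cd in auto)
    also have "\<dots> \<le> (\<psi> M * cos (D / 2)) ^ n * exp (- (M * x))"
      using pv cd cle by (intro mult_right_mono power_mono mult_left_mono) auto
    also have "\<dots> = cos (D / 2) ^ n * G M"
      using Min by (simp add: G_def wt_def power_mult_distrib)
    finally have "g v \<le> cos (D / 2) ^ n * G M" .
    moreover have "G v = g v" using True by (simp add: G_def g_def wt_def)
    moreover have "M = m / 2 + (1 / 2) * v" by (simp add: M_def)
    ultimately show ?thesis using True by simp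
  qed
  have "(\<integral>v. indicator {v. D < \<bar>v - m\<bar>} v * G v \<partial>lborel)
      \<le> (\<integral>v. cos (D / 2) ^ n * G (m / 2 + (1 / 2) * v) \<partial>lborel)"
    using integrable_mult_indicator[of "{v. D < \<bar>v - m\<bar>}" lborel G] Gi Gi2
    by (intro integral_mono pt) auto
  also have "\<dots> = cos (D / 2) ^ n * (\<integral>v. G (m / 2 + (1 / 2) * v) \<partial>lborel)" by simp
  also have "(\<integral>v. G (m / 2 + (1 / 2) * v) \<partial>lborel) = 2 * (\<integral>v. G v \<partial>lborel)"
    using lborel_integral_real_affine[of "1 / 2" G "m / 2"] by simp
  finally show ?thesis unfolding G_def Fr_def by (auto intro!: exI[of _ m])
qed

lemma F_norm_ge_large_n:
  assumes Y: "0 \<le> Y"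
  shows "\<exists>n0. \<forall>n\<ge>n0. \<forall>x y. \<bar>y\<bar> \<le> Y \<longrightarrow> Fr n x / 2 \<le> norm (F r \<theta> n (of_real x - \<i> * of_real y))"
proof -
  \<comment> \<open>The width on which \<open>exp (i v y)\<close> varies by at most a quarter.\<close>
  define D where "D = 1 / (4 * (Y + 1))"
  have D: "0 < D" "D \<le> 1" "Y * D \<le> 1 / 4" using Y by (auto simp: D_def field_simps)
  have c: "0 \<le> cos (D / 2)" "cos (D / 2) < 1"
  proof -
    show "0 \<le> cos (D / 2)" using D pi_gt3 by (intro cos_ge_zero) auto
    have "cos (D / 2) < cos 0" using D pi_gt3 by (intro cos_monotone_0_pi) auto
    then show "cos (D / 2) < 1" by simp
  qed
  obtain n0 where n0: "cos (D / 2) ^ n0 < 1 / 16"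
    using real_arch_pow_inv[OF _ c(2), of "1/16"] by auto
  show ?thesis
  proof (intro exI allI impI)
    fix n x y assume n: "n0 \<le> n" and y: "\<bar>y\<bar> \<le> Y"
    obtain m where m: "(\<integral>v. indicator {v. D < \<bar>v - m\<bar>} v * (wt n v * exp (- (v * x))) \<partial>lborel)
       \<le> 2 * cos (D / 2) ^ n * Fr n x" using wt_tail_le D by blast
    have "cos (D / 2) ^ n \<le> cos (D / 2) ^ n0" using c n by (intro power_decreasing) auto
    then have cn: "cos (D / 2) ^ n \<le> 1 / 16" using n0 by simp
    have "(1 - Y * D - 2 * (2 * cos (D / 2) ^ n)) * Fr n x \<le> norm (F r \<theta> n (of_real x - \<i> * of_real y))"
      by (rule F_norm_ge_of_concentration[OF m y]) (use D in auto)
    moreover have "1 / 2 * Fr n x \<le> (1 - Y * D - 2 * (2 * cos (D / 2) ^ n)) * Fr n x"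
      using cn D Fr_pos[of n x] by (intro mult_right_mono) auto
    ultimately show "Fr n x / 2 \<le> norm (F r \<theta> n (of_real x - \<i> * of_real y))" by simp
  qed
qed

text \<open>For \<open>s * x\<close> large the factor \<open>exp (- (v * x))\<close> concentrates the measure at the end \<open>e\<close> of the arc, for fixed \<open>n\<close>.\<close>

lemma F_norm_ge_one_sided:
  fixes e s :: real
  assumes es: "(e = lo \<and> s = 1) \<or> (e = hi \<and> s = - 1)" and Y: "0 \<le> Y"
  shows "\<exists>N. \<forall>x y. N \<le> s * x \<and> \<bar>y\<bar> \<le> Y \<longrightarrow> Fr n x / 2 \<le> norm (F r \<theta> n (of_real x - \<i> * of_real y))"
proof -
  define D where "D = min (1 / (4 * (Y + 1))) ((hi - lo) / 2)"
  have YD: "Y * D \<le> 1 / 4"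
  proof -
    have "Y * D \<le> Y * (1 / (4 * (Y + 1)))" using Y by (intro mult_left_mono) (auto simp: D_def)
    also have "\<dots> \<le> 1 / 4" using Y by (simp add: field_simps)
    finally show ?thesis .
  qed
  have "D \<le> (hi - lo) / 2" unfolding D_def by (rule min.cobounded2)
  then have D: "0 < D" "D < hi - lo" using Y lo_less_hi by (auto simp: D_def)
  \<comment> \<open>Between these points \<open>\<psi>\<close> is bounded below, and the exponential exceeds its values on the tail by a factor that grows with \<open>s * x\<close>.\<close>
  define a where "a = (if s = 1 then lo + D / 4 else hi - D / 2)"
  define b where "b = (if s = 1 then lo + D / 2 else hi - D / 4)"
  have ab: "lo < a" "a \<le> b" "b < hi" "b - a = D / 4" using D es by (auto simp: a_def b_def)
  have "continuous_on {a..b} (\<lambda>u. \<psi> u ^ n)" by (intro continuous_intros)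
  then obtain u0 where u0: "u0 \<in> {a..b}" "\<And>u. u \<in> {a..b} \<Longrightarrow> \<psi> u0 ^ n \<le> \<psi> u ^ n"
    using continuous_attains_inf[of "{a..b}" "\<lambda>u. \<psi> u ^ n"] ab by auto
  define k where "k = \<psi> u0 ^ n"
  have k: "0 < k" using psi_pos[of u0] u0 ab by (simp add: k_def)
  have lower: "D / 4 * (k * exp (- (e * x) - s * x * (D / 2))) \<le> Fr n x" if "0 \<le> s * x" for x
    unfolding ab(4)[symmetric]
  proof (rule Fr_ge)
    fix u assume u: "a \<le> u" "u \<le> b"
    have "0 \<le> s * x * (D / 2 - s * (u - e))"
      by (rule mult_nonneg_nonneg[OF that]) (use u D es in \<open>auto simp: a_def b_def\<close>)
    moreover have "s * s = 1" using es by auto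
    ultimately have "- (e * x) - s * x * (D / 2) \<le> - (u * x)"
      using es by (auto simp: algebra_simps)
    then show "k * exp (- (e * x) - s * x * (D / 2)) \<le> \<psi> u ^ n * exp (- (u * x))"
      using u0(2)[of u] u k psi_nonneg[of u] ab by (intro mult_mono) (auto simp: k_def)
  qed (use ab in auto)
  have upper: "(\<integral>v. indicator {v. D < \<bar>v - e\<bar>} v * (wt n v * exp (- (v * x))) \<partial>lborel)
     \<le> (hi - lo) * exp (- (e * x) - s * x * D)" if "0 \<le> s * x" for x
  proof -
    have "(\<integral>v. indicator {v. D < \<bar>v - e\<bar>} v * (wt n v * exp (- (v * x))) \<partial>lborel)
      \<le> (\<integral>v. indicator {lo..hi} v * exp (- (e * x) - s * x * D) \<partial>lborel)"
    proof (rule integral_mono)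
      show "integrable lborel (\<lambda>v. indicator {v. D < \<bar>v - e\<bar>} v * (wt n v * exp (- (v * x))))"
        using integrable_mult_indicator[of "{v. D < \<bar>v - e\<bar>}" lborel "\<lambda>v. wt n v * exp (- (v * x))"]
          integrable_wt_exp by auto
      show "integrable lborel (\<lambda>v. indicator {lo..hi} v * exp (- (e * x) - s * x * D))"
        using lo_less_hi by simp
      fix v
      show "indicator {v. D < \<bar>v - e\<bar>} v * (wt n v * exp (- (v * x)))
          \<le> indicator {lo..hi} v * exp (- (e * x) - s * x * D)"
      proof (cases "lo < v \<and> v < hi \<and> D < \<bar>v - e\<bar>")
        case True
        have "0 \<le> s * x * (s * (v - e) - D)"
          by (rule mult_nonneg_nonneg[OF that]) (use True es in auto)
        moreover have "s * s = 1" using es by auto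
        ultimately have "- (v * x) \<le> - (e * x) - s * x * D"
          using es by (auto simp: algebra_simps)
        then have "wt n v * exp (- (v * x)) \<le> 1 * exp (- (e * x) - s * x * D)"
          using wt_le_1 wt_nonneg by (intro mult_mono) auto
        then show ?thesis using True by simp
      next
        case False
        then show ?thesis by (auto simp: indicator_def wt_def)
      qed
    qed
    also have "\<dots> = (hi - lo) * exp (- (e * x) - s * x * D)"
      using lo_less_hi by simp
    finally show ?thesis .
  qed
  define N where "N = max 0 (2 / D * ln (32 * (hi - lo) / (D * k)))"
  show ?thesis
  proof (intro exI allI impI)
    fix x y assume *: "N \<le> s * x \<and> \<bar>y\<bar> \<le> Y"
    then have sx: "0 \<le> s * x" by (simp add: N_def)
    have pos: "0 < 32 * (hi - lo) / (D * k)" using D k lo_less_hi by simp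
    have "2 / D * ln (32 * (hi - lo) / (D * k)) \<le> s * x" using * by (simp add: N_def)
    then have "ln (32 * (hi - lo) / (D * k)) \<le> s * x * (D / 2)" using D by (simp add: field_simps)
    then have "32 * (hi - lo) / (D * k) \<le> exp (s * x * (D / 2))"
      using pos by (metis exp_le_cancel_iff exp_ln)
    then have E: "32 * (hi - lo) \<le> D * k * exp (s * x * (D / 2))"
      using D k by (simp add: field_simps)
    have "(hi - lo) * exp (- (e * x) - s * x * D)
        \<le> (D * k * exp (s * x * (D / 2)) / 32) * exp (- (e * x) - s * x * D)"
      using E by (intro mult_right_mono) auto
    also have "\<dots> = 1 / 8 * (D / 4 * (k * exp (- (e * x) - s * x * (D / 2))))"
    proof -
      have "exp (s * x * (D / 2)) * exp (- (e * x) - s * x * D) = exp (- (e * x) - s * x * (D / 2))"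
        unfolding exp_add[symmetric] by (simp add: field_simps)
      then show ?thesis by (simp add: mult.assoc)
    qed
    also have "\<dots> \<le> 1 / 8 * Fr n x" using lower[OF sx] by simp
    finally have "(\<integral>v. indicator {v. D < \<bar>v - e\<bar>} v * (wt n v * exp (- (v * x))) \<partial>lborel) \<le> 1 / 8 * Fr n x"
      using upper[OF sx] by linarith
    then have "(1 - Y * D - 2 * (1 / 8)) * Fr n x \<le> norm (F r \<theta> n (of_real x - \<i> * of_real y))"
      by (rule F_norm_ge_of_concentration) (use * D in auto)
    moreover have "1 / 2 * Fr n x \<le> (1 - Y * D - 2 * (1 / 8)) * Fr n x"
      using YD Fr_pos[of n x] by (intro mult_right_mono) auto
    ultimately show "Fr n x / 2 \<le> norm (F r \<theta> n (of_real x - \<i> * of_real y))" by simp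
  qed
qed

lemma F_norm_ge_large_x:
  assumes Y: "0 \<le> Y"
  shows "\<exists>N. \<forall>x y. N \<le> \<bar>x\<bar> \<and> \<bar>y\<bar> \<le> Y \<longrightarrow> Fr n x / 2 \<le> norm (F r \<theta> n (of_real x - \<i> * of_real y))"
proof -
  obtain N1 where N1: "\<And>x y. N1 \<le> 1 * x \<Longrightarrow> \<bar>y\<bar> \<le> Y \<Longrightarrow> Fr n x / 2 \<le> norm (F r \<theta> n (of_real x - \<i> * of_real y))"
    using F_norm_ge_one_sided[of lo 1 Y n] Y by blast
  obtain N2 where N2: "\<And>x y. N2 \<le> - 1 * x \<Longrightarrow> \<bar>y\<bar> \<le> Y \<Longrightarrow> Fr n x / 2 \<le> norm (F r \<theta> n (of_real x - \<i> * of_real y))"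
    using F_norm_ge_one_sided[of hi "- 1" Y n] Y by blast
  show ?thesis
  proof (intro exI allI impI)
    fix x y assume *: "max N1 N2 \<le> \<bar>x\<bar> \<and> \<bar>y\<bar> \<le> Y"
    show "Fr n x / 2 \<le> norm (F r \<theta> n (of_real x - \<i> * of_real y))"
      using N1[of x y] N2[of x y] * by (cases "x \<ge> 0") auto
  qed
qed

lemma F_holomorphic: "F r \<theta> n holomorphic_on UNIV"
proof -
  have e: "F r \<theta> n = (\<lambda>\<xi>. integral (cbox lo hi) (\<lambda>v. exp (- (of_real v * \<xi>)) * of_real (\<psi> v ^ n)))"
    by (rule ext) (simp add: F_def Jint_eq integral_open_interval_real)
  show ?thesis unfolding e
  proof (rule leibniz_rule_holomorphic)
    show "((\<lambda>x. exp (- (of_real t * x)) * of_real (\<psi> t ^ n)) has_field_derivative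
        - of_real t * exp (- (of_real t * x)) * of_real (\<psi> t ^ n)) (at x within UNIV)" for x t
      by (auto intro!: derivative_eq_intros)
    show "(\<lambda>v. exp (- (of_real v * x)) * of_real (\<psi> v ^ n)) integrable_on cbox lo hi" for x :: complex
      by (intro integrable_continuous continuous_intros)
    show "continuous_on (UNIV \<times> cbox lo hi) (\<lambda>(x, t). - of_real t * exp (- (of_real t * x)) * complex_of_real (\<psi> t ^ n))"
      unfolding split_beta by (intro continuous_intros)
  qed auto
qed

lemma continuous_F [continuous_intros]:
  "continuous_on S f \<Longrightarrow> continuous_on S (\<lambda>x. F r \<theta> n (f x))"
  using continuous_on_compose2[OF holomorphic_on_imp_continuous_on[OF F_holomorphic]] by blast

lemma continuous_Fr [continuous_intros]:
  assumes "continuous_on S f" shows "continuous_on S (\<lambda>x. Fr n (f x))"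
proof -
  have "continuous_on S (\<lambda>x. Re (F r \<theta> n (of_real (f x))))"
    by (rule continuous_on_Re, rule continuous_F, rule continuous_on_of_real, rule assms)
  then show ?thesis by (simp add: F_of_real)
qed

text \<open>For large \<open>\<bar>x\<bar>\<close> the comparison with \<open>Fr\<close> holds anyway, and on the remaining compact interval it
  follows from the absence of zeros.\<close>

lemma F_norm_ge_on_line:
  assumes nz: "\<And>x::real. F r \<theta> n (of_real x - \<i> * of_real y) \<noteq> 0"
  shows "\<exists>c>0. \<forall>x. c * Fr n x \<le> norm (F r \<theta> n (of_real x - \<i> * of_real y))"
proof -
  obtain N where N: "\<And>x y'. N \<le> \<bar>x\<bar> \<Longrightarrow> \<bar>y'\<bar> \<le> \<bar>y\<bar> \<Longrightarrow> Fr n x / 2 \<le> norm (F r \<theta> n (of_real x - \<i> * of_real y'))"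
    using F_norm_ge_large_x[of "\<bar>y\<bar>" n] by auto
  define R where "R = (\<lambda>x. norm (F r \<theta> n (of_real x - \<i> * of_real y)) / Fr n x)"
  have "continuous_on {- \<bar>N\<bar>..\<bar>N\<bar>} R" unfolding R_def
    by (intro continuous_intros) (use Fr_pos[of n] in \<open>auto simp: less_le\<close>)
  then have "\<exists>x0\<in>{- \<bar>N\<bar>..\<bar>N\<bar>}. \<forall>x\<in>{- \<bar>N\<bar>..\<bar>N\<bar>}. R x0 \<le> R x"
    by (intro continuous_attains_inf) auto
  then obtain x0 where x0: "\<And>x. x \<in> {- \<bar>N\<bar>..\<bar>N\<bar>} \<Longrightarrow> R x0 \<le> R x"
    by blast
  have R0: "0 < R x0" unfolding R_def using nz Fr_pos by simp
  show ?thesis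
  proof (intro exI[of _ "min (1/2) (R x0)"] conjI allI)
    show "0 < min (1/2) (R x0)" using R0 by simp
    fix x
    show "min (1/2) (R x0) * Fr n x \<le> norm (F r \<theta> n (of_real x - \<i> * of_real y))"
    proof (cases "N \<le> \<bar>x\<bar>")
      case True
      have "min (1/2) (R x0) * Fr n x \<le> 1/2 * Fr n x"
        using Fr_pos[of n x] by (intro mult_right_mono) auto
      then show ?thesis using N[OF True, of y] by simp
    next
      case False
      then have "R x0 \<le> R x" by (intro x0) auto
      then have "R x0 * Fr n x \<le> norm (F r \<theta> n (of_real x - \<i> * of_real y))"
        using Fr_pos[of n x] by (simp add: R_def[of] pos_le_divide_eq)
      moreover have "min (1/2) (R x0) * Fr n x \<le> R x0 * Fr n x"
        using Fr_pos[of n x] by (intro mult_right_mono) auto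
      ultimately show ?thesis by linarith
    qed
  qed
qed

text \<open>The concentration bound gives the constant \<open>1/2\<close> for all large \<open>j\<close> at once, and the absence of zeros gives some constant for each of the remaining ones.\<close>

lemma F_norm_ge_on_line_uniform:
  assumes nz: "\<And>(x::real) j. F r \<theta> (Suc j) (of_real x - \<i> * of_real y) \<noteq> 0"
  shows "\<exists>c>0. \<forall>j x. c * Fr (Suc j) x \<le> norm (F r \<theta> (Suc j) (of_real x - \<i> * of_real y))"
proof -
  obtain n0 where n0: "\<And>n x y'. n0 \<le> n \<Longrightarrow> \<bar>y'\<bar> \<le> \<bar>y\<bar> \<Longrightarrow> Fr n x / 2 \<le> norm (F r \<theta> n (of_real x - \<i> * of_real y'))"
    using F_norm_ge_large_n[of "\<bar>y\<bar>"] by auto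
  have "\<exists>c>0. \<forall>x. c * Fr (Suc j) x \<le> norm (F r \<theta> (Suc j) (of_real x - \<i> * of_real y))" for j
    using F_norm_ge_on_line nz by blast
  then obtain c where c: "\<And>j. c j > 0" "\<And>j x. c j * Fr (Suc j) x \<le> norm (F r \<theta> (Suc j) (of_real x - \<i> * of_real y))"
    by metis
  define C where "C = Min (insert (1/2) (c ` {..n0}))"
  have C: "0 < C" "C \<le> 1/2" using c by (auto simp: C_def)
  have C3: "C \<le> c j" if "j \<le> n0" for j
    unfolding C_def using that by (intro Min_le) auto
  show ?thesis
  proof (intro exI[of _ C] conjI allI)
    fix j x
    show "C * Fr (Suc j) x \<le> norm (F r \<theta> (Suc j) (of_real x - \<i> * of_real y))"
    proof (cases "j \<le> n0")
      case True
      have "C * Fr (Suc j) x \<le> c j * Fr (Suc j) x"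
        using C3[OF True] Fr_pos[of "Suc j" x] by (intro mult_right_mono) auto
      then show ?thesis using c(2)[of j x] by linarith
    next
      case False
      have "C * Fr (Suc j) x \<le> 1/2 * Fr (Suc j) x"
        using C(2) Fr_pos[of "Suc j" x] by (intro mult_right_mono) auto
      then show ?thesis using n0[of "Suc j" y x] False by simp
    qed
  qed (rule C)
qed

lemma complex_eq_minus: "\<xi> = of_real (Re \<xi>) - \<i> * of_real (- Im \<xi>)"
  by (simp add: complex_eq_iff)

lemma finite_zeros_horizontal_strip: "finite {\<xi>. F r \<theta> n \<xi> = 0 \<and> \<bar>Im \<xi>\<bar> \<le> Y}"
proof -
  obtain N where N: "\<And>x y. N \<le> \<bar>x\<bar> \<Longrightarrow> \<bar>y\<bar> \<le> \<bar>Y\<bar> \<Longrightarrow> Fr n x / 2 \<le> norm (F r \<theta> n (of_real x - \<i> * of_real y))"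
    using F_norm_ge_large_x[of "\<bar>Y\<bar>" n] by auto
  define B where "B = cbox (Complex (- \<bar>N\<bar>) (- Y)) (Complex \<bar>N\<bar> Y)"
  have "finite {\<xi> \<in> B. F r \<theta> n \<xi> = 0}"
  proof (cases "F r \<theta> n constant_on UNIV")
    case True
    then have "F r \<theta> n \<xi> = F r \<theta> n (of_real 0)" for \<xi>
      unfolding constant_on_def by (metis UNIV_I)
    then have "F r \<theta> n \<xi> \<noteq> 0" for \<xi>
      using Fr_pos[of n 0] by (simp only: F_of_real) simp
    then show ?thesis by simp
  next
    case False
    then show ?thesis
      by (intro holomorphic_compact_finite_zeros[OF F_holomorphic]) (auto simp: B_def)
  qed
  moreover have "{\<xi>. F r \<theta> n \<xi> = 0 \<and> \<bar>Im \<xi>\<bar> \<le> Y} \<subseteq> {\<xi> \<in> B. F r \<theta> n \<xi> = 0}"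
  proof
    fix \<xi> assume \<xi>: "\<xi> \<in> {\<xi>. F r \<theta> n \<xi> = 0 \<and> \<bar>Im \<xi>\<bar> \<le> Y}"
    have "\<bar>Re \<xi>\<bar> < N"
    proof (rule ccontr)
      assume "\<not> \<bar>Re \<xi>\<bar> < N"
      moreover have "\<bar>- Im \<xi>\<bar> \<le> \<bar>Y\<bar>" using \<xi> by auto
      ultimately have "Fr n (Re \<xi>) / 2 \<le> norm (F r \<theta> n \<xi>)"
        using N[of "Re \<xi>" "- Im \<xi>"] complex_eq_minus[of \<xi>] by simp
      then show False using \<xi> Fr_pos[of n "Re \<xi>"] by simp
    qed
    then show "\<xi> \<in> {\<xi> \<in> B. F r \<theta> n \<xi> = 0}"
      using \<xi> by (auto simp: B_def in_cbox_complex_iff)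
  qed
  ultimately show ?thesis by (rule finite_subset[rotated])
qed

lemma finite_strip_zeros:
  assumes h: "0 \<le> h" shows "finite (strip_zeros r \<theta> h)"
proof -
  obtain n0 where n0: "\<And>n x y. n0 \<le> n \<Longrightarrow> \<bar>y\<bar> \<le> h \<Longrightarrow> Fr n x / 2 \<le> norm (F r \<theta> n (of_real x - \<i> * of_real y))"
    using F_norm_ge_large_n[OF h] by blast
  define Z where "Z = (\<lambda>j. {\<xi>. F r \<theta> (Suc j) \<xi> = 0 \<and> - h < Im \<xi> \<and> Im \<xi> < 0})"
  have fin: "finite (Z j)" for j
    by (rule finite_subset[OF _ finite_zeros_horizontal_strip[of "Suc j" h]]) (auto simp: Z_def)
  have emp: "j < n0" if "\<xi> \<in> Z j" for j \<xi>
  proof (rule ccontr)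
    assume "\<not> j < n0"
    then show False
      using n0[of "Suc j" "- Im \<xi>" "Re \<xi>"] that complex_eq_minus[of \<xi>] Fr_pos[of "Suc j" "Re \<xi>"]
      by (simp add: Z_def)
  qed
  have "strip_zeros r \<theta> h \<subseteq> (SIGMA j:{..<n0}. Z j)"
    using emp by (auto simp: strip_zeros_def Z_def)
  moreover have "finite (SIGMA j:{..<n0}. Z j)" using fin by auto
  ultimately show ?thesis by (rule finite_subset)
qed

end

section \<open>Contour shifts and residues\<close>

lemma tendsto_integral_symmetric_interval:
  fixes g :: "real \<Rightarrow> complex"
  assumes g: "integrable lborel g"
  shows "(\<lambda>n. integral {- real n..real n} g) \<longlonglongrightarrow> (\<integral>x. g x \<partial>lborel)"
proof -
  have "(\<lambda>n. \<integral>x. indicator {- real n..real n} x *\<^sub>R g x \<partial>lborel) \<longlonglongrightarrow> (\<integral>x. g x \<partial>lborel)"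
  proof (rule integral_dominated_convergence[where w = "\<lambda>x. norm (g x)"])
    show "AE x in lborel. (\<lambda>n. indicator {- real n..real n} x *\<^sub>R g x) \<longlonglongrightarrow> g x"
    proof (rule AE_I2)
      fix x
      obtain N :: nat where N: "\<bar>x\<bar> \<le> real N" using real_arch_simple by blast
      have "eventually (\<lambda>n. indicator {- real n..real n} x *\<^sub>R g x = g x) sequentially"
        using eventually_ge_at_top[of N]
      proof eventually_elim
        case (elim n)
        then have "\<bar>x\<bar> \<le> real n" using N by linarith
        then show ?case by (auto simp: indicator_def)
      qed
      then show "(\<lambda>n. indicator {- real n..real n} x *\<^sub>R g x) \<longlonglongrightarrow> g x"
        by (rule tendsto_eventually)
    qed
  qed (use g in \<open>auto simp: indicator_def\<close>)
  moreover have "(\<integral>x. indicator {- real n..real n} x *\<^sub>R g x \<partial>lborel) = integral {- real n..real n} g" for n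
  proof -
    have "set_integrable lborel {- real n..real n} g"
      unfolding set_integrable_def by (rule integrable_mult_indicator[OF _ g]) simp
    then show ?thesis
      using set_borel_integral_eq_integral(2)[of "{- real n..real n}" g]
      by (simp add: set_lebesgue_integral_def)
  qed
  ultimately show ?thesis by simp
qed

lemma contour_integral_horizontal:
  assumes "a < b"
  shows "contour_integral (linepath (of_real a + \<i> * of_real v) (of_real b + \<i> * of_real v)) f
    = integral {a..b} (\<lambda>x. f (of_real x + \<i> * of_real v))"
proof -
  have "contour_integral (linepath (of_real a + \<i> * of_real v) (of_real b + \<i> * of_real v)) f
      = contour_integral ((+) (\<i> * of_real v) \<circ> linepath (of_real a) (of_real b)) f"
    by (simp add: linepath_translate add.commute)
  also have "\<dots> = contour_integral (linepath (of_real a) (of_real b)) (\<lambda>x. f (x + \<i> * of_real v))"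
    by (rule contour_integral_translate)
  also have "\<dots> = integral {a..b} (\<lambda>x. f (of_real x + \<i> * of_real v))"
    using contour_integral_linepath_Reals_eq[of "of_real a" "of_real b" "\<lambda>x. f (x + \<i> * of_real v)"] assms
    by simp
  finally show ?thesis .
qed

text \<open>The residue theorem for a rectangle whose vertical sides recede to infinity, where the decay makes
  them negligible.\<close>

lemma line_shift_residues:
  fixes f :: "complex \<Rightarrow> complex" and B :: "real \<Rightarrow> real"
  assumes v: "w1 < v1" "v1 < v2" "v2 < w2"
    and fin: "finite P" and P: "P \<subseteq> {z. v1 < Im z \<and> Im z < v2}"
    and hol: "f holomorphic_on {z. w1 < Im z \<and> Im z < w2} - P"
    and decay: "\<And>z. v1 \<le> Im z \<Longrightarrow> Im z \<le> v2 \<Longrightarrow> N \<le> \<bar>Re z\<bar> \<Longrightarrow> norm (f z) \<le> B \<bar>Re z\<bar>"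
    and B: "(B \<longlongrightarrow> 0) at_top"
    and i1: "integrable lborel (\<lambda>x. f (of_real x + \<i> * of_real v1))"
    and i2: "integrable lborel (\<lambda>x. f (of_real x + \<i> * of_real v2))"
  shows "(\<integral>x. f (of_real x + \<i> * of_real v1) \<partial>lborel) - (\<integral>x. f (of_real x + \<i> * of_real v2) \<partial>lborel)
    = 2 * pi * \<i> * (\<Sum>p\<in>P. residue f p)"
proof -
  define S where "S = {z. w1 < Im z \<and> Im z < w2}"
  have S: "S = {z. w1 < Im z} \<inter> {z. Im z < w2}" by (auto simp: S_def)
  have oS: "open S" unfolding S by (intro open_Int open_halfspace_Im_gt open_halfspace_Im_lt)
  have cS: "convex S" unfolding S by (intro convex_Int convex_halfspace_Im_gt convex_halfspace_Im_lt)
  have fc: "continuous_on (S - P) f"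
    using hol holomorphic_on_imp_continuous_on S_def by blast
  obtain M where M: "\<And>p. p \<in> P \<Longrightarrow> \<bar>Re p\<bar> < M"
  proof -
    have "\<bar>Re p\<bar> < (\<Sum>p\<in>P. \<bar>Re p\<bar>) + 1" if "p \<in> P" for p
      using member_le_sum[of p P "\<lambda>p. \<bar>Re p\<bar>"] that fin by simp
    then show ?thesis using that by blast
  qed
  define I where "I = (\<lambda>v R. integral {- R..R} (\<lambda>x. f (of_real x + \<i> * of_real v)))"
  define c where "c = (\<lambda>R v. complex_of_real R + \<i> * of_real v)"
  have main: "norm (I v1 R - I v2 R - 2 * pi * \<i> * (\<Sum>p\<in>P. residue f p)) \<le> 2 * (v2 - v1) * B R"
    if R: "R > 0" "N \<le> R" "M \<le> R" for R
  proof -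
    let ?a = "c (- R) v1" and ?b = "c R v2"
    define g where "g = rectpath ?a ?b"
    have g: "g = linepath (c (-R) v1) (c R v1) +++ linepath (c R v1) (c R v2)
        +++ linepath (c R v2) (c (-R) v2) +++ linepath (c (-R) v2) (c (-R) v1)"
    proof -
      have "Complex (Re ?b) (Im ?a) = c R v1" "Complex (Re ?a) (Im ?b) = c (- R) v2"
        by (simp_all add: c_def complex_eq_iff)
      then show ?thesis by (simp only: g_def rectpath_def Let_def)
    qed
    have pim: "path_image g = cbox ?a ?b - box ?a ?b"
      unfolding g_def by (rule path_image_rectpath_cbox_minus_box) (use R v in \<open>simp_all add: c_def\<close>)
    have inbox: "p \<in> box ?a ?b" if "p \<in> P" for p
    proof -
      have "v1 < Im p" "Im p < v2" using P that by auto
      moreover have "\<bar>Re p\<bar> < R" using M[OF that] R by linarith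
      ultimately show ?thesis by (simp add: in_box_complex_iff c_def abs_less_iff)
    qed
    have gS: "path_image g \<subseteq> S - P"
    proof
      fix z assume "z \<in> path_image g"
      then have z: "z \<in> cbox ?a ?b" "z \<notin> box ?a ?b" unfolding pim by auto
      have "z \<in> S" using z(1) v by (simp add: in_cbox_complex_iff c_def S_def)
      then show "z \<in> S - P" using z(2) inbox by blast
    qed
    have segs: "closed_segment (c (-R) v1) (c R v1) \<subseteq> S - P" "closed_segment (c R v1) (c R v2) \<subseteq> S - P"
      "closed_segment (c R v2) (c (-R) v2) \<subseteq> S - P" "closed_segment (c (-R) v2) (c (-R) v1) \<subseteq> S - P"
      using gS unfolding g by (auto simp: path_image_join)
    have ci: "f contour_integrable_on linepath x y" if "closed_segment x y \<subseteq> S - P" for x y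
      by (intro contour_integrable_continuous_linepath continuous_on_subset[OF fc] that)
    have "contour_integral g f = 2 * pi * \<i> * (\<Sum>p\<in>P. winding_number g p * residue f p)"
    proof (rule Residue_theorem[OF oS convex_connected[OF cS] fin])
      show "f holomorphic_on S - P" using hol by (simp add: S_def)
      show "\<forall>z. z \<notin> S \<longrightarrow> winding_number g z = 0"
        unfolding g_def using R v
        by (auto intro!: winding_number_rectpath_outside simp: in_cbox_complex_iff c_def S_def)
    qed (use gS in \<open>auto simp: g_def\<close>)
    also have "(\<Sum>p\<in>P. winding_number g p * residue f p) = (\<Sum>p\<in>P. residue f p)"
    proof (rule sum.cong[OF refl])
      fix p assume "p \<in> P"
      then have "p \<in> box ?a ?b" by (rule inbox)
      then show "winding_number g p * residue f p = residue f p"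
        unfolding g_def by (simp add: winding_number_rectpath)
    qed
    finally have res: "contour_integral g f = 2 * pi * \<i> * (\<Sum>p\<in>P. residue f p)" .
    have "contour_integral g f = contour_integral (linepath (c (-R) v1) (c R v1)) f
       + (contour_integral (linepath (c R v1) (c R v2)) f
       + (contour_integral (linepath (c R v2) (c (-R) v2)) f
       + contour_integral (linepath (c (-R) v2) (c (-R) v1)) f))"
      unfolding g using segs by (simp add: ci)
    moreover have "contour_integral (linepath (c (-R) v1) (c R v1)) f = I v1 R"
      unfolding c_def I_def using R by (intro contour_integral_horizontal) simp
    moreover have "contour_integral (linepath (c R v2) (c (-R) v2)) f = - I v2 R"
    proof -
      have "contour_integral (linepath (c R v2) (c (-R) v2)) f = - contour_integral (linepath (c (-R) v2) (c R v2)) f"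
        using ci segs(3) by (intro contour_integral_reverse_linepath contour_integrable_continuous_linepath
            continuous_on_subset[OF fc]) (simp add: closed_segment_commute)
      also have "contour_integral (linepath (c (-R) v2) (c R v2)) f = I v2 R"
        unfolding c_def I_def using R by (intro contour_integral_horizontal) simp
      finally show ?thesis .
    qed
    moreover have side: "norm (contour_integral (linepath x y) f) \<le> B R * (v2 - v1)"
      if "closed_segment x y \<subseteq> S - P" and e: "\<exists>s\<in>{R, -R}. (x = c s v1 \<and> y = c s v2) \<or> (x = c s v2 \<and> y = c s v1)" for x y
    proof -
      have n: "norm (y - x) = v2 - v1"
        using e v by (auto simp: c_def norm_mult simp flip: right_diff_distrib of_real_diff)
      have "norm (contour_integral (linepath x y) f) \<le> B R * norm (y - x)"
      proof (rule contour_integral_bound_linepath[OF ci[OF that(1)]])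
        have z: "norm (f z) \<le> B R" if zin: "z \<in> closed_segment x y" for z
        proof -
          obtain s where s: "s \<in> {R, - R}" "(x = c s v1 \<and> y = c s v2) \<or> (x = c s v2 \<and> y = c s v1)"
            using e by blast
          obtain u where u: "0 \<le> u" "u \<le> 1" "z = (1 - u) *\<^sub>R x + u *\<^sub>R y"
            using zin by (auto simp: in_segment)
          have "Re z = (1 - u) * Re x + u * Re y" using u(3) by simp
          moreover have "Re x = s" "Re y = s" using s(2) by (auto simp: c_def)
          ultimately have "Re z = s" by (simp add: algebra_simps)
          moreover have "Im z \<in> closed_segment (Im x) (Im y)"
            using u by (auto simp: in_segment)
          then have "v1 \<le> Im z \<and> Im z \<le> v2"
            using s(2) v by (auto simp: c_def closed_segment_eq_real_ivl split: if_splits)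
          moreover have "\<bar>s\<bar> = R" using s(1) R(1) by auto
          ultimately show ?thesis using decay[of z] R(2) by simp
        qed
        then show "norm (f z) \<le> B R" if "z \<in> closed_segment x y" for z using that .
        show "0 \<le> B R" using z[of x] norm_ge_zero order_trans by (metis ends_in_segment(1))
      qed
      then show ?thesis using n by simp
    qed
    ultimately have "I v1 R - I v2 R - 2 * pi * \<i> * (\<Sum>p\<in>P. residue f p)
      = - (contour_integral (linepath (c R v1) (c R v2)) f + contour_integral (linepath (c (-R) v2) (c (-R) v1)) f)"
      using res by (simp add: algebra_simps)
    then have "norm (I v1 R - I v2 R - 2 * pi * \<i> * (\<Sum>p\<in>P. residue f p))
       \<le> norm (contour_integral (linepath (c R v1) (c R v2)) f) + norm (contour_integral (linepath (c (-R) v2) (c (-R) v1)) f)"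
      by (simp only: norm_minus_cancel norm_triangle_ineq)
    also have "\<dots> \<le> B R * (v2 - v1) + B R * (v2 - v1)"
      using segs by (intro add_mono side) auto
    finally show ?thesis by (simp add: algebra_simps)
  qed
  have "(\<lambda>n. I v1 (real n) - I v2 (real n)) \<longlonglongrightarrow>
      (\<integral>x. f (of_real x + \<i> * of_real v1) \<partial>lborel) - (\<integral>x. f (of_real x + \<i> * of_real v2) \<partial>lborel)"
    unfolding I_def by (intro tendsto_diff tendsto_integral_symmetric_interval i1 i2)
  moreover have "(\<lambda>n. I v1 (real n) - I v2 (real n)) \<longlonglongrightarrow> 2 * pi * \<i> * (\<Sum>p\<in>P. residue f p)"
  proof (rule LIM_zero_cancel, rule Lim_null_comparison)
    have "eventually (\<lambda>n. max 1 (max N M) \<le> real n) sequentially"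
      using filterlim_real_sequentially unfolding filterlim_at_top by blast
    then show "eventually (\<lambda>n. norm (I v1 (real n) - I v2 (real n) - 2 * pi * \<i> * (\<Sum>p\<in>P. residue f p))
        \<le> 2 * (v2 - v1) * B (real n)) sequentially"
      by (rule eventually_mono) (rule main; simp)
    have "(\<lambda>n. B (real n)) \<longlonglongrightarrow> 0"
      using filterlim_compose[OF B filterlim_real_sequentially] .
    then show "(\<lambda>n. 2 * (v2 - v1) * B (real n)) \<longlonglongrightarrow> 0"
      using tendsto_mult_right_zero by blast
  qed
  ultimately show ?thesis by (rule LIMSEQ_unique)
qed

lemma higher_deriv_exp_mult: "(deriv ^^ n) (\<lambda>w. exp (c * w)) = (\<lambda>w::complex. c ^ n * exp (c * w))"
proof (induction n)
  case (Suc n)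
  have "deriv (\<lambda>w. c ^ n * exp (c * w)) w = c ^ Suc n * exp (c * w)" for w
    by (rule DERIV_imp_deriv) (auto intro!: derivative_eq_intros)
  then show ?case unfolding funpow.simps o_apply Suc.IH by (intro ext)
qed simp

text \<open>Write \<open>F w = g w * (w - \<xi>) ^ m\<close>. The residue is the \<open>(m - 1)\<close>-st Taylor coefficient of \<open>exp (c * w) / g w\<close>,
  and by the Leibniz rule this is \<open>exp (c * \<xi>)\<close> times a polynomial in \<open>c\<close>. Its top coefficient comes
  from putting all derivatives on the exponential, hence is a nonzero multiple of \<open>1 / g \<xi>\<close>.\<close>

lemma residue_exp_over_zero:
  fixes F :: "complex \<Rightarrow> complex"
  assumes F: "F holomorphic_on UNIV" and z: "F \<xi> = 0" and nz: "F w \<noteq> 0"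
  shows "\<exists>Q. Q \<noteq> 0 \<and> int (degree Q) = zorder F \<xi> - 1 \<and>
    (\<forall>c. residue (\<lambda>w. exp (c * w) / F w) \<xi> = exp (c * \<xi>) * poly Q c)"
proof -
  define g where "g = zor_poly F \<xi>"
  define m where "m = nat (zorder F \<xi>) - 1"
  have "(if F \<xi> = 0 then zorder F \<xi> > 0 else zorder F \<xi> = 0) \<and> (\<exists>r. r>0 \<and> cball \<xi> r \<subseteq> UNIV \<and> g holomorphic_on cball \<xi> r
    \<and> (\<forall>w\<in>cball \<xi> r. F w = g w * (w-\<xi>) ^ nat (zorder F \<xi>) \<and> g w \<noteq>0))"
    unfolding g_def by (rule zorder_exist_zero[OF F]) (use nz in auto)
  then obtain \<rho> where pos: "zorder F \<xi> > 0" and \<rho>: "\<rho> > 0" and gh: "g holomorphic_on cball \<xi> \<rho>"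
    and eq: "\<And>w. w \<in> cball \<xi> \<rho> \<Longrightarrow> F w = g w * (w-\<xi>) ^ nat (zorder F \<xi>)"
    and g0: "\<And>w. w \<in> cball \<xi> \<rho> \<Longrightarrow> g w \<noteq> 0"
    using z by auto
  have m: "nat (zorder F \<xi>) = Suc m" "zorder F \<xi> - 1 = int m" using pos by (auto simp: m_def)
  define H where "H = (\<lambda>w. 1 / g w)"
  have Hh: "H holomorphic_on ball \<xi> \<rho>" unfolding H_def
    using g0 by (intro holomorphic_intros holomorphic_on_subset[OF gh]) auto
  define q where "q = (\<lambda>i. of_nat (m choose i) * (deriv ^^ (m - i)) H \<xi> / fact m)"
  define Q where "Q = (\<Sum>i=0..m. monom (q i) i)"
  have cQ: "coeff Q i = (if i \<le> m then q i else 0)" for i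
    by (auto simp: Q_def coeff_sum coeff_monom)
  have qm: "q m \<noteq> 0" using g0[of \<xi>] \<rho> by (simp add: q_def H_def)
  have deg: "degree Q = m"
    using cQ qm by (intro antisym degree_le le_degree) auto
  have res: "residue (\<lambda>w. exp (c * w) / F w) \<xi> = exp (c * \<xi>) * poly Q c" for c
  proof -
    have "residue (\<lambda>w. exp (c * w) / F w) \<xi> = residue (\<lambda>w. (exp (c * w) * H w) / (w - \<xi>) ^ Suc m) \<xi>"
    proof (rule residue_cong[OF _ refl])
      have "eventually (\<lambda>w. w \<in> ball \<xi> \<rho>) (at \<xi>)"
        using \<rho> by (intro eventually_at_in_open') auto
      then show "eventually (\<lambda>w. exp (c * w) / F w = (exp (c * w) * H w) / (w - \<xi>) ^ Suc m) (at \<xi>)"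
        by eventually_elim (simp add: eq H_def m(1))
    qed
    also have "\<dots> = (deriv ^^ m) (\<lambda>w. exp (c * w) * H w) \<xi> / fact m"
      by (rule residue_holomorphic_over_power[of "ball \<xi> \<rho>"])
         (use \<rho> Hh in \<open>auto intro!: holomorphic_intros\<close>)
    also have "(deriv ^^ m) (\<lambda>w. exp (c * w) * H w) \<xi>
      = (\<Sum>i=0..m. of_nat (m choose i) * (deriv ^^ i) (\<lambda>w. exp (c * w)) \<xi> * (deriv ^^ (m-i)) H \<xi>)"
      by (rule higher_deriv_mult[of _ "ball \<xi> \<rho>"])
         (use \<rho> Hh in \<open>auto intro!: holomorphic_intros\<close>)
    also have "\<dots> / fact m = exp (c * \<xi>) * poly Q c"
      unfolding higher_deriv_exp_mult
      by (simp add: Q_def poly_sum poly_monom q_def sum_distrib_left sum_divide_distrib mult_ac)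
    finally show ?thesis .
  qed
  show ?thesis
    using deg qm cQ[of m] m res by (intro exI[of _ Q]) auto
qed

section \<open>The kernel of the strip\<close>

lemma integrable_exp_neg_abs:
  assumes "0 < (\<delta>::real)" shows "integrable lborel (\<lambda>x. exp (- (\<delta> * \<bar>x\<bar>)))"
proof -
  have half: "(\<integral>\<^sup>+x. ennreal (exp (- (\<delta> * x))) * indicator {0..} x \<partial>lborel) = ennreal (1 / \<delta>)"
  proof -
    have "(\<integral>\<^sup>+x. ennreal (exp (- (\<delta> * x))) * indicator {0..} x \<partial>lborel) = ennreal (0 - - exp (- (\<delta> * 0)) / \<delta>)"
    proof (rule nn_integral_FTC_atLeast)
      show "((\<lambda>x. - exp (- (\<delta> * x)) / \<delta>) has_real_derivative exp (- (\<delta> * x))) (at x)" for x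
        using assms by (auto intro!: derivative_eq_intros)
      have "((\<lambda>x. - exp (- (\<delta> * x)) / \<delta>) \<longlongrightarrow> - 0 / \<delta>) at_top"
        using assms by (intro tendsto_intros filterlim_compose[OF exp_at_bot]
            filterlim_compose[OF filterlim_uminus_at_bot_at_top] filterlim_tendsto_pos_mult_at_top filterlim_ident)
           auto
      then show "((\<lambda>x. - exp (- (\<delta> * x)) / \<delta>) \<longlongrightarrow> 0) at_top" by simp
    qed auto
    then show ?thesis by simp
  qed
  have neg: "(\<integral>\<^sup>+x. ennreal (exp (\<delta> * x)) * indicator {..0} x \<partial>lborel) = ennreal (1 / \<delta>)"
  proof -
    have "(\<integral>\<^sup>+x. ennreal (exp (\<delta> * x)) * indicator {..0} x \<partial>lborel)
        = (\<integral>\<^sup>+x. ennreal (exp (\<delta> * (0 + - 1 * x))) * indicator {..0} (0 + - 1 * x) \<partial>lborel)"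
      by (subst nn_integral_real_affine[where c = "- 1" and t = 0]) auto
    also have "\<dots> = (\<integral>\<^sup>+x. ennreal (exp (- (\<delta> * x))) * indicator {0..} x \<partial>lborel)"
      by (intro nn_integral_cong) (auto simp: indicator_def)
    finally show ?thesis using half by simp
  qed
  have "(\<integral>\<^sup>+x. ennreal (exp (- (\<delta> * \<bar>x\<bar>))) \<partial>lborel)
    \<le> (\<integral>\<^sup>+x. ennreal (exp (- (\<delta> * x))) * indicator {0..} x + ennreal (exp (\<delta> * x)) * indicator {..0} x \<partial>lborel)"
    by (intro nn_integral_mono) (auto simp: indicator_def abs_if)
  also have "\<dots> = ennreal (1 / \<delta>) + ennreal (1 / \<delta>)"
    using half neg by (subst nn_integral_add) auto
  also have "\<dots> < \<infinity>" by simp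
  finally show ?thesis by (intro integrableI_bounded) auto
qed

lemma exp_neg_abs_tendsto_0: "0 < \<delta> \<Longrightarrow> ((\<lambda>x. C * exp (- (\<delta> * x))) \<longlongrightarrow> 0) at_top" for C \<delta> :: real
proof -
  assume "0 < \<delta>"
  then have "((\<lambda>x. C * exp (- (\<delta> * x))) \<longlongrightarrow> C * 0) at_top"
    by (intro tendsto_intros filterlim_compose[OF exp_at_bot]
            filterlim_compose[OF filterlim_uminus_at_bot_at_top] filterlim_tendsto_pos_mult_at_top filterlim_ident)
           auto
  then show ?thesis by simp
qed

lemma integrable_exp_dominated:
  fixes f :: "real \<Rightarrow> 'b::{banach, second_countable_topology}"
  assumes "f \<in> borel_measurable borel" "0 < \<delta>" "\<And>x. norm (f x) \<le> C * exp (- (\<delta> * \<bar>x\<bar>))"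
  shows "integrable lborel f"
proof (rule Bochner_Integration.integrable_bound)
  show "integrable lborel (\<lambda>x. C * exp (- (\<delta> * \<bar>x\<bar>)))"
    by (intro integrable_mult_right integrable_exp_neg_abs assms)
  show "AE x in lborel. norm (f x) \<le> norm (C * exp (- (\<delta> * \<bar>x\<bar>)))"
  proof (rule AE_I2)
    fix x have "norm (f x) \<le> C * exp (- (\<delta> * \<bar>x\<bar>))" by (rule assms)
    also have "\<dots> \<le> norm (C * exp (- (\<delta> * \<bar>x\<bar>)))" by simp
    finally show "norm (f x) \<le> norm (C * exp (- (\<delta> * \<bar>x\<bar>)))" .
  qed
qed (use assms in auto)

context lens_angle
begin

lemma Fr_nz: "Fr n x \<noteq> 0" using Fr_pos[of n x] by simp

text \<open>With half of \<open>\<psi> v0\<close> sacrificed, the weight \<open>sqrt (\<psi> v) ^ j\<close> makes the bound uniform up to the boundary of the strip.\<close>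

lemma kernel_ratio_bound:
  assumes v0: "lo < v0" "v0 < hi"
  shows "\<exists>C>0. \<exists>\<delta>>0. \<forall>v x. lo < v \<and> v < hi \<longrightarrow>
    sqrt (\<psi> v) ^ j * exp (- (x * (v + v0) / 2)) / Fr (Suc j) x \<le> C * exp (- (\<delta> * \<bar>x\<bar>))"
proof -
  define \<eta> where "\<eta> = \<psi> v0 / 2"
  have \<eta>: "0 < \<eta>" "2 * \<eta> \<le> \<psi> v0" using psi_pos[OF v0] by (auto simp: \<eta>_def)
  define \<delta> where "\<delta> = \<eta> / (2 * (1 + r))"
  have \<delta>: "0 < \<delta>" using \<eta> r_pos by (simp add: \<delta>_def)
  define C where "C = 4 / (\<delta> * \<eta>) / sqrt \<eta> ^ j"
  show ?thesis
  proof (intro exI conjI allI impI)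
    show "0 < C" using \<delta> \<eta> by (simp add: C_def)
    show "0 < \<delta> / 2" using \<delta> by simp
    fix v x assume v: "lo < v \<and> v < hi"
    have "exp (- (x * (v + v0) / 2)) * sqrt (\<psi> v * (\<psi> v0 - \<eta>)) ^ j
        \<le> 4 / (\<delta> * \<eta>) * exp (- (\<delta> * \<bar>x\<bar> / 2)) * Fr (Suc j) x"
      using v by (intro kernel_weight_bound v0 \<eta> \<delta>_def) auto
    moreover have "\<psi> v0 - \<eta> = \<eta>" by (simp add: \<eta>_def)
    ultimately have "sqrt \<eta> ^ j * (sqrt (\<psi> v) ^ j * exp (- (x * (v + v0) / 2)))
        \<le> 4 / (\<delta> * \<eta>) * exp (- (\<delta> * \<bar>x\<bar> / 2)) * Fr (Suc j) x"
      by (simp add: real_sqrt_mult power_mult_distrib mult_ac)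
    moreover have ratio: "Z / f \<le> Q / A" if "0 < A" "0 < f" "A * Z \<le> Q * f" for A Z Q f :: real
      using that by (simp add: field_simps)
    moreover have "0 < sqrt \<eta> ^ j" using \<eta> by simp
    ultimately have "sqrt (\<psi> v) ^ j * exp (- (x * (v + v0) / 2)) / Fr (Suc j) x
        \<le> 4 / (\<delta> * \<eta>) * exp (- (\<delta> * \<bar>x\<bar> / 2)) / sqrt \<eta> ^ j"
      using Fr_pos[of "Suc j" x] by blast
    then show "sqrt (\<psi> v) ^ j * exp (- (x * (v + v0) / 2)) / Fr (Suc j) x \<le> C * exp (- (\<delta> / 2 * \<bar>x\<bar>))"
      by (simp add: C_def)
  qed
qed

lemma exp_ratio_bound:
  assumes t: "lo < t" "t < hi" and n: "0 < n"
  shows "\<exists>C>0. \<exists>\<delta>>0. \<forall>x. exp (- (x * t)) / Fr n x \<le> C * exp (- (\<delta> * \<bar>x\<bar>))"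
proof -
  obtain j where j: "n = Suc j" using n gr0_implies_Suc by blast
  obtain C \<delta> where C: "C > 0" "\<delta> > 0" "\<And>v x. lo < v \<and> v < hi \<Longrightarrow>
    sqrt (\<psi> v) ^ j * exp (- (x * (v + t) / 2)) / Fr (Suc j) x \<le> C * exp (- (\<delta> * \<bar>x\<bar>))"
    using kernel_ratio_bound[OF t] by blast
  have p: "0 < sqrt (\<psi> t) ^ j" using psi_pos[OF t] by simp
  show ?thesis
  proof (intro exI conjI allI)
    show "0 < C / sqrt (\<psi> t) ^ j" using C p by simp
    fix x
    have "sqrt (\<psi> t) ^ j * (exp (- (x * t)) / Fr n x) \<le> C * exp (- (\<delta> * \<bar>x\<bar>))"
      using C(3)[of t x] t unfolding j by simp
    then show "exp (- (x * t)) / Fr n x \<le> C / sqrt (\<psi> t) ^ j * exp (- (\<delta> * \<bar>x\<bar>))"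
      using p by (simp add: field_simps)
  qed (rule C)
qed

text \<open>For \<open>t\<close> between \<open>a\<close> and \<open>b\<close> the exponential is dominated by the sum of those at the two ends.\<close>

lemma exp_ratio_bound_uniform:
  assumes ab: "lo < a" "a \<le> b" "b < hi" and n: "0 < n"
  shows "\<exists>C>0. \<exists>\<delta>>0. \<forall>x t. a \<le> t \<and> t \<le> b \<longrightarrow> exp (- (x * t)) / Fr n x \<le> C * exp (- (\<delta> * \<bar>x\<bar>))"
proof -
  obtain C1 d1 where 1: "C1 > 0" "d1 > 0" "\<And>x. exp (- (x * a)) / Fr n x \<le> C1 * exp (- (d1 * \<bar>x\<bar>))"
    using exp_ratio_bound[of a n] ab n by auto
  obtain C2 d2 where 2: "C2 > 0" "d2 > 0" "\<And>x. exp (- (x * b)) / Fr n x \<le> C2 * exp (- (d2 * \<bar>x\<bar>))"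
    using exp_ratio_bound[of b n] ab n by auto
  show ?thesis
  proof (intro exI conjI allI impI)
    show "0 < C1 + C2" "0 < min d1 d2" using 1 2 by auto
    fix x t assume t: "a \<le> t \<and> t \<le> b"
    have "exp (- (x * t)) \<le> exp (- (x * a)) + exp (- (x * b))"
    proof (cases "x \<ge> 0")
      case True
      then have "exp (- (x * t)) \<le> exp (- (x * a))" using t by (simp add: mult_left_mono)
      then show ?thesis by (simp add: add_increasing2)
    next
      case False
      then have "exp (- (x * t)) \<le> exp (- (x * b))" using t by (simp add: mult_left_mono_neg)
      then show ?thesis by (simp add: add_increasing)
    qed
    then have "exp (- (x * t)) / Fr n x \<le> (exp (- (x * a)) + exp (- (x * b))) / Fr n x"
      using Fr_pos[of n x] by (simp add: divide_right_mono)
    also have "\<dots> \<le> C1 * exp (- (d1 * \<bar>x\<bar>)) + C2 * exp (- (d2 * \<bar>x\<bar>))"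
      unfolding add_divide_distrib by (intro add_mono 1 2)
    also have "\<dots> \<le> C1 * exp (- (min d1 d2 * \<bar>x\<bar>)) + C2 * exp (- (min d1 d2 * \<bar>x\<bar>))"
      using 1 2 by (intro add_mono mult_left_mono) (auto intro!: mult_right_mono)
    finally show "exp (- (x * t)) / Fr n x \<le> (C1 + C2) * exp (- (min d1 d2 * \<bar>x\<bar>))"
      by (simp add: algebra_simps)
  qed
qed

text \<open>The kernel of the strip with weight \<open>\<psi> ^ n\<close>, written as an integral over the line \<open>Im \<xi> = - y\<close>. The
  reproducing kernel is the case \<open>y = 0\<close>, where \<open>F\<close> has no zeros; the other lines produce the expansion.\<close>

definition kern_at :: "nat \<Rightarrow> real \<Rightarrow> complex \<Rightarrow> complex" where
  "kern_at n y \<tau> = (\<integral>x. exp (\<i> * (of_real x - \<i> * of_real y) * \<tau> / 2) /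
     F r \<theta> n (of_real x - \<i> * of_real y) \<partial>lborel) / (4 * pi)"

abbreviation kern :: "nat \<Rightarrow> complex \<Rightarrow> complex" where "kern n \<equiv> kern_at n 0"

lemma norm_exp_line: "norm (exp (\<i> * (of_real x - \<i> * of_real y) * \<tau> / 2)) = exp (y * Re \<tau> / 2) * exp (- (x * (Im \<tau> / 2)))"
  by (simp add: norm_exp_eq_Re algebra_simps diff_divide_distrib flip: exp_add)

lemma kern_integrand_bound:
  assumes c: "c > 0" "\<And>x. c * Fr n x \<le> norm (F r \<theta> n (of_real x - \<i> * of_real y))"
  shows "norm (exp (\<i> * (of_real x - \<i> * of_real y) * \<tau> / 2) / F r \<theta> n (of_real x - \<i> * of_real y))
    \<le> exp (y * Re \<tau> / 2) / c * (exp (- (x * (Im \<tau> / 2))) / Fr n x)"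
proof -
  have "norm (exp (\<i> * (of_real x - \<i> * of_real y) * \<tau> / 2) / F r \<theta> n (of_real x - \<i> * of_real y))
      \<le> exp (y * Re \<tau> / 2) * exp (- (x * (Im \<tau> / 2))) / (c * Fr n x)"
    unfolding norm_divide norm_exp_line
    using c Fr_pos[of n x] by (intro divide_left_mono) (auto intro!: mult_pos_pos intro: less_le_trans)
  then show ?thesis by simp
qed

lemma kern_integrand_measurable:
  "(\<lambda>x. exp (\<i> * (of_real x - \<i> * of_real y) * \<tau> / 2) / F r \<theta> n (of_real x - \<i> * of_real y)) \<in> borel_measurable borel"
  by (intro borel_measurable_divide borel_measurable_continuous_onI continuous_intros) auto

lemma kern_integrand_integrable:
  assumes nz: "\<And>x::real. F r \<theta> n (of_real x - \<i> * of_real y) \<noteq> 0" and n: "0 < n"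
    and \<tau>: "lo < Im \<tau> / 2" "Im \<tau> / 2 < hi"
  shows "integrable lborel (\<lambda>x. exp (\<i> * (of_real x - \<i> * of_real y) * \<tau> / 2) / F r \<theta> n (of_real x - \<i> * of_real y))"
proof -
  obtain c where c: "c > 0" "\<And>x. c * Fr n x \<le> norm (F r \<theta> n (of_real x - \<i> * of_real y))"
    using F_norm_ge_on_line[OF nz] by blast
  obtain C \<delta> where C: "C > 0" "\<delta> > 0" "\<And>x. exp (- (x * (Im \<tau> / 2))) / Fr n x \<le> C * exp (- (\<delta> * \<bar>x\<bar>))"
    using exp_ratio_bound[OF \<tau> n] by auto
  show ?thesis
  proof (rule integrable_exp_dominated[OF kern_integrand_measurable C(2)])
    fix x
    have "norm (exp (\<i> * (of_real x - \<i> * of_real y) * \<tau> / 2) / F r \<theta> n (of_real x - \<i> * of_real y))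
      \<le> exp (y * Re \<tau> / 2) / c * (exp (- (x * (Im \<tau> / 2))) / Fr n x)" by (rule kern_integrand_bound[OF c])
    also have "\<dots> \<le> exp (y * Re \<tau> / 2) / c * (C * exp (- (\<delta> * \<bar>x\<bar>)))"
      using c by (intro mult_left_mono C) auto
    finally show "norm (exp (\<i> * (of_real x - \<i> * of_real y) * \<tau> / 2) / F r \<theta> n (of_real x - \<i> * of_real y))
      \<le> (exp (y * Re \<tau> / 2) / c * C) * exp (- (\<delta> * \<bar>x\<bar>))" by (simp add: mult.assoc)
  qed
qed

lemma F_real_nz: "F r \<theta> n (of_real x - \<i> * of_real 0) \<noteq> 0"
  using Fr_pos[of n x] by (simp add: F_of_real)

text \<open>Room beyond a line that no zero enters, as needed for a holomorphic function on an open strip containing both lines.\<close>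

lemma exists_gap:
  assumes "finite (A :: real set)" shows "\<exists>w>v. \<forall>a\<in>A. \<not> (v < a \<and> a < w)"
proof -
  define w where "w = Min (insert (v + 1) {a\<in>A. v < a})"
  have "v < w" unfolding w_def using assms by (subst Min_gr_iff) auto
  moreover have "w \<le> a" if "a \<in> A" "v < a" for a
    unfolding w_def using assms that by (intro Min_le) auto
  ultimately show ?thesis by (meson not_le)
qed

text \<open>\<open>line_shift_residues\<close> applied to \<open>exp (i \<xi> \<tau> / 2) / F \<xi>\<close>. The condition on \<open>Im \<tau>\<close> gives the decay, since
  \<open>F\<close> is comparable to \<open>Fr\<close> far out in every horizontal strip.\<close>

lemma kern_shift:
  assumes y: "y1 < y2" and n: "0 < n"
    and nz1: "\<And>x::real. F r \<theta> n (of_real x - \<i> * of_real y1) \<noteq> 0"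
    and nz2: "\<And>x::real. F r \<theta> n (of_real x - \<i> * of_real y2) \<noteq> 0"
    and \<tau>: "lo < Im \<tau> / 2" "Im \<tau> / 2 < hi"
  shows "kern_at n y1 \<tau> = kern_at n y2 \<tau> - \<i> / 2 *
    (\<Sum>\<xi> | F r \<theta> n \<xi> = 0 \<and> - y2 < Im \<xi> \<and> Im \<xi> < - y1. residue (\<lambda>\<xi>. exp (\<i> * \<xi> * \<tau> / 2) / F r \<theta> n \<xi>) \<xi>)"
proof -
  define Y where "Y = \<bar>y1\<bar> + \<bar>y2\<bar>"
  define f where "f = (\<lambda>\<xi>. exp (\<i> * \<xi> * \<tau> / 2) / F r \<theta> n \<xi>)"
  define A where "A = {\<xi>. F r \<theta> n \<xi> = 0 \<and> \<bar>Im \<xi>\<bar> \<le> Y + 1}"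
  define P where "P = {\<xi>. F r \<theta> n \<xi> = 0 \<and> - y2 < Im \<xi> \<and> Im \<xi> < - y1}"
  have fA: "finite A" unfolding A_def by (rule finite_zeros_horizontal_strip)
  have PA: "P \<subseteq> A" by (auto simp: P_def A_def Y_def)
  have fP: "finite P" by (rule finite_subset[OF PA fA])
  obtain w2 where w2: "w2 > - y1" "\<And>a. a \<in> A \<Longrightarrow> \<not> (- y1 < Im a \<and> Im a < w2)"
    using exists_gap[of "Im ` A" "- y1"] fA by auto
  obtain w1 where w1: "w1 > y2" "\<And>a. a \<in> A \<Longrightarrow> \<not> (y2 < - Im a \<and> - Im a < w1)"
    using exists_gap[of "(\<lambda>a. - Im a) ` A" y2] fA by auto
  define u1 where "u1 = max (- w1) (- y2 - 1)"
  define u2 where "u2 = min w2 (- y1 + 1)"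
  have on_line: "Im \<xi> \<noteq> - y1 \<and> Im \<xi> \<noteq> - y2" if "F r \<theta> n \<xi> = 0" for \<xi>
    using nz1[of "Re \<xi>"] nz2[of "Re \<xi>"] that complex_eq_minus[of \<xi>] by auto
  have hol: "f holomorphic_on {z. u1 < Im z \<and> Im z < u2} - P"
  proof -
    have "F r \<theta> n z \<noteq> 0" if z: "u1 < Im z" "Im z < u2" "z \<notin> P" for z
    proof
      assume 0: "F r \<theta> n z = 0"
      have "z \<in> A" using 0 z y by (auto simp: A_def Y_def u1_def u2_def)
      then have "Im z \<le> - y1" "- Im z \<le> y2" using w1(2)[of z] w2(2)[of z] z by (auto simp: u1_def u2_def)
      then show False using on_line[OF 0] z(3) 0 by (auto simp: P_def)
    qed
    then show ?thesis unfolding f_def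
      by (intro holomorphic_intros holomorphic_on_subset[OF F_holomorphic]) auto
  qed
  obtain N where N: "\<And>x y. N \<le> \<bar>x\<bar> \<Longrightarrow> \<bar>y\<bar> \<le> Y \<Longrightarrow> Fr n x / 2 \<le> norm (F r \<theta> n (of_real x - \<i> * of_real y))"
    using F_norm_ge_large_x[of Y n] by (auto simp: Y_def)
  obtain C \<delta> where C: "C > 0" "\<delta> > 0" "\<And>x. exp (- (x * (Im \<tau> / 2))) / Fr n x \<le> C * exp (- (\<delta> * \<bar>x\<bar>))"
    using exp_ratio_bound[OF \<tau> n] by auto
  have shape: "f (of_real x + \<i> * of_real (- y)) = exp (\<i> * (of_real x - \<i> * of_real y) * \<tau> / 2) / F r \<theta> n (of_real x - \<i> * of_real y)" for x y
    by (simp add: f_def)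
  have "(\<integral>x. f (of_real x + \<i> * of_real (- y2)) \<partial>lborel) - (\<integral>x. f (of_real x + \<i> * of_real (- y1)) \<partial>lborel)
      = 2 * pi * \<i> * (\<Sum>p\<in>P. residue f p)"
  proof (rule line_shift_residues[OF _ _ _ fP _ hol])
    show "u1 < - y2" "- y2 < - y1" "- y1 < u2" using w1 w2 y by (auto simp: u1_def u2_def)
    show "((\<lambda>x. (2 * exp (Y * \<bar>Re \<tau>\<bar> / 2) * C) * exp (- (\<delta> * x))) \<longlongrightarrow> 0) at_top"
      by (rule exp_neg_abs_tendsto_0[OF C(2)])
    show "integrable lborel (\<lambda>x. f (of_real x + \<i> * of_real (- y2)))"
      "integrable lborel (\<lambda>x. f (of_real x + \<i> * of_real (- y1)))"
      unfolding shape by (intro kern_integrand_integrable nz1 nz2 n \<tau>)+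
    fix z assume z: "- y2 \<le> Im z" "Im z \<le> - y1" "N \<le> \<bar>Re z\<bar>"
    define x y' where "x = Re z" and "y' = - Im z"
    have zz: "z = of_real x + \<i> * of_real (- y')" by (simp add: x_def y'_def complex_eq_iff)
    have y': "\<bar>y'\<bar> \<le> Y" using z by (auto simp: y'_def Y_def)
    have Fz: "Fr n x / 2 \<le> norm (F r \<theta> n (of_real x - \<i> * of_real y'))"
      using N[of x y'] z y' by (simp add: x_def)
    have "norm (f z) = exp (y' * Re \<tau> / 2) * exp (- (x * (Im \<tau> / 2))) / norm (F r \<theta> n (of_real x - \<i> * of_real y'))"
      unfolding zz shape norm_divide norm_exp_line ..
    also have "\<dots> \<le> exp (y' * Re \<tau> / 2) * exp (- (x * (Im \<tau> / 2))) / (Fr n x / 2)"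
      using Fz Fr_pos[of n x] by (intro divide_left_mono) (auto intro!: mult_pos_pos intro: less_le_trans)
    also have "\<dots> = exp (y' * Re \<tau> / 2) * 2 * (exp (- (x * (Im \<tau> / 2))) / Fr n x)" by simp
    also have "\<dots> \<le> exp (Y * \<bar>Re \<tau>\<bar> / 2) * 2 * (C * exp (- (\<delta> * \<bar>x\<bar>)))"
    proof (intro mult_mono C(3))
      have "y' * Re \<tau> \<le> \<bar>y'\<bar> * \<bar>Re \<tau>\<bar>" by (metis abs_ge_self abs_mult)
      also have "\<dots> \<le> Y * \<bar>Re \<tau>\<bar>" using y' by (intro mult_right_mono) auto
      finally show "exp (y' * Re \<tau> / 2) \<le> exp (Y * \<bar>Re \<tau>\<bar> / 2)" by simp
    qed (use Fr_pos[of n x] in auto)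
    finally show "norm (f z) \<le> (2 * exp (Y * \<bar>Re \<tau>\<bar> / 2) * C) * exp (- (\<delta> * \<bar>Re z\<bar>))"
      by (simp add: x_def mult_ac)
  qed (auto simp: P_def)
  then have "4 * pi * kern_at n y2 \<tau> - 4 * pi * kern_at n y1 \<tau> = 2 * pi * \<i> * (\<Sum>p\<in>P. residue f p)"
    unfolding shape kern_at_def by simp
  moreover have "kern_at n y2 \<tau> - kern_at n y1 \<tau> = (4 * pi * kern_at n y2 \<tau> - 4 * pi * kern_at n y1 \<tau>) / (4 * pi)"
    by (simp add: diff_divide_distrib)
  ultimately have D: "kern_at n y2 \<tau> - kern_at n y1 \<tau> = \<i> / 2 * (\<Sum>p\<in>P. residue f p)" by simp
  show ?thesis unfolding P_def[symmetric] f_def[symmetric] D[symmetric] by simp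
qed

lemma F_nz_near_real: "\<bar>y\<bar> \<le> 1/4 \<Longrightarrow> F r \<theta> n (of_real x - \<i> * of_real y) \<noteq> 0"
  using F_norm_ge_near_real[of y n x] Fr_pos[of n x] by auto

lemma kern_eq_near_real:
  assumes y: "\<bar>y\<bar> \<le> 1/4" and n: "0 < n" and \<tau>: "lo < Im \<tau> / 2" "Im \<tau> / 2 < hi"
  shows "kern n \<tau> = kern_at n y \<tau>"
proof -
  have none: "F r \<theta> n \<xi> \<noteq> 0" if "\<bar>Im \<xi>\<bar> \<le> 1/4" for \<xi>
    using F_nz_near_real[of "- Im \<xi>" n "Re \<xi>"] that complex_eq_minus[of \<xi>] by simp
  consider "y = 0" | "0 < y" | "y < 0" by linarith
  then show ?thesis
  proof cases
    case 2
    have e: "{\<xi>. F r \<theta> n \<xi> = 0 \<and> - y < Im \<xi> \<and> Im \<xi> < - 0} = {}" using none y by auto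
    show ?thesis using kern_shift[OF 2 n F_nz_near_real F_nz_near_real \<tau>] y unfolding e by simp
  next
    case 3
    have e: "{\<xi>. F r \<theta> n \<xi> = 0 \<and> - 0 < Im \<xi> \<and> Im \<xi> < - y} = {}" using none y by auto
    show ?thesis using kern_shift[OF 3 n F_nz_near_real F_nz_near_real \<tau>] y unfolding e by simp
  qed simp
qed

text \<open>The line can be moved by \<open>1/4\<close> in either direction without meeting a zero; moving it in the
  direction given by the sign of \<open>Re \<tau>\<close> yields exponential decay.\<close>

lemma norm_kern_le:
  assumes n: "0 < n" and \<tau>: "lo < Im \<tau> / 2" "Im \<tau> / 2 < hi"
  shows "norm (kern n \<tau>) \<le> exp (- (\<bar>Re \<tau>\<bar> / 8)) * (\<integral>x. exp (- (x * (Im \<tau> / 2))) / Fr n x \<partial>lborel)"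
proof -
  define y :: real where "y = (if Re \<tau> \<ge> 0 then - 1/4 else 1/4)"
  have y: "\<bar>y\<bar> \<le> 1/4" by (simp add: y_def)
  have yr: "y * Re \<tau> / 2 = - (\<bar>Re \<tau>\<bar> / 8)" by (auto simp: y_def)
  obtain C \<delta> where C: "C > 0" "\<delta> > 0" "\<And>x. exp (- (x * (Im \<tau> / 2))) / Fr n x \<le> C * exp (- (\<delta> * \<bar>x\<bar>))"
    using exp_ratio_bound[OF \<tau> n] by auto
  have m: "(\<lambda>x. exp (- (x * (Im \<tau> / 2))) / Fr n x) \<in> borel_measurable borel"
    by (intro borel_measurable_divide borel_measurable_continuous_onI continuous_intros)
  have int: "integrable lborel (\<lambda>x. exp (- (x * (Im \<tau> / 2))) / Fr n x)"
    by (rule integrable_exp_dominated[OF m C(2)]) (use C(3) Fr_pos[of n] in \<open>auto simp: less_imp_le\<close>)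
  have F12: "1/2 * Fr n x \<le> norm (F r \<theta> n (of_real x - \<i> * of_real y))" for x
    using F_norm_ge_near_real[OF y, of n x] by simp
  have "norm (\<integral>x. exp (\<i> * (of_real x - \<i> * of_real y) * \<tau> / 2) / F r \<theta> n (of_real x - \<i> * of_real y) \<partial>lborel)
     \<le> (\<integral>x. norm (exp (\<i> * (of_real x - \<i> * of_real y) * \<tau> / 2) / F r \<theta> n (of_real x - \<i> * of_real y)) \<partial>lborel)"
    by (rule integral_norm_bound)
  also have "\<dots> \<le> (\<integral>x. exp (y * Re \<tau> / 2) / (1/2) * (exp (- (x * (Im \<tau> / 2))) / Fr n x) \<partial>lborel)"
  proof (rule integral_mono)
    show "integrable lborel (\<lambda>x. norm (exp (\<i> * (of_real x - \<i> * of_real y) * \<tau> / 2) / F r \<theta> n (of_real x - \<i> * of_real y)))"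
      by (intro integrable_norm kern_integrand_integrable F_nz_near_real y n \<tau>)
    show "integrable lborel (\<lambda>x. exp (y * Re \<tau> / 2) / (1/2) * (exp (- (x * (Im \<tau> / 2))) / Fr n x))"
      using int by (rule integrable_mult_right)
    show "norm (exp (\<i> * (of_real x - \<i> * of_real y) * \<tau> / 2) / F r \<theta> n (of_real x - \<i> * of_real y))
       \<le> exp (y * Re \<tau> / 2) / (1/2) * (exp (- (x * (Im \<tau> / 2))) / Fr n x)" for x
      by (rule kern_integrand_bound[OF _ F12]) simp
  qed
  also have "\<dots> = 2 * exp (- (\<bar>Re \<tau>\<bar> / 8)) * (\<integral>x. exp (- (x * (Im \<tau> / 2))) / Fr n x \<partial>lborel)"
    unfolding yr integral_mult_right_zero by simp
  finally have b: "norm (\<integral>x. exp (\<i> * (of_real x - \<i> * of_real y) * \<tau> / 2) / F r \<theta> n (of_real x - \<i> * of_real y) \<partial>lborel)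
    \<le> 2 * exp (- (\<bar>Re \<tau>\<bar> / 8)) * (\<integral>x. exp (- (x * (Im \<tau> / 2))) / Fr n x \<partial>lborel)" (is "_ \<le> ?R") .
  have "norm (kern n \<tau>) = norm (\<integral>x. exp (\<i> * (of_real x - \<i> * of_real y) * \<tau> / 2) / F r \<theta> n (of_real x - \<i> * of_real y) \<partial>lborel) / (4 * pi)"
    by (simp only: kern_eq_near_real[OF y n \<tau>]) (simp add: kern_at_def norm_divide norm_mult)
  also have "\<dots> \<le> ?R / (4 * pi)" using b by (intro divide_right_mono) auto
  also have "\<dots> \<le> ?R / 2"
  proof (rule divide_left_mono)
    show "0 \<le> ?R" using b norm_ge_zero order_trans by blast
  qed (use pi_gt3 in auto)
  finally show ?thesis by simp
qed

text \<open>The weight compensates the growth of the kernel at the boundary of the strip. This is what makes the kernel square integrable.\<close>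

lemma kern_weighted_decay:
  assumes v0: "lo < Im s0" "Im s0 < hi"
  shows "\<exists>C>0. \<forall>s. lo < Im s \<and> Im s < hi \<longrightarrow>
    sqrt (\<psi> (Im s)) ^ j * norm (kern (Suc j) (s0 - cnj s)) \<le> C * exp (- (\<bar>Re s\<bar> / 8))"
proof -
  obtain C \<delta> where C: "C > 0" "\<delta> > 0" "\<And>v x. lo < v \<and> v < hi \<Longrightarrow>
    sqrt (\<psi> v) ^ j * exp (- (x * (v + Im s0) / 2)) / Fr (Suc j) x \<le> C * exp (- (\<delta> * \<bar>x\<bar>))"
    using kernel_ratio_bound[OF v0] by blast
  define D where "D = (\<integral>x. C * exp (- (\<delta> * \<bar>x\<bar>)) \<partial>lborel)"
  have Di: "integrable lborel (\<lambda>x. C * exp (- (\<delta> * \<bar>x\<bar>)))"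
    by (intro integrable_mult_right integrable_exp_neg_abs C)
  have D0: "0 \<le> D" unfolding D_def using C by (intro Bochner_Integration.integral_nonneg) auto
  show ?thesis
  proof (intro exI[of _ "(D + 1) * exp (\<bar>Re s0\<bar> / 8)"] conjI allI impI)
    show "0 < (D + 1) * exp (\<bar>Re s0\<bar> / 8)" using D0 by simp
    fix s assume s: "lo < Im s \<and> Im s < hi"
    define \<tau> where "\<tau> = s0 - cnj s"
    have im: "Im \<tau> = Im s + Im s0" by (simp add: \<tau>_def)
    have \<tau>: "lo < Im \<tau> / 2" "Im \<tau> / 2 < hi" using s v0 by (auto simp: im)
    have p: "0 \<le> sqrt (\<psi> (Im s)) ^ j" using psi_pos s by (simp add: less_imp_le)
    have b: "sqrt (\<psi> (Im s)) ^ j * (\<integral>x. exp (- (x * (Im \<tau> / 2))) / Fr (Suc j) x \<partial>lborel) \<le> D"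
    proof -
      have pt: "sqrt (\<psi> (Im s)) ^ j * (exp (- (x * (Im \<tau> / 2))) / Fr (Suc j) x) \<le> C * exp (- (\<delta> * \<bar>x\<bar>))" for x
        using C(3)[of "Im s" x] s by (simp add: im)
      have nn: "0 \<le> sqrt (\<psi> (Im s)) ^ j * (exp (- (x * (Im \<tau> / 2))) / Fr (Suc j) x)" for x
        using p Fr_pos[of "Suc j" x] by (simp add: less_imp_le)
      have m: "(\<lambda>x. sqrt (\<psi> (Im s)) ^ j * (exp (- (x * (Im \<tau> / 2))) / Fr (Suc j) x)) \<in> borel_measurable borel"
        by (intro borel_measurable_times borel_measurable_divide borel_measurable_continuous_onI continuous_intros)
      have "integrable lborel (\<lambda>x. sqrt (\<psi> (Im s)) ^ j * (exp (- (x * (Im \<tau> / 2))) / Fr (Suc j) x))"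
        by (rule integrable_exp_dominated[OF m C(2), where C = C])
           (simp only: real_norm_def abs_of_nonneg[OF nn] pt)
      then have "(\<integral>x. sqrt (\<psi> (Im s)) ^ j * (exp (- (x * (Im \<tau> / 2))) / Fr (Suc j) x) \<partial>lborel) \<le> D"
        unfolding D_def by (intro integral_mono Di pt)
      then show ?thesis by (simp only: integral_mult_right_zero)
    qed
    have "sqrt (\<psi> (Im s)) ^ j * norm (kern (Suc j) \<tau>)
      \<le> sqrt (\<psi> (Im s)) ^ j * (exp (- (\<bar>Re \<tau>\<bar> / 8)) * (\<integral>x. exp (- (x * (Im \<tau> / 2))) / Fr (Suc j) x \<partial>lborel))"
      by (intro mult_left_mono norm_kern_le \<tau> p) simp
    also have "\<dots> = exp (- (\<bar>Re \<tau>\<bar> / 8)) * (sqrt (\<psi> (Im s)) ^ j * (\<integral>x. exp (- (x * (Im \<tau> / 2))) / Fr (Suc j) x \<partial>lborel))"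
      by (simp only: mult_ac)
    also have "\<dots> \<le> exp (- (\<bar>Re \<tau>\<bar> / 8)) * (D + 1)" using b by (intro mult_left_mono) auto
    also have "\<dots> \<le> exp (\<bar>Re s0\<bar> / 8 - \<bar>Re s\<bar> / 8) * (D + 1)"
    proof -
      have "Re \<tau> = Re s0 - Re s" by (simp add: \<tau>_def)
      then have "- (\<bar>Re \<tau>\<bar> / 8) \<le> \<bar>Re s0\<bar> / 8 - \<bar>Re s\<bar> / 8" by linarith
      then show ?thesis using D0 by (intro mult_right_mono) auto
    qed
    also have "\<dots> = (D + 1) * exp (\<bar>Re s0\<bar> / 8) * exp (- (\<bar>Re s\<bar> / 8))"
    proof -
      have "exp (\<bar>Re s0\<bar> / 8 - \<bar>Re s\<bar> / 8) = exp (\<bar>Re s0\<bar> / 8) * exp (- (\<bar>Re s\<bar> / 8))"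
        by (simp flip: exp_add)
      then show ?thesis by (simp only: mult_ac)
    qed
    finally show "sqrt (\<psi> (Im s)) ^ j * norm (kern (Suc j) (s0 - cnj s))
       \<le> (D + 1) * exp (\<bar>Re s0\<bar> / 8) * exp (- (\<bar>Re s\<bar> / 8))" by (simp add: \<tau>_def)
  qed
qed

text \<open>The integrals over bounded intervals are holomorphic and converge locally uniformly.\<close>

lemma kern_holomorphic:
  assumes n: "0 < n" shows "kern n holomorphic_on {\<tau>. 2 * lo < Im \<tau> \<and> Im \<tau> < 2 * hi}"
proof -
  define S where "S = {\<tau>. 2 * lo < Im \<tau> \<and> Im \<tau> < 2 * hi}"
  have S: "S = {z. 2 * lo < Im z} \<inter> {z. Im z < 2 * hi}" by (auto simp: S_def)
  have oS: "open S" unfolding S by (intro open_Int open_halfspace_Im_gt open_halfspace_Im_lt)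
  define g where "g = (\<lambda>\<tau> x. exp (\<i> * of_real x * \<tau> / 2) / of_real (Fr n x))"
  define f where "f = (\<lambda>k \<tau>. integral (cbox (- real k) (real k)) (g \<tau>))"
  have kg: "kern n \<tau> = (\<integral>x. g \<tau> x \<partial>lborel) / (4 * pi)" for \<tau>
    by (simp add: kern_at_def g_def F_of_real)
  have gc: "continuous_on X (g \<tau>)" for X \<tau> unfolding g_def
    by (intro continuous_intros) (simp_all add: Fr_nz)
  have fh: "f k holomorphic_on S" for k
  proof (rule holomorphic_on_subset)
    show "f k holomorphic_on UNIV" unfolding f_def
    proof (rule leibniz_rule_holomorphic)
      show "((\<lambda>\<tau>. g \<tau> x) has_field_derivative (\<i> * of_real x / 2) * exp (\<i> * of_real x * \<tau> / 2) / of_real (Fr n x)) (at \<tau> within UNIV)" for \<tau> x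
        unfolding g_def by (auto intro!: derivative_eq_intros simp: Fr_nz)
      show "g \<tau> integrable_on cbox (- real k) (real k)" for \<tau> by (intro integrable_continuous gc)
      show "continuous_on (UNIV \<times> cbox (- real k) (real k)) (\<lambda>(\<tau>, x). (\<i> * of_real x / 2) * exp (\<i> * of_real x * \<tau> / 2) / complex_of_real (Fr n x))"
        unfolding split_beta by (intro continuous_intros) (simp_all add: Fr_nz)
    qed auto
  qed auto
  have "(\<lambda>\<tau>. \<integral>x. g \<tau> x \<partial>lborel) holomorphic_on S"
  proof (rule holomorphic_uniform_sequence[OF oS fh])
    fix \<tau>0 assume "\<tau>0 \<in> S"
    then obtain d where d: "d > 0" "cball \<tau>0 d \<subseteq> S" using oS open_contains_cball by blast
    define a b where "a = (Im \<tau>0 - d) / 2" and "b = (Im \<tau>0 + d) / 2"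
    have "\<tau>0 - \<i> * of_real d \<in> S" "\<tau>0 + \<i> * of_real d \<in> S"
      using d by (auto intro!: subsetD[OF d(2)] simp: dist_norm norm_mult)
    then have ab: "lo < a" "a \<le> b" "b < hi" using d(1) by (auto simp: S_def a_def b_def)
    obtain C \<delta> where C: "C > 0" "\<delta> > 0" "\<And>x t. a \<le> t \<and> t \<le> b \<Longrightarrow> exp (- (x * t)) / Fr n x \<le> C * exp (- (\<delta> * \<bar>x\<bar>))"
      using exp_ratio_bound_uniform[OF ab n] by blast
    define E where "E = (\<lambda>x. C * exp (- (\<delta> * \<bar>x\<bar>)))"
    have Ei: "integrable lborel E" unfolding E_def
      by (intro integrable_mult_right integrable_exp_neg_abs C)
    have gE: "norm (g \<tau> x) \<le> E x" if "\<tau> \<in> cball \<tau>0 d" for \<tau> x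
    proof -
      have "\<bar>Im \<tau> - Im \<tau>0\<bar> \<le> d"
        using that abs_Im_le_cmod[of "\<tau> - \<tau>0"] by (simp add: dist_norm norm_minus_commute)
      then have "a \<le> Im \<tau> / 2 \<and> Im \<tau> / 2 \<le> b" by (auto simp: a_def b_def)
      then have "exp (- (x * (Im \<tau> / 2))) / Fr n x \<le> E x" unfolding E_def by (rule C(3))
      moreover have "norm (g \<tau> x) = exp (- (x * (Im \<tau> / 2))) / Fr n x"
        using Fr_pos[of n x] by (simp add: g_def norm_divide norm_exp_eq_Re)
      ultimately show ?thesis by simp
    qed
    have gi: "integrable lborel (g \<tau>)" if "\<tau> \<in> cball \<tau>0 d" for \<tau>
      by (rule integrable_exp_dominated[OF borel_measurable_continuous_onI[OF gc] C(2)])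
         (use gE[OF that] in \<open>auto simp: E_def\<close>)
    define T where "T = (\<lambda>k. (\<integral>x. E x \<partial>lborel) - (\<integral>x. indicator {- real k..real k} x *\<^sub>R E x \<partial>lborel))"
    have Ek: "integrable lborel (\<lambda>x. indicator {- real k..real k} x *\<^sub>R E x)" for k
      by (rule integrable_mult_indicator[OF _ Ei]) simp
    have err: "norm (f k \<tau> - (\<integral>x. g \<tau> x \<partial>lborel)) \<le> T k" if \<tau>: "\<tau> \<in> cball \<tau>0 d" for k \<tau>
    proof -
      have gk: "integrable lborel (\<lambda>x. indicator {- real k..real k} x *\<^sub>R g \<tau> x)"
        by (rule integrable_mult_indicator[OF _ gi[OF \<tau>]]) simp
      have fk: "f k \<tau> = (\<integral>x. indicator {- real k..real k} x *\<^sub>R g \<tau> x \<partial>lborel)"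
        using set_borel_integral_eq_integral(2)[of "{- real k..real k}" "g \<tau>"] gk
        by (simp add: f_def set_lebesgue_integral_def set_integrable_def)
      have "norm (f k \<tau> - (\<integral>x. g \<tau> x \<partial>lborel)) = norm (\<integral>x. g \<tau> x - indicator {- real k..real k} x *\<^sub>R g \<tau> x \<partial>lborel)"
        unfolding fk Bochner_Integration.integral_diff[OF gi[OF \<tau>] gk] by (rule norm_minus_commute)
      also have "\<dots> \<le> (\<integral>x. norm (g \<tau> x - indicator {- real k..real k} x *\<^sub>R g \<tau> x) \<partial>lborel)"
        by (rule integral_norm_bound)
      also have "\<dots> \<le> (\<integral>x. E x - indicator {- real k..real k} x *\<^sub>R E x \<partial>lborel)"
      proof (rule integral_mono)
        show "norm (g \<tau> x - indicator {- real k..real k} x *\<^sub>R g \<tau> x) \<le> E x - indicator {- real k..real k} x *\<^sub>R E x" for x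
          using gE[OF \<tau>, of x] by (auto simp: indicator_def)
      qed (use gi[OF \<tau>] gk Ei Ek in auto)
      also have "\<dots> = T k" unfolding T_def by (rule Bochner_Integration.integral_diff[OF Ei Ek])
      finally show ?thesis .
    qed
    have "T \<longlonglongrightarrow> 0"
    proof -
      have "(\<lambda>k. \<integral>x. indicator {- real k..real k} x *\<^sub>R E x \<partial>lborel) \<longlonglongrightarrow> (\<integral>x. E x \<partial>lborel)"
      proof (rule integral_dominated_convergence[where w = E])
        show "AE x in lborel. (\<lambda>k. indicator {- real k..real k} x *\<^sub>R E x) \<longlonglongrightarrow> E x"
        proof (rule AE_I2)
          fix x
          obtain N :: nat where N: "\<bar>x\<bar> \<le> real N" using real_arch_simple by blast
          have "eventually (\<lambda>k. indicator {- real k..real k} x *\<^sub>R E x = E x) sequentially"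
            using eventually_ge_at_top[of N]
          proof eventually_elim
            case (elim k)
            then have "\<bar>x\<bar> \<le> real k" using N by linarith
            then show ?case by (auto simp: indicator_def)
          qed
          then show "(\<lambda>k. indicator {- real k..real k} x *\<^sub>R E x) \<longlonglongrightarrow> E x"
            by (rule tendsto_eventually)
        qed
      qed (use Ei C(1) in \<open>auto simp: indicator_def E_def\<close>)
      then show ?thesis unfolding T_def by (auto intro!: tendsto_eq_intros)
    qed
    then have "uniform_limit (cball \<tau>0 d) f (\<lambda>\<tau>. \<integral>x. g \<tau> x \<partial>lborel) sequentially"
      unfolding uniform_limit_iff
    proof (intro allI impI)
      fix e :: real assume e: "e > 0"
      have "eventually (\<lambda>k. T k < e) sequentially" using \<open>T \<longlonglongrightarrow> 0\<close> e by (rule order_tendstoD)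
      then show "\<forall>\<^sub>F k in sequentially. \<forall>x\<in>cball \<tau>0 d. dist (f k x) (\<integral>y. g x y \<partial>lborel) < e"
        by eventually_elim (auto simp: dist_norm intro: le_less_trans[OF err])
    qed
    then show "\<exists>d. 0 < d \<and> cball \<tau>0 d \<subseteq> S \<and> uniform_limit (cball \<tau>0 d) f (\<lambda>\<tau>. \<integral>x. g \<tau> x \<partial>lborel) sequentially"
      using d by blast
  qed
  then have "(\<lambda>\<tau>. (\<integral>x. g \<tau> x \<partial>lborel) / (4 * pi)) holomorphic_on S" by (intro holomorphic_intros) auto
  then show ?thesis using kg by (simp add: S_def cong: holomorphic_cong)
qed

end

section \<open>Taylor coefficients and area integrals over discs\<close>

definition disc_moment :: "nat \<Rightarrow> real \<Rightarrow> real" where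
  "disc_moment j R = (\<integral>u. indicator (ball 0 R) u * norm u ^ (2 * j) \<partial>(lborel :: complex measure))"

lemma lborel_distr_rotation:
  assumes m: "norm (m::complex) = 1" shows "distr lborel borel (\<lambda>z. m * z) = lborel"
proof (rule measure_eqI)
  fix A :: "complex set" assume "A \<in> sets (distr lborel borel (\<lambda>z. m * z))"
  then have A: "A \<in> sets borel" by simp
  have mm: "(\<lambda>z. m * z) \<in> borel_measurable borel"
    by (intro borel_measurable_continuous_onI continuous_intros)
  have "emeasure (distr lborel borel (\<lambda>z. m * z)) A = (\<integral>\<^sup>+z. indicator A z \<partial>distr lborel borel (\<lambda>z. m * z))"
    using A by simp
  also have "\<dots> = (\<integral>\<^sup>+z. indicator A (m * z) \<partial>lborel)"
    using A mm by (subst nn_integral_distr) auto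
  also have "\<dots> = (\<integral>\<^sup>+z. indicator A z \<partial>lborel)"
    using nn_integral_complex_affine[of m "indicator A" 0] m A by force
  finally show "emeasure (distr lborel borel (\<lambda>z. m * z)) A = emeasure lborel A" using A by simp
qed simp

lemma integral_rotation:
  fixes H :: "complex \<Rightarrow> 'b::{banach, second_countable_topology}"
  assumes m: "norm m = 1" and H: "H \<in> borel_measurable borel"
  shows "(\<integral>z. H (m * z) \<partial>lborel) = (\<integral>z. H z \<partial>lborel)"
    and "integrable lborel (\<lambda>z. H (m * z)) \<longleftrightarrow> integrable lborel H"
proof -
  have mm: "(\<lambda>z. m * z) \<in> lborel \<rightarrow>\<^sub>M borel"
    by (auto intro!: borel_measurable_continuous_onI continuous_intros)
  show "(\<integral>z. H (m * z) \<partial>lborel) = (\<integral>z. H z \<partial>lborel)"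
    using integral_distr[OF mm H] lborel_distr_rotation[OF m] by simp
  show "integrable lborel (\<lambda>z. H (m * z)) \<longleftrightarrow> integrable lborel H"
    using integrable_distr_eq[OF mm H] lborel_distr_rotation[OF m] by simp
qed

lemma disc_moment_integrable:
  "integrable (lborel :: complex measure) (\<lambda>u. indicator (ball 0 R) u * norm u ^ (2 * j))"
proof -
  have "set_integrable (lborel :: complex measure) (cball 0 R) (\<lambda>u. norm u ^ (2 * j))"
    unfolding set_integrable_def by (intro borel_integrable_compact continuous_intros) auto
  then have "set_integrable (lborel :: complex measure) (ball 0 R) (\<lambda>u. norm u ^ (2 * j))"
    by (rule set_integrable_subset) auto
  then show ?thesis by (simp add: set_integrable_def)
qed

lemma disc_moment_scale:
  assumes R: "0 < R" shows "disc_moment j R = R ^ (2 * j + 2) * disc_moment j 1"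
proof -
  let ?f = "\<lambda>R u::complex. ennreal (indicator (ball 0 R) u * norm u ^ (2 * j))"
  have nn: "ennreal (disc_moment j R) = (\<integral>\<^sup>+u. ?f R u \<partial>lborel)" for R
    unfolding disc_moment_def by (rule nn_integral_eq_integral[symmetric, OF disc_moment_integrable]) auto
  have d0: "0 \<le> disc_moment j R" for R unfolding disc_moment_def by (intro Bochner_Integration.integral_nonneg) auto
  have m1: "?f R \<in> borel_measurable borel" for R
    using borel_measurable_integrable[OF disc_moment_integrable[of R j]] by simp
  have "ennreal (disc_moment j R) = ennreal ((norm (complex_of_real R))\<^sup>2) * (\<integral>\<^sup>+u. ?f R (of_real R * u + 0) \<partial>lborel)"
    unfolding nn using R by (intro nn_integral_complex_affine m1) auto
  also have "(\<integral>\<^sup>+u. ?f R (of_real R * u + 0) \<partial>lborel) = (\<integral>\<^sup>+u. ennreal (R ^ (2 * j)) * ?f 1 u \<partial>lborel)"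
    using R by (intro nn_integral_cong)
      (auto simp: indicator_def norm_mult power_mult_distrib ennreal_mult' mult_less_cancel_left1)
  also have "\<dots> = ennreal (R ^ (2 * j)) * ennreal (disc_moment j 1)"
    unfolding nn using m1[of 1] by (intro nn_integral_cmult) auto
  finally have "ennreal (disc_moment j R)
      = ennreal ((norm (complex_of_real R))\<^sup>2) * (ennreal (R ^ (2 * j)) * ennreal (disc_moment j 1))" .
  also have "\<dots> = ennreal ((norm (complex_of_real R))\<^sup>2) * ennreal (R ^ (2 * j) * disc_moment j 1)"
    using R d0[of 1] by (subst ennreal_mult) auto
  also have "\<dots> = ennreal ((norm (complex_of_real R))\<^sup>2 * (R ^ (2 * j) * disc_moment j 1))"
    using R d0[of 1] by (subst ennreal_mult) auto
  also have "(norm (complex_of_real R))\<^sup>2 * (R ^ (2 * j) * disc_moment j 1) = R ^ (2 * j + 2) * disc_moment j 1"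
    by (simp add: power_add power2_eq_square)
  finally have "ennreal (disc_moment j R) = ennreal (R ^ (2 * j + 2) * disc_moment j 1)" .
  then show ?thesis using d0 R by simp
qed

text \<open>The moments decay more slowly than any geometric sequence with ratio below \<open>1\<close>: compare with the
  integral over the annulus between \<open>l\<close> and \<open>1\<close>.\<close>

lemma disc_moment_lower:
  assumes l: "0 < l" "l < 1" shows "\<exists>a>0. \<forall>j. a * l ^ (2 * j) \<le> disc_moment j 1"
proof -
  define A where "A = ball (0::complex) 1 - cball 0 l"
  have A: "A \<in> sets borel" "emeasure lborel A < \<infinity>"
  proof -
    show "A \<in> sets borel" by (simp add: A_def)
    have "emeasure lborel A \<le> emeasure lborel (ball (0::complex) 1)"
      by (rule emeasure_mono) (auto simp: A_def)
    then show "emeasure lborel A < \<infinity>"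
      using emeasure_bounded_finite[of "ball (0::complex) 1"] by (auto simp: less_top)
  qed
  have "of_real ((1 + l) / 2) \<in> A" using l by (simp add: A_def norm_divide)
      (smt (verit) norm_of_real of_real_1 of_real_add)
  then have pos: "0 < measure lborel A"
  proof -
    have oA: "open A" unfolding A_def by (intro open_Diff) auto
    assume "of_real ((1 + l) / 2) \<in> A"
    then obtain e where e: "e > 0" "ball (of_real ((1 + l) / 2)) e \<subseteq> A"
      using oA open_contains_ball by blast
    have "0 < measure lborel (ball (complex_of_real ((1 + l) / 2)) e)"
      using content_ball_pos[OF e(1)] by simp
    also have "\<dots> \<le> measure lborel A"
      using e A by (intro measure_mono_fmeasurable) (auto intro!: fmeasurableI)
    finally show ?thesis .
  qed
  show ?thesis
  proof (intro exI conjI allI)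
    show "0 < measure lborel A" by (rule pos)
    fix j
    have "measure lborel A * l ^ (2 * j) = (\<integral>u. indicator A u * l ^ (2 * j) \<partial>lborel)"
      using A by simp
    also have "\<dots> \<le> disc_moment j 1" unfolding disc_moment_def
    proof (rule integral_mono[OF _ disc_moment_integrable])
      show "integrable lborel (\<lambda>u. indicator A u * l ^ (2 * j))"
        using A by (intro integrable_mult_left) (auto intro: integrable_real_indicator)
      show "indicator A u * l ^ (2 * j) \<le> indicator (ball 0 1) u * norm u ^ (2 * j)" for u
        using l by (auto simp: A_def indicator_def intro!: power_mono)
    qed
    finally show "measure lborel A * l ^ (2 * j) \<le> disc_moment j 1" .
  qed
qed

lemma disc_moment_pos: assumes "0 < R" shows "0 < disc_moment j R"
proof -
  obtain a where a: "a > 0" "a * (1/2) ^ (2 * j) \<le> disc_moment j 1"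
    using disc_moment_lower[of "1/2"] by auto
  then have "0 < disc_moment j 1" by (smt (verit) zero_less_mult_iff zero_less_power half_gt_zero)
  then show ?thesis using disc_moment_scale[OF assms, of j] assms by simp
qed

definition taylor_coeff :: "nat \<Rightarrow> (complex \<Rightarrow> complex) \<Rightarrow> complex" where
  "taylor_coeff j g = (deriv ^^ j) g 0 / fact j"

lemma circle_mean_eq_taylor_coeff:
  assumes g: "g holomorphic_on ball 0 R" and u: "norm u < R"
  shows "((\<lambda>t. g (exp (2 * of_real pi * \<i> * of_real t) * u) * cnj (exp (2 * of_real pi * \<i> * of_real t)) ^ j)
      has_integral taylor_coeff j g * u ^ j) {0..1}"
proof -
  have R: "0 < R" using u norm_ge_zero[of u] by linarith
  define f where "f = (\<lambda>w. g (u * w))"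
  define S where "S = (\<lambda>w. u * w) -` ball 0 R"
  have oS: "open S" unfolding S_def by (intro open_vimage continuous_intros) auto
  have cS: "cball 0 1 \<subseteq> S"
  proof
    fix w :: complex assume "w \<in> cball 0 1"
    then have "norm u * norm w \<le> norm u * 1" by (intro mult_left_mono) auto
    then show "w \<in> S" using u by (simp add: S_def norm_mult)
  qed
  have fh: "f holomorphic_on S" unfolding f_def
    by (rule holomorphic_on_compose[of "\<lambda>w. u * w" S g, unfolded o_def])
       (auto intro!: holomorphic_intros holomorphic_on_subset[OF g] simp: S_def)
  have "(deriv ^^ j) f 0 = u ^ j * (deriv ^^ j) g (u * 0)"
    unfolding f_def
    by (rule higher_deriv_compose_linear[OF g oS open_ball]) (use R u in \<open>auto simp: S_def\<close>)
  then have d: "(deriv ^^ j) f 0 / fact j = taylor_coeff j g * u ^ j" by (simp add: taylor_coeff_def)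
  have "((\<lambda>w. f w / (w - 0) ^ Suc j) has_contour_integral ((2 * pi * \<i>) / fact j * (deriv ^^ j) f 0)) (circlepath 0 1)"
  proof (rule Cauchy_has_contour_integral_higher_derivative_circlepath)
    show "continuous_on (cball 0 1) f"
      using fh cS holomorphic_on_imp_continuous_on holomorphic_on_subset by blast
    show "f holomorphic_on ball 0 1"
      using cS ball_subset_cball by (intro holomorphic_on_subset[OF fh]) blast
  qed auto
  then have *: "((\<lambda>t. f (exp (2 * of_real pi * \<i> * of_real t)) / exp (2 * of_real pi * \<i> * of_real t) ^ Suc j
     * (2 * of_real pi * \<i> * exp (2 * of_real pi * \<i> * of_real t))) has_integral ((2 * pi * \<i>) / fact j * (deriv ^^ j) f 0)) {0..1}"
    unfolding has_contour_integral_def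
  proof (rule has_integral_eq[rotated])
    fix t :: real assume "t \<in> {0..1}"
    then show "f (circlepath 0 1 t) / (circlepath 0 1 t - 0) ^ Suc j * vector_derivative (circlepath 0 1) (at t within {0..1})
      = f (exp (2 * of_real pi * \<i> * of_real t)) / exp (2 * of_real pi * \<i> * of_real t) ^ Suc j
     * (2 * of_real pi * \<i> * exp (2 * of_real pi * \<i> * of_real t))"
      by (subst vector_derivative_circlepath01) (auto simp: circlepath)
  qed
  have e: "f (exp (2 * of_real pi * \<i> * of_real t)) / exp (2 * of_real pi * \<i> * of_real t) ^ Suc j
     * (2 * of_real pi * \<i> * exp (2 * of_real pi * \<i> * of_real t))
     = (2 * of_real pi * \<i>) * (g (exp (2 * of_real pi * \<i> * of_real t) * u) * cnj (exp (2 * of_real pi * \<i> * of_real t)) ^ j)" for t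
  proof -
    define E where "E = exp (2 * of_real pi * \<i> * of_real t)"
    have "E = exp (\<i> * of_real (2 * pi * t))" by (simp add: E_def mult_ac)
    then have n: "norm E = 1" by (simp only: norm_exp_i_times)
    have "E * cnj E = 1" using n by (simp add: complex_norm_square[symmetric])
    then have c: "cnj E = 1 / E" by (metis nonzero_eq_divide_eq mult.commute mult_zero_left zero_neq_one)
    have "E \<noteq> 0" by (simp add: E_def)
    then show ?thesis unfolding E_def[symmetric] c f_def by (simp add: power_divide mult.commute)
  qed
  have "((\<lambda>t. (2 * of_real pi * \<i>) * (g (exp (2 * of_real pi * \<i> * of_real t) * u) * cnj (exp (2 * of_real pi * \<i> * of_real t)) ^ j))
     has_integral (2 * of_real pi * \<i>) * (taylor_coeff j g * u ^ j)) {0..1}"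
    using * unfolding e d[symmetric] by simp
  from has_integral_mult_right[OF this, of "1 / (2 * of_real pi * \<i>)"]
  show ?thesis by simp
qed

text \<open>Averaging over rotations turns the area integral into a mean over circles, which Cauchy's formula
  evaluates.\<close>

lemma integral_disc_cnj_power:
  assumes g: "g holomorphic_on ball 0 R" and R: "0 < R"
    and int: "integrable lborel (\<lambda>u. indicator (ball 0 R) u *\<^sub>R (g u * cnj u ^ j))"
  shows "(\<integral>u. indicator (ball 0 R) u *\<^sub>R (g u * cnj u ^ j) \<partial>lborel) = disc_moment j R * taylor_coeff j g"
proof -
  define H where "H = (\<lambda>u. indicator (ball 0 R) u *\<^sub>R (g u * cnj u ^ j))"
  define e where "e = (\<lambda>t::real. exp (2 * of_real pi * \<i> * of_real t))"
  define Q where "Q = (\<lambda>t u. indicator {0..1} t *\<^sub>R H (e t * u))"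
  have ne: "norm (e t) = 1" for t
  proof -
    have "e t = exp (\<i> * of_real (2 * pi * t))" by (simp add: e_def mult_ac)
    then show ?thesis by (simp only: norm_exp_i_times)
  qed
  have Hi: "integrable lborel H" using int by (simp add: H_def)
  have Hm [measurable]: "H \<in> borel_measurable borel" using Hi by auto
  have em [measurable]: "e \<in> borel_measurable borel" unfolding e_def
    by (intro borel_measurable_continuous_onI continuous_intros)
  have Qm: "case_prod Q \<in> borel_measurable (lborel \<Otimes>\<^sub>M lborel)"
    unfolding Q_def by measurable
  have Hr: "integrable lborel (\<lambda>u. H (e t * u))" "(\<integral>u. H (e t * u) \<partial>lborel) = (\<integral>u. H u \<partial>lborel)"
      "(\<integral>u. norm (H (e t * u)) \<partial>lborel) = (\<integral>u. norm (H u) \<partial>lborel)" for t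
    using integral_rotation[OF ne[of t] Hm] integral_rotation[OF ne[of t], of "\<lambda>u. norm (H u)"] Hi by auto
  have Qi: "integrable (lborel \<Otimes>\<^sub>M lborel) (case_prod Q)"
  proof (rule lborel_pair.Fubini_integrable[OF Qm])
    have "(\<lambda>t. \<integral>u. norm (case_prod Q (t, u)) \<partial>lborel) = (\<lambda>t. indicator {0..1} t * (\<integral>u. norm (H u) \<partial>lborel))"
      by (rule ext) (simp add: Q_def Hr)
    then show "integrable lborel (\<lambda>t. \<integral>u. norm (case_prod Q (t, u)) \<partial>lborel)" by simp
    show "AE t in lborel. integrable lborel (\<lambda>u. case_prod Q (t, u))"
      using Hr by (auto simp: Q_def intro!: AE_I2)
  qed
  have inner: "(\<integral>t. Q t u \<partial>lborel) = of_real (indicator (ball 0 R) u * norm u ^ (2 * j)) * taylor_coeff j g" for u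
  proof (cases "u \<in> ball 0 R")
    case False
    then have "Q t u = 0" for t by (simp add: Q_def H_def norm_mult ne)
    then show ?thesis using False by simp
  next
    case True
    then have u: "norm u < R" by simp
    have Qe: "Q t u = indicator {0..1} t *\<^sub>R ((g (e t * u) * cnj (e t) ^ j) * cnj u ^ j)" for t
      using u by (simp add: Q_def H_def norm_mult ne power_mult_distrib mult_ac)
    have cg: "continuous_on (ball 0 R) g" using g holomorphic_on_imp_continuous_on by blast
    have ce: "continuous_on A e" for A unfolding e_def by (intro continuous_intros)
    have si: "set_integrable lborel {0..1} (\<lambda>t. (g (e t * u) * cnj (e t) ^ j) * cnj u ^ j)"
      by (intro borel_integrable_atLeastAtMost' continuous_intros continuous_on_compose2[OF cg] ce)
         (use u in \<open>auto simp: norm_mult ne\<close>)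
    have "(\<integral>t. Q t u \<partial>lborel) = integral {0..1} (\<lambda>t. (g (e t * u) * cnj (e t) ^ j) * cnj u ^ j)"
      using set_borel_integral_eq_integral(2)[OF si] by (simp only: Qe set_lebesgue_integral_def)
    also have "\<dots> = taylor_coeff j g * u ^ j * cnj u ^ j"
    proof (intro integral_unique has_integral_mult_left)
      show "((\<lambda>t. g (e t * u) * cnj (e t) ^ j) has_integral taylor_coeff j g * u ^ j) {0..1}"
        unfolding e_def by (rule circle_mean_eq_taylor_coeff[OF g u])
    qed
    also have "\<dots> = of_real (norm u ^ (2 * j)) * taylor_coeff j g"
    proof -
      have "u ^ j * cnj u ^ j = of_real ((norm u)\<^sup>2) ^ j"
        by (simp only: complex_norm_square power_mult_distrib)
      also have "\<dots> = of_real (norm u ^ (2 * j))" by (simp only: of_real_power[symmetric] power_mult)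
      finally show ?thesis by (metis mult.assoc mult.commute)
    qed
    finally show ?thesis using True by simp
  qed
  have "(\<integral>u. H u \<partial>lborel) = (\<integral>t. indicator {0..1} t *\<^sub>R (\<integral>u. H u \<partial>lborel) \<partial>(lborel::real measure))"
    by simp
  also have "\<dots> = (\<integral>t. \<integral>u. Q t u \<partial>lborel \<partial>lborel)" by (simp add: Q_def Hr)
  also have "\<dots> = (\<integral>u. \<integral>t. Q t u \<partial>lborel \<partial>lborel)"
    by (rule lborel_pair.Fubini_integral[OF Qi, symmetric])
  also have "\<dots> = (\<integral>u. of_real (indicator (ball 0 R) u * norm u ^ (2 * j)) * taylor_coeff j g \<partial>(lborel :: complex measure))"
    by (simp only: inner)
  also have "\<dots> = disc_moment j R * taylor_coeff j g"
    unfolding disc_moment_def by (simp only: integral_mult_left_zero integral_complex_of_real)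
  finally show ?thesis by (simp add: H_def)
qed

lemma taylor_coeff_0: "taylor_coeff 0 g = g 0" by (simp add: taylor_coeff_def)

text \<open>Bessel's inequality for a single monomial. For \<open>j = 0\<close> it is the mean value estimate that bounds a
  holomorphic function by its square integral.\<close>

lemma taylor_coeff_L2_bound:
  assumes g: "g holomorphic_on ball 0 R" and R: "0 < R"
    and int: "integrable lborel (\<lambda>u. indicator (ball 0 R) u * (norm (g u))\<^sup>2)"
  shows "integrable lborel (\<lambda>u. indicator (ball 0 R) u *\<^sub>R (g u * cnj u ^ j))"
    and "disc_moment j R * (norm (taylor_coeff j g))\<^sup>2 \<le> (\<integral>u. indicator (ball 0 R) u * (norm (g u))\<^sup>2 \<partial>lborel)"
proof -
  let ?I = "indicator (ball 0 R) :: complex \<Rightarrow> real"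
  have cg: "continuous_on (ball 0 R) g" using g holomorphic_on_imp_continuous_on by blast
  have m: "(\<lambda>u. ?I u *\<^sub>R (g u * cnj u ^ j)) \<in> borel_measurable borel"
    by (intro borel_measurable_continuous_on_indicator continuous_intros cg) auto
  show i1: "integrable lborel (\<lambda>u. ?I u *\<^sub>R (g u * cnj u ^ j))"
  proof (rule Bochner_Integration.integrable_bound)
    show "integrable lborel (\<lambda>u. ?I u * (norm (g u))\<^sup>2 + ?I u * norm u ^ (2 * j))"
      using int disc_moment_integrable by (rule Bochner_Integration.integrable_add)
    show "AE u in lborel. norm (?I u *\<^sub>R (g u * cnj u ^ j)) \<le> norm (?I u * (norm (g u))\<^sup>2 + ?I u * norm u ^ (2 * j))"
    proof (rule AE_I2)
      fix u
      have "2 * (norm (g u) * norm u ^ j) \<le> (norm (g u))\<^sup>2 + (norm u ^ j)\<^sup>2"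
        using sum_squares_bound[of "norm (g u)" "norm u ^ j"] by simp
      moreover have "0 \<le> norm (g u) * norm u ^ j" by simp
      moreover have "(norm u ^ j)\<^sup>2 = norm u ^ (2 * j)" by (simp only: power_mult[symmetric] mult.commute)
      ultimately have "norm (g u) * norm u ^ j \<le> (norm (g u))\<^sup>2 + norm u ^ (2 * j)"
        by linarith
      then show "norm (?I u *\<^sub>R (g u * cnj u ^ j)) \<le> norm (?I u * (norm (g u))\<^sup>2 + ?I u * norm u ^ (2 * j))"
        by (auto simp: indicator_def norm_mult norm_power)
    qed
  qed (use m in simp)
  define a where "a = taylor_coeff j g"
  have val: "(\<integral>u. ?I u *\<^sub>R (g u * cnj u ^ j) \<partial>lborel) = disc_moment j R * a"
    unfolding a_def by (rule integral_disc_cnj_power[OF g R i1])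
  have i2: "integrable lborel (\<lambda>u. Re (cnj a * (?I u *\<^sub>R (g u * cnj u ^ j))))"
    using i1 by (intro integrable_Re integrable_mult_right)
  have sq: "?I u * (norm (g u - a * u ^ j))\<^sup>2 = ?I u * (norm (g u))\<^sup>2 - 2 * Re (cnj a * (?I u *\<^sub>R (g u * cnj u ^ j)))
      + (norm a)\<^sup>2 * (?I u * norm u ^ (2 * j))" for u
  proof -
    have "(norm (x - y))\<^sup>2 = (norm x)\<^sup>2 - 2 * Re (x * cnj y) + (norm y)\<^sup>2" for x y :: complex
      unfolding cmod_power2 by (simp add: power2_eq_square algebra_simps)
    then have "(norm (g u - a * u ^ j))\<^sup>2 = (norm (g u))\<^sup>2 - 2 * Re (g u * cnj (a * u ^ j)) + (norm (a * u ^ j))\<^sup>2" .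
    moreover have "(norm (a * u ^ j))\<^sup>2 = (norm a)\<^sup>2 * norm u ^ (2 * j)"
      by (simp only: norm_mult norm_power power_mult_distrib power_mult[symmetric] mult.commute[of j])
    ultimately show ?thesis by (auto simp: indicator_def mult_ac)
  qed
  have "0 \<le> (\<integral>u. ?I u * (norm (g u - a * u ^ j))\<^sup>2 \<partial>lborel)" by (intro Bochner_Integration.integral_nonneg) auto
  also have "\<dots> = (\<integral>u. ?I u * (norm (g u))\<^sup>2 \<partial>lborel) - 2 * (\<integral>u. Re (cnj a * (?I u *\<^sub>R (g u * cnj u ^ j))) \<partial>lborel)
      + (norm a)\<^sup>2 * disc_moment j R"
    unfolding sq disc_moment_def using int i2 disc_moment_integrable[of R j] by simp
  also have "(\<integral>u. Re (cnj a * (?I u *\<^sub>R (g u * cnj u ^ j))) \<partial>lborel) = Re (cnj a * (disc_moment j R * a))"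
    by (simp only: integral_Re[OF integrable_mult_right[OF i1]] integral_mult_right_zero val)
  also have "Re (cnj a * (disc_moment j R * a)) = (norm a)\<^sup>2 * disc_moment j R"
    unfolding cmod_power2 by (simp add: power2_eq_square algebra_simps)
  finally show "disc_moment j R * (norm (taylor_coeff j g))\<^sup>2 \<le> (\<integral>u. ?I u * (norm (g u))\<^sup>2 \<partial>lborel)"
    by (simp add: a_def mult.commute)
qed

section \<open>Fourier inversion on the strip\<close>

lemma lborel_complex_eq_distr_prod:
  "(lborel :: complex measure) = distr (lborel \<Otimes>\<^sub>M lborel) borel (\<lambda>(x, y). Complex x y)"
  unfolding lborel_prod
proof (rule lborel_eqI)
  have [measurable]: "(\<lambda>(x, y). Complex x y) \<in> borel_measurable (borel :: (real \<times> real) measure)"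
    unfolding split_beta by (intro borel_measurable_continuous_onI continuous_intros)
  fix l u :: complex
  assume le: "\<And>b. b \<in> Basis \<Longrightarrow> l \<bullet> b \<le> u \<bullet> b"
  have eq: "(\<lambda>(x, y). Complex x y) -` box l u = box (Re l, Im l) (Re u, Im u)"
    by (auto simp: mem_box Basis_complex_def Basis_prod_def)
  have le': "Re l \<le> Re u" "Im l \<le> Im u"
    using le[of 1] le[of \<i>] by (auto simp: Basis_complex_def)
  have "emeasure (distr lborel borel (\<lambda>(x, y). Complex x y)) (box l u)
      = emeasure lborel (box (Re l, Im l) (Re u, Im u))"
    by (subst emeasure_distr) (auto simp: eq)
  also have "\<dots> = (\<Prod>b\<in>Basis. ((Re u, Im u) - (Re l, Im l)) \<bullet> b)"
    by (rule emeasure_lborel_box) (use le' in \<open>auto simp: Basis_prod_def\<close>)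
  also have "\<dots> = (\<Prod>b\<in>Basis. (u - l) \<bullet> b)"
    by (simp add: Basis_prod_def Basis_complex_def mult.commute)
  finally show "emeasure (distr lborel borel (\<lambda>(x, y). Complex x y)) (box l u)
      = (\<Prod>b\<in>Basis. (u - l) \<bullet> b)" .
qed simp

lemma integral_complex_iterated:
  fixes f :: "complex \<Rightarrow> 'b::{banach, second_countable_topology}"
  assumes f: "integrable lborel f"
  shows "(\<integral>z. f z \<partial>lborel) = (\<integral>y. \<integral>x. f (Complex x y) \<partial>lborel \<partial>lborel)"
proof -
  have m: "(\<lambda>(x, y). Complex x y) \<in> lborel \<Otimes>\<^sub>M lborel \<rightarrow>\<^sub>M borel"
    unfolding lborel_prod split_beta by (auto intro!: borel_measurable_continuous_onI continuous_intros)
  have fm: "f \<in> borel_measurable borel" using f by auto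
  have i: "integrable (lborel \<Otimes>\<^sub>M lborel) (\<lambda>p. f (case p of (x, y) \<Rightarrow> Complex x y))"
    using f unfolding lborel_complex_eq_distr_prod integrable_distr_eq[OF m fm] .
  then have i': "integrable (lborel \<Otimes>\<^sub>M lborel) (\<lambda>(x, y). f (Complex x y))"
    by (simp add: case_prod_unfold)
  have "(\<integral>z. f z \<partial>lborel) = (\<integral>p. f (case p of (x, y) \<Rightarrow> Complex x y) \<partial>(lborel \<Otimes>\<^sub>M lborel))"
    by (subst lborel_complex_eq_distr_prod) (rule integral_distr[OF m fm])
  also have "\<dots> = (\<integral>p. (case p of (x, y) \<Rightarrow> f (Complex x y)) \<partial>(lborel \<Otimes>\<^sub>M lborel))"
    by (simp add: case_prod_unfold)
  also have "\<dots> = (\<integral>y. \<integral>x. f (Complex x y) \<partial>lborel \<partial>lborel)"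
    by (rule lborel_pair.integral_snd[OF i', symmetric])
  finally show ?thesis .
qed

lemma integrable_complex_product:
  fixes f :: "complex \<Rightarrow> 'b::{banach, second_countable_topology}"
  assumes f: "f \<in> borel_measurable borel" and A: "integrable lborel (A::real\<Rightarrow>real)" and B: "integrable lborel (B::real\<Rightarrow>real)"
    and le: "\<And>z. norm (f z) \<le> A (Re z) * B (Im z)"
  shows "integrable lborel f"
proof -
  have m: "(\<lambda>(x, y). Complex x y) \<in> lborel \<Otimes>\<^sub>M lborel \<rightarrow>\<^sub>M borel"
    unfolding lborel_prod split_beta by (auto intro!: borel_measurable_continuous_onI continuous_intros)
  have fm: "(\<lambda>p. f (case p of (x, y) \<Rightarrow> Complex x y)) \<in> borel_measurable (lborel \<Otimes>\<^sub>M lborel)"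
    using measurable_compose[OF m f] .
  have "integrable (lborel \<Otimes>\<^sub>M lborel) (\<lambda>p. A (fst p) * B (snd p))"
  proof (rule lborel_pair.Fubini_integrable)
    show "(\<lambda>p. A (fst p) * B (snd p)) \<in> borel_measurable (lborel \<Otimes>\<^sub>M lborel)"
      using A B by measurable
    have "integrable lborel (\<lambda>x. \<bar>A x\<bar> * (\<integral>y. \<bar>B y\<bar> \<partial>lborel))" using A by simp
    then show "integrable lborel (\<lambda>x. \<integral>y. norm (A (fst (x, y)) * B (snd (x, y))) \<partial>lborel)"
      by (simp add: abs_mult)
    show "AE x in lborel. integrable lborel (\<lambda>y. A (fst (x, y)) * B (snd (x, y)))"
      using B by simp
  qed
  then have "integrable (lborel \<Otimes>\<^sub>M lborel) (\<lambda>p. f (case p of (x, y) \<Rightarrow> Complex x y))"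
  proof (rule Bochner_Integration.integrable_bound[OF _ fm], intro AE_I2)
    fix p :: "real \<times> real"
    have "norm (f (case p of (x, y) \<Rightarrow> Complex x y)) \<le> A (fst p) * B (snd p)"
      using le[of "Complex (fst p) (snd p)"] by (simp add: split_beta)
    then show "norm (f (case p of (x, y) \<Rightarrow> Complex x y)) \<le> norm (A (fst p) * B (snd p))" by simp
  qed
  then show ?thesis unfolding lborel_complex_eq_distr_prod integrable_distr_eq[OF m f] .
qed

lemma integrable_pair_dominated:
  fixes f :: "real \<Rightarrow> real \<Rightarrow> 'b::{banach, second_countable_topology}"
  assumes f: "case_prod f \<in> borel_measurable (lborel \<Otimes>\<^sub>M lborel)"
    and A: "integrable lborel A" and B: "integrable lborel B"
    and le: "\<And>x y. norm (f x y) \<le> A x * B y"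
  shows "integrable (lborel \<Otimes>\<^sub>M lborel) (case_prod f)"
proof -
  have "integrable (lborel \<Otimes>\<^sub>M lborel) (\<lambda>p. A (fst p) * B (snd p))"
  proof (rule lborel_pair.Fubini_integrable)
    show "(\<lambda>p. A (fst p) * B (snd p)) \<in> borel_measurable (lborel \<Otimes>\<^sub>M lborel)"
      using A B by measurable
    have "integrable lborel (\<lambda>x. \<bar>A x\<bar> * (\<integral>y. \<bar>B y\<bar> \<partial>lborel))" using A by simp
    then show "integrable lborel (\<lambda>x. \<integral>y. norm (A (fst (x, y)) * B (snd (x, y))) \<partial>lborel)"
      by (simp add: abs_mult)
    show "AE x in lborel. integrable lborel (\<lambda>y. A (fst (x, y)) * B (snd (x, y)))"
      using B by simp
  qed
  then show ?thesis
  proof (rule Bochner_Integration.integrable_bound[OF _ f], intro AE_I2)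
    fix p :: "real \<times> real"
    have "norm (case_prod f p) \<le> A (fst p) * B (snd p)" using le by (simp add: split_beta)
    then show "norm (case_prod f p) \<le> norm (A (fst p) * B (snd p))" by simp
  qed
qed

lemma integral_exp_half_line:
  assumes w: "0 < Im w"
  shows "(\<integral>x. indicator {0..} x *\<^sub>R exp (\<i> * of_real x * w / 2) \<partial>lborel) = 2 * \<i> / w"
proof -
  define f where "f = (\<lambda>x::real. exp (\<i> * of_real x * w / 2))"
  define G where "G = (\<lambda>x::real. 2 / (\<i> * w) * exp (\<i> * of_real x * w / 2))"
  have w0: "w \<noteq> 0" using w by auto
  have nf: "norm (f x) = exp (- (Im w / 2 * x))" for x by (simp add: f_def norm_exp_eq_Re)
  have fc: "continuous_on A f" for A unfolding f_def by (intro continuous_intros) auto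
  have fint: "integrable lborel (\<lambda>x. indicator {0..} x *\<^sub>R f x)"
  proof (rule integrable_exp_dominated[of _ "Im w / 2" 1])
    show "(\<lambda>x. indicator {0..} x *\<^sub>R f x) \<in> borel_measurable borel"
      by (intro borel_measurable_continuous_on_indicator fc) auto
  qed (use w nf in \<open>auto simp: indicator_def\<close>)
  have "((\<lambda>b. set_lebesgue_integral lborel {0..b} f) \<longlongrightarrow> set_lebesgue_integral lborel {0..} f) at_top"
    by (rule tendsto_set_lebesgue_integral_at_top) (use fint in \<open>auto simp: set_integrable_def\<close>)
  moreover have "((\<lambda>b. set_lebesgue_integral lborel {0..b} f) \<longlongrightarrow> 0 - G 0) at_top"
  proof (rule Lim_transform_eventually)
    have "(G \<longlongrightarrow> 0) at_top"
    proof (rule tendsto_norm_zero_cancel, rule tendsto_cong[THEN iffD1, rotated])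
      show "((\<lambda>x. norm (2 / (\<i> * w)) * exp (- (Im w / 2 * x))) \<longlongrightarrow> 0) at_top"
        by (rule exp_neg_abs_tendsto_0) (use w in simp)
      show "eventually (\<lambda>x. norm (2 / (\<i> * w)) * exp (- (Im w / 2 * x)) = norm (G x)) at_top"
      proof (rule always_eventually, rule allI)
        show "norm (2 / (\<i> * w)) * exp (- (Im w / 2 * x)) = norm (G x)" for x
          by (simp only: G_def norm_mult nf[symmetric] f_def)
      qed
    qed
    then show "((\<lambda>b. G b - G 0) \<longlongrightarrow> 0 - G 0) at_top" by (intro tendsto_intros)
    show "eventually (\<lambda>b. G b - G 0 = set_lebesgue_integral lborel {0..b} f) at_top"
      using eventually_ge_at_top[of 0]
    proof eventually_elim
      case (elim b)
      have "(f has_integral (G b - G 0)) {0..b}"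
      proof (rule fundamental_theorem_of_calculus[OF elim])
        fix x assume "x \<in> {0..b}"
        have "((\<lambda>z. 2 / (\<i> * w) * exp (\<i> * z * w / 2)) has_field_derivative exp (\<i> * of_real x * w / 2)) (at (of_real x))"
          using w0 by (auto intro!: derivative_eq_intros simp: field_simps)
        then show "(G has_vector_derivative f x) (at x within {0..b})"
          unfolding G_def f_def by (rule has_vector_derivative_real_field[THEN has_vector_derivative_at_within])
      qed
      moreover have "set_integrable lborel {0..b} f" by (intro borel_integrable_atLeastAtMost' fc)
      ultimately show ?case
        using set_borel_integral_eq_integral(2)[of "{0..b}" f] by (metis integral_unique)
    qed
  qed
  ultimately have "set_lebesgue_integral lborel {0..} f = 0 - G 0"
    using tendsto_unique trivial_limit_at_top_linorder by blast
  moreover have "0 - G 0 = 2 * \<i> / w"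
    using w0 by (simp add: G_def divide_simps mult.assoc[symmetric])
  ultimately show ?thesis by (simp only: set_lebesgue_integral_def f_def)
qed

lemma integral_exp_half_line_neg:
  assumes w: "Im w < 0"
  shows "(\<integral>x. indicator {..0} x *\<^sub>R exp (\<i> * of_real x * w / 2) \<partial>lborel) = - 2 * \<i> / w"
proof -
  have "(\<integral>x. indicator {..0} x *\<^sub>R exp (\<i> * of_real x * w / 2) \<partial>(lborel::real measure))
      = (\<integral>x. indicator {..0} (0 + - 1 * x) *\<^sub>R exp (\<i> * of_real (0 + - 1 * x) * w / 2) \<partial>(lborel::real measure))"
    using lborel_integral_real_affine[of "- 1" "\<lambda>x. indicator {..0} x *\<^sub>R exp (\<i> * of_real x * w / 2)" 0] by simp
  also have "\<dots> = (\<integral>x. indicator {0..} x *\<^sub>R exp (\<i> * of_real x * (- w) / 2) \<partial>(lborel::real measure))"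
    by (intro Bochner_Integration.integral_cong) (auto simp: indicator_def)
  also have "\<dots> = 2 * \<i> / (- w)" by (rule integral_exp_half_line) (use w in simp)
  finally show ?thesis by simp
qed

context lens_angle
begin

definition strip :: "complex set" where "strip = {s. lo < Im s \<and> Im s < hi}"

text \<open>A class of functions for which every integral below converges absolutely. It is reached from general
  square integrable functions by multiplication with a Gaussian.\<close>

definition strip_decaying :: "(complex \<Rightarrow> complex) \<Rightarrow> bool" where
  "strip_decaying g \<longleftrightarrow> g holomorphic_on strip \<and>
    (\<forall>a b. lo < a \<and> b < hi \<longrightarrow> (\<exists>C. \<forall>s. a \<le> Im s \<and> Im s \<le> b \<longrightarrow> norm (g s) \<le> C * exp (- \<bar>Re s\<bar>)))"

text \<open>The Fourier transform along the line \<open>Im s = v\<close>, normalised by the point \<open>s0\<close>. By Cauchy's theorem it does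
  not depend on \<open>v\<close>.\<close>

definition line_transform :: "(complex \<Rightarrow> complex) \<Rightarrow> complex \<Rightarrow> real \<Rightarrow> real \<Rightarrow> complex" where
  "line_transform g s0 v \<xi> =
    (\<integral>\<sigma>. g (of_real \<sigma> + \<i> * of_real v) * exp (\<i> * of_real \<xi> * (s0 - (of_real \<sigma> + \<i> * of_real v)) / 2) \<partial>lborel)"

lemma open_strip: "open strip"
proof -
  have "strip = {z. lo < Im z} \<inter> {z. Im z < hi}" by (auto simp: strip_def)
  then show ?thesis by (simp only: open_Int open_halfspace_Im_gt open_halfspace_Im_lt)
qed

lemma continuous_on_line:
  assumes g: "g holomorphic_on strip" and v: "lo < v" "v < hi"
  shows "continuous_on UNIV (\<lambda>\<sigma>. g (of_real \<sigma> + \<i> * of_real v))"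
  by (rule continuous_on_compose2[OF holomorphic_on_imp_continuous_on[OF g]])
     (use v in \<open>auto intro!: continuous_intros simp: strip_def\<close>)

lemma norm_exp_strip:
  "norm (exp (\<i> * of_real \<xi> * (s0 - s) / 2)) = exp (- (\<xi> * (Im s0 - Im s) / 2))"
  by (simp add: norm_exp_eq_Re)

text \<open>\<open>line_shift_residues\<close> with no poles.\<close>

lemma line_transform_indep:
  assumes g: "strip_decaying g" and v: "lo < v" "v < w" "w < hi"
  shows "line_transform g s0 v \<xi> = line_transform g s0 w \<xi>"
proof -
  have gh: "g holomorphic_on strip" using g by (simp add: strip_decaying_def)
  obtain C where C: "\<And>s. v \<le> Im s \<Longrightarrow> Im s \<le> w \<Longrightarrow> norm (g s) \<le> C * exp (- \<bar>Re s\<bar>)"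
    using g v unfolding strip_decaying_def by blast
  define f where "f = (\<lambda>s. g s * exp (\<i> * of_real \<xi> * (s0 - s) / 2))"
  define M where "M = exp (\<bar>\<xi>\<bar> * (\<bar>Im s0\<bar> + (\<bar>v\<bar> + \<bar>w\<bar>)) / 2)"
  have fb: "norm (f s) \<le> C * M * exp (- (1 * \<bar>Re s\<bar>))" if "v \<le> Im s" "Im s \<le> w" for s
  proof -
    have C0: "0 \<le> C * exp (- \<bar>Re s\<bar>)" using C[OF that] norm_ge_zero order_trans by blast
    have "- (\<xi> * (Im s0 - Im s)) \<le> \<bar>\<xi>\<bar> * \<bar>Im s0 - Im s\<bar>" by (metis abs_ge_minus_self abs_mult)
    also have "\<dots> \<le> \<bar>\<xi>\<bar> * (\<bar>Im s0\<bar> + (\<bar>v\<bar> + \<bar>w\<bar>))" using that by (intro mult_left_mono) auto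
    finally have "exp (- (\<xi> * (Im s0 - Im s) / 2)) \<le> M" by (simp add: M_def)
    then have "norm (f s) \<le> (C * exp (- \<bar>Re s\<bar>)) * M"
      unfolding f_def norm_mult norm_exp_strip using C[OF that] C0 by (intro mult_mono) auto
    then show ?thesis by (simp add: mult_ac)
  qed
  have fh: "f holomorphic_on {z. lo < Im z \<and> Im z < hi} - {}"
    unfolding f_def using gh by (auto intro!: holomorphic_intros simp: strip_def)
  have int: "integrable lborel (\<lambda>x. f (of_real x + \<i> * of_real u))" if "u = v \<or> u = w" for u
  proof (rule integrable_exp_dominated[of _ 1 "C * M"])
    have "continuous_on UNIV (\<lambda>x. f (of_real x + \<i> * of_real u))"
      unfolding f_def using that v by (intro continuous_intros continuous_on_line[OF gh]) auto
    then show "(\<lambda>x. f (of_real x + \<i> * of_real u)) \<in> borel_measurable borel"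
      by (rule borel_measurable_continuous_onI)
    show "norm (f (of_real x + \<i> * of_real u)) \<le> C * M * exp (- (1 * \<bar>x\<bar>))" for x
      using fb[of "of_real x + \<i> * of_real u"] that v by auto
  qed simp
  have "(\<integral>x. f (of_real x + \<i> * of_real v) \<partial>lborel) - (\<integral>x. f (of_real x + \<i> * of_real w) \<partial>lborel)
      = 2 * pi * \<i> * (\<Sum>p\<in>{}. residue f p)"
    by (rule line_shift_residues[OF v(1,2,3) finite.emptyI _ fh _ exp_neg_abs_tendsto_0[of 1 "C * M"], where N = 0])
       (use fb int in auto)
  then show ?thesis by (simp add: line_transform_def f_def)
qed

lemma line_transform_eq:
  assumes "strip_decaying g" "lo < v" "v < hi" "lo < w" "w < hi"
  shows "line_transform g s0 v \<xi> = line_transform g s0 w \<xi>"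
proof (cases v w rule: linorder_cases)
  case less
  then show ?thesis using line_transform_indep[OF assms(1,2) _ assms(5)] by blast
next
  case greater
  then show ?thesis using line_transform_indep[OF assms(1,4) _ assms(3)] by metis
qed simp

lemma line_bound:
  assumes g: "strip_decaying g" and v: "lo < v" "v < hi"
  obtains C where "0 < C" "\<And>\<sigma>. norm (g (of_real \<sigma> + \<i> * of_real v)) \<le> C * exp (- (1 * \<bar>\<sigma>\<bar>))"
proof -
  obtain C where C: "\<And>s. v \<le> Im s \<Longrightarrow> Im s \<le> v \<Longrightarrow> norm (g s) \<le> C * exp (- \<bar>Re s\<bar>)"
    using g v unfolding strip_decaying_def by blast
  show ?thesis
  proof (rule that[of "\<bar>C\<bar> + 1"])
    fix \<sigma> :: real
    have "norm (g (of_real \<sigma> + \<i> * of_real v)) \<le> C * exp (- \<bar>\<sigma>\<bar>)"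
      using C[of "of_real \<sigma> + \<i> * of_real v"] by simp
    also have "\<dots> \<le> (\<bar>C\<bar> + 1) * exp (- (1 * \<bar>\<sigma>\<bar>))" by (simp add: mult_right_mono)
    finally show "norm (g (of_real \<sigma> + \<i> * of_real v)) \<le> (\<bar>C\<bar> + 1) * exp (- (1 * \<bar>\<sigma>\<bar>))" .
  qed simp
qed

lemma line_measurable:
  assumes g: "strip_decaying g" and v: "lo < v" "v < hi"
  shows "(\<lambda>\<sigma>. g (of_real \<sigma> + \<i> * of_real v)) \<in> borel_measurable borel"
  using g v by (intro borel_measurable_continuous_onI continuous_on_line) (auto simp: strip_decaying_def)

lemma line_transform_measurable:
  assumes g: "strip_decaying g" and v: "lo < v" "v < hi"
  shows "line_transform g s0 v \<in> borel_measurable borel"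
proof -
  note [measurable] = line_measurable[OF g v]
  have e: "(\<lambda>p. exp (\<i> * of_real (fst p) * (s0 - (of_real (snd p) + \<i> * of_real v)) / 2)) \<in> borel_measurable (borel \<Otimes>\<^sub>M borel)"
    unfolding borel_prod by (intro borel_measurable_continuous_onI continuous_intros) auto
  have "(\<lambda>p. g (of_real (snd p) + \<i> * of_real v) * exp (\<i> * of_real (fst p) * (s0 - (of_real (snd p) + \<i> * of_real v)) / 2))
      \<in> borel_measurable (borel \<Otimes>\<^sub>M borel)"
    by (intro borel_measurable_times e) measurable
  then have "(\<lambda>\<xi>. \<integral>\<sigma>. g (of_real \<sigma> + \<i> * of_real v) * exp (\<i> * of_real \<xi> * (s0 - (of_real \<sigma> + \<i> * of_real v)) / 2) \<partial>lborel) \<in> borel_measurable borel"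
    by (intro lborel.borel_measurable_lebesgue_integral) (simp add: split_beta)
  then show ?thesis unfolding line_transform_def[abs_def] .
qed

lemma norm_line_transform_le:
  assumes g: "strip_decaying g" and v: "lo < v" "v < hi"
  shows "\<exists>C>0. \<forall>\<xi>. norm (line_transform g s0 v \<xi>) \<le> C * exp (- (\<xi> * (Im s0 - v) / 2))"
proof -
  obtain C where C: "0 < C" "\<And>\<sigma>. norm (g (of_real \<sigma> + \<i> * of_real v)) \<le> C * exp (- (1 * \<bar>\<sigma>\<bar>))"
    using line_bound[OF g v] by blast
  define I where "I = (\<integral>\<sigma>. C * exp (- (1 * \<bar>\<sigma>\<bar>)) \<partial>lborel)"
  have Ii: "integrable lborel (\<lambda>\<sigma>. C * exp (- (1 * \<bar>\<sigma>\<bar>)))"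
    by (intro integrable_mult_right integrable_exp_neg_abs) simp
  have I0: "0 \<le> I" unfolding I_def using C by (intro Bochner_Integration.integral_nonneg) auto
  show ?thesis
  proof (intro exI[of _ "I + 1"] conjI allI)
    fix \<xi>
    define E where "E = exp (- (\<xi> * (Im s0 - v) / 2))"
    have pt: "norm (g (of_real \<sigma> + \<i> * of_real v) * exp (\<i> * of_real \<xi> * (s0 - (of_real \<sigma> + \<i> * of_real v)) / 2))
        \<le> C * exp (- (1 * \<bar>\<sigma>\<bar>)) * E" for \<sigma>
      unfolding norm_mult norm_exp_strip E_def using C(2)[of \<sigma>] by (auto intro!: mult_mono)
    have m: "(\<lambda>\<sigma>. g (of_real \<sigma> + \<i> * of_real v) * exp (\<i> * of_real \<xi> * (s0 - (of_real \<sigma> + \<i> * of_real v)) / 2)) \<in> borel_measurable borel"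
      by (rule borel_measurable_times[OF line_measurable[OF g v]],
          rule borel_measurable_continuous_onI, intro continuous_intros) auto
    have int: "integrable lborel (\<lambda>\<sigma>. g (of_real \<sigma> + \<i> * of_real v) * exp (\<i> * of_real \<xi> * (s0 - (of_real \<sigma> + \<i> * of_real v)) / 2))"
      by (rule integrable_exp_dominated[OF m, of 1 "C * E"]) (use pt in \<open>auto simp: mult_ac\<close>)
    have "norm (line_transform g s0 v \<xi>) \<le> (\<integral>\<sigma>. norm (g (of_real \<sigma> + \<i> * of_real v) * exp (\<i> * of_real \<xi> * (s0 - (of_real \<sigma> + \<i> * of_real v)) / 2)) \<partial>lborel)"
      unfolding line_transform_def by (rule integral_norm_bound)
    also have "\<dots> \<le> (\<integral>\<sigma>. C * exp (- (1 * \<bar>\<sigma>\<bar>)) * E \<partial>lborel)"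
      by (intro integral_mono integrable_norm int integrable_mult_left Ii pt)
    also have "\<dots> = I * E" unfolding I_def by (rule integral_mult_left_zero)
    also have "\<dots> \<le> (I + 1) * E" by (simp add: E_def)
    finally show "norm (line_transform g s0 v \<xi>) \<le> (I + 1) * exp (- (\<xi> * (Im s0 - v) / 2))" by (simp add: E_def)
  qed (use I0 in simp)
qed

text \<open>Taking the line below \<open>s0\<close> gives decay for positive frequencies, taking it above gives decay for negative ones.\<close>

lemma line_transform_decay:
  assumes g: "strip_decaying g" and s0: "lo < Im s0" "Im s0 < hi" and v: "lo < v" "v < hi"
  shows "\<exists>C>0. \<exists>\<delta>>0. \<forall>\<xi>. norm (line_transform g s0 v \<xi>) \<le> C * exp (- (\<delta> * \<bar>\<xi>\<bar>))"
proof -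
  define v1 v2 where "v1 = (lo + Im s0) / 2" and "v2 = (hi + Im s0) / 2"
  have v12: "lo < v1" "v1 < Im s0" "Im s0 < v2" "v2 < hi" using s0 by (auto simp: v1_def v2_def)
  obtain C1 where C1: "C1 > 0" "\<And>\<xi>. norm (line_transform g s0 v1 \<xi>) \<le> C1 * exp (- (\<xi> * (Im s0 - v1) / 2))"
    using norm_line_transform_le[OF g, of v1 s0] v12 by auto
  obtain C2 where C2: "C2 > 0" "\<And>\<xi>. norm (line_transform g s0 v2 \<xi>) \<le> C2 * exp (- (\<xi> * (Im s0 - v2) / 2))"
    using norm_line_transform_le[OF g, of v2 s0] v12 by auto
  define d where "d = min (Im s0 - v1) (v2 - Im s0) / 2"
  have d: "0 < d" "d \<le> (Im s0 - v1) / 2" "d \<le> (v2 - Im s0) / 2" using v12 by (auto simp: d_def)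
  show ?thesis
  proof (intro exI conjI allI)
    show "0 < max C1 C2" "0 < d" using C1 d by auto
    fix \<xi> :: real
    show "norm (line_transform g s0 v \<xi>) \<le> max C1 C2 * exp (- (d * \<bar>\<xi>\<bar>))"
    proof (cases "0 \<le> \<xi>")
      case True
      have "norm (line_transform g s0 v \<xi>) \<le> C1 * exp (- (\<xi> * (Im s0 - v1) / 2))"
        using C1(2)[of \<xi>] line_transform_eq[OF g v, of v1 s0 \<xi>] v12 by simp
      also have "\<dots> \<le> max C1 C2 * exp (- (d * \<bar>\<xi>\<bar>))"
        using C1(1) True mult_left_mono[OF d(2) True] by (intro mult_mono) (auto simp: mult.commute)
      finally show ?thesis .
    next
      case False
      have "norm (line_transform g s0 v \<xi>) \<le> C2 * exp (- (\<xi> * (Im s0 - v2) / 2))"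
        using C2(2)[of \<xi>] line_transform_eq[OF g v, of v2 s0 \<xi>] v12 by simp
      also have "\<dots> \<le> max C1 C2 * exp (- (d * \<bar>\<xi>\<bar>))"
      proof (intro mult_mono)
        have "- \<xi> * d \<le> - \<xi> * ((v2 - Im s0) / 2)" using False d(3) by (intro mult_left_mono) auto
        then have "- (\<xi> * (Im s0 - v2) / 2) \<le> - (d * \<bar>\<xi>\<bar>)" using False by (simp add: field_simps)
        then show "exp (- (\<xi> * (Im s0 - v2) / 2)) \<le> exp (- (d * \<bar>\<xi>\<bar>))" by simp
      qed (use C2(1) in auto)
      finally show ?thesis .
    qed
  qed
qed

text \<open>Fourier inversion on the strip: the positive and the negative frequencies are integrated
  along lines below and above the point, where the frequency integral is elementary, and the
  two lines together form a Cauchy integral.\<close>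

lemma integral_line_transform:
  fixes g :: "complex \<Rightarrow> complex"
  assumes g: "strip_decaying g" and s0: "lo < Im s0" "Im s0 < hi" and v: "lo < v" "v < hi"
  shows "(\<integral>\<xi>. line_transform g s0 v \<xi> \<partial>lborel) = 4 * pi * g s0"
proof -
  define v1 v2 where "v1 = (lo + Im s0) / 2" and "v2 = (hi + Im s0) / 2"
  have v12: "lo < v1" "v1 < Im s0" "Im s0 < v2" "v2 < hi" using s0 by (auto simp: v1_def v2_def)
  have gh: "g holomorphic_on strip" using g by (simp add: strip_decaying_def)
  define sl where "sl = (\<lambda>u \<sigma>. complex_of_real \<sigma> + \<i> * of_real u)"
  have half: "(\<integral>\<xi>. indicator T \<xi> *\<^sub>R line_transform g s0 u \<xi> \<partial>lborel)
      = (\<integral>\<sigma>. g (sl u \<sigma>) * (\<integral>\<xi>. indicator T \<xi> *\<^sub>R exp (\<i> * of_real \<xi> * (s0 - sl u \<sigma>) / 2) \<partial>lborel) \<partial>lborel)"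
    if u: "lo < u" "u < hi" and T: "T \<in> sets borel" and d: "0 < d" and dT: "\<And>\<xi>. \<xi> \<in> T \<Longrightarrow> d * \<bar>\<xi>\<bar> \<le> \<xi> * (Im s0 - u) / 2" for u T d
  proof -
    obtain C where C0: "0 < C" and C': "\<And>\<sigma>. norm (g (of_real \<sigma> + \<i> * of_real u)) \<le> C * exp (- (1 * \<bar>\<sigma>\<bar>))"
      using line_bound[OF g u] by blast
    have C: "0 < C" "norm (g (sl u \<sigma>)) \<le> C * exp (- (1 * \<bar>\<sigma>\<bar>))" for \<sigma>
      using C0 C' unfolding sl_def by auto
    note [measurable] = T
    have [measurable]: "(\<lambda>\<sigma>. g (sl u \<sigma>)) \<in> borel_measurable borel"
      unfolding sl_def by (rule line_measurable[OF g u])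
    define Q where "Q = (\<lambda>\<sigma> \<xi>. indicator T \<xi> *\<^sub>R (g (sl u \<sigma>) * exp (\<i> * of_real \<xi> * (s0 - sl u \<sigma>) / 2)))"
    have e: "(\<lambda>p. exp (\<i> * of_real (snd p) * (s0 - sl u (fst p)) / 2)) \<in> borel_measurable (lborel \<Otimes>\<^sub>M lborel)"
    proof -
      have "continuous_on UNIV (\<lambda>p. exp (\<i> * of_real (snd p) * (s0 - sl u (fst p)) / 2))"
        unfolding sl_def by (intro continuous_intros) auto
      then show ?thesis unfolding lborel_prod by (simp add: borel_measurable_continuous_onI)
    qed
    have g1: "(\<lambda>p. g (sl u (fst p))) \<in> borel_measurable (lborel \<Otimes>\<^sub>M lborel)" by measurable
    have Qm: "case_prod Q \<in> borel_measurable (lborel \<Otimes>\<^sub>M lborel)"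
      unfolding Q_def split_beta by (intro borel_measurable_scaleR borel_measurable_times e g1) measurable
    have Qi: "integrable (lborel \<Otimes>\<^sub>M lborel) (case_prod Q)"
    proof (rule integrable_pair_dominated[OF Qm])
      show "integrable lborel (\<lambda>\<sigma>. C * exp (- (1 * \<bar>\<sigma>\<bar>)))"
        by (intro integrable_mult_right integrable_exp_neg_abs) simp
      show "integrable lborel (\<lambda>\<xi>. exp (- (d * \<bar>\<xi>\<bar>)))" by (rule integrable_exp_neg_abs[OF d])
      show "norm (Q \<sigma> \<xi>) \<le> C * exp (- (1 * \<bar>\<sigma>\<bar>)) * exp (- (d * \<bar>\<xi>\<bar>))" for \<sigma> \<xi>
      proof (cases "\<xi> \<in> T")
        case True
        have "norm (Q \<sigma> \<xi>) = norm (g (sl u \<sigma>)) * exp (- (\<xi> * (Im s0 - u) / 2))"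
          using True by (simp add: Q_def norm_mult norm_exp_strip) (simp add: sl_def)
        also have "\<dots> \<le> C * exp (- (1 * \<bar>\<sigma>\<bar>)) * exp (- (d * \<bar>\<xi>\<bar>))"
          using C dT[OF True] by (intro mult_mono) auto
        finally show ?thesis .
      qed (use C in \<open>auto simp: Q_def\<close>)
    qed
    have "(\<integral>\<xi>. indicator T \<xi> *\<^sub>R line_transform g s0 u \<xi> \<partial>lborel) = (\<integral>\<xi>. \<integral>\<sigma>. Q \<sigma> \<xi> \<partial>lborel \<partial>lborel)"
      unfolding line_transform_def Q_def sl_def by simp
    also have "\<dots> = (\<integral>\<sigma>. \<integral>\<xi>. Q \<sigma> \<xi> \<partial>lborel \<partial>lborel)" by (rule lborel_pair.Fubini_integral[OF Qi])
    also have "\<dots> = (\<integral>\<sigma>. g (sl u \<sigma>) * (\<integral>\<xi>. indicator T \<xi> *\<^sub>R exp (\<i> * of_real \<xi> * (s0 - sl u \<sigma>) / 2) \<partial>lborel) \<partial>lborel)"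
      unfolding Q_def mult_scaleR_right[symmetric] integral_mult_right_zero ..
    finally show ?thesis .
  qed
  have pos: "(\<integral>\<xi>. indicator {0..} \<xi> *\<^sub>R line_transform g s0 v1 \<xi> \<partial>lborel) = (\<integral>\<sigma>. g (sl v1 \<sigma>) * (2 * \<i> / (s0 - sl v1 \<sigma>)) \<partial>lborel)"
  proof -
    have "(\<integral>\<xi>. indicator {0..} \<xi> *\<^sub>R exp (\<i> * of_real \<xi> * (s0 - sl v1 \<sigma>) / 2) \<partial>lborel) = 2 * \<i> / (s0 - sl v1 \<sigma>)" for \<sigma>
      by (rule integral_exp_half_line) (use v12 in \<open>simp add: sl_def\<close>)
    then show ?thesis
      using half[of v1 "{0..}" "(Im s0 - v1) / 2"] v12 by simp
  qed
  have neg: "(\<integral>\<xi>. indicator {..0} \<xi> *\<^sub>R line_transform g s0 v2 \<xi> \<partial>lborel) = (\<integral>\<sigma>. g (sl v2 \<sigma>) * (- 2 * \<i> / (s0 - sl v2 \<sigma>)) \<partial>lborel)"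
  proof -
    have "(\<integral>\<xi>. indicator {..0} \<xi> *\<^sub>R exp (\<i> * of_real \<xi> * (s0 - sl v2 \<sigma>) / 2) \<partial>lborel) = - 2 * \<i> / (s0 - sl v2 \<sigma>)" for \<sigma>
      by (rule integral_exp_half_line_neg) (use v12 in \<open>simp add: sl_def\<close>)
    moreover have "(v2 - Im s0) / 2 * \<bar>\<xi>\<bar> \<le> \<xi> * (Im s0 - v2) / 2" if "\<xi> \<in> {..0}" for \<xi>
      using that by (simp add: algebra_simps)
    ultimately show ?thesis
      using half[of v2 "{..0}" "(v2 - Im s0) / 2"] v12 by simp
  qed
  have li: "integrable lborel (line_transform g s0 u)" if u: "lo < u" "u < hi" for u
  proof -
    obtain C \<delta> where "C > 0" "\<delta> > 0" "\<And>\<xi>. norm (line_transform g s0 u \<xi>) \<le> C * exp (- (\<delta> * \<bar>\<xi>\<bar>))"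
      using line_transform_decay[OF g s0 u] by blast
    then show ?thesis using integrable_exp_dominated[OF line_transform_measurable[OF g u]] by blast
  qed
  have "(\<integral>\<xi>. line_transform g s0 v \<xi> \<partial>lborel)
      = (\<integral>\<xi>. indicator {0..} \<xi> *\<^sub>R line_transform g s0 v1 \<xi> + indicator {..0} \<xi> *\<^sub>R line_transform g s0 v2 \<xi> \<partial>lborel)"
  proof (rule integral_cong_AE)
    show "line_transform g s0 v \<in> borel_measurable lborel" using line_transform_measurable[OF g v] by simp
    show "(\<lambda>\<xi>. indicator {0..} \<xi> *\<^sub>R line_transform g s0 v1 \<xi> + indicator {..0} \<xi> *\<^sub>R line_transform g s0 v2 \<xi>) \<in> borel_measurable lborel"
      using line_transform_measurable[OF g, of v1 s0] line_transform_measurable[OF g, of v2 s0] v12 by simp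
    show "AE \<xi> in lborel. line_transform g s0 v \<xi> = indicator {0..} \<xi> *\<^sub>R line_transform g s0 v1 \<xi> + indicator {..0} \<xi> *\<^sub>R line_transform g s0 v2 \<xi>"
      using AE_lborel_singleton[of "0::real"]
    proof eventually_elim
      case (elim \<xi>)
      then show ?case
        using line_transform_eq[OF g v, of v1 s0 \<xi>] line_transform_eq[OF g v, of v2 s0 \<xi>] v12
        by (auto simp: indicator_def)
    qed
  qed
  also have "\<dots> = (\<integral>\<sigma>. g (sl v1 \<sigma>) * (2 * \<i> / (s0 - sl v1 \<sigma>)) \<partial>lborel) + (\<integral>\<sigma>. g (sl v2 \<sigma>) * (- 2 * \<i> / (s0 - sl v2 \<sigma>)) \<partial>lborel)"
    unfolding pos[symmetric] neg[symmetric]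
    using v12 by (intro Bochner_Integration.integral_add integrable_mult_indicator li) auto
  also have "\<dots> = - 2 * \<i> * (\<integral>\<sigma>. g (sl v1 \<sigma>) / (sl v1 \<sigma> - s0) \<partial>lborel) + 2 * \<i> * (\<integral>\<sigma>. g (sl v2 \<sigma>) / (sl v2 \<sigma> - s0) \<partial>lborel)"
  proof -
    have e1: "g (sl v1 \<sigma>) * (2 * \<i> / (s0 - sl v1 \<sigma>)) = - 2 * \<i> * (g (sl v1 \<sigma>) / (sl v1 \<sigma> - s0))" for \<sigma>
      by (metis (no_types, opaque_lifting) divide_minus_right minus_diff_eq minus_mult_left mult.commute minus_divide_left times_divide_eq_right)
    have e2: "g (sl v2 \<sigma>) * (- 2 * \<i> / (s0 - sl v2 \<sigma>)) = 2 * \<i> * (g (sl v2 \<sigma>) / (sl v2 \<sigma> - s0))" for \<sigma>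
      by (metis (no_types, opaque_lifting) divide_minus_right minus_diff_eq minus_mult_left mult.commute minus_divide_left times_divide_eq_right)
    show ?thesis unfolding e1 e2 by (simp only: integral_mult_right_zero)
  qed
  also have "\<dots> = - 2 * \<i> * ((\<integral>\<sigma>. g (sl v1 \<sigma>) / (sl v1 \<sigma> - s0) \<partial>lborel) - (\<integral>\<sigma>. g (sl v2 \<sigma>) / (sl v2 \<sigma> - s0) \<partial>lborel))"
    by (simp add: algebra_simps)
  also have "(\<integral>\<sigma>. g (sl v1 \<sigma>) / (sl v1 \<sigma> - s0) \<partial>lborel) - (\<integral>\<sigma>. g (sl v2 \<sigma>) / (sl v2 \<sigma> - s0) \<partial>lborel) = 2 * pi * \<i> * g s0"
  proof -
    define f where "f = (\<lambda>s. g s / (s - s0))"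
    obtain C where C: "\<And>s. v1 \<le> Im s \<Longrightarrow> Im s \<le> v2 \<Longrightarrow> norm (g s) \<le> C * exp (- \<bar>Re s\<bar>)"
      using g v12 unfolding strip_decaying_def by blast
    have fh: "f holomorphic_on {z. lo < Im z \<and> Im z < hi} - {s0}"
      unfolding f_def using holomorphic_on_subset[OF gh] by (auto intro!: holomorphic_intros simp: strip_def)
    have fd: "norm (f s) \<le> C / e * exp (- (1 * \<bar>Re s\<bar>))" if "v1 \<le> Im s" "Im s \<le> v2" "0 < e" "e \<le> norm (s - s0)" for s e
    proof -
      have "norm (f s) = norm (g s) / norm (s - s0)" by (simp add: f_def norm_divide)
      also have "\<dots> \<le> norm (g s) / e" using that by (intro divide_left_mono) (auto intro: mult_pos_pos less_le_trans)
      also have "\<dots> \<le> C * exp (- \<bar>Re s\<bar>) / e" using C that by (intro divide_right_mono) auto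
      finally show ?thesis by simp
    qed
    have int: "integrable lborel (\<lambda>x. f (of_real x + \<i> * of_real u))" if "u = v1 \<or> u = v2" for u
    proof -
      define e where "e = \<bar>u - Im s0\<bar>"
      have e: "0 < e" using that v12 by (auto simp: e_def)
      have en: "e \<le> norm (of_real x + \<i> * of_real u - s0)" for x
        using abs_Im_le_cmod[of "of_real x + \<i> * of_real u - s0"] by (simp add: e_def)
      show ?thesis
      proof (rule integrable_exp_dominated[of _ 1 "C / e"])
        have "(of_real x + \<i> * of_real u) - s0 \<noteq> 0" for x using en[of x] e by auto
        then have "continuous_on UNIV (\<lambda>x. f (of_real x + \<i> * of_real u))"
          unfolding f_def using that v12 by (intro continuous_intros continuous_on_line[OF gh]) auto
        then show "(\<lambda>x. f (of_real x + \<i> * of_real u)) \<in> borel_measurable borel"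
          by (rule borel_measurable_continuous_onI)
        show "norm (f (of_real x + \<i> * of_real u)) \<le> C / e * exp (- (1 * \<bar>x\<bar>))" for x
          using fd[of "of_real x + \<i> * of_real u" e] en e that v12 by auto
      qed simp
    qed
    have "(\<integral>x. f (of_real x + \<i> * of_real v1) \<partial>lborel) - (\<integral>x. f (of_real x + \<i> * of_real v2) \<partial>lborel)
        = 2 * pi * \<i> * (\<Sum>p\<in>{s0}. residue f p)"
    proof (rule line_shift_residues[OF v12(1) _ v12(4) _ _ fh _ exp_neg_abs_tendsto_0[of 1 "C / 1"], where N = "\<bar>Re s0\<bar> + 1"])
      fix z assume z: "v1 \<le> Im z" "Im z \<le> v2" "\<bar>Re s0\<bar> + 1 \<le> \<bar>Re z\<bar>"
      have "1 \<le> norm (z - s0)" using z abs_Re_le_cmod[of "z - s0"] by simp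
      then show "norm (f z) \<le> C / 1 * exp (- (1 * \<bar>Re z\<bar>))" using fd[of z 1] z by simp
    qed (use v12 int in auto)
    moreover have "residue f s0 = g s0"
      unfolding f_def by (rule residue_simple[OF open_strip]) (use s0 gh in \<open>auto simp: strip_def\<close>)
    ultimately show ?thesis by (simp add: f_def sl_def)
  qed
  finally show ?thesis by simp
qed

lemma kern_eq: "kern n \<tau> = (\<integral>x. exp (\<i> * of_real x * \<tau> / 2) / of_real (Fr n x) \<partial>lborel) / (4 * pi)"
  by (simp add: kern_at_def F_of_real)

text \<open>On the line \<open>Im s = v\<close> the kernel acts on the Fourier transform as multiplication by
  \<open>exp (- (v * \<xi>)) / Fr n \<xi>\<close>. Integrated against the weight this becomes \<open>1\<close>, because \<open>Fr n \<xi>\<close> is exactly the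
  integral of \<open>wt n v * exp (- (v * \<xi>))\<close>; Fourier inversion finishes the proof.\<close>

lemma strip_reproducing_decaying:
  fixes g :: "complex \<Rightarrow> complex"
  assumes g: "strip_decaying g" and s0: "lo < Im s0" "Im s0 < hi" and n: "0 < n"
  shows "(\<integral>v. \<integral>\<sigma>. wt n v *\<^sub>R (kern n (s0 - cnj (Complex \<sigma> v)) * g (Complex \<sigma> v)) \<partial>lborel \<partial>lborel) = g s0"
proof -
  define L where "L = line_transform g s0 (Im s0)"
  have Lm [measurable]: "L \<in> borel_measurable borel" unfolding L_def by (rule line_transform_measurable[OF g s0])
  obtain CL dL where CL: "CL > 0" "dL > 0" "\<And>\<xi>. norm (L \<xi>) \<le> CL * exp (- (dL * \<bar>\<xi>\<bar>))"
    using line_transform_decay[OF g s0 s0] unfolding L_def by blast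
  have Li: "integrable lborel L" by (rule integrable_exp_dominated[OF Lm CL(2,3)])
  have Frm [measurable]: "Fr n \<in> borel_measurable borel"
    by (intro borel_measurable_continuous_onI continuous_intros)
  have slice: "(\<integral>\<sigma>. kern n (s0 - cnj (Complex \<sigma> v)) * g (Complex \<sigma> v) \<partial>lborel)
      = (\<integral>\<xi>. of_real (exp (- (v * \<xi>)) / Fr n \<xi>) * L \<xi> \<partial>lborel) / (4 * pi)" if v: "lo < v" "v < hi" for v
  proof -
    define sl where "sl = (\<lambda>\<sigma>. complex_of_real \<sigma> + \<i> * of_real v)"
    have slc: "Complex \<sigma> v = sl \<sigma>" for \<sigma> by (simp add: sl_def complex_eq_iff)
    obtain C where C: "0 < C" "\<And>\<sigma>. norm (g (sl \<sigma>)) \<le> C * exp (- (1 * \<bar>\<sigma>\<bar>))"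
      using line_bound[OF g v] unfolding sl_def by blast
    have gm [measurable]: "(\<lambda>\<sigma>. g (sl \<sigma>)) \<in> borel_measurable borel"
      unfolding sl_def by (rule line_measurable[OF g v])
    have t: "lo < (Im s0 + v) / 2" "(Im s0 + v) / 2 < hi" using s0 v by auto
    obtain D d where D: "D > 0" "d > 0" "\<And>x. exp (- (x * ((Im s0 + v) / 2))) / Fr n x \<le> D * exp (- (d * \<bar>x\<bar>))"
      using exp_ratio_bound[OF t n] by blast
    define Q where "Q = (\<lambda>\<sigma> \<xi>. exp (\<i> * of_real \<xi> * (s0 - cnj (sl \<sigma>)) / 2) / of_real (Fr n \<xi>) * g (sl \<sigma>))"
    have e1: "(\<lambda>p. exp (\<i> * of_real (snd p) * (s0 - cnj (sl (fst p))) / 2) / of_real (Fr n (snd p))) \<in> borel_measurable (lborel \<Otimes>\<^sub>M lborel)"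
    proof -
      have "continuous_on UNIV (\<lambda>p. exp (\<i> * of_real (snd p) * (s0 - cnj (sl (fst p))) / 2) / of_real (Fr n (snd p)))"
        unfolding sl_def by (intro continuous_intros) (auto simp: Fr_nz)
      then show ?thesis unfolding lborel_prod by (simp add: borel_measurable_continuous_onI)
    qed
    have g1: "(\<lambda>p. g (sl (fst p))) \<in> borel_measurable (lborel \<Otimes>\<^sub>M lborel)" by measurable
    have Qm: "case_prod Q \<in> borel_measurable (lborel \<Otimes>\<^sub>M lborel)"
      unfolding Q_def case_prod_unfold by (intro borel_measurable_times e1 g1)
    have Qi: "integrable (lborel \<Otimes>\<^sub>M lborel) (case_prod Q)"
    proof (rule integrable_pair_dominated[OF Qm])
      show "integrable lborel (\<lambda>\<sigma>. C * exp (- (1 * \<bar>\<sigma>\<bar>)))"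
        by (intro integrable_mult_right integrable_exp_neg_abs) simp
      show "integrable lborel (\<lambda>\<xi>. D * exp (- (d * \<bar>\<xi>\<bar>)))"
        by (intro integrable_mult_right integrable_exp_neg_abs D)
      fix \<sigma> \<xi>
      have "norm (Q \<sigma> \<xi>) = exp (- (\<xi> * ((Im s0 + v) / 2))) / Fr n \<xi> * norm (g (sl \<sigma>))"
        using Fr_pos[of n \<xi>] by (simp add: Q_def norm_mult norm_divide norm_exp_eq_Re) (simp add: sl_def)
      also have "\<dots> \<le> (D * exp (- (d * \<bar>\<xi>\<bar>))) * (C * exp (- (1 * \<bar>\<sigma>\<bar>)))"
        using C D Fr_pos[of n \<xi>] by (intro mult_mono) auto
      finally show "norm (Q \<sigma> \<xi>) \<le> C * exp (- (1 * \<bar>\<sigma>\<bar>)) * (D * exp (- (d * \<bar>\<xi>\<bar>)))" by (simp only: mult_ac)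
    qed
    have inner: "(\<integral>\<sigma>. Q \<sigma> \<xi> \<partial>lborel) = of_real (exp (- (v * \<xi>)) / Fr n \<xi>) * L \<xi>" for \<xi>
    proof -
      have ex: "exp (\<i> * of_real \<xi> * (s0 - cnj (sl \<sigma>)) / 2) = of_real (exp (- (v * \<xi>))) * exp (\<i> * of_real \<xi> * (s0 - sl \<sigma>) / 2)" for \<sigma>
      proof -
        have "\<i> * of_real \<xi> * (s0 - cnj (sl \<sigma>)) / 2 = of_real (- (v * \<xi>)) + \<i> * of_real \<xi> * (s0 - sl \<sigma>) / 2"
          by (simp add: sl_def complex_eq_iff field_simps)
        then show ?thesis by (simp only: exp_add exp_of_real)
      qed
      have "(\<integral>\<sigma>. Q \<sigma> \<xi> \<partial>lborel) = (\<integral>\<sigma>. of_real (exp (- (v * \<xi>)) / Fr n \<xi>) * (g (sl \<sigma>) * exp (\<i> * of_real \<xi> * (s0 - sl \<sigma>) / 2)) \<partial>lborel)"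
        unfolding Q_def ex by (intro Bochner_Integration.integral_cong) (auto simp: mult_ac)
      also have "\<dots> = of_real (exp (- (v * \<xi>)) / Fr n \<xi>) * line_transform g s0 v \<xi>"
        unfolding line_transform_def sl_def by (rule integral_mult_right_zero)
      also have "line_transform g s0 v \<xi> = L \<xi>" unfolding L_def by (rule line_transform_eq[OF g v s0])
      finally show ?thesis .
    qed
    have "(\<integral>\<sigma>. kern n (s0 - cnj (Complex \<sigma> v)) * g (Complex \<sigma> v) \<partial>lborel)
        = (\<integral>\<sigma>. (\<integral>\<xi>. Q \<sigma> \<xi> \<partial>lborel) / (4 * pi) \<partial>lborel)"
      unfolding slc kern_eq Q_def integral_mult_left_zero
      by (intro Bochner_Integration.integral_cong refl) (rule times_divide_eq_left)
    also have "\<dots> = (\<integral>\<sigma>. \<integral>\<xi>. Q \<sigma> \<xi> \<partial>lborel \<partial>lborel) / (4 * pi)" by (rule integral_divide_zero)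
    also have "(\<integral>\<sigma>. \<integral>\<xi>. Q \<sigma> \<xi> \<partial>lborel \<partial>lborel) = (\<integral>\<xi>. \<integral>\<sigma>. Q \<sigma> \<xi> \<partial>lborel \<partial>lborel)"
      by (rule lborel_pair.Fubini_integral[OF Qi, symmetric])
    finally show ?thesis by (simp only: inner)
  qed
  define R where "R = (\<lambda>\<xi> v. wt n v *\<^sub>R (of_real (exp (- (v * \<xi>)) / Fr n \<xi>) * L \<xi>))"
  have Rm: "case_prod R \<in> borel_measurable (lborel \<Otimes>\<^sub>M lborel)"
    unfolding R_def by measurable
  have ws: "integrable lborel (\<lambda>v. wt n v * exp (- (v * \<xi>)))" for \<xi> by (rule integrable_wt_exp)
  have Rint: "(\<integral>v. R \<xi> v \<partial>lborel) = L \<xi>" "integrable lborel (\<lambda>v. R \<xi> v)" "(\<integral>v. norm (R \<xi> v) \<partial>lborel) = norm (L \<xi>)" for \<xi>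
  proof -
    have e: "R \<xi> v = of_real (wt n v * exp (- (v * \<xi>))) * (L \<xi> / of_real (Fr n \<xi>))" for v
      by (simp add: R_def scaleR_conv_of_real)
    have "(\<integral>v. R \<xi> v \<partial>lborel) = of_real (Fr n \<xi>) * (L \<xi> / of_real (Fr n \<xi>))"
      unfolding e by (simp only: integral_mult_left_zero integral_complex_of_real Fr_def)
    then show "(\<integral>v. R \<xi> v \<partial>lborel) = L \<xi>" by (simp add: Fr_nz)
    show "integrable lborel (\<lambda>v. R \<xi> v)" unfolding e by (intro integrable_mult_left integrable_of_real ws)
    have "norm (R \<xi> v) = (wt n v * exp (- (v * \<xi>))) * (norm (L \<xi>) / Fr n \<xi>)" for v
    proof -
      have "norm (complex_of_real (wt n v * exp (- (v * \<xi>)))) = wt n v * exp (- (v * \<xi>))"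
        unfolding norm_of_real by (simp add: wt_nonneg)
      moreover have "norm (L \<xi> / of_real (Fr n \<xi>)) = norm (L \<xi>) / Fr n \<xi>"
        using Fr_pos[of n \<xi>] by (simp add: norm_divide)
      ultimately show ?thesis unfolding e norm_mult by (simp only:)
    qed
    then have "(\<integral>v. norm (R \<xi> v) \<partial>lborel) = Fr n \<xi> * (norm (L \<xi>) / Fr n \<xi>)"
      by (simp only: integral_mult_left_zero Fr_def)
    then show "(\<integral>v. norm (R \<xi> v) \<partial>lborel) = norm (L \<xi>)" by (simp add: Fr_nz)
  qed
  have Ri: "integrable (lborel \<Otimes>\<^sub>M lborel) (case_prod R)"
  proof (rule lborel_pair.Fubini_integrable[OF Rm])
    show "integrable lborel (\<lambda>\<xi>. \<integral>v. norm (case_prod R (\<xi>, v)) \<partial>lborel)"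
      using Li by (simp add: Rint)
    show "AE \<xi> in lborel. integrable lborel (\<lambda>v. case_prod R (\<xi>, v))" using Rint by simp
  qed
  have "(\<integral>v. \<integral>\<sigma>. wt n v *\<^sub>R (kern n (s0 - cnj (Complex \<sigma> v)) * g (Complex \<sigma> v)) \<partial>lborel \<partial>lborel)
      = (\<integral>v. (\<integral>\<xi>. R \<xi> v \<partial>lborel) / (4 * pi) \<partial>lborel)"
  proof (intro Bochner_Integration.integral_cong refl)
    fix v
    show "(\<integral>\<sigma>. wt n v *\<^sub>R (kern n (s0 - cnj (Complex \<sigma> v)) * g (Complex \<sigma> v)) \<partial>lborel) = (\<integral>\<xi>. R \<xi> v \<partial>lborel) / (4 * pi)"
    proof (cases "lo < v \<and> v < hi")
      case True
      then have v: "lo < v" "v < hi" by auto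
      show ?thesis unfolding R_def integral_scaleR_right slice[OF v] by (simp add: scaleR_conv_of_real)
    next
      case False
      then have "wt n v = 0" by (auto simp: wt_def)
      then show ?thesis by (simp add: R_def)
    qed
  qed
  also have "\<dots> = (\<integral>v. \<integral>\<xi>. R \<xi> v \<partial>lborel \<partial>lborel) / (4 * pi)" by (rule integral_divide_zero)
  also have "(\<integral>v. \<integral>\<xi>. R \<xi> v \<partial>lborel \<partial>lborel) = (\<integral>\<xi>. \<integral>v. R \<xi> v \<partial>lborel \<partial>lborel)"
    by (rule lborel_pair.Fubini_integral[OF Ri])
  also have "\<dots> = 4 * pi * g s0" unfolding Rint L_def by (rule integral_line_transform[OF g s0 s0])
  finally show ?thesis by simp
qed

section \<open>The reproducing property on the weighted Bergman space of the strip\<close>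

text \<open>On a slightly larger substrip the weight is bounded below, and the mean value estimate on discs of a fixed radius applies.\<close>

lemma weighted_L2_bounded_on_substrips:
  fixes G :: "complex \<Rightarrow> complex"
  assumes G: "G holomorphic_on strip"
    and L2: "integrable lborel (\<lambda>s. wt n (Im s) * (norm (G s))\<^sup>2)"
    and ab: "lo < a" "a \<le> b" "b < hi"
  shows "\<exists>M>0. \<forall>s. a \<le> Im s \<and> Im s \<le> b \<longrightarrow> norm (G s) \<le> M"
proof -
  define d where "d = min (a - lo) (hi - b) / 2"
  have "d \<le> (a - lo) / 2" "d \<le> (hi - b) / 2" "0 < d"
    using ab by (auto simp: d_def divide_right_mono)
  then have d: "0 < d" "lo < a - d" "b + d < hi" using ab by auto
  have Gc: "continuous_on strip G" using G holomorphic_on_imp_continuous_on by blast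
  have "continuous_on {a - d..b + d} (\<lambda>u. \<psi> u ^ n)" by (intro continuous_intros)
  then have "\<exists>u0\<in>{a - d..b + d}. \<forall>u\<in>{a - d..b + d}. \<psi> u0 ^ n \<le> \<psi> u ^ n"
    using ab d by (intro continuous_attains_inf) auto
  then obtain u0 where u0: "u0 \<in> {a - d..b + d}" "\<And>u. u \<in> {a - d..b + d} \<Longrightarrow> \<psi> u0 ^ n \<le> \<psi> u ^ n" by blast
  define m where "m = \<psi> u0 ^ n"
  have m: "0 < m" using u0 d psi_pos[of u0] by (simp add: m_def)
  define I where "I = (\<integral>s. wt n (Im s) * (norm (G s))\<^sup>2 \<partial>lborel)"
  define c where "c = disc_moment 0 d"
  have c: "0 < c" unfolding c_def by (rule disc_moment_pos[OF d(1)])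
  have I0: "0 \<le> I" unfolding I_def by (intro Bochner_Integration.integral_nonneg) (auto simp: wt_nonneg)
  have bound: "c * (norm (G s))\<^sup>2 \<le> I / m" if s: "a \<le> Im s" "Im s \<le> b" for s
  proof -
    have near: "a - d \<le> Im (s + u) \<and> Im (s + u) \<le> b + d" if "u \<in> cball 0 d" for u
      using that s abs_Im_le_cmod[of u] by auto
    have sub: "s + u \<in> strip" if "u \<in> cball 0 d" for u using near[OF that] d by (auto simp: strip_def)
    have hol: "(\<lambda>u. G (s + u)) holomorphic_on ball 0 d"
    proof (rule holomorphic_on_compose[of "\<lambda>u. s + u" "ball 0 d" G, unfolded o_def])
      show "G holomorphic_on (\<lambda>u. s + u) ` ball 0 d"
        by (rule holomorphic_on_subset[OF G], rule image_subsetI, rule sub) simp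
    qed (intro holomorphic_intros)
    have cc: "continuous_on (cball 0 d) (\<lambda>u. (norm (G (s + u)))\<^sup>2)"
    proof -
      have "continuous_on (cball 0 d) (\<lambda>u. G (s + u))"
        by (rule continuous_on_compose2[OF Gc]) (intro continuous_intros, rule image_subsetI, rule sub)
      then show ?thesis by (intro continuous_intros)
    qed
    have "integrable lborel (\<lambda>u. indicator (cball 0 d) u *\<^sub>R (norm (G (s + u)))\<^sup>2)"
      by (rule borel_integrable_compact[OF compact_cball cc])
    then have "set_integrable lborel (ball 0 d) (\<lambda>u. (norm (G (s + u)))\<^sup>2)"
      unfolding set_integrable_def[symmetric] by (rule set_integrable_subset) auto
    then have int: "integrable lborel (\<lambda>u. indicator (ball 0 d) u * (norm (G (s + u)))\<^sup>2)"
      by (simp add: set_integrable_def)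
    have tr: "integrable lborel (\<lambda>u. wt n (Im (s + u)) * (norm (G (s + u)))\<^sup>2)"
        "(\<integral>u. wt n (Im (s + u)) * (norm (G (s + u)))\<^sup>2 \<partial>lborel) = I"
    proof -
      have mm: "(+) s \<in> lborel \<rightarrow>\<^sub>M borel" by simp
      have fm: "(\<lambda>s. wt n (Im s) * (norm (G s))\<^sup>2) \<in> borel_measurable borel" using L2 by auto
      show "integrable lborel (\<lambda>u. wt n (Im (s + u)) * (norm (G (s + u)))\<^sup>2)"
        using integrable_distr_eq[OF mm fm] L2 by (simp add: lborel_distr_plus)
      show "(\<integral>u. wt n (Im (s + u)) * (norm (G (s + u)))\<^sup>2 \<partial>lborel) = I"
        using integral_distr[OF mm fm] by (simp add: lborel_distr_plus I_def)
    qed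
    have "c * (norm (taylor_coeff 0 (\<lambda>u. G (s + u))))\<^sup>2 \<le> (\<integral>u. indicator (ball 0 d) u * (norm (G (s + u)))\<^sup>2 \<partial>lborel)"
      unfolding c_def by (rule taylor_coeff_L2_bound(2)[OF hol d(1) int])
    also have "\<dots> \<le> (\<integral>u. wt n (Im (s + u)) * (norm (G (s + u)))\<^sup>2 / m \<partial>lborel)"
    proof (rule integral_mono[OF int])
      show "integrable lborel (\<lambda>u. wt n (Im (s + u)) * (norm (G (s + u)))\<^sup>2 / m)"
        by (rule integrable_divide[OF tr(1)])
      fix u
      show "indicator (ball 0 d) u * (norm (G (s + u)))\<^sup>2 \<le> wt n (Im (s + u)) * (norm (G (s + u)))\<^sup>2 / m"
      proof (cases "u \<in> ball 0 d")
        case True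
        then have u: "u \<in> cball 0 d" by simp
        then have "m \<le> wt n (Im (s + u))"
          using near[OF u] u0(2)[of "Im (s + u)"] d by (auto simp: m_def wt_def)
        then have "1 \<le> wt n (Im (s + u)) / m" using m by simp
        then have "1 * (norm (G (s + u)))\<^sup>2 \<le> wt n (Im (s + u)) / m * (norm (G (s + u)))\<^sup>2"
          by (rule mult_right_mono) simp
        then show ?thesis using True by simp
      next
        case False
        then show ?thesis using m wt_nonneg by simp
      qed
    qed
    also have "\<dots> = I / m" using tr(2) by simp
    finally show ?thesis by (simp add: taylor_coeff_0)
  qed
  show ?thesis
  proof (intro exI[of _ "sqrt (I / m / c) + 1"] conjI allI impI)
    have "0 \<le> I / m / c" using I0 m c by simp
    then show "0 < sqrt (I / m / c) + 1" by (simp add: add_nonneg_pos)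
    fix s assume "a \<le> Im s \<and> Im s \<le> b"
    then have "(norm (G s))\<^sup>2 \<le> I / m / c" using bound[of s]
      by (subst pos_le_divide_eq[OF c]) (simp only: mult.commute)
    then have "norm (G s) \<le> sqrt (I / m / c)" by (rule real_le_rsqrt)
    then show "norm (G s) \<le> sqrt (I / m / c) + 1" by simp
  qed
qed

lemma norm_gaussian: "norm (exp (- (of_real e * (s - s0)\<^sup>2))) = exp (- (e * (Re s - Re s0)\<^sup>2) + e * (Im s - Im s0)\<^sup>2)"
  by (simp add: norm_exp_eq_Re power2_eq_square algebra_simps)

text \<open>On lines the Gaussian decays like \<open>exp (- e (Re s)\<^sup>2)\<close>, which beats every exponential.\<close>

lemma strip_decaying_gaussian:
  fixes G :: "complex \<Rightarrow> complex"
  assumes G: "G holomorphic_on strip"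
    and L2: "integrable lborel (\<lambda>s. wt n (Im s) * (norm (G s))\<^sup>2)" and e: "0 < e"
  shows "strip_decaying (\<lambda>s. G s * exp (- (of_real e * (s - s0)\<^sup>2)))"
  unfolding strip_decaying_def
proof (intro conjI allI impI)
  show "(\<lambda>s. G s * exp (- (of_real e * (s - s0)\<^sup>2))) holomorphic_on strip"
    by (intro holomorphic_intros G)
  fix a b assume ab: "lo < a \<and> b < hi"
  show "\<exists>C. \<forall>s. a \<le> Im s \<and> Im s \<le> b \<longrightarrow> norm (G s * exp (- (of_real e * (s - s0)\<^sup>2))) \<le> C * exp (- \<bar>Re s\<bar>)"
  proof (cases "a \<le> b")
    case False then show ?thesis by (intro exI[of _ 0]) auto
  next
    case True
    obtain M where M: "M > 0" "\<And>s. a \<le> Im s \<and> Im s \<le> b \<Longrightarrow> norm (G s) \<le> M"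
      using weighted_L2_bounded_on_substrips[OF G L2 _ True] ab by blast
    \<comment> \<open>The constant \<open>1 / (4 * e)\<close> comes from completing the square in \<open>x - e * x\<^sup>2\<close>.\<close>
    define B where "B = 1 / (4 * e) + \<bar>Re s0\<bar> + e * (\<bar>a\<bar> + \<bar>b\<bar> + \<bar>Im s0\<bar>)\<^sup>2"
    show ?thesis
    proof (intro exI[of _ "M * exp B"] allI impI)
      fix s assume s: "a \<le> Im s \<and> Im s \<le> b"
      define x where "x = \<bar>Re s - Re s0\<bar>"
      have "0 \<le> (2 * e * x - 1)\<^sup>2 / (4 * e)" using e by simp
      also have "\<dots> = e * x\<^sup>2 - x + 1 / (4 * e)" using e by (simp add: power2_eq_square field_simps)
      finally have 1: "- (e * (Re s - Re s0)\<^sup>2) \<le> - x + 1 / (4 * e)" by (simp add: x_def)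
      have 2: "\<bar>Re s\<bar> \<le> x + \<bar>Re s0\<bar>" by (simp add: x_def)
      have "\<bar>Im s - Im s0\<bar> \<le> \<bar>\<bar>a\<bar> + \<bar>b\<bar> + \<bar>Im s0\<bar>\<bar>" using s by linarith
      then have "(Im s - Im s0)\<^sup>2 \<le> (\<bar>a\<bar> + \<bar>b\<bar> + \<bar>Im s0\<bar>)\<^sup>2" by (simp only: abs_le_square_iff)
      then have 3: "e * (Im s - Im s0)\<^sup>2 \<le> e * (\<bar>a\<bar> + \<bar>b\<bar> + \<bar>Im s0\<bar>)\<^sup>2" using e by simp
      have "- (e * (Re s - Re s0)\<^sup>2) + e * (Im s - Im s0)\<^sup>2 \<le> B + (- \<bar>Re s\<bar>)"
        using 1 2 3 unfolding B_def by linarith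
      then have "norm (exp (- (of_real e * (s - s0)\<^sup>2))) \<le> exp B * exp (- \<bar>Re s\<bar>)"
        unfolding norm_gaussian by (simp flip: exp_add)
      then have "norm (G s) * norm (exp (- (of_real e * (s - s0)\<^sup>2))) \<le> M * (exp B * exp (- \<bar>Re s\<bar>))"
        using M s by (intro mult_mono) auto
      then show "norm (G s * exp (- (of_real e * (s - s0)\<^sup>2))) \<le> M * exp B * exp (- \<bar>Re s\<bar>)"
        by (simp add: norm_mult mult.assoc)
    qed
  qed
qed

lemma wt_measurable_Im [measurable]: "(\<lambda>s. wt n (Im s)) \<in> borel_measurable borel"
  by measurable

lemma continuous_on_kern_strip:
  assumes s0: "lo < Im s0" "Im s0 < hi" and n: "0 < n"
  shows "continuous_on strip (\<lambda>s. kern n (s0 - cnj s))"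
  by (rule continuous_on_compose2[OF holomorphic_on_imp_continuous_on[OF kern_holomorphic[OF n]]])
     (use s0 in \<open>auto intro!: continuous_intros simp: strip_def\<close>)

lemma strip_measurable:
  fixes f :: "complex \<Rightarrow> complex"
  assumes "continuous_on strip f" shows "(\<lambda>s. wt n (Im s) *\<^sub>R f s) \<in> borel_measurable borel"
proof -
  have "(\<lambda>s. indicator strip s *\<^sub>R (\<psi> (Im s) ^ n *\<^sub>R f s)) \<in> borel_measurable borel"
    using open_strip assms by (intro borel_measurable_continuous_on_indicator continuous_intros) auto
  also have "(\<lambda>s. indicator strip s *\<^sub>R (\<psi> (Im s) ^ n *\<^sub>R f s)) = (\<lambda>s. wt n (Im s) *\<^sub>R f s)"
    by (auto simp: strip_def wt_def indicator_def)
  finally show ?thesis .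
qed

text \<open>The weight has exponent \<open>j + 1\<close>, of which \<open>j\<close> are used up by \<open>kern_weighted_decay\<close>.\<close>

lemma kern_weighted_L2:
  assumes s0: "lo < Im s0" "Im s0 < hi"
  shows "integrable lborel (\<lambda>s. wt (Suc j) (Im s) * (norm (kern (Suc j) (s0 - cnj s)))\<^sup>2)"
proof -
  obtain C where C: "C > 0" "\<And>s. lo < Im s \<and> Im s < hi \<Longrightarrow>
    sqrt (\<psi> (Im s)) ^ j * norm (kern (Suc j) (s0 - cnj s)) \<le> C * exp (- (\<bar>Re s\<bar> / 8))"
    using kern_weighted_decay[OF s0] by blast
  have m: "(\<lambda>s. wt (Suc j) (Im s) * (norm (kern (Suc j) (s0 - cnj s)))\<^sup>2) \<in> borel_measurable borel"
  proof -
    have "(\<lambda>s. wt (Suc j) (Im s) *\<^sub>R complex_of_real ((norm (kern (Suc j) (s0 - cnj s)))\<^sup>2)) \<in> borel_measurable borel"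
      by (intro strip_measurable continuous_intros continuous_on_kern_strip s0) simp
    then have "(\<lambda>s. Re (wt (Suc j) (Im s) *\<^sub>R complex_of_real ((norm (kern (Suc j) (s0 - cnj s)))\<^sup>2))) \<in> borel_measurable borel"
      by measurable
    then show ?thesis by simp
  qed
  show ?thesis
  proof (rule integrable_complex_product[OF m, of "\<lambda>x. C\<^sup>2 * exp (- (1/4 * \<bar>x\<bar>))" "indicator {lo<..<hi}"])
    show "integrable lborel (\<lambda>x. C\<^sup>2 * exp (- (1/4 * \<bar>x\<bar>)))"
      by (intro integrable_mult_right integrable_exp_neg_abs) simp
    show "integrable lborel (indicator {lo<..<hi} :: real \<Rightarrow> real)"
      using lo_less_hi by (intro integrable_real_indicator) auto
    fix s
    show "norm (wt (Suc j) (Im s) * (norm (kern (Suc j) (s0 - cnj s)))\<^sup>2)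
        \<le> C\<^sup>2 * exp (- (1/4 * \<bar>Re s\<bar>)) * indicator {lo<..<hi} (Im s)"
    proof (cases "lo < Im s \<and> Im s < hi")
      case True
      have p: "0 < \<psi> (Im s)" using psi_pos True by blast
      have "(sqrt (\<psi> (Im s)) ^ j)\<^sup>2 = (sqrt (\<psi> (Im s)) ^ 2) ^ j" by (simp only: power_mult[symmetric] mult.commute)
      then have sq: "(sqrt (\<psi> (Im s)) ^ j)\<^sup>2 = \<psi> (Im s) ^ j" using p by simp
      have "wt (Suc j) (Im s) * (norm (kern (Suc j) (s0 - cnj s)))\<^sup>2
          = \<psi> (Im s) * (sqrt (\<psi> (Im s)) ^ j * norm (kern (Suc j) (s0 - cnj s)))\<^sup>2"
        using True by (simp add: wt_def power_mult_distrib sq)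
      also have "\<dots> \<le> 1 * (C * exp (- (\<bar>Re s\<bar> / 8)))\<^sup>2"
        by (rule mult_mono[OF psi_le_1 power_mono[OF C(2)[OF True]]]) (use p in auto)
      also have "\<dots> = C\<^sup>2 * exp (- (1/4 * \<bar>Re s\<bar>))"
        by (simp add: power_mult_distrib power2_eq_square flip: exp_add)
      finally show ?thesis using True wt_nonneg[of "Suc j" "Im s"] by (simp add: abs_mult)
    next
      case False
      then show ?thesis using C(1) by (auto simp: wt_def)
    qed
  qed
qed

text \<open>The Gaussian factors tend to \<open>1\<close> and equal \<open>1\<close> at \<open>s0\<close>, so the general case follows from the decaying one by dominated convergence.\<close>

lemma strip_reproducing:
  fixes G :: "complex \<Rightarrow> complex"
  assumes G: "G holomorphic_on strip"
    and L2: "integrable lborel (\<lambda>s. wt (Suc j) (Im s) * (norm (G s))\<^sup>2)" and s0: "lo < Im s0" "Im s0 < hi"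
  shows "integrable lborel (\<lambda>s. wt (Suc j) (Im s) *\<^sub>R (kern (Suc j) (s0 - cnj s) * G s))"
    and "(\<integral>s. wt (Suc j) (Im s) *\<^sub>R (kern (Suc j) (s0 - cnj s) * G s) \<partial>lborel) = G s0"
proof -
  define H where "H = (\<lambda>s. wt (Suc j) (Im s) *\<^sub>R (kern (Suc j) (s0 - cnj s) * G s))"
  have Gc: "continuous_on strip G" using G holomorphic_on_imp_continuous_on by blast
  have Hm: "H \<in> borel_measurable borel" unfolding H_def
    by (intro strip_measurable continuous_intros continuous_on_kern_strip s0 Gc) simp
  have Hi: "integrable lborel H"
  proof (rule Bochner_Integration.integrable_bound)
    show "integrable lborel (\<lambda>s. wt (Suc j) (Im s) * (norm (kern (Suc j) (s0 - cnj s)))\<^sup>2 + wt (Suc j) (Im s) * (norm (G s))\<^sup>2)"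
      by (intro Bochner_Integration.integrable_add kern_weighted_L2 s0 L2)
    show "AE s in lborel. norm (H s) \<le> norm (wt (Suc j) (Im s) * (norm (kern (Suc j) (s0 - cnj s)))\<^sup>2 + wt (Suc j) (Im s) * (norm (G s))\<^sup>2)"
    proof (rule AE_I2)
      fix s
      define A B where "A = norm (kern (Suc j) (s0 - cnj s))" and "B = norm (G s)"
      have "2 * (A * B) \<le> A\<^sup>2 + B\<^sup>2" using sum_squares_bound[of A B] by simp
      moreover have "0 \<le> A * B" by (simp add: A_def B_def)
      ultimately have "A * B \<le> A\<^sup>2 + B\<^sup>2" by linarith
      then have "wt (Suc j) (Im s) * (A * B) \<le> wt (Suc j) (Im s) * (A\<^sup>2 + B\<^sup>2)"
        by (rule mult_left_mono) (rule wt_nonneg)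
      moreover have "norm (H s) = wt (Suc j) (Im s) * (A * B)"
        using wt_nonneg[of "Suc j" "Im s"] by (simp add: H_def A_def B_def norm_mult)
      ultimately show "norm (H s) \<le> norm (wt (Suc j) (Im s) * A\<^sup>2 + wt (Suc j) (Im s) * B\<^sup>2)"
        by (simp add: distrib_left)
    qed
  qed (use Hm in simp)
  then show "integrable lborel (\<lambda>s. wt (Suc j) (Im s) *\<^sub>R (kern (Suc j) (s0 - cnj s) * G s))" by (simp add: H_def)
  define E where "E = (\<lambda>k s. exp (- (of_real (inverse (real (Suc k))) * (s - s0)\<^sup>2)))"
  have Ec: "continuous_on UNIV (E k)" for k unfolding E_def by (intro continuous_intros)
  have HEm: "(\<lambda>s. E k s * H s) \<in> borel_measurable borel" for k
    by (intro borel_measurable_times Hm borel_measurable_continuous_onI Ec)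
  have EH: "norm (E k s * H s) \<le> exp ((hi - lo)\<^sup>2) * norm (H s)" for k s
  proof (cases "lo < Im s \<and> Im s < hi")
    case True
    define e where "e = inverse (real (Suc k))"
    have e: "0 < e" "e \<le> 1" by (auto simp: e_def inverse_eq_divide)
    have "\<bar>Im s - Im s0\<bar> \<le> \<bar>hi - lo\<bar>" using True s0 by linarith
    then have "(Im s - Im s0)\<^sup>2 \<le> (hi - lo)\<^sup>2" by (simp only: abs_le_square_iff)
    then have "e * (Im s - Im s0)\<^sup>2 \<le> 1 * (hi - lo)\<^sup>2" using e by (intro mult_mono) auto
    moreover have "0 \<le> e * (Re s - Re s0)\<^sup>2" using e by simp
    ultimately have "norm (E k s) \<le> exp ((hi - lo)\<^sup>2)"
      unfolding E_def norm_gaussian e_def[symmetric] by simp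
    then show ?thesis by (simp add: norm_mult mult_right_mono)
  next
    case False
    then show ?thesis by (auto simp: H_def wt_def)
  qed
  have each: "(\<integral>s. E k s * H s \<partial>lborel) = G s0" for k
  proof -
    define g where "g = (\<lambda>s. G s * E k s)"
    have sd: "strip_decaying g"
      unfolding g_def E_def by (rule strip_decaying_gaussian[OF G L2]) simp
    have int: "integrable lborel (\<lambda>s. E k s * H s)"
    proof (rule Bochner_Integration.integrable_bound)
      show "integrable lborel (\<lambda>s. exp ((hi - lo)\<^sup>2) * norm (H s))" using Hi by simp
      show "AE s in lborel. norm (E k s * H s) \<le> norm (exp ((hi - lo)\<^sup>2) * norm (H s))"
        using EH by simp
    qed (use HEm in simp)
    have eq: "E k s * H s = wt (Suc j) (Im s) *\<^sub>R (kern (Suc j) (s0 - cnj s) * g s)" for s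
      by (simp add: H_def g_def mult_ac)
    have "(\<integral>s. E k s * H s \<partial>lborel) = (\<integral>v. \<integral>\<sigma>. E k (Complex \<sigma> v) * H (Complex \<sigma> v) \<partial>lborel \<partial>lborel)"
      by (rule integral_complex_iterated[OF int])
    also have "\<dots> = (\<integral>v. \<integral>\<sigma>. wt (Suc j) v *\<^sub>R (kern (Suc j) (s0 - cnj (Complex \<sigma> v)) * g (Complex \<sigma> v)) \<partial>lborel \<partial>lborel)"
      by (simp only: eq complex.sel)
    also have "\<dots> = g s0" by (rule strip_reproducing_decaying[OF sd s0]) simp
    finally show ?thesis by (simp add: g_def E_def)
  qed
  have "(\<lambda>k. \<integral>s. E k s * H s \<partial>lborel) \<longlonglongrightarrow> (\<integral>s. H s \<partial>lborel)"
  proof (rule integral_dominated_convergence[where w = "\<lambda>s. exp ((hi - lo)\<^sup>2) * norm (H s)"])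
    show "integrable lborel (\<lambda>s. exp ((hi - lo)\<^sup>2) * norm (H s))" using Hi by simp
    show "AE s in lborel. (\<lambda>k. E k s * H s) \<longlonglongrightarrow> H s"
    proof (rule AE_I2)
      fix s
      have "(\<lambda>k. exp (- (of_real (inverse (real (Suc k))) * (s - s0)\<^sup>2)) * H s) \<longlonglongrightarrow> exp (- (of_real 0 * (s - s0)\<^sup>2)) * H s"
        by (intro tendsto_intros LIMSEQ_inverse_real_of_nat)
      then show "(\<lambda>k. E k s * H s) \<longlonglongrightarrow> H s" by (simp add: E_def)
    qed
    show "AE s in lborel. norm (E k s * H s) \<le> exp ((hi - lo)\<^sup>2) * norm (H s)" for k using EH by simp
  qed (use HEm Hm in auto)
  then have "(\<lambda>k. G s0) \<longlonglongrightarrow> (\<integral>s. H s \<partial>lborel)" by (simp only: each)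
  then show "(\<integral>s. wt (Suc j) (Im s) *\<^sub>R (kern (Suc j) (s0 - cnj s) * G s) \<partial>lborel) = G s0"
    unfolding H_def using LIMSEQ_unique tendsto_const by metis
qed

end

section \<open>The model domain\<close>

text \<open>Morera's theorem: contour integrals over triangles may be exchanged with the integral over the parameter.\<close>

lemma holomorphic_integral_param:
  fixes h :: "complex \<Rightarrow> real \<Rightarrow> complex"
  assumes U: "open U" and c: "continuous_on (U \<times> {0..1}) (\<lambda>(s, t). h s t)"
    and hol: "\<And>t. t \<in> {0..1} \<Longrightarrow> (\<lambda>s. h s t) holomorphic_on U"
  shows "(\<lambda>s. integral {0..1} (h s)) holomorphic_on U"
proof -
  define I where "I = (\<lambda>s. integral {0..1} (h s))"
  have Ic: "continuous_on U I"
    unfolding I_def using integral_continuous_on_param[of U 0 1 h] c by simp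
  have line: "contour_integral (linepath a b) I = integral {0..1} (\<lambda>t. contour_integral (linepath a b) (\<lambda>s. h s t))"
    if ab: "closed_segment a b \<subseteq> U" for a b
  proof -
    have lp: "linepath a b u \<in> U" if "u \<in> {0..1}" for u
      using that ab linepath_in_path by fastforce
    have cc: "continuous_on (cbox (0, 0) (1, 1)) (\<lambda>(u, t). h (linepath a b u) t * (b - a))"
    proof -
      have "continuous_on ({0..1} \<times> {0..1}) (\<lambda>p. h (linepath a b (fst p)) (snd p))"
      proof -
        have q: "continuous_on ({0..1} \<times> {0..1}) (\<lambda>p. (linepath a b (fst p), snd p :: real))"
          unfolding linepath_def by (intro continuous_intros)
        have "(\<lambda>p. (linepath a b (fst p), snd p)) ` ({0..1} \<times> {0..1}) \<subseteq> U \<times> {0..1}"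
          using lp by auto
        from continuous_on_compose2[OF c q this] show ?thesis by (simp add: case_prod_unfold)
      qed
      then have "continuous_on ({0..1} \<times> {0..1}) (\<lambda>p. h (linepath a b (fst p)) (snd p) * (b - a))"
        by (intro continuous_intros)
      then show ?thesis by (simp add: case_prod_unfold cbox_Pair_eq)
    qed
    have ci: "contour_integral (linepath a b) f = integral {0..1} (\<lambda>u. f (linepath a b u) * (b - a))" for f
      by (simp add: contour_integral_integral)
    have "contour_integral (linepath a b) I = integral (cbox 0 1) (\<lambda>u. integral (cbox 0 1) (\<lambda>t. h (linepath a b u) t * (b - a)))"
      unfolding ci I_def by simp
    also have "\<dots> = integral (cbox 0 1) (\<lambda>t. integral (cbox 0 1) (\<lambda>u. h (linepath a b u) t * (b - a)))"
      by (rule integral_swap_continuous[OF cc])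
    finally show ?thesis unfolding ci by simp
  qed
  have "I analytic_on U"
  proof (rule Morera_triangle[OF Ic U])
    fix a b c :: complex
    show "convex hull {a, b, c} \<subseteq> U \<longrightarrow> contour_integral (linepath a b) I + contour_integral (linepath b c) I + contour_integral (linepath c a) I = 0"
    proof
      assume hull: "convex hull {a, b, c} \<subseteq> U"
      have segs: "closed_segment a b \<subseteq> U" "closed_segment b c \<subseteq> U" "closed_segment c a \<subseteq> U"
        unfolding segment_convex_hull by (rule subset_trans[OF hull_mono hull], simp)+
      define k where "k = (\<lambda>x y t. contour_integral (linepath x y) (\<lambda>s. h s t))"
      have kc: "continuous_on {0..1} (k x y)" if "closed_segment x y \<subseteq> U" for x y
      proof -
        have lp: "linepath x y u \<in> U" if "u \<in> {0..1}" for u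
          using that \<open>closed_segment x y \<subseteq> U\<close> linepath_in_path by fastforce
        have "continuous_on ({0..1} \<times> {0..1}) (\<lambda>p. h (linepath x y (snd p)) (fst p))"
        proof -
          have q: "continuous_on ({0..1} \<times> {0..1}) (\<lambda>p. (linepath x y (snd p), fst p :: real))"
            unfolding linepath_def by (intro continuous_intros)
          have "(\<lambda>p. (linepath x y (snd p), fst p)) ` ({0..1} \<times> {0..1}) \<subseteq> U \<times> {0..1}"
            using lp by auto
          from continuous_on_compose2[OF c q this] show ?thesis by (simp add: case_prod_unfold)
        qed
        then have "continuous_on ({0..1} \<times> {0..1}) (\<lambda>p. h (linepath x y (snd p)) (fst p) * (y - x))"
          by (intro continuous_intros)
        then have "continuous_on {0..1} (\<lambda>t. integral {0..1} (\<lambda>u. h (linepath x y u) t * (y - x)))"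
          using integral_continuous_on_param[of "{0..1}" 0 1 "\<lambda>t u. h (linepath x y u) t * (y - x)"]
          by (simp add: case_prod_unfold)
        then show ?thesis by (simp add: k_def contour_integral_integral)
      qed
      have zero: "k a b t + k b c t + k c a t = 0" if t: "t \<in> {0..1}" for t
      proof -
        have ht: "(\<lambda>s. h s t) holomorphic_on convex hull {a, b, c}"
          using hol[OF t] hull holomorphic_on_subset by blast
        have cont: "continuous_on U (\<lambda>s. h s t)" using hol[OF t] holomorphic_on_imp_continuous_on by blast
        have cint: "(\<lambda>s. h s t) contour_integrable_on linepath x y" if "closed_segment x y \<subseteq> U" for x y
          by (intro contour_integrable_continuous_linepath continuous_on_subset[OF cont that])
        have "contour_integral (linepath a b +++ linepath b c +++ linepath c a) (\<lambda>s. h s t) = 0"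
          by (rule contour_integral_unique[OF Cauchy_theorem_triangle[OF ht]])
        then show ?thesis using segs cint by (simp add: k_def add.assoc)
      qed
      have "contour_integral (linepath a b) I + contour_integral (linepath b c) I + contour_integral (linepath c a) I
          = integral {0..1} (k a b) + integral {0..1} (k b c) + integral {0..1} (k c a)"
        using line segs by (simp add: k_def)
      also have "\<dots> = integral {0..1} (\<lambda>t. k a b t + k b c t + k c a t)"
        using segs kc by (simp add: integral_add integrable_continuous_interval continuous_on_add)
      also have "\<dots> = integral {0..1} (\<lambda>t::real. 0)" by (rule integral_cong) (rule zero)
      finally show "contour_integral (linepath a b) I + contour_integral (linepath b c) I + contour_integral (linepath c a) I = 0" by simp
    qed
  qed
  then show ?thesis unfolding I_def by (rule analytic_imp_holomorphic)
qed

text \<open>By Cauchy's formula the coefficient is a mean over a fixed circle.\<close>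

lemma taylor_coeff_holomorphic_param:
  fixes f :: "complex \<Rightarrow> complex \<Rightarrow> complex"
  assumes U: "open U" and R: "0 < R"
    and c: "continuous_on (U \<times> ball 0 R) (\<lambda>(s, w). f s w)"
    and fw: "\<And>s. s \<in> U \<Longrightarrow> f s holomorphic_on ball 0 R"
    and fs: "\<And>w. w \<in> ball 0 R \<Longrightarrow> (\<lambda>s. f s w) holomorphic_on U"
  shows "(\<lambda>s. taylor_coeff j (f s)) holomorphic_on U"
proof -
  define e where "e = (\<lambda>t::real. exp (2 * of_real pi * \<i> * of_real t))"
  define u where "u = complex_of_real (R / 2)"
  have ne: "norm (e t) = 1" for t
  proof -
    have "e t = exp (\<i> * of_real (2 * pi * t))" by (simp add: e_def mult_ac)
    then show ?thesis by (simp only: norm_exp_i_times)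
  qed
  have u: "norm u < R" "u \<noteq> 0" using R by (auto simp: u_def)
  have eu: "e t * u \<in> ball 0 R" for t using u by (simp add: norm_mult ne)
  have ec: "continuous_on A e" for A unfolding e_def by (intro continuous_intros)
  define h where "h = (\<lambda>s t. f s (e t * u) * cnj (e t) ^ j)"
  have hc: "continuous_on (U \<times> {0..1}) (\<lambda>(s, t). h s t)"
  proof -
    have "continuous_on (U \<times> {0..1}) (\<lambda>p. e (snd p))"
      by (rule continuous_on_compose2[OF ec[of UNIV]]) (auto intro!: continuous_intros)
    moreover from this have "continuous_on (U \<times> {0..1}) (\<lambda>p. f (fst p) (e (snd p) * u))"
    proof -
      assume "continuous_on (U \<times> {0..1}) (\<lambda>p. e (snd p))"
      then have q: "continuous_on (U \<times> {0..1}) (\<lambda>p. (fst p, e (snd p) * u))"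
        by (intro continuous_intros)
      have "(\<lambda>p. (fst p, e (snd p) * u)) ` (U \<times> {0..1}) \<subseteq> U \<times> ball 0 R"
        using eu by auto
      from continuous_on_compose2[OF c q this] show ?thesis by (simp add: case_prod_unfold)
    qed
    ultimately show ?thesis unfolding h_def case_prod_unfold by (intro continuous_intros)
  qed
  have "(\<lambda>s. integral {0..1} (h s)) holomorphic_on U"
    by (rule holomorphic_integral_param[OF U hc]) (use fs[OF eu] in \<open>auto simp: h_def intro!: holomorphic_intros\<close>)
  then have "(\<lambda>s. integral {0..1} (h s) / u ^ j) holomorphic_on U"
    using u by (intro holomorphic_intros) auto
  moreover have "integral {0..1} (h s) / u ^ j = taylor_coeff j (f s)" if "s \<in> U" for s
  proof -
    have "integral {0..1} (h s) = taylor_coeff j (f s) * u ^ j"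
      unfolding h_def e_def
      by (rule integral_unique, rule circle_mean_eq_taylor_coeff[OF fw[OF that] u(1)])
    then show ?thesis using u by simp
  qed
  ultimately show ?thesis by (simp cong: holomorphic_cong)
qed

lemma taylor_coeff_sums:
  assumes g: "g holomorphic_on ball 0 R" and b: "norm b < R"
  shows "(\<lambda>j. taylor_coeff j g * b ^ j) sums g b"
  using holomorphic_power_series[OF g, of b] b by (simp add: taylor_coeff_def)

context lens_angle
begin

definition model :: "(complex \<times> complex) set" where
  "model = {(s, b). lo < Im s \<and> Im s < hi \<and> (norm b)\<^sup>2 < \<psi> (Im s)}"

lemma open_model: "open model"
proof -
  have "model = {p. lo < Im (fst p)} \<inter> {p. Im (fst p) < hi} \<inter> {p. (norm (snd p))\<^sup>2 < \<psi> (Im (fst p))}"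
    by (auto simp: model_def)
  also have "open \<dots>"
    by (intro open_Int open_Collect_less continuous_intros)
  finally show ?thesis .
qed

lemma model_fibre:
  assumes "lo < Im s" "Im s < hi"
  shows "(s, b) \<in> model \<longleftrightarrow> b \<in> ball 0 (sqrt (\<psi> (Im s)))"
proof -
  have "(norm b)\<^sup>2 < \<psi> (Im s) \<longleftrightarrow> norm b < sqrt (\<psi> (Im s))"
    using real_sqrt_less_iff[of "(norm b)\<^sup>2" "\<psi> (Im s)"] by simp
  then show ?thesis using assms by (simp add: model_def)
qed

text \<open>Integrating \<open>\<bar>b\<bar>\<close> to the power \<open>2 j\<close> over the fibres of the model produces the weight \<open>\<psi> ^ (j + 1)\<close>.\<close>

lemma disc_moment_fibre:
  assumes "lo < Im s" "Im s < hi"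
  shows "disc_moment j (sqrt (\<psi> (Im s))) = wt (Suc j) (Im s) * disc_moment j 1"
proof -
  have p: "0 < \<psi> (Im s)" using psi_pos assms by auto
  have "sqrt (\<psi> (Im s)) ^ (2 * j + 2) = (sqrt (\<psi> (Im s)) ^ 2) ^ Suc j"
    by (simp only: power_mult[symmetric]) simp
  also have "\<dots> = \<psi> (Im s) ^ Suc j" using p by simp
  finally show ?thesis using disc_moment_scale[of "sqrt (\<psi> (Im s))" j] p assms by (simp add: wt_def)
qed

lemma model_measurable:
  fixes f :: "complex \<times> complex \<Rightarrow> 'b::{second_countable_topology, real_normed_vector}"
  assumes "continuous_on model f"
  shows "(\<lambda>p. indicator model p *\<^sub>R f p) \<in> borel_measurable (lborel \<Otimes>\<^sub>M lborel)"
  using borel_measurable_continuous_on_indicator[OF _ assms] open_model by (simp add: lborel_prod)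

lemma continuous_on_kern_model:
  assumes s0: "lo < Im s0" "Im s0 < hi"
  shows "continuous_on model (\<lambda>p. kern (Suc j) (s0 - cnj (fst p)))"
  by (rule continuous_on_compose2[OF continuous_on_kern_strip[OF s0]])
     (auto intro!: continuous_intros simp: model_def strip_def)

lemma model_kern_L2:
  assumes s0: "lo < Im s0" "Im s0 < hi"
  shows "integrable (lborel \<Otimes>\<^sub>M lborel)
    (\<lambda>p. indicator model p * (norm (cnj (snd p) ^ j * kern (Suc j) (s0 - cnj (fst p))))\<^sup>2)"
proof -
  define f where "f = (\<lambda>p. (norm (cnj (snd p) ^ j * kern (Suc j) (s0 - cnj (fst p))))\<^sup>2)"
  have "continuous_on model f" unfolding f_def by (intro continuous_intros continuous_on_kern_model s0)
  then have m: "(\<lambda>p. indicator model p * f p) \<in> borel_measurable (lborel \<Otimes>\<^sub>M lborel)"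
    using model_measurable[of f] by simp
  have fib: "integrable lborel (\<lambda>b. indicator model (s, b) * f (s, b)) \<and>
      (\<integral>b. norm (indicator model (s, b) * f (s, b)) \<partial>lborel)
      = disc_moment j 1 * (wt (Suc j) (Im s) * (norm (kern (Suc j) (s0 - cnj s)))\<^sup>2)" for s
  proof (cases "lo < Im s \<and> Im s < hi")
    case True
    then have s: "lo < Im s" "Im s < hi" by auto
    have e: "indicator model (s, b) * f (s, b)
      = (indicator (ball 0 (sqrt (\<psi> (Im s)))) b * norm b ^ (2 * j)) * (norm (kern (Suc j) (s0 - cnj s)))\<^sup>2" for b
      using model_fibre[OF s, of b]
      by (auto simp: f_def indicator_def norm_mult norm_power power_mult_distrib mult.commute[of j] simp flip: power_mult)
    have nn: "norm (indicator model (s, b) * f (s, b)) = indicator model (s, b) * f (s, b)" for b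
      by (simp add: f_def)
    have A: "integrable lborel (\<lambda>b::complex. indicator (ball 0 (sqrt (\<psi> (Im s)))) b * norm b ^ (2 * j) * (norm (kern (Suc j) (s0 - cnj s)))\<^sup>2)"
      by (intro integrable_mult_left disc_moment_integrable)
    have B: "(\<integral>b. indicator (ball 0 (sqrt (\<psi> (Im s)))) b * norm b ^ (2 * j) * (norm (kern (Suc j) (s0 - cnj s)))\<^sup>2 \<partial>(lborel :: complex measure))
          = disc_moment j 1 * (wt (Suc j) (Im s) * (norm (kern (Suc j) (s0 - cnj s)))\<^sup>2)"
      unfolding integral_mult_left_zero disc_moment_def[symmetric] disc_moment_fibre[OF s]
      by (simp add: mult_ac)
    have C: "norm (indicator model (s, b) * f (s, b))
      = indicator (ball 0 (sqrt (\<psi> (Im s)))) b * norm b ^ (2 * j) * (norm (kern (Suc j) (s0 - cnj s)))\<^sup>2" for b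
      unfolding nn by (rule e)
    show ?thesis
    proof
      show "integrable lborel (\<lambda>b. indicator model (s, b) * f (s, b))" unfolding e by (rule A)
      show "(\<integral>b. norm (indicator model (s, b) * f (s, b)) \<partial>lborel)
        = disc_moment j 1 * (wt (Suc j) (Im s) * (norm (kern (Suc j) (s0 - cnj s)))\<^sup>2)"
        unfolding C by (rule B)
    qed
  next
    case False
    then have "indicator model (s, b) = (0::real)" for b by (auto simp: model_def)
    then show ?thesis using False by (auto simp: wt_def)
  qed
  have "integrable (lborel \<Otimes>\<^sub>M lborel) (\<lambda>p. indicator model p * f p)"
  proof (rule lborel_pair.Fubini_integrable)
    show "(\<lambda>p. indicator model p * f p) \<in> borel_measurable (lborel \<Otimes>\<^sub>M lborel)" by (rule m)
    show "integrable lborel (\<lambda>s. \<integral>b. norm (indicator model (s, b) * f (s, b)) \<partial>lborel)"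
      unfolding conjunct2[OF fib] by (intro integrable_mult_right kern_weighted_L2 s0)
    show "AE s in lborel. integrable lborel (\<lambda>b. indicator model (s, b) * f (s, b))" using fib by simp
  qed
  then show ?thesis by (simp only: f_def)
qed

text \<open>Integration over the fibre extracts the \<open>j\<close>-th Taylor coefficient in \<open>b\<close>, with the weight of the strip as
  a factor. That coefficient is holomorphic in \<open>s\<close>, square integrable with this weight by Bessel's
  inequality, and therefore reproduced by the kernel of the strip.\<close>

lemma model_reproducing:
  fixes f :: "complex \<Rightarrow> complex \<Rightarrow> complex"
  assumes fc: "continuous_on model (\<lambda>p. f (fst p) (snd p))"
    and fb: "\<And>s. lo < Im s \<Longrightarrow> Im s < hi \<Longrightarrow> f s holomorphic_on ball 0 (sqrt (\<psi> (Im s)))"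
    and fs: "\<And>b. (\<lambda>s. f s b) holomorphic_on {s. (s, b) \<in> model}"
    and fL2: "integrable (lborel \<Otimes>\<^sub>M lborel) (\<lambda>p. indicator model p * (norm (f (fst p) (snd p)))\<^sup>2)"
    and s0: "lo < Im s0" "Im s0 < hi"
  shows "integrable (lborel \<Otimes>\<^sub>M lborel)
      (\<lambda>p. indicator model p *\<^sub>R (cnj (snd p) ^ j * kern (Suc j) (s0 - cnj (fst p)) * f (fst p) (snd p)))"
    and "(\<integral>p. indicator model p *\<^sub>R (cnj (snd p) ^ j * kern (Suc j) (s0 - cnj (fst p)) * f (fst p) (snd p))
      \<partial>(lborel \<Otimes>\<^sub>M lborel)) = disc_moment j 1 * taylor_coeff j (f s0)"
proof -
  define k where "k = (\<lambda>p. cnj (snd p) ^ j * kern (Suc j) (s0 - cnj (fst p)))"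
  define g where "g = (\<lambda>p. f (fst p) (snd p))"
  have kc: "continuous_on model k" unfolding k_def by (intro continuous_intros continuous_on_kern_model s0)
  have gc: "continuous_on model g" unfolding g_def by (rule fc)
  have km: "(\<lambda>p. indicator model p *\<^sub>R (k p * g p)) \<in> borel_measurable (lborel \<Otimes>\<^sub>M lborel)"
    by (intro model_measurable continuous_intros kc gc)
  have int: "integrable (lborel \<Otimes>\<^sub>M lborel) (\<lambda>p. indicator model p *\<^sub>R (k p * g p))"
  proof (rule Bochner_Integration.integrable_bound[OF _ km])
    show "integrable (lborel \<Otimes>\<^sub>M lborel) (\<lambda>p. indicator model p * (norm (k p))\<^sup>2 + indicator model p * (norm (g p))\<^sup>2)"
      using model_kern_L2[OF s0, of j] fL2 unfolding k_def g_def by (rule Bochner_Integration.integrable_add)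
    show "AE p in lborel \<Otimes>\<^sub>M lborel. norm (indicator model p *\<^sub>R (k p * g p))
        \<le> norm (indicator model p * (norm (k p))\<^sup>2 + indicator model p * (norm (g p))\<^sup>2)"
    proof (rule AE_I2)
      fix p
      have "2 * (norm (k p) * norm (g p)) \<le> (norm (k p))\<^sup>2 + (norm (g p))\<^sup>2"
        using sum_squares_bound[of "norm (k p)" "norm (g p)"] by simp
      moreover have "0 \<le> norm (k p) * norm (g p)" by simp
      ultimately have "norm (k p) * norm (g p) \<le> (norm (k p))\<^sup>2 + (norm (g p))\<^sup>2" by linarith
      then show "norm (indicator model p *\<^sub>R (k p * g p))
        \<le> norm (indicator model p * (norm (k p))\<^sup>2 + indicator model p * (norm (g p))\<^sup>2)"
        by (auto simp: indicator_def norm_mult)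
    qed
  qed
  then show "integrable (lborel \<Otimes>\<^sub>M lborel)
      (\<lambda>p. indicator model p *\<^sub>R (cnj (snd p) ^ j * kern (Suc j) (s0 - cnj (fst p)) * f (fst p) (snd p)))"
    by (simp add: k_def g_def)
  define G where "G = (\<lambda>s. taylor_coeff j (f s))"
  have Gh: "G holomorphic_on strip"
  proof -
    have "G field_differentiable (at s1)" if s1: "s1 \<in> strip" for s1
    proof -
      \<comment> \<open>A disc contained in all fibres near \<open>s1\<close>, so that the coefficient depends holomorphically on \<open>s\<close> there.\<close>
      define R where "R = sqrt (\<psi> (Im s1) / 2)"
      have p1: "0 < \<psi> (Im s1)" using s1 psi_pos by (auto simp: strip_def)
      then have R: "0 < R" "R\<^sup>2 < \<psi> (Im s1)" by (auto simp: R_def)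
      define U where "U = strip \<inter> {s. R\<^sup>2 < \<psi> (Im s)}"
      have oU: "open U" unfolding U_def
        by (intro open_Int open_strip open_Collect_less continuous_intros)
      have s1U: "s1 \<in> U" using s1 R by (simp add: U_def)
      have inm: "(s, w) \<in> model" if "s \<in> U" "w \<in> ball 0 R" for s w
      proof -
        have "(norm w)\<^sup>2 < R\<^sup>2" using that by (intro power_strict_mono) auto
        then show ?thesis using that by (auto simp: U_def model_def strip_def)
      qed
      have "G holomorphic_on U" unfolding G_def
      proof (rule taylor_coeff_holomorphic_param[OF oU R(1)])
        show "continuous_on (U \<times> ball 0 R) (\<lambda>(s, w). f s w)"
        proof -
          have "U \<times> ball 0 R \<subseteq> model" using inm by auto
          from continuous_on_subset[OF fc this] show ?thesis by (simp add: case_prod_unfold)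
        qed
        show "f s holomorphic_on ball 0 R" if "s \<in> U" for s
        proof (rule holomorphic_on_subset[OF fb])
          show st: "lo < Im s" "Im s < hi" using that by (auto simp: U_def strip_def)
          show "ball (0::complex) R \<subseteq> ball 0 (sqrt (\<psi> (Im s)))"
          proof
            fix w :: complex assume "w \<in> ball 0 R"
            then have "(s, w) \<in> model" by (rule inm[OF that])
            then show "w \<in> ball 0 (sqrt (\<psi> (Im s)))" by (simp only: model_fibre[OF st])
          qed
        qed
        show "(\<lambda>s. f s w) holomorphic_on U" if "w \<in> ball 0 R" for w
          by (rule holomorphic_on_subset[OF fs]) (use inm that in auto)
      qed
      then show ?thesis using oU s1U holomorphic_on_imp_differentiable_at by blast
    qed
    then show ?thesis using open_strip by (simp add: holomorphic_on_def field_differentiable_at_within)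
  qed
  have Gc: "continuous_on strip G" using Gh holomorphic_on_imp_continuous_on by blast
  have c1: "0 < disc_moment j 1" by (rule disc_moment_pos) simp
  have fib_int: "integrable lborel (\<lambda>b. indicator (ball 0 (sqrt (\<psi> (Im s)))) b * (norm (f s b))\<^sup>2)"
    if s: "lo < Im s" "Im s < hi" and i: "integrable lborel (\<lambda>b. indicator model (s, b) * (norm (f s b))\<^sup>2)" for s
  proof -
    have "indicator model (s, b) = (indicator (ball 0 (sqrt (\<psi> (Im s)))) b :: real)" for b
      using model_fibre[OF s, of b] by (simp add: indicator_def)
    then show ?thesis using i by simp
  qed
  \<comment> \<open>Fubini gives square integrability on almost every fibre only.\<close>
  have AEi: "AE s in lborel. integrable lborel (\<lambda>b. indicator model (s, b) * (norm (f s b))\<^sup>2)"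
    using lborel_pair.AE_integrable_fst'[OF fL2] by simp
  have GL2: "integrable lborel (\<lambda>s. wt (Suc j) (Im s) * (norm (G s))\<^sup>2)"
  proof (rule Bochner_Integration.integrable_bound)
    show "integrable lborel (\<lambda>s. (\<integral>b. indicator model (s, b) * (norm (f s b))\<^sup>2 \<partial>lborel) / disc_moment j 1)"
      using lborel_pair.integrable_fst'[OF fL2] by simp
    show "AE s in lborel. norm (wt (Suc j) (Im s) * (norm (G s))\<^sup>2)
        \<le> norm ((\<integral>b. indicator model (s, b) * (norm (f s b))\<^sup>2 \<partial>lborel) / disc_moment j 1)"
      using AEi
    proof eventually_elim
      case (elim s)
      show ?case
      proof (cases "lo < Im s \<and> Im s < hi")
        case True
        then have s: "lo < Im s" "Im s < hi" by auto
        have ie: "indicator model (s, b) = (indicator (ball 0 (sqrt (\<psi> (Im s)))) b :: real)" for b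
          using model_fibre[OF s, of b] by (simp add: indicator_def)
        have "disc_moment j (sqrt (\<psi> (Im s))) * (norm (G s))\<^sup>2 \<le> (\<integral>b. indicator model (s, b) * (norm (f s b))\<^sup>2 \<partial>lborel)"
          unfolding G_def ie
          by (rule taylor_coeff_L2_bound(2)[OF fb[OF s] _ fib_int[OF s elim]]) (use psi_pos[OF s] in simp)
        then have "wt (Suc j) (Im s) * (norm (G s))\<^sup>2 \<le> (\<integral>b. indicator model (s, b) * (norm (f s b))\<^sup>2 \<partial>lborel) / disc_moment j 1"
          unfolding disc_moment_fibre[OF s] using c1 by (simp add: pos_le_divide_eq mult_ac)
        then show ?thesis using wt_nonneg[of "Suc j" "Im s"] c1 by simp
      next
        case False
        then show ?thesis by (auto simp: wt_def)
      qed
    qed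
    have "(\<lambda>s. wt (Suc j) (Im s) *\<^sub>R complex_of_real ((norm (G s))\<^sup>2)) \<in> borel_measurable borel"
      by (intro strip_measurable continuous_intros Gc)
    then have "(\<lambda>s. Re (wt (Suc j) (Im s) *\<^sub>R complex_of_real ((norm (G s))\<^sup>2))) \<in> borel_measurable borel" by measurable
    then show "(\<lambda>s. wt (Suc j) (Im s) * (norm (G s))\<^sup>2) \<in> borel_measurable lborel" by simp
  qed
  have slice: "(\<integral>b. indicator model (s, b) *\<^sub>R (k (s, b) * g (s, b)) \<partial>lborel)
      = disc_moment j 1 * (wt (Suc j) (Im s) *\<^sub>R (kern (Suc j) (s0 - cnj s) * G s))"
    if i: "integrable lborel (\<lambda>b. indicator model (s, b) * (norm (f s b))\<^sup>2)" for s
  proof (cases "lo < Im s \<and> Im s < hi")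
    case True
    then have s: "lo < Im s" "Im s < hi" by auto
    have R: "0 < sqrt (\<psi> (Im s))" using psi_pos[OF s] by simp
    have e: "indicator model (s, b) *\<^sub>R (k (s, b) * g (s, b))
        = kern (Suc j) (s0 - cnj s) * (indicator (ball 0 (sqrt (\<psi> (Im s)))) b *\<^sub>R (f s b * cnj b ^ j))" for b
      using model_fibre[OF s, of b] by (auto simp: indicator_def k_def g_def)
    have "(\<integral>b. indicator (ball 0 (sqrt (\<psi> (Im s)))) b *\<^sub>R (f s b * cnj b ^ j) \<partial>lborel) = disc_moment j (sqrt (\<psi> (Im s))) * G s"
      unfolding G_def
      by (intro integral_disc_cnj_power fb[OF s] R taylor_coeff_L2_bound(1)[OF fb[OF s] R fib_int[OF s i]])
    then have "(\<integral>b. indicator model (s, b) *\<^sub>R (k (s, b) * g (s, b)) \<partial>lborel)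
       = kern (Suc j) (s0 - cnj s) * (disc_moment j (sqrt (\<psi> (Im s))) * G s)"
      unfolding e integral_mult_right_zero by simp
    then show ?thesis unfolding disc_moment_fibre[OF s] by (simp add: scaleR_conv_of_real mult_ac)
  next
    case False
    then have "indicator model (s, b) = (0::real)" for b by (auto simp: model_def)
    moreover have "wt (Suc j) (Im s) = 0" using False by (auto simp: wt_def)
    ultimately show ?thesis by simp
  qed
  have "(\<integral>p. indicator model p *\<^sub>R (k p * g p) \<partial>(lborel \<Otimes>\<^sub>M lborel))
      = (\<integral>s. \<integral>b. indicator model (s, b) *\<^sub>R (k (s, b) * g (s, b)) \<partial>lborel \<partial>lborel)"
    by (rule lborel_pair.integral_fst'[OF int, symmetric])
  also have "\<dots> = (\<integral>s. disc_moment j 1 * (wt (Suc j) (Im s) *\<^sub>R (kern (Suc j) (s0 - cnj s) * G s)) \<partial>lborel)"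
  proof (rule integral_cong_AE)
    show "(\<lambda>s. \<integral>b. indicator model (s, b) *\<^sub>R (k (s, b) * g (s, b)) \<partial>lborel) \<in> borel_measurable lborel"
      using lborel_pair.integrable_fst'[OF int] by auto
    show "(\<lambda>s. disc_moment j 1 * (wt (Suc j) (Im s) *\<^sub>R (kern (Suc j) (s0 - cnj s) * G s))) \<in> borel_measurable lborel"
      by (rule borel_measurable_integrable[OF integrable_mult_right[OF strip_reproducing(1)[OF Gh GL2 s0]]])
    show "AE s in lborel. (\<integral>b. indicator model (s, b) *\<^sub>R (k (s, b) * g (s, b)) \<partial>lborel)
        = disc_moment j 1 * (wt (Suc j) (Im s) *\<^sub>R (kern (Suc j) (s0 - cnj s) * G s))"
      using AEi by eventually_elim (rule slice)
  qed
  also have "\<dots> = disc_moment j 1 * G s0"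
    using strip_reproducing(2)[OF Gh GL2 s0] by (simp only: integral_mult_right_zero)
  finally show "(\<integral>p. indicator model p *\<^sub>R (cnj (snd p) ^ j * kern (Suc j) (s0 - cnj (fst p)) * f (fst p) (snd p))
      \<partial>(lborel \<Otimes>\<^sub>M lborel)) = disc_moment j 1 * taylor_coeff j (f s0)"
    by (simp add: k_def g_def G_def)
qed

end

section \<open>Coordinates on the lens domain\<close>

text \<open>The notation for coefficients of power series would compete with that for components of vectors.\<close>

no_notation fps_nth (infixl "$" 75)

lemma norm_vec2: "(norm (z :: complex ^ 2))\<^sup>2 = (norm (z $ 1))\<^sup>2 + (norm (z $ 2))\<^sup>2"
  by (simp add: norm_vec_def L2_set_def UNIV_2)

lemma norm_unit_frame:
  fixes q1 q2 \<alpha> \<beta> :: complex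
  assumes "q1 * cnj q1 + q2 * cnj q2 = 1"
  shows "(norm (q1 * \<alpha> + \<beta> * cnj q2))\<^sup>2 + (norm (q2 * \<alpha> - \<beta> * cnj q1))\<^sup>2 = (norm \<alpha>)\<^sup>2 + (norm \<beta>)\<^sup>2"
proof -
  have "(q1 * \<alpha> + \<beta> * cnj q2) * cnj (q1 * \<alpha> + \<beta> * cnj q2) + (q2 * \<alpha> - \<beta> * cnj q1) * cnj (q2 * \<alpha> - \<beta> * cnj q1)
    = (q1 * cnj q1 + q2 * cnj q2) * (\<alpha> * cnj \<alpha> + \<beta> * cnj \<beta>)"
    by (simp add: algebra_simps)
  then have "complex_of_real ((norm (q1 * \<alpha> + \<beta> * cnj q2))\<^sup>2 + (norm (q2 * \<alpha> - \<beta> * cnj q1))\<^sup>2)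
    = complex_of_real ((norm \<alpha>)\<^sup>2 + (norm \<beta>)\<^sup>2)"
    unfolding of_real_add complex_norm_square assms by simp
  then show ?thesis using of_real_eq_iff by blast
qed

text \<open>The second assumption encodes that \<open>q\<close> is the tangent point that is not fixed by the angle \<open>\<theta>\<close>: there
  \<open>q - a\<close> equals \<open>r\<close> times the conjugate of \<open>exp (i \<theta>)\<close> times \<open>q\<close>.\<close>

locale lens_domain = lens_angle +
  fixes a q :: "complex ^ 2"
  assumes norm_q: "norm q = 1"
    and a_eq: "a = cnj (1 - of_real r * exp (\<i> * of_real \<theta>)) *s q"
begin

text \<open>The squared norm of \<open>a\<close> is that of \<open>dd\<close>. The other tangent point has the coordinates \<open>x = cc\<close> and
  \<open>w = 0\<close>, and \<open>kap\<close> normalises the Moebius map so that the circles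
  in which the two spheres meet the line \<open>w = 0\<close> become the lines \<open>Re t = 0\<close> and \<open>Re (exp (i \<theta>) t) = 0\<close>.\<close>

definition dd :: complex where "dd = 1 - of_real r * exp (\<i> * of_real \<theta>)"
definition cc :: complex where "cc = 2 * \<i> * of_real (r * sin \<theta>)"
definition kap :: complex where "kap = - 2 * cnj dd / cc"
definition \<Omega> :: "(complex ^ 2) set" where "\<Omega> = ball 0 1 \<inter> ball a r"

lemma sin_nz: "sin \<theta> \<noteq> 0"
  using \<theta>_gt \<theta>_lt \<theta>_nz by (metis abs_less_iff minus_less_iff sin_eq_0_pi)

lemma Im_dd: "Im dd = - (r * sin \<theta>)"
  by (simp add: dd_def Im_exp)

lemma dd_nz: "dd \<noteq> 0" using sin_nz r_pos Im_dd by auto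
lemma cc_nz: "cc \<noteq> 0" using sin_nz r_pos by (simp add: cc_def)
lemma kap_nz: "kap \<noteq> 0" using dd_nz cc_nz by (simp add: kap_def)
lemma cnj_cc: "cnj cc = - cc" by (simp add: cc_def)
lemma kap_cc: "kap * cc = - 2 * cnj dd" using cc_nz by (simp add: kap_def)
lemma norm_1_dd: "norm (1 - dd) = r" using r_pos by (simp add: dd_def norm_mult)

lemma Re_kap: "Re kap = - 1"
  using sin_nz r_pos by (simp add: kap_def Re_divide cc_def Im_dd power2_eq_square)

lemma Re_kap_1_dd: "Re (kap * (1 - dd)) = - 1"
proof -
  have "kap * (1 - dd) = kap + 2 * (dd * cnj dd) / cc" using cc_nz by (simp add: kap_def field_simps)
  moreover have "Re (2 * (dd * cnj dd) / cc) = 0"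
    by (simp add: complex_mult_cnj cc_def Re_divide)
  ultimately show ?thesis by (simp add: Re_kap)
qed

lemma q_unit: "q $ 1 * cnj (q $ 1) + q $ 2 * cnj (q $ 2) = 1"
proof -
  have "complex_of_real ((norm (q $ 1))\<^sup>2 + (norm (q $ 2))\<^sup>2) = 1"
    using norm_vec2[of q] norm_q by simp
  then show ?thesis by (simp only: of_real_add complex_norm_square)
qed

lemma a_comp: "a $ 1 = cnj dd * q $ 1" "a $ 2 = cnj dd * q $ 2"
  by (simp_all add: a_eq dd_def algebra_simps)

text \<open>The inverse of the linear coordinates \<open>xcoord\<close> and \<open>wcoord\<close>, written in the unitary frame of \<open>q\<close> and the vector orthogonal to it.\<close>

definition pt :: "complex \<Rightarrow> complex \<Rightarrow> complex ^ 2" where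
  "pt x w = vector [q $ 1 * (1 + x / dd) + w / cnj dd * cnj (q $ 2),
                    q $ 2 * (1 + x / dd) - w / cnj dd * cnj (q $ 1)]"

definition xcoord :: "complex ^ 2 \<Rightarrow> complex" where "xcoord z = herm (z - q) a"
definition wcoord :: "complex ^ 2 \<Rightarrow> complex" where "wcoord z = herm (z - q) (tconj a)"

lemma tconj_comp: "tconj a $ 1 = cnj (a $ 2)" "tconj a $ 2 = - cnj (a $ 1)"
  by (simp_all add: tconj_def)

lemma xcoord_pt [simp]: "xcoord (pt x w) = x"
proof -
  have "xcoord (pt x w) = x * (q $ 1 * cnj (q $ 1) + q $ 2 * cnj (q $ 2))"
    using dd_nz by (simp add: xcoord_def herm_def pt_def a_comp field_simps)
  then show ?thesis by (simp add: q_unit)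
qed

lemma wcoord_pt [simp]: "wcoord (pt x w) = w"
proof -
  have "wcoord (pt x w) = w * (q $ 1 * cnj (q $ 1) + q $ 2 * cnj (q $ 2))"
    using dd_nz by (simp add: wcoord_def herm_def pt_def tconj_comp a_comp field_simps)
  then show ?thesis by (simp add: q_unit)
qed

lemma pt_coords: "pt (xcoord z) (wcoord z) = z"
proof -
  define u v where "u = z $ 1 - q $ 1" and "v = z $ 2 - q $ 2"
  have x: "xcoord z / dd = u * cnj (q $ 1) + v * cnj (q $ 2)"
    using dd_nz by (simp add: xcoord_def herm_def a_comp u_def v_def field_simps)
  have w: "wcoord z / cnj dd = u * q $ 2 - v * q $ 1"
    using dd_nz by (simp add: wcoord_def herm_def tconj_comp a_comp u_def v_def field_simps)
  have "q $ 1 * (1 + (u * cnj (q $ 1) + v * cnj (q $ 2))) + (u * q $ 2 - v * q $ 1) * cnj (q $ 2)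
      = q $ 1 + u * (q $ 1 * cnj (q $ 1) + q $ 2 * cnj (q $ 2))" by (simp add: algebra_simps)
  moreover have "q $ 2 * (1 + (u * cnj (q $ 1) + v * cnj (q $ 2))) - (u * q $ 2 - v * q $ 1) * cnj (q $ 1)
      = q $ 2 + v * (q $ 1 * cnj (q $ 1) + q $ 2 * cnj (q $ 2))" by (simp add: algebra_simps)
  ultimately show ?thesis
    by (simp add: pt_def x w vec_eq_iff forall_2 q_unit) (simp add: u_def v_def)
qed

lemma norm_pt_shift: "(norm (pt x w - m *s q))\<^sup>2 = (norm (1 + x / dd - m))\<^sup>2 + (norm (w / cnj dd))\<^sup>2"
proof -
  have 1: "(pt x w - m *s q) $ 1 = q $ 1 * (1 + x / dd - m) + w / cnj dd * cnj (q $ 2)"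
    and 2: "(pt x w - m *s q) $ 2 = q $ 2 * (1 + x / dd - m) - w / cnj dd * cnj (q $ 1)"
    by (simp_all add: pt_def algebra_simps)
  show ?thesis by (simp only: norm_vec2 1 2 norm_unit_frame[OF q_unit])
qed

text \<open>A ball with centre on the complex line through \<open>q\<close> whose sphere passes through \<open>q\<close>: at \<open>x = w = 0\<close> both sides vanish, so no constant term appears.\<close>

lemma ball_shift_iff:
  assumes \<rho>: "0 < \<rho>" "\<rho> = norm (1 - m)"
  shows "norm (pt x w - m *s q) < \<rho> \<longleftrightarrow> (norm w)\<^sup>2 < - (norm x)\<^sup>2 - 2 * Re (x * cnj (dd * (1 - m)))"
proof -
  have nd: "0 < (norm dd)\<^sup>2" using dd_nz by simp
  have "norm (pt x w - m *s q) < \<rho> \<longleftrightarrow> (norm (pt x w - m *s q))\<^sup>2 < \<rho>\<^sup>2"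
    using \<rho>(1) by (metis norm_ge_zero less_imp_le power2_less_imp_less power_strict_mono pos2)
  also have "\<dots> \<longleftrightarrow> (norm dd)\<^sup>2 * ((norm (1 + x / dd - m))\<^sup>2 + (norm (w / cnj dd))\<^sup>2) < (norm dd)\<^sup>2 * \<rho>\<^sup>2"
    unfolding norm_pt_shift using nd by (simp only: mult_less_cancel_left_pos)
  also have "(norm dd)\<^sup>2 * ((norm (1 + x / dd - m))\<^sup>2 + (norm (w / cnj dd))\<^sup>2) = (norm (dd * (1 - m) + x))\<^sup>2 + (norm w)\<^sup>2"
  proof -
    have "dd * (1 + x / dd - m) = dd * (1 - m) + x" using dd_nz by (simp add: field_simps)
    then have "norm dd * norm (1 + x / dd - m) = norm (dd * (1 - m) + x)" by (metis norm_mult)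
    moreover have "norm dd * norm (w / cnj dd) = norm w" using dd_nz by (simp add: norm_divide)
    ultimately show ?thesis by (metis distrib_left power_mult_distrib)
  qed
  also have "(norm (dd * (1 - m) + x))\<^sup>2 = (norm dd)\<^sup>2 * \<rho>\<^sup>2 + 2 * Re (x * cnj (dd * (1 - m))) + (norm x)\<^sup>2"
  proof -
    have "(norm (A + x))\<^sup>2 = (norm A)\<^sup>2 + 2 * Re (x * cnj A) + (norm x)\<^sup>2" for A
      unfolding cmod_power2 by (simp add: power2_eq_square algebra_simps)
    then have "(norm (dd * (1 - m) + x))\<^sup>2 = (norm (dd * (1 - m)))\<^sup>2 + 2 * Re (x * cnj (dd * (1 - m))) + (norm x)\<^sup>2" .
    then show ?thesis by (simp only: \<rho>(2) norm_mult power_mult_distrib)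
  qed
  finally show ?thesis by auto
qed

text \<open>Both right hand sides have the form \<open>Re (m * (kap * x * cnj (x - cc)))\<close>, with \<open>m = 1\<close> and \<open>m = 1 - dd\<close>. The
  coefficient of \<open>\<bar>x\<bar>\<^sup>2\<close> is \<open>Re (m * kap)\<close>, which is \<open>- 1\<close> in both cases; this determines \<open>kap\<close>.\<close>

lemma pt_in_\<Omega>_iff:
  "pt x w \<in> \<Omega> \<longleftrightarrow> (norm w)\<^sup>2 < Re (kap * x * cnj (x - cc))
     \<and> (norm w)\<^sup>2 < Re (of_real r * exp (\<i> * of_real \<theta>) * (kap * x * cnj (x - cc)))"
proof -
  have e: "m * (kap * x * cnj (x - cc)) = of_real ((norm x)\<^sup>2) * (m * kap) - 2 * (x * cnj (dd * cnj m))" for m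
  proof -
    have "m * (kap * x * cnj (x - cc)) = (x * cnj x) * (m * kap) + m * x * (kap * cc)"
      by (simp add: cnj_cc algebra_simps)
    then show ?thesis unfolding kap_cc complex_norm_square by (simp add: algebra_simps)
  qed
  have b1: "pt x w \<in> ball 0 1 \<longleftrightarrow> (norm w)\<^sup>2 < Re (kap * x * cnj (x - cc))"
  proof -
    have "pt x w \<in> ball 0 1 \<longleftrightarrow> norm (pt x w - 0 *s q) < 1" by simp
    also have "\<dots> \<longleftrightarrow> (norm w)\<^sup>2 < - (norm x)\<^sup>2 - 2 * Re (x * cnj (dd * (1 - 0)))" by (rule ball_shift_iff) auto
    also have "- (norm x)\<^sup>2 - 2 * Re (x * cnj (dd * (1 - 0))) = Re (1 * (kap * x * cnj (x - cc)))"
      unfolding e by (simp add: Re_kap)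
    finally show ?thesis by simp
  qed
  have b2: "pt x w \<in> ball a r \<longleftrightarrow> (norm w)\<^sup>2 < Re ((1 - dd) * (kap * x * cnj (x - cc)))"
  proof -
    have aq: "a = cnj dd *s q" by (simp add: a_eq dd_def)
    have "pt x w \<in> ball a r \<longleftrightarrow> norm (pt x w - cnj dd *s q) < r"
      by (simp add: aq dist_norm norm_minus_commute)
    also have "\<dots> \<longleftrightarrow> (norm w)\<^sup>2 < - (norm x)\<^sup>2 - 2 * Re (x * cnj (dd * (1 - cnj dd)))"
    proof (rule ball_shift_iff[OF r_pos])
      have "norm (1 - cnj dd) = norm (cnj (1 - dd))" by simp
      then show "r = norm (1 - cnj dd)" by (simp only: complex_mod_cnj norm_1_dd)
    qed
    also have "- (norm x)\<^sup>2 - 2 * Re (x * cnj (dd * (1 - cnj dd))) = Re ((1 - dd) * (kap * x * cnj (x - cc)))"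
    proof -
      have "Re ((1 - dd) * kap) = - 1" using Re_kap_1_dd by (simp only: mult.commute)
      moreover have "Re (of_real R * z) = R * Re z" "Re (2 * z) = 2 * Re z" for R z by simp_all
      moreover have "cnj (1 - dd) = 1 - cnj dd" by simp
      ultimately show ?thesis by (simp only: e minus_complex.sel)
    qed
    finally show ?thesis .
  qed
  have "1 - dd = of_real r * exp (\<i> * of_real \<theta>)" by (simp add: dd_def)
  then show ?thesis unfolding \<Omega>_def using b1 b2 by auto
qed

end

section \<open>The lens domain as image of the model\<close>

lemma continuous_on_vector2:
  assumes "continuous_on S f" "continuous_on S g"
  shows "continuous_on S (\<lambda>p. vector [f p, g p] :: complex ^ 2)"
proof -
  have "continuous_on S (\<lambda>p. pair_to_vec (f p, g p))"
    by (rule continuous_on_compose2[OF linear_continuous_on[OF bounded_linear_pair_to_vec]])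
       (use assms in \<open>auto intro: continuous_on_Pair\<close>)
  then show ?thesis by (simp add: pair_to_vec_def)
qed

lemma measurable_compose_vector2:
  fixes H :: "complex ^ 2 \<Rightarrow> ennreal" and f g :: "'c::topological_space \<Rightarrow> complex"
  assumes H: "H \<in> borel_measurable borel" and fg: "continuous_on UNIV f" "continuous_on UNIV g"
  shows "(\<lambda>p. H (vector [f p, g p])) \<in> borel_measurable borel"
  using measurable_compose[OF borel_measurable_continuous_onI[OF continuous_on_vector2[OF fg]] H] .

lemma nn_integral_complex_swap:
  fixes f :: "complex \<Rightarrow> complex \<Rightarrow> ennreal"
  assumes "(\<lambda>p. f (fst p) (snd p)) \<in> borel_measurable borel"
  shows "(\<integral>\<^sup>+x. \<integral>\<^sup>+y. f x y \<partial>lborel \<partial>lborel) = (\<integral>\<^sup>+y. \<integral>\<^sup>+x. f x y \<partial>lborel \<partial>lborel)"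
  by (rule lborel_pair.Fubini'[symmetric]) (use assms in \<open>simp add: lborel_prod case_prod_unfold\<close>)

lemma borel_measurable_nn_integral_complex:
  fixes f :: "complex \<Rightarrow> complex \<Rightarrow> ennreal"
  assumes "(\<lambda>p. f (fst p) (snd p)) \<in> borel_measurable borel"
  shows "(\<lambda>x. \<integral>\<^sup>+y. f x y \<partial>lborel) \<in> borel_measurable borel"
proof -
  have "(\<lambda>x. \<integral>\<^sup>+y. f x y \<partial>lborel) \<in> borel_measurable lborel"
    by (rule lborel.borel_measurable_nn_integral) (use assms in \<open>simp add: lborel_prod case_prod_unfold\<close>)
  then show ?thesis by simp
qed

context lens_domain
begin

lemma continuous_on_pt:
  assumes "continuous_on S f" "continuous_on S g" shows "continuous_on S (\<lambda>p. pt (f p) (g p))"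
  unfolding pt_def using dd_nz by (intro continuous_on_vector2 continuous_intros assms) auto

text \<open>The coordinates are linear with determinant of modulus \<open>(norm dd)\<^sup>2\<close>. Integrating one variable at a time
  needs a nonzero entry of the matrix to divide by, whence the distinction of cases.\<close>

lemma nn_integral_pt:
  fixes H :: "complex ^ 2 \<Rightarrow> ennreal"
  assumes H: "H \<in> borel_measurable borel"
  shows "(\<integral>\<^sup>+z. H z \<partial>lborel) = ennreal (1 / (norm dd) ^ 4) * (\<integral>\<^sup>+x. \<integral>\<^sup>+w. H (pt x w) \<partial>lborel \<partial>lborel)"
proof -
  have mpt: "(\<lambda>p. H (pt (snd p) (fst p))) \<in> borel_measurable borel" "(\<lambda>p. H (pt (fst p) (snd p))) \<in> borel_measurable borel"
  proof -
    have "continuous_on UNIV (\<lambda>p. pt (snd p) (fst p))" "continuous_on UNIV (\<lambda>p. pt (fst p) (snd p))"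
      by (intro continuous_on_pt continuous_intros)+
    then show "(\<lambda>p. H (pt (snd p) (fst p))) \<in> borel_measurable borel" "(\<lambda>p. H (pt (fst p) (snd p))) \<in> borel_measurable borel"
      by (auto intro: measurable_compose[OF borel_measurable_continuous_onI H])
  qed
  show ?thesis
  proof (cases "q $ 1 = 0")
    case False
    define m1 m2 where "m1 = q $ 1 / dd" and "m2 = - 1 / (q $ 1 * cnj dd)"
    define t1 where "t1 = (\<lambda>w. q $ 1 + w / cnj dd * cnj (q $ 2))"
    define c where "c = q $ 2 / q $ 1"
    have m0: "m1 \<noteq> 0" "m2 \<noteq> 0" using False dd_nz by (auto simp: m1_def m2_def)
    have pte: "vector [m1 * x + t1 w, m2 * w + c * (m1 * x + t1 w)] = pt x w" for x w
    proof -
      have "m2 * w + c * (m1 * x + t1 w) = q $ 2 * (1 + x / dd) - w / cnj dd * cnj (q $ 1)"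
      proof -
        have "q $ 1 * (m2 * w + c * (m1 * x + t1 w)) = q $ 1 * (q $ 2 * (1 + x / dd)) + w / cnj dd * (q $ 2 * cnj (q $ 2) - 1)"
          using False dd_nz by (simp add: m1_def m2_def t1_def c_def field_simps)
        also have "q $ 2 * cnj (q $ 2) - 1 = - (q $ 1 * cnj (q $ 1))" using q_unit by (simp add: algebra_simps)
        finally have "q $ 1 * (m2 * w + c * (m1 * x + t1 w)) = q $ 1 * (q $ 2 * (1 + x / dd) - w / cnj dd * cnj (q $ 1))"
          by (simp add: algebra_simps)
        then show ?thesis using False by simp
      qed
      moreover have "m1 * x + t1 w = q $ 1 * (1 + x / dd) + w / cnj dd * cnj (q $ 2)"
        by (simp add: m1_def t1_def algebra_simps)
      ultimately show ?thesis by (simp add: pt_def)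
    qed
    have meas: "(\<lambda>p. H (vector [fst p, m2 * snd p + c * fst p])) \<in> borel_measurable borel"
      by (rule measurable_compose_vector2[OF H]) (intro continuous_intros)+
    have "(\<integral>\<^sup>+z. H z \<partial>lborel) = (\<integral>\<^sup>+z1. \<integral>\<^sup>+z2. H (vector [z1, z2]) \<partial>lborel \<partial>lborel)" by (rule nn_integral_complex2[OF H])
    also have "\<dots> = (\<integral>\<^sup>+z1. ennreal ((norm m2)\<^sup>2) * (\<integral>\<^sup>+w. H (vector [z1, m2 * w + c * z1]) \<partial>lborel) \<partial>lborel)"
      by (intro nn_integral_cong nn_integral_complex_affine m0 measurable_compose_vector2[OF H] continuous_intros)
    also have "\<dots> = ennreal ((norm m2)\<^sup>2) * (\<integral>\<^sup>+z1. \<integral>\<^sup>+w. H (vector [z1, m2 * w + c * z1]) \<partial>lborel \<partial>lborel)"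
      by (rule nn_integral_cmult) (use borel_measurable_nn_integral_complex[OF meas] in simp)
    also have "(\<integral>\<^sup>+z1. \<integral>\<^sup>+w. H (vector [z1, m2 * w + c * z1]) \<partial>lborel \<partial>lborel)
        = (\<integral>\<^sup>+w. \<integral>\<^sup>+z1. H (vector [z1, m2 * w + c * z1]) \<partial>lborel \<partial>lborel)"
      by (rule nn_integral_complex_swap[OF meas])
    also have "\<dots> = (\<integral>\<^sup>+w. ennreal ((norm m1)\<^sup>2) * (\<integral>\<^sup>+x. H (pt x w) \<partial>lborel) \<partial>lborel)"
    proof (intro nn_integral_cong)
      fix w
      have "(\<integral>\<^sup>+z1. H (vector [z1, m2 * w + c * z1]) \<partial>lborel)
          = ennreal ((norm m1)\<^sup>2) * (\<integral>\<^sup>+x. H (vector [m1 * x + t1 w, m2 * w + c * (m1 * x + t1 w)]) \<partial>lborel)"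
        by (intro nn_integral_complex_affine m0 measurable_compose_vector2[OF H] continuous_intros)
      then show "(\<integral>\<^sup>+z1. H (vector [z1, m2 * w + c * z1]) \<partial>lborel) = ennreal ((norm m1)\<^sup>2) * (\<integral>\<^sup>+x. H (pt x w) \<partial>lborel)"
        by (simp only: pte)
    qed
    also have "\<dots> = ennreal ((norm m1)\<^sup>2) * (\<integral>\<^sup>+w. \<integral>\<^sup>+x. H (pt x w) \<partial>lborel \<partial>lborel)"
      by (rule nn_integral_cmult) (use borel_measurable_nn_integral_complex[of "\<lambda>w x. H (pt x w)"] mpt in simp)
    also have "(\<integral>\<^sup>+w. \<integral>\<^sup>+x. H (pt x w) \<partial>lborel \<partial>lborel) = (\<integral>\<^sup>+x. \<integral>\<^sup>+w. H (pt x w) \<partial>lborel \<partial>lborel)"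
      using nn_integral_complex_swap[of "\<lambda>w x. H (pt x w)"] mpt by simp
    finally have r: "(\<integral>\<^sup>+z. H z \<partial>lborel)
       = ennreal ((norm m2)\<^sup>2) * (ennreal ((norm m1)\<^sup>2) * (\<integral>\<^sup>+x. \<integral>\<^sup>+w. H (pt x w) \<partial>lborel \<partial>lborel))" .
    have "(norm m2)\<^sup>2 * (norm m1)\<^sup>2 = 1 / (norm dd) ^ 4"
      using False by (simp add: m1_def m2_def norm_divide norm_mult field_simps eval_nat_numeral)
    then show ?thesis unfolding r by (simp add: mult.assoc[symmetric] ennreal_mult[symmetric] del: mult.assoc)
  next
    case True
    define m where "m = cnj (q $ 2) / cnj dd"
    define m' where "m' = q $ 2 / dd"
    have q2: "q $ 2 * cnj (q $ 2) = 1" using q_unit True by simp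
    then have "complex_of_real ((norm (q $ 2))\<^sup>2) = of_real 1" by (simp only: complex_norm_square of_real_1)
    then have nq2: "norm (q $ 2) = 1" by (metis of_real_eq_iff norm_ge_zero power2_eq_1_iff zero_le_one neg_0_le_iff_le not_one_le_zero)
    have m0: "m \<noteq> 0" "m' \<noteq> 0" using nq2 dd_nz by (auto simp: m_def m'_def)
    have pte: "vector [m * w + 0, m' * x + q $ 2] = pt x w" for x w
      using True by (simp add: pt_def m_def m'_def algebra_simps)
    have meas: "(\<lambda>p. H (vector [fst p, m' * snd p + q $ 2])) \<in> borel_measurable borel"
      by (rule measurable_compose_vector2[OF H]) (intro continuous_intros)+
    have "(\<integral>\<^sup>+z. H z \<partial>lborel) = (\<integral>\<^sup>+z1. \<integral>\<^sup>+z2. H (vector [z1, z2]) \<partial>lborel \<partial>lborel)" by (rule nn_integral_complex2[OF H])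
    also have "\<dots> = (\<integral>\<^sup>+z1. ennreal ((norm m')\<^sup>2) * (\<integral>\<^sup>+x. H (vector [z1, m' * x + q $ 2]) \<partial>lborel) \<partial>lborel)"
      by (intro nn_integral_cong nn_integral_complex_affine m0 measurable_compose_vector2[OF H] continuous_intros)
    also have "\<dots> = ennreal ((norm m')\<^sup>2) * (\<integral>\<^sup>+z1. \<integral>\<^sup>+x. H (vector [z1, m' * x + q $ 2]) \<partial>lborel \<partial>lborel)"
      by (rule nn_integral_cmult) (use borel_measurable_nn_integral_complex[OF meas] in simp)
    also have "(\<integral>\<^sup>+z1. \<integral>\<^sup>+x. H (vector [z1, m' * x + q $ 2]) \<partial>lborel \<partial>lborel)
        = (\<integral>\<^sup>+x. \<integral>\<^sup>+z1. H (vector [z1, m' * x + q $ 2]) \<partial>lborel \<partial>lborel)"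
      by (rule nn_integral_complex_swap[OF meas])
    also have "\<dots> = (\<integral>\<^sup>+x. ennreal ((norm m)\<^sup>2) * (\<integral>\<^sup>+w. H (pt x w) \<partial>lborel) \<partial>lborel)"
    proof (intro nn_integral_cong)
      fix x
      have "(\<integral>\<^sup>+z1. H (vector [z1, m' * x + q $ 2]) \<partial>lborel)
          = ennreal ((norm m)\<^sup>2) * (\<integral>\<^sup>+w. H (vector [m * w + 0, m' * x + q $ 2]) \<partial>lborel)"
        by (intro nn_integral_complex_affine m0 measurable_compose_vector2[OF H] continuous_intros)
      then show "(\<integral>\<^sup>+z1. H (vector [z1, m' * x + q $ 2]) \<partial>lborel) = ennreal ((norm m)\<^sup>2) * (\<integral>\<^sup>+w. H (pt x w) \<partial>lborel)"
        by (simp only: pte)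
    qed
    also have "\<dots> = ennreal ((norm m)\<^sup>2) * (\<integral>\<^sup>+x. \<integral>\<^sup>+w. H (pt x w) \<partial>lborel \<partial>lborel)"
      by (rule nn_integral_cmult) (use borel_measurable_nn_integral_complex[of "\<lambda>x w. H (pt x w)"] mpt in simp)
    finally have r: "(\<integral>\<^sup>+z. H z \<partial>lborel)
       = ennreal ((norm m')\<^sup>2) * (ennreal ((norm m)\<^sup>2) * (\<integral>\<^sup>+x. \<integral>\<^sup>+w. H (pt x w) \<partial>lborel \<partial>lborel))" .
    have "(norm m')\<^sup>2 * (norm m)\<^sup>2 = 1 / (norm dd) ^ 4"
      by (simp add: m_def m'_def norm_divide nq2 field_simps eval_nat_numeral)
    then show ?thesis unfolding r by (simp add: mult.assoc[symmetric] ennreal_mult[symmetric] del: mult.assoc)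
  qed
qed

text \<open>The inverse of \<open>s = Ln (kap * x / (x - cc))\<close>, the value \<open>x - cc\<close>, the resulting map from the model to the
  lens, and its complex Jacobian determinant up to a unimodular factor.\<close>

definition xs :: "complex \<Rightarrow> complex" where "xs s = cc * exp s / (exp s - kap)"
definition ys :: "complex \<Rightarrow> complex" where "ys s = cc * kap / (exp s - kap)"
definition Phi :: "complex \<times> complex \<Rightarrow> complex ^ 2" where
  "Phi p = pt (xs (fst p)) (ys (fst p) * exp (fst p / 2) * snd p)"
definition jac :: "complex \<Rightarrow> complex" where
  "jac s = xs s * (ys s)\<^sup>2 * exp (s / 2) / (of_real ((norm dd)\<^sup>2) * cc)"

lemma strip_cos: assumes "s \<in> strip" shows "0 < cos (Im s)" "0 < cos (Im s + \<theta>)"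
  using cos_pos_arc assms by (auto simp: strip_def)

lemma exp_ne_kap: assumes "s \<in> strip" shows "exp s - kap \<noteq> 0"
proof
  assume "exp s - kap = 0"
  then have "Re (exp s) = - 1" using Re_kap by simp
  moreover have "0 < exp (Re s) * cos (Im s)" using strip_cos(1)[OF assms] by simp
  ultimately show False by (simp add: Re_exp)
qed

lemma xs_minus_cc: assumes "s \<in> strip" shows "xs s - cc = ys s"
  using exp_ne_kap[OF assms] by (simp add: xs_def ys_def field_simps)

lemma kap_xs: "kap * xs s = exp s * ys s" by (simp add: xs_def ys_def)

lemma ys_nz: assumes "s \<in> strip" shows "ys s \<noteq> 0"
  using exp_ne_kap[OF assms] cc_nz kap_nz by (simp add: ys_def)

lemma xs_nz: assumes "s \<in> strip" shows "xs s \<noteq> 0"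
  using exp_ne_kap[OF assms] cc_nz by (simp add: xs_def)

lemma jac_nz: assumes "s \<in> strip" shows "jac s \<noteq> 0"
  using xs_nz[OF assms] ys_nz[OF assms] dd_nz cc_nz by (simp add: jac_def)

text \<open>With \<open>y = x - cc\<close> one has \<open>kap * x * cnj y = \<bar>y\<bar>\<^sup>2 * exp s\<close>, so that the two conditions on \<open>w\<close> involve \<open>cos (Im s)\<close>
  and \<open>r * cos (Im s + \<theta>)\<close>; their minimum is \<open>\<psi>\<close>.\<close>

lemma pt_xs_in_\<Omega>_iff:
  assumes s: "s \<in> strip"
  shows "pt (xs s) w \<in> \<Omega> \<longleftrightarrow> (norm w)\<^sup>2 < (norm (ys s))\<^sup>2 * exp (Re s) * \<psi> (Im s)"
proof -
  define N where "N = (norm (ys s))\<^sup>2 * exp (Re s)"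
  have N: "0 < N" using ys_nz[OF s] by (simp add: N_def)
  have k: "kap * xs s * cnj (xs s - cc) = of_real ((norm (ys s))\<^sup>2) * exp s"
    unfolding xs_minus_cc[OF s] kap_xs complex_norm_square by (simp add: mult_ac)
  have 1: "Re (kap * xs s * cnj (xs s - cc)) = N * cos (Im s)"
    unfolding k by (simp add: Re_exp N_def del: of_real_power)
  have "of_real r * exp (\<i> * of_real \<theta>) * (of_real ((norm (ys s))\<^sup>2) * exp s)
      = of_real (r * (norm (ys s))\<^sup>2) * exp (s + \<i> * of_real \<theta>)"
    by (simp add: exp_add mult_ac)
  then have 2: "Re (of_real r * exp (\<i> * of_real \<theta>) * (kap * xs s * cnj (xs s - cc))) = N * (r * cos (Im s + \<theta>))"
    unfolding k by (simp add: Re_exp N_def del: of_real_power of_real_mult)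
  have "N * \<psi> (Im s) = min (N * cos (Im s)) (N * (r * cos (Im s + \<theta>)))"
    using N by (simp add: psi_def min_mult_distrib_left)
  then show ?thesis unfolding pt_in_\<Omega>_iff 1 2 N_def[symmetric] by simp
qed

lemma Phi_in_\<Omega>_iff:
  assumes s: "s \<in> strip" shows "Phi (s, b) \<in> \<Omega> \<longleftrightarrow> (s, b) \<in> model"
proof -
  define N where "N = (norm (ys s))\<^sup>2 * exp (Re s)"
  have N: "0 < N" using ys_nz[OF s] by (simp add: N_def)
  have "(norm (exp (s / 2)))\<^sup>2 = exp (Re s)" by (simp add: norm_exp_eq_Re power2_eq_square flip: exp_add)
  then have "(norm (ys s * exp (s / 2) * b))\<^sup>2 = N * (norm b)\<^sup>2"
    by (simp only: norm_mult power_mult_distrib N_def)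
  then show ?thesis using s N
    by (simp add: Phi_def pt_xs_in_\<Omega>_iff[OF s] N_def[symmetric] model_def strip_def)
qed

lemma model_strip: "p \<in> model \<Longrightarrow> fst p \<in> strip" by (auto simp: model_def strip_def)

text \<open>Both cosines are positive on the lens, and the only component of this set of angles that the principal branch of the
  logarithm can reach is the arc.\<close>

lemma pt_in_\<Omega>_xs:
  assumes "pt x w \<in> \<Omega>" shows "\<exists>s\<in>strip. x = xs s \<and> exp s = kap * x / (x - cc) \<and> s = Ln (kap * x / (x - cc))"
proof -
  have c1: "0 < Re (kap * x * cnj (x - cc))" and c2: "0 < Re (of_real r * exp (\<i> * of_real \<theta>) * (kap * x * cnj (x - cc)))"
    using assms zero_le_power2[of "norm w"] unfolding pt_in_\<Omega>_iff by linarith+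
  have y: "x - cc \<noteq> 0" and x: "x \<noteq> 0" using c1 by auto
  define t where "t = kap * x / (x - cc)"
  have t0: "t \<noteq> 0" using x y kap_nz by (simp add: t_def)
  have kt: "kap * x * cnj (x - cc) = of_real ((norm (x - cc))\<^sup>2) * t"
    unfolding complex_norm_square t_def using y by simp
  have n0: "0 < (norm (x - cc))\<^sup>2" using y by simp
  define s where "s = Ln t"
  have es: "exp s = t" using t0 by (simp add: s_def)
  have Im: "- pi < Im s" "Im s \<le> pi" using t0 by (auto simp: s_def mpi_less_Im_Ln Im_Ln_le_pi)
  have "0 < (norm (x - cc))\<^sup>2 * (exp (Re s) * cos (Im s))"
    using c1 unfolding kt es[symmetric] by (simp add: Re_exp del: of_real_power)
  then have p1: "0 < cos (Im s)" using n0 by (simp add: zero_less_mult_iff)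
  have "of_real r * exp (\<i> * of_real \<theta>) * (of_real ((norm (x - cc))\<^sup>2) * exp s)
      = of_real (r * (norm (x - cc))\<^sup>2) * exp (s + \<i> * of_real \<theta>)"
    by (simp add: exp_add mult_ac)
  then have "0 < r * (norm (x - cc))\<^sup>2 * (exp (Re s) * cos (Im s + \<theta>))"
    using c2 unfolding kt es[symmetric] by (simp add: Re_exp del: of_real_power of_real_mult)
  moreover have "0 < r * (norm (x - cc))\<^sup>2" using n0 r_pos by (rule mult_pos_pos[rotated])
  ultimately have "0 < exp (Re s) * cos (Im s + \<theta>)" by (rule zero_less_mult_pos)
  then have p2: "0 < cos (Im s + \<theta>)" by (rule zero_less_mult_pos) simp
  have cosneg: "cos u \<le> 0" if "pi / 2 \<le> u" "u \<le> 3 * pi / 2" for u :: real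
  proof -
    have "0 \<le> cos (u - pi)" using that by (intro cos_ge_zero) auto
    then show ?thesis by simp
  qed
  have v: "- pi / 2 < Im s" "Im s < pi / 2"
  proof -
    show "- pi / 2 < Im s"
    proof (rule ccontr)
      assume "\<not> - pi / 2 < Im s"
      then have "cos (- Im s) \<le> 0" using Im by (intro cosneg) auto
      then show False using p1 by simp
    qed
    show "Im s < pi / 2"
    proof (rule ccontr)
      assume "\<not> Im s < pi / 2"
      then have "cos (Im s) \<le> 0" using Im by (intro cosneg) auto
      then show False using p1 by simp
    qed
  qed
  have v2: "- pi / 2 < Im s + \<theta>" "Im s + \<theta> < pi / 2"
  proof -
    show "- pi / 2 < Im s + \<theta>"
    proof (rule ccontr)
      assume "\<not> - pi / 2 < Im s + \<theta>"
      then have "cos (- (Im s + \<theta>)) \<le> 0" using v \<theta>_gt by (intro cosneg) auto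
      then show False using p2 by (simp only: cos_minus)
    qed
    show "Im s + \<theta> < pi / 2"
    proof (rule ccontr)
      assume "\<not> Im s + \<theta> < pi / 2"
      then have "cos (Im s + \<theta>) \<le> 0" using v \<theta>_lt by (intro cosneg) auto
      then show False using p2 by simp
    qed
  qed
  have st: "s \<in> strip" using v v2 by (auto simp: strip_def lo_def hi_def)
  have "xs s = cc * t / (t - kap)" by (simp add: xs_def es)
  also have "t - kap = kap * cc / (x - cc)" using y by (simp add: t_def field_simps)
  also have "cc * t / (kap * cc / (x - cc)) = x" using y cc_nz kap_nz by (simp add: t_def)
  finally show ?thesis using st es by (auto simp: t_def s_def intro!: bexI[of _ s])
qed

lemma strip_Im_abs_less_pi: "s \<in> strip \<Longrightarrow> \<bar>Im s\<bar> < pi"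
proof -
  assume "s \<in> strip"
  then have "- pi / 2 \<le> Im s" "Im s \<le> pi / 2"
    using closed_arc(1,2)[of "Im s"] by (auto simp: strip_def)
  then show "\<bar>Im s\<bar> < pi" using pi_gt_zero by linarith
qed

lemma Ln_exp_strip: assumes "s \<in> strip" shows "Ln (exp s) = s"
  using strip_Im_abs_less_pi[OF assms] by (simp add: Ln_exp abs_less_iff)

lemma exp_from_xs: assumes "s \<in> strip" shows "kap * xs s / (xs s - cc) = exp s"
  unfolding xs_minus_cc[OF assms] kap_xs using ys_nz[OF assms] by simp

lemma xs_inj: "inj_on xs strip"
  by (rule inj_onI) (metis exp_from_xs Ln_exp_strip)

lemma xs_deriv: assumes "s \<in> strip" shows "(xs has_field_derivative - (xs s * ys s / cc)) (at s)"
proof -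
  have "(xs has_field_derivative (cc * exp s * (exp s - kap) - cc * exp s * exp s) / ((exp s - kap) * (exp s - kap))) (at s)"
    unfolding xs_def[abs_def] using exp_ne_kap[OF assms] by (auto intro!: derivative_eq_intros)
  moreover have "cc * exp s * (exp s - kap) - cc * exp s * exp s = - (cc * exp s * kap)" by (simp add: algebra_simps)
  moreover have "xs s * ys s / cc = cc * exp s * kap / ((exp s - kap) * (exp s - kap))"
    using cc_nz by (simp add: xs_def ys_def)
  ultimately show ?thesis by simp
qed

lemma xs_holomorphic: "xs holomorphic_on strip"
  unfolding xs_def[abs_def] using exp_ne_kap by (intro holomorphic_intros) auto
lemma ys_holomorphic: "ys holomorphic_on strip"
  unfolding ys_def[abs_def] using exp_ne_kap by (intro holomorphic_intros) auto
lemma jac_holomorphic: "jac holomorphic_on strip"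
  unfolding jac_def[abs_def] using cc_nz dd_nz by (intro holomorphic_intros xs_holomorphic ys_holomorphic) auto

lemma continuous_on_model_fst:
  assumes "f holomorphic_on strip" shows "continuous_on model (\<lambda>p. f (fst p))"
  by (rule continuous_on_compose2[OF holomorphic_on_imp_continuous_on[OF assms]])
     (auto intro!: continuous_intros model_strip)

lemma continuous_on_Phi: "continuous_on model Phi"
  unfolding Phi_def[abs_def]
  by (intro continuous_on_pt continuous_intros continuous_on_model_fst xs_holomorphic ys_holomorphic) auto

text \<open>\<open>Phi\<close> extended by an arbitrary constant, which makes it a Borel function on the whole space.\<close>

definition Phi' :: "complex \<times> complex \<Rightarrow> complex ^ 2" where "Phi' p = (if p \<in> model then Phi p else q)"

lemma Phi'_measurable [measurable]: "Phi' \<in> borel_measurable borel"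
  unfolding Phi'_def[abs_def] using open_model continuous_on_Phi
  by (intro borel_measurable_continuous_on_if) auto

definition jac_weight :: "complex \<times> complex \<Rightarrow> real" where
  "jac_weight p = indicator model p * (norm (jac (fst p)))\<^sup>2"

lemma jac_weight_measurable [measurable]: "jac_weight \<in> borel_measurable borel"
proof -
  have "(\<lambda>p. indicator model p *\<^sub>R (norm (jac (fst p)))\<^sup>2) \<in> borel_measurable borel"
    using open_model by (intro borel_measurable_continuous_on_indicator continuous_intros continuous_on_model_fst jac_holomorphic) auto
  then show ?thesis by (simp add: jac_weight_def[abs_def])
qed

lemma norm_jac_factor:
  assumes "s \<in> strip"
  shows "1 / (norm dd) ^ 4 * ((norm (- (xs s * ys s / cc)))\<^sup>2 * (norm (ys s * exp (s / 2)))\<^sup>2) = (norm (jac s))\<^sup>2"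
  by (simp add: jac_def norm_mult norm_divide norm_power power_divide power_mult_distrib field_simps
      flip: power_mult) 

lemma open_\<Omega>: "open \<Omega>" unfolding \<Omega>_def by (intro open_Int open_ball)

lemma nn_integral_\<Omega>:
  fixes H :: "complex ^ 2 \<Rightarrow> ennreal"
  assumes H: "H \<in> borel_measurable borel"
  shows "(\<integral>\<^sup>+z. indicator \<Omega> z * H z \<partial>lborel) = (\<integral>\<^sup>+p. ennreal (jac_weight p) * H (Phi' p) \<partial>(lborel \<Otimes>\<^sub>M lborel))"
proof -
  define K where "K = (\<lambda>z. indicator \<Omega> z * H z)"
  note [measurable] = H
  have [measurable]: "\<Omega> \<in> sets borel" "model \<in> sets borel" "strip \<in> sets borel"
    using open_\<Omega> open_model open_strip by auto
  have Km: "K \<in> borel_measurable borel" unfolding K_def by measurable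
  define G where "G = (\<lambda>x. \<integral>\<^sup>+w. K (pt x w) \<partial>lborel)"
  have mpt: "(\<lambda>p. K (pt (fst p) (snd p))) \<in> borel_measurable borel"
    by (rule measurable_compose[OF borel_measurable_continuous_onI Km]) (intro continuous_on_pt continuous_intros)
  have Gm: "G \<in> borel_measurable borel" unfolding G_def by (rule borel_measurable_nn_integral_complex[OF mpt])
  have Gz: "G x = indicator (xs ` strip) x * G x" for x
  proof (cases "x \<in> xs ` strip")
    case False
    then have "K (pt x w) = 0" for w using pt_in_\<Omega>_xs[of x w] by (auto simp: K_def indicator_def)
    then show ?thesis by (simp add: G_def)
  qed simp
  have dxs: "deriv xs s = - (xs s * ys s / cc)" if "s \<in> strip" for s
    by (rule DERIV_imp_deriv[OF xs_deriv[OF that]])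
  have Gs: "G (xs s) = ennreal ((norm (ys s * exp (s / 2)))\<^sup>2) * (\<integral>\<^sup>+b. indicator model (s, b) * H (Phi' (s, b)) \<partial>lborel)"
    if s: "s \<in> strip" for s
  proof -
    have m0: "ys s * exp (s / 2) \<noteq> 0" using ys_nz[OF s] by simp
    have mm: "(\<lambda>w. K (pt (xs s) w)) \<in> borel_measurable borel"
      by (rule measurable_compose[OF borel_measurable_continuous_onI Km]) (intro continuous_on_pt continuous_intros)
    have "G (xs s) = ennreal ((norm (ys s * exp (s / 2)))\<^sup>2) * (\<integral>\<^sup>+b. K (pt (xs s) (ys s * exp (s / 2) * b + 0)) \<partial>lborel)"
      unfolding G_def by (rule nn_integral_complex_affine[OF m0 mm])
    also have "(\<integral>\<^sup>+b. K (pt (xs s) (ys s * exp (s / 2) * b + 0)) \<partial>lborel) = (\<integral>\<^sup>+b. indicator model (s, b) * H (Phi' (s, b)) \<partial>lborel)"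
    proof (intro nn_integral_cong)
      fix b
      have "pt (xs s) (ys s * exp (s / 2) * b + 0) = Phi (s, b)" by (simp add: Phi_def)
      then show "K (pt (xs s) (ys s * exp (s / 2) * b + 0)) = indicator model (s, b) * H (Phi' (s, b))"
        using Phi_in_\<Omega>_iff[OF s, of b] by (simp add: K_def Phi'_def indicator_def)
    qed
    finally show ?thesis .
  qed
  have Hm: "(\<lambda>p. ennreal (jac_weight p) * H (Phi' p)) \<in> borel_measurable borel"
    by measurable
  have Hb: "(\<lambda>b. indicator model (s, b) * H (Phi' (s, b))) \<in> borel_measurable borel" for s
  proof -
    have "(\<lambda>p. indicator model p * H (Phi' p)) \<in> borel_measurable borel" by measurable
    moreover have "(\<lambda>b. (s, b)) \<in> borel \<rightarrow>\<^sub>M (borel :: (complex \<times> complex) measure)"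
      by (intro borel_measurable_continuous_onI continuous_intros)
    ultimately show ?thesis using measurable_compose by blast
  qed
  have "(\<integral>\<^sup>+z. K z \<partial>lborel) = ennreal (1 / (norm dd) ^ 4) * (\<integral>\<^sup>+x. G x \<partial>lborel)"
    unfolding G_def by (rule nn_integral_pt[OF Km])
  also have "(\<integral>\<^sup>+x. G x \<partial>lborel) = (\<integral>\<^sup>+x. indicator (xs ` strip) x * G x \<partial>lborel)"
    by (intro nn_integral_cong Gz)
  also have "\<dots> = (\<integral>\<^sup>+s. indicator strip s * (ennreal ((norm (deriv xs s))\<^sup>2) * G (xs s)) \<partial>lborel)"
    by (rule nn_integral_conformal_image[OF open_strip xs_holomorphic xs_inj Gm])
  also have "ennreal (1 / (norm dd) ^ 4) * \<dots> = (\<integral>\<^sup>+s. ennreal (1 / (norm dd) ^ 4) * (indicator strip s * (ennreal ((norm (deriv xs s))\<^sup>2) * G (xs s))) \<partial>lborel)"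
  proof (rule nn_integral_cmult[symmetric])
    have "(\<lambda>s. if s \<in> strip then xs s else 0) \<in> borel_measurable borel"
      using open_strip holomorphic_on_imp_continuous_on[OF xs_holomorphic] by (intro borel_measurable_continuous_on_if) auto
    from measurable_compose[OF this Gm] have 1: "(\<lambda>s. G (if s \<in> strip then xs s else 0)) \<in> borel_measurable borel" .
    have "(\<lambda>s. if s \<in> strip then deriv xs s else 0) \<in> borel_measurable borel"
      using open_strip holomorphic_on_imp_continuous_on[OF holomorphic_deriv[OF xs_holomorphic open_strip]]
      by (intro borel_measurable_continuous_on_if) auto
    then have "(\<lambda>s. indicator strip s * (ennreal ((norm (if s \<in> strip then deriv xs s else 0))\<^sup>2) * G (if s \<in> strip then xs s else 0))) \<in> borel_measurable borel"
      using 1 by measurable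
    moreover have "(\<lambda>s. indicator strip s * (ennreal ((norm (if s \<in> strip then deriv xs s else 0))\<^sup>2) * G (if s \<in> strip then xs s else 0)))
      = (\<lambda>s. indicator strip s * (ennreal ((norm (deriv xs s))\<^sup>2) * G (xs s)))" by (auto simp: indicator_def fun_eq_iff)
    ultimately show "(\<lambda>s. indicator strip s * (ennreal ((norm (deriv xs s))\<^sup>2) * G (xs s))) \<in> borel_measurable lborel" by simp
  qed
  also have "\<dots> = (\<integral>\<^sup>+s. \<integral>\<^sup>+b. ennreal (jac_weight (s, b)) * H (Phi' (s, b)) \<partial>lborel \<partial>lborel)"
  proof (intro nn_integral_cong)
    fix s
    show "ennreal (1 / (norm dd) ^ 4) * (indicator strip s * (ennreal ((norm (deriv xs s))\<^sup>2) * G (xs s)))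
       = (\<integral>\<^sup>+b. ennreal (jac_weight (s, b)) * H (Phi' (s, b)) \<partial>lborel)"
    proof (cases "s \<in> strip")
      case False
      then have "jac_weight (s, b) = 0" for b by (auto simp: jac_weight_def model_def strip_def)
      then show ?thesis using False by simp
    next
      case True
      define A where "A = (\<integral>\<^sup>+b. indicator model (s, b) * H (Phi' (s, b)) \<partial>lborel)"
      have "(\<integral>\<^sup>+b. ennreal (jac_weight (s, b)) * H (Phi' (s, b)) \<partial>lborel) = (\<integral>\<^sup>+b. ennreal ((norm (jac s))\<^sup>2) * (indicator model (s, b) * H (Phi' (s, b))) \<partial>lborel)"
        by (intro nn_integral_cong) (auto simp: jac_weight_def indicator_def)
      also have "\<dots> = ennreal ((norm (jac s))\<^sup>2) * A" unfolding A_def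
        by (rule nn_integral_cmult) (use Hb in simp)
      also have "ennreal ((norm (jac s))\<^sup>2) = ennreal (1 / (norm dd) ^ 4) * (ennreal ((norm (deriv xs s))\<^sup>2) * ennreal ((norm (ys s * exp (s / 2)))\<^sup>2))"
        unfolding dxs[OF True] norm_jac_factor[OF True, symmetric]
        by (subst ennreal_mult, simp, simp, subst ennreal_mult) auto
      finally show ?thesis unfolding Gs[OF True] A_def[symmetric] using True by (simp add: mult.assoc)
    qed
  qed
  also have "\<dots> = (\<integral>\<^sup>+p. ennreal (jac_weight p) * H (Phi' p) \<partial>(lborel \<Otimes>\<^sub>M lborel))"
    by (rule lborel.nn_integral_fst) (use Hm in \<open>simp add: lborel_prod\<close>)
  finally show ?thesis by (simp add: K_def)
qed

text \<open>As an identity of measures the change of variables transfers to integrals with values in any Banach space.\<close>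

lemma \<Omega>_eq_distr:
  "density lborel (\<lambda>z. ennreal (indicator \<Omega> z)) = distr (density (lborel \<Otimes>\<^sub>M lborel) (\<lambda>p. ennreal (jac_weight p))) borel Phi'"
proof (rule measure_eqI)
  fix A assume "A \<in> sets (density lborel (\<lambda>z. ennreal (indicator \<Omega> z)))"
  then have A: "A \<in> sets borel" by simp
  have "emeasure (density lborel (\<lambda>z. ennreal (indicator \<Omega> z))) A = (\<integral>\<^sup>+z. indicator \<Omega> z * indicator A z \<partial>lborel)"
    using A open_\<Omega> by (simp add: emeasure_density ennreal_indicator)
  also have "\<dots> = (\<integral>\<^sup>+p. ennreal (jac_weight p) * indicator A (Phi' p) \<partial>(lborel \<Otimes>\<^sub>M lborel))"
    by (rule nn_integral_\<Omega>) (use A in simp)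
  also have "\<dots> = (\<integral>\<^sup>+p. ennreal (jac_weight p) * indicator (Phi' -` A) p \<partial>(lborel \<Otimes>\<^sub>M lborel))"
    by (intro nn_integral_cong) (simp add: indicator_def)
  also have "\<dots> = emeasure (distr (density (lborel \<Otimes>\<^sub>M lborel) (\<lambda>p. ennreal (jac_weight p))) borel Phi') A"
    using A measurable_sets[OF Phi'_measurable A] Phi'_measurable jac_weight_measurable
    by (simp add: emeasure_distr emeasure_density lborel_prod)
  finally show "emeasure (density lborel (\<lambda>z. ennreal (indicator \<Omega> z))) A
    = emeasure (distr (density (lborel \<Otimes>\<^sub>M lborel) (\<lambda>p. ennreal (jac_weight p))) borel Phi') A" .
qed simp

lemma integral_\<Omega>:
  fixes f :: "complex ^ 2 \<Rightarrow> 'b::{banach, second_countable_topology}"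
  assumes f: "continuous_on \<Omega> f"
  shows "integrable lborel (\<lambda>z. indicator \<Omega> z *\<^sub>R f z)
      \<longleftrightarrow> integrable (lborel \<Otimes>\<^sub>M lborel) (\<lambda>p. indicator model p *\<^sub>R ((norm (jac (fst p)))\<^sup>2 *\<^sub>R f (Phi p)))"
    and "(\<integral>z. indicator \<Omega> z *\<^sub>R f z \<partial>lborel)
      = (\<integral>p. indicator model p *\<^sub>R ((norm (jac (fst p)))\<^sup>2 *\<^sub>R f (Phi p)) \<partial>(lborel \<Otimes>\<^sub>M lborel))"
proof -
  define g where "g = (\<lambda>z. indicator \<Omega> z *\<^sub>R f z)"
  have gm: "g \<in> borel_measurable borel" unfolding g_def
    using open_\<Omega> f by (intro borel_measurable_continuous_on_indicator) auto
  have m1: "Phi' \<in> density (lborel \<Otimes>\<^sub>M lborel) (\<lambda>p. ennreal (jac_weight p)) \<rightarrow>\<^sub>M borel"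
    using Phi'_measurable by (simp add: lborel_prod)
  have gP: "(\<lambda>p. g (Phi' p)) \<in> borel_measurable (lborel \<Otimes>\<^sub>M lborel)"
    using measurable_compose[OF Phi'_measurable gm] by (simp add: lborel_prod)
  have jw: "jac_weight \<in> borel_measurable (lborel \<Otimes>\<^sub>M lborel)" using jac_weight_measurable by (simp add: lborel_prod)
  have jw0: "AE p in lborel \<Otimes>\<^sub>M lborel. 0 \<le> jac_weight p" by (simp add: jac_weight_def)
  have e: "jac_weight p *\<^sub>R g (Phi' p) = indicator model p *\<^sub>R ((norm (jac (fst p)))\<^sup>2 *\<^sub>R f (Phi p))" for p
  proof (cases "p \<in> model")
    case True
    then have "Phi p \<in> \<Omega>" using Phi_in_\<Omega>_iff[of "fst p" "snd p"] model_strip[OF True] by simp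
    then show ?thesis using True by (simp add: jac_weight_def g_def Phi'_def)
  qed (simp add: jac_weight_def)
  have gg: "indicator \<Omega> z *\<^sub>R g z = g z" for z by (simp add: g_def indicator_def)
  have io: "(\<lambda>z. indicator \<Omega> z :: real) \<in> borel_measurable lborel" using open_\<Omega> by simp
  have "integrable lborel g \<longleftrightarrow> integrable (density lborel (\<lambda>z. ennreal (indicator \<Omega> z))) g"
    using integrable_density[of g lborel "indicator \<Omega>"] gm io by (simp add: gg)
  also have "\<dots> \<longleftrightarrow> integrable (density (lborel \<Otimes>\<^sub>M lborel) (\<lambda>p. ennreal (jac_weight p))) (\<lambda>p. g (Phi' p))"
    unfolding \<Omega>_eq_distr by (rule integrable_distr_eq[OF m1 gm])
  also have "\<dots> \<longleftrightarrow> integrable (lborel \<Otimes>\<^sub>M lborel) (\<lambda>p. jac_weight p *\<^sub>R g (Phi' p))"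
    by (rule integrable_density[OF gP jw jw0])
  finally have X: "integrable lborel g \<longleftrightarrow> integrable (lborel \<Otimes>\<^sub>M lborel) (\<lambda>p. jac_weight p *\<^sub>R g (Phi' p))" .
  show "integrable lborel (\<lambda>z. indicator \<Omega> z *\<^sub>R f z)
      \<longleftrightarrow> integrable (lborel \<Otimes>\<^sub>M lborel) (\<lambda>p. indicator model p *\<^sub>R ((norm (jac (fst p)))\<^sup>2 *\<^sub>R f (Phi p)))"
    unfolding g_def[symmetric] e[symmetric] by (rule X)
  have "(\<integral>z. g z \<partial>lborel) = (\<integral>z. g z \<partial>density lborel (\<lambda>z. ennreal (indicator \<Omega> z)))"
    using integral_density[of g lborel "indicator \<Omega>"] gm io by (simp add: gg)
  also have "\<dots> = (\<integral>p. g (Phi' p) \<partial>density (lborel \<Otimes>\<^sub>M lborel) (\<lambda>p. ennreal (jac_weight p)))"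
    unfolding \<Omega>_eq_distr by (rule integral_distr[OF m1 gm])
  also have "\<dots> = (\<integral>p. jac_weight p *\<^sub>R g (Phi' p) \<partial>(lborel \<Otimes>\<^sub>M lborel))"
    by (rule integral_density[OF gP jw jw0])
  finally have Y: "(\<integral>z. g z \<partial>lborel) = (\<integral>p. jac_weight p *\<^sub>R g (Phi' p) \<partial>(lborel \<Otimes>\<^sub>M lborel))" .
  show "(\<integral>z. indicator \<Omega> z *\<^sub>R f z \<partial>lborel)
      = (\<integral>p. indicator model p *\<^sub>R ((norm (jac (fst p)))\<^sup>2 *\<^sub>R f (Phi p)) \<partial>(lborel \<Otimes>\<^sub>M lborel))"
    unfolding g_def[symmetric] e[symmetric] by (rule Y)
qed

end

section \<open>The Bergman kernel of the lens as a series\<close>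

lemma holomorphic2_on_imp_continuous_on: "holomorphic2_on f S \<Longrightarrow> continuous_on S f"
  unfolding holomorphic2_on_def
  by (intro continuous_at_imp_continuous_on ballI) (metis has_derivative_continuous)

lemma holomorphic2_on_compose:
  assumes g: "holomorphic2_on g S" and f: "\<And>z. z \<in> S \<Longrightarrow> f field_differentiable at (g z)"
  shows "holomorphic2_on (\<lambda>z. f (g z)) S"
  unfolding holomorphic2_on_def
proof
  fix z assume z: "z \<in> S"
  obtain D where D: "(g has_derivative D) (at z)" "\<And>c v. D (c *s v) = c * D v"
    using g z unfolding holomorphic2_on_def by blast
  obtain f' where "(f has_field_derivative f') (at (g z))" using f[OF z] unfolding field_differentiable_def by blast
  then have "(f has_derivative (\<lambda>h. f' * h)) (at (g z))" by (simp add: has_field_derivative_def)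
  then have "((\<lambda>z. f (g z)) has_derivative (\<lambda>h. f' * D h)) (at z)" using has_derivative_compose[OF D(1)] by blast
  then show "\<exists>D. ((\<lambda>z. f (g z)) has_derivative D) (at z) \<and> (\<forall>c v. D (c *s v) = c * D v)"
    using D(2) by (intro exI[of _ "\<lambda>h. f' * D h"]) (simp add: mult.left_commute)
qed

lemma holomorphic2_on_mult:
  assumes "holomorphic2_on f S" "holomorphic2_on g S" shows "holomorphic2_on (\<lambda>z. f z * g z) S"
  unfolding holomorphic2_on_def
proof
  fix z assume z: "z \<in> S"
  obtain D where D: "(f has_derivative D) (at z)" "\<And>c v. D (c *s v) = c * D v"
    using assms(1) z unfolding holomorphic2_on_def by blast
  obtain E where E: "(g has_derivative E) (at z)" "\<And>c v. E (c *s v) = c * E v"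
    using assms(2) z unfolding holomorphic2_on_def by blast
  show "\<exists>D. ((\<lambda>z. f z * g z) has_derivative D) (at z) \<and> (\<forall>c v. D (c *s v) = c * D v)"
    using has_derivative_mult[OF D(1) E(1)] D(2) E(2)
    by (intro exI[of _ "\<lambda>h. f z * E h + D h * g z"]) (simp add: algebra_simps)
qed

lemma holomorphic2_on_cong:
  assumes "open S" "holomorphic2_on f S" "\<And>z. z \<in> S \<Longrightarrow> f z = g z" shows "holomorphic2_on g S"
  unfolding holomorphic2_on_def
proof
  fix z assume z: "z \<in> S"
  obtain D where D: "(f has_derivative D) (at z)" "\<And>c v. D (c *s v) = c * D v"
    using assms(2) z unfolding holomorphic2_on_def by blast
  have "(g has_derivative D) (at z)"
    by (rule has_derivative_transform_within_open[OF D(1) assms(1) z]) (rule assms(3))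
  then show "\<exists>D. (g has_derivative D) (at z) \<and> (\<forall>c v. D (c *s v) = c * D v)" using D(2) by blast
qed

text \<open>A holomorphic function of two variables is holomorphic along holomorphic curves.\<close>

lemma holomorphic2_on_curve:
  assumes f: "holomorphic2_on f S" and c: "(\<gamma> has_derivative (\<lambda>h. h *s v)) (at t)" and t: "\<gamma> t \<in> S"
  shows "(\<lambda>t. f (\<gamma> t)) field_differentiable at t"
proof -
  obtain D where D: "(f has_derivative D) (at (\<gamma> t))" "\<And>c v. D (c *s v) = c * D v"
    using f t unfolding holomorphic2_on_def by blast
  have "((\<lambda>t. f (\<gamma> t)) has_derivative (\<lambda>h. D (h *s v))) (at t)"
    using has_derivative_compose[OF c D(1)] .
  then have "((\<lambda>t. f (\<gamma> t)) has_derivative (\<lambda>h. D v * h)) (at t)" by (simp add: D(2) mult.commute)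
  then show ?thesis unfolding field_differentiable_def has_field_derivative_def by blast
qed

lemma bounded_linear_herm: "bounded_linear (\<lambda>v. herm v w)"
  by (rule linear_conv_bounded_linear[THEN iffD1], rule linearI)
     (auto simp: herm_def algebra_simps)

lemma herm_scale: "herm (c *s v) w = c * herm v w"
  by (simp add: herm_def algebra_simps)

lemma holomorphic2_on_herm: "holomorphic2_on (\<lambda>z. herm (z - q) w) S"
  unfolding holomorphic2_on_def
proof
  fix z
  have "((\<lambda>z. herm (z - q) w) has_derivative (\<lambda>v. herm v w)) (at z)"
    by (rule bounded_linear.has_derivative[OF bounded_linear_herm]) (auto intro!: derivative_eq_intros)
  then show "\<exists>D. ((\<lambda>z. herm (z - q) w) has_derivative D) (at z) \<and> (\<forall>c v. D (c *s v) = c * D v)"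
    using herm_scale by blast
qed

lemma bounded_linear_vector_smult: "bounded_linear (\<lambda>c. c *s (v :: complex ^ 2))"
  by (rule linear_conv_bounded_linear[THEN iffD1], rule linearI)
     (auto simp: vec_eq_iff algebra_simps)

context lens_domain
begin

lemma pt_has_derivative:
  assumes x: "(x has_field_derivative x') (at t)" and w: "(w has_field_derivative w') (at t)"
  shows "\<exists>v. ((\<lambda>t. pt (x t) (w t)) has_derivative (\<lambda>h. h *s v)) (at t)"
proof -
  define p where "p = (vector [cnj (q $ 2), - cnj (q $ 1)] :: complex ^ 2)"
  have e: "pt x w = q + ((x / dd) *s q + (w / cnj dd) *s p)" for x w
    by (simp add: pt_def p_def vec_eq_iff forall_2 algebra_simps)
  have 1: "((\<lambda>t. (x t / dd) *s q) has_derivative (\<lambda>h. (x' / dd * h) *s q)) (at t)"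
    by (rule bounded_linear.has_derivative[OF bounded_linear_vector_smult])
       (rule DERIV_cdivide[OF x, unfolded has_field_derivative_def])
  have 2: "((\<lambda>t. (w t / cnj dd) *s p) has_derivative (\<lambda>h. (w' / cnj dd * h) *s p)) (at t)"
    by (rule bounded_linear.has_derivative[OF bounded_linear_vector_smult])
       (rule DERIV_cdivide[OF w, unfolded has_field_derivative_def])
  have "((\<lambda>t. pt (x t) (w t)) has_derivative (\<lambda>h. 0 + ((x' / dd * h) *s q + (w' / cnj dd * h) *s p))) (at t)"
    unfolding e by (intro has_derivative_add has_derivative_const 1 2)
  moreover have "(\<lambda>h. 0 + ((x' / dd * h) *s q + (w' / cnj dd * h) *s p)) = (\<lambda>h. h *s ((x' / dd) *s q + (w' / cnj dd) *s p))"
    by (rule ext) (simp add: vec_eq_iff algebra_simps)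
  ultimately show ?thesis by (metis (no_types))
qed

lemma holomorphic2_on_pt:
  assumes f: "holomorphic2_on f \<Omega>" and S: "open S"
    and x: "x holomorphic_on S" and w: "w holomorphic_on S" and im: "\<And>t. t \<in> S \<Longrightarrow> pt (x t) (w t) \<in> \<Omega>"
  shows "(\<lambda>t. f (pt (x t) (w t))) holomorphic_on S"
proof -
  have "(\<lambda>t. f (pt (x t) (w t))) field_differentiable at t" if t: "t \<in> S" for t
  proof -
    obtain v where "((\<lambda>t. pt (x t) (w t)) has_derivative (\<lambda>h. h *s v)) (at t)"
      using pt_has_derivative[OF holomorphic_derivI[OF x S t] holomorphic_derivI[OF w S t]] by blast
    then show ?thesis by (rule holomorphic2_on_curve[OF f]) (rule im[OF t])
  qed
  then show ?thesis by (simp add: holomorphic_on_def field_differentiable_at_within)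
qed

definition scoord :: "complex ^ 2 \<Rightarrow> complex" where
  "scoord z = Ln (kap * xcoord z / (xcoord z - cc))"
definition bcoord :: "complex ^ 2 \<Rightarrow> complex" where
  "bcoord z = wcoord z / ((xcoord z - cc) * exp (scoord z / 2))"

lemma scoord:
  assumes z: "z \<in> \<Omega>"
  shows "scoord z \<in> strip" "xs (scoord z) = xcoord z" "exp (scoord z) = kap * xcoord z / (xcoord z - cc)"
    "ys (scoord z) = xcoord z - cc"
proof -
  have "pt (xcoord z) (wcoord z) \<in> \<Omega>" using z by (simp add: pt_coords)
  from pt_in_\<Omega>_xs[OF this]
  show 1: "scoord z \<in> strip" and 2: "xs (scoord z) = xcoord z" and "exp (scoord z) = kap * xcoord z / (xcoord z - cc)"
    by (auto simp: scoord_def)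
  show "ys (scoord z) = xcoord z - cc" using xs_minus_cc[OF 1] 2 by simp
qed

lemma Phi_coords: assumes z: "z \<in> \<Omega>" shows "Phi (scoord z, bcoord z) = z"
proof -
  have y: "xcoord z - cc \<noteq> 0" using ys_nz[OF scoord(1)[OF z]] scoord(4)[OF z] by simp
  then have "Phi (scoord z, bcoord z) = pt (xcoord z) (wcoord z)"
    by (simp add: Phi_def scoord[OF z] bcoord_def)
  then show ?thesis by (simp add: pt_coords)
qed

lemma coords_in_model: assumes z: "z \<in> \<Omega>" shows "(scoord z, bcoord z) \<in> model"
  using Phi_in_\<Omega>_iff[OF scoord(1)[OF z], of "bcoord z"] Phi_coords[OF z] z by simp

lemma Phi_in_\<Omega>: "p \<in> model \<Longrightarrow> Phi p \<in> \<Omega>"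
  using Phi_in_\<Omega>_iff[of "fst p" "snd p"] model_strip[of p] by simp

lemma coords_Phi:
  assumes p: "p \<in> model" shows "scoord (Phi p) = fst p" "bcoord (Phi p) = snd p"
proof -
  have s: "fst p \<in> strip" by (rule model_strip[OF p])
  have x: "xcoord (Phi p) = xs (fst p)" "wcoord (Phi p) = ys (fst p) * exp (fst p / 2) * snd p"
    by (simp_all add: Phi_def)
  show 1: "scoord (Phi p) = fst p" unfolding scoord_def x exp_from_xs[OF s] by (rule Ln_exp_strip[OF s])
  show "bcoord (Phi p) = snd p" unfolding bcoord_def 1 x xs_minus_cc[OF s] using ys_nz[OF s] by simp
qed

lemma holomorphic2_xcoord: "holomorphic2_on xcoord S"
  unfolding xcoord_def[abs_def] by (rule holomorphic2_on_herm)
lemma holomorphic2_wcoord: "holomorphic2_on wcoord S"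
  unfolding wcoord_def[abs_def] by (rule holomorphic2_on_herm)

lemma holomorphic2_scoord: "holomorphic2_on scoord \<Omega>"
  unfolding scoord_def[abs_def]
proof (rule holomorphic2_on_compose[OF holomorphic2_xcoord])
  fix z assume z: "z \<in> \<Omega>"
  have y: "xcoord z - cc \<noteq> 0" using ys_nz[OF scoord(1)[OF z]] scoord(4)[OF z] by simp
  have "kap * xcoord z / (xcoord z - cc) \<notin> \<real>\<^sub>\<le>\<^sub>0"
  proof
    assume "kap * xcoord z / (xcoord z - cc) \<in> \<real>\<^sub>\<le>\<^sub>0"
    then have "Re (exp (scoord z)) \<le> 0" unfolding scoord(3)[OF z] complex_nonpos_Reals_iff by (rule conjunct1)
    moreover have "0 < Re (exp (scoord z))" using strip_cos(1)[OF scoord(1)[OF z]] by (simp add: Re_exp)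
    ultimately show False by simp
  qed
  note nr = this
  show "(\<lambda>x. Ln (kap * x / (x - cc))) field_differentiable at (xcoord z)"
  proof (rule field_differentiable_compose[of "\<lambda>x. kap * x / (x - cc)" _ Ln, unfolded o_def, rotated])
    show "(\<lambda>x. kap * x / (x - cc)) field_differentiable at (xcoord z)"
      by (intro field_differentiable_divide field_differentiable_mult field_differentiable_diff field_differentiable_const
          field_differentiable_ident y)
  qed (rule field_differentiable_at_Ln[OF nr])
qed

lemma holomorphic2_of_scoord:
  assumes "f holomorphic_on strip" shows "holomorphic2_on (\<lambda>z. f (scoord z)) \<Omega>"
proof (rule holomorphic2_on_compose[OF holomorphic2_scoord])
  fix z assume "z \<in> \<Omega>"
  then have "scoord z \<in> strip" by (rule scoord)
  then show "f field_differentiable at (scoord z)"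
    using holomorphic_on_imp_differentiable_at[OF assms open_strip] by blast
qed

lemma bcoord_eq: assumes "z \<in> \<Omega>" shows "bcoord z = wcoord z * (1 / (ys (scoord z) * exp (scoord z / 2)))"
  by (simp add: bcoord_def scoord(4)[OF assms])

lemma holomorphic2_bcoord: "holomorphic2_on bcoord \<Omega>"
proof (rule holomorphic2_on_cong[OF open_\<Omega>])
  show "holomorphic2_on (\<lambda>z. wcoord z * (1 / (ys (scoord z) * exp (scoord z / 2)))) \<Omega>"
    by (intro holomorphic2_on_mult holomorphic2_wcoord holomorphic2_of_scoord[of "\<lambda>s. 1 / (ys s * exp (s / 2))"] holomorphic_intros ys_holomorphic)
       (auto simp: ys_nz)
qed (simp add: bcoord_eq)

text \<open>The part of the Bergman kernel that is homogeneous of degree \<open>j\<close> in \<open>b\<close>.\<close>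

definition kernel_term :: "nat \<Rightarrow> complex ^ 2 \<Rightarrow> complex ^ 2 \<Rightarrow> complex" where
  "kernel_term j z \<zeta> = (bcoord z * cnj (bcoord \<zeta>)) ^ j * kern (Suc j) (scoord z - cnj (scoord \<zeta>))
     / (of_real (disc_moment j 1) * jac (scoord z) * cnj (jac (scoord \<zeta>)))"

lemma cnj_kern: "cnj (kern n \<tau>) = kern n (- cnj \<tau>)"
proof -
  have "cnj (\<integral>x. exp (\<i> * of_real x * \<tau> / 2) / of_real (Fr n x) \<partial>lborel)
      = (\<integral>x. cnj (exp (\<i> * of_real x * \<tau> / 2) / of_real (Fr n x)) \<partial>lborel)"
    by (rule Bochner_Integration.integral_cnj[symmetric])
  also have "\<dots> = (\<integral>x. exp (\<i> * of_real x * (- cnj \<tau>) / 2) / of_real (Fr n x) \<partial>lborel)"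
    by (intro Bochner_Integration.integral_cong refl) (simp add: exp_cnj)
  finally show ?thesis by (simp add: kern_eq)
qed

lemma cnj_kernel_term: "cnj (kernel_term j z \<zeta>) = kernel_term j \<zeta> z"
  by (simp add: kernel_term_def cnj_kern power_mult_distrib mult_ac)

lemma kernel_term_antiholomorphic:
  assumes z: "z \<in> \<Omega>" shows "holomorphic2_on (\<lambda>\<zeta>. cnj (kernel_term j z \<zeta>)) \<Omega>"
proof -
  define C where "C = cnj (bcoord z) ^ j / (of_real (disc_moment j 1) * cnj (jac (scoord z)))"
  define f where "f = (\<lambda>s. C * kern (Suc j) (s - cnj (scoord z)) / jac s)"
  have sz: "lo < Im (scoord z)" "Im (scoord z) < hi" using scoord(1)[OF z] by (auto simp: strip_def)
  have "(\<lambda>s. kern (Suc j) (s - cnj (scoord z))) holomorphic_on strip"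
    by (rule holomorphic_on_compose_gen[OF _ kern_holomorphic, unfolded o_def])
       (use sz in \<open>auto intro!: holomorphic_intros simp: strip_def\<close>)
  then have fh: "f holomorphic_on strip" unfolding f_def
    by (intro holomorphic_intros jac_holomorphic) (auto simp: jac_nz)
  have "holomorphic2_on (\<lambda>\<zeta>. bcoord \<zeta> ^ j * f (scoord \<zeta>)) \<Omega>"
    by (intro holomorphic2_on_mult holomorphic2_of_scoord fh holomorphic2_on_compose[OF holomorphic2_bcoord, of "\<lambda>b. b ^ j"])
       (intro derivative_intros)
  moreover have "cnj (kernel_term j z \<zeta>) = bcoord \<zeta> ^ j * f (scoord \<zeta>)" for \<zeta>
    unfolding cnj_kernel_term by (simp add: kernel_term_def f_def C_def power_mult_distrib mult_ac)
  ultimately show ?thesis by simp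
qed

lemma kernel_term_continuous:
  assumes z: "z \<in> \<Omega>" shows "continuous_on \<Omega> (\<lambda>\<zeta>. kernel_term j z \<zeta>)"
proof -
  have "continuous_on \<Omega> (\<lambda>\<zeta>. cnj (cnj (kernel_term j z \<zeta>)))"
    by (intro continuous_on_cnj holomorphic2_on_imp_continuous_on kernel_term_antiholomorphic z)
  then show ?thesis by simp
qed

lemma kernel_term_Phi:
  assumes z: "z \<in> \<Omega>" and p: "p \<in> model"
  shows "of_real ((norm (jac (fst p)))\<^sup>2) * kernel_term j z (Phi p)
    = (bcoord z ^ j / (of_real (disc_moment j 1) * jac (scoord z))) * (cnj (snd p) ^ j * kern (Suc j) (scoord z - cnj (fst p)) * jac (fst p))"
proof -
  have J: "cnj (jac (fst p)) \<noteq> 0" using jac_nz[OF model_strip[OF p]] by simp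
  have "kernel_term j z (Phi p) = (bcoord z * cnj (snd p)) ^ j * kern (Suc j) (scoord z - cnj (fst p))
     / (of_real (disc_moment j 1) * jac (scoord z) * cnj (jac (fst p)))"
    by (simp add: kernel_term_def coords_Phi[OF p])
  then show ?thesis unfolding complex_norm_square using J by (simp add: power_mult_distrib)
qed

text \<open>In the model coordinates the factor \<open>1 / jac\<close> cancels against the change of volume, and the square
  integrability is that of the kernel of the strip.\<close>

lemma kernel_term_bergman:
  assumes z: "z \<in> \<Omega>" shows "(\<lambda>\<zeta>. cnj (kernel_term j z \<zeta>)) \<in> bergman_space \<Omega>"
proof -
  have sz: "lo < Im (scoord z)" "Im (scoord z) < hi" using scoord(1)[OF z] by (auto simp: strip_def)
  define C where "C = bcoord z ^ j / (of_real (disc_moment j 1) * jac (scoord z))"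
  have cont: "continuous_on \<Omega> (\<lambda>\<zeta>. (norm (cnj (kernel_term j z \<zeta>)))\<^sup>2)"
    by (intro continuous_intros kernel_term_continuous z)
  have e: "indicator model p *\<^sub>R ((norm (jac (fst p)))\<^sup>2 *\<^sub>R (norm (cnj (kernel_term j z (Phi p))))\<^sup>2)
      = (norm C)\<^sup>2 * (indicator model p * (norm (cnj (snd p) ^ j * kern (Suc j) (scoord z - cnj (fst p))))\<^sup>2)" for p
  proof (cases "p \<in> model")
    case True
    have J: "0 < norm (jac (fst p))" using jac_nz[OF model_strip[OF True]] by simp
    have "norm (of_real ((norm (jac (fst p)))\<^sup>2) * kernel_term j z (Phi p)) = norm (C * (cnj (snd p) ^ j * kern (Suc j) (scoord z - cnj (fst p)) * jac (fst p)))"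
      unfolding kernel_term_Phi[OF z True] C_def ..
    then have "(norm (jac (fst p)))\<^sup>2 * norm (kernel_term j z (Phi p)) = norm C * norm (cnj (snd p) ^ j * kern (Suc j) (scoord z - cnj (fst p))) * norm (jac (fst p))"
      by (simp add: norm_mult norm_power mult_ac)
    then have "norm (jac (fst p)) * norm (kernel_term j z (Phi p)) = norm C * norm (cnj (snd p) ^ j * kern (Suc j) (scoord z - cnj (fst p)))"
      using J by (simp add: power2_eq_square)
    then have "(norm (jac (fst p)) * norm (kernel_term j z (Phi p)))\<^sup>2 = (norm C * norm (cnj (snd p) ^ j * kern (Suc j) (scoord z - cnj (fst p))))\<^sup>2"
      by simp
    then show ?thesis using True by (simp add: power_mult_distrib)
  qed simp
  have "integrable lborel (\<lambda>\<zeta>. indicator \<Omega> \<zeta> *\<^sub>R (norm (cnj (kernel_term j z \<zeta>)))\<^sup>2)"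
    unfolding integral_\<Omega>(1)[OF cont] e by (intro integrable_mult_right model_kern_L2 sz)
  then show ?thesis
    using kernel_term_antiholomorphic[OF z] by (simp add: bergman_space_def set_integrable_def)
qed

text \<open>Multiplication by the complex Jacobian determinant makes the pullback an isometry, so the Bergman
  space of the lens becomes that of the model.\<close>

lemma pullback:
  assumes f: "f \<in> bergman_space \<Omega>"
  defines "g \<equiv> \<lambda>s b. jac s * f (Phi (s, b))"
  shows "continuous_on model (\<lambda>p. g (fst p) (snd p))"
    and "\<And>s. lo < Im s \<Longrightarrow> Im s < hi \<Longrightarrow> g s holomorphic_on ball 0 (sqrt (\<psi> (Im s)))"
    and "\<And>b. (\<lambda>s. g s b) holomorphic_on {s. (s, b) \<in> model}"
    and "integrable (lborel \<Otimes>\<^sub>M lborel) (\<lambda>p. indicator model p * (norm (g (fst p) (snd p)))\<^sup>2)"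
proof -
  have fh: "holomorphic2_on f \<Omega>" and f2: "integrable lborel (\<lambda>z. indicator \<Omega> z *\<^sub>R (norm (f z))\<^sup>2)"
    using f by (auto simp: bergman_space_def set_integrable_def)
  have fc: "continuous_on \<Omega> f" by (rule holomorphic2_on_imp_continuous_on[OF fh])
  show "continuous_on model (\<lambda>p. g (fst p) (snd p))" unfolding g_def prod.collapse
    by (intro continuous_intros continuous_on_model_fst jac_holomorphic continuous_on_compose2[OF fc continuous_on_Phi])
       (auto intro: Phi_in_\<Omega>)
  show "g s holomorphic_on ball 0 (sqrt (\<psi> (Im s)))" if s: "lo < Im s" "Im s < hi" for s
    unfolding g_def Phi_def fst_conv snd_conv
  proof (intro holomorphic_intros holomorphic2_on_pt[OF fh])
    fix b :: complex assume "b \<in> ball 0 (sqrt (\<psi> (Im s)))"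
    then have "(s, b) \<in> model" using model_fibre[OF s] by simp
    then have "Phi (s, b) \<in> \<Omega>" by (rule Phi_in_\<Omega>)
    then show "pt (xs s) (ys s * exp (s / 2) * b) \<in> \<Omega>" by (simp add: Phi_def)
  qed auto
  show "(\<lambda>s. g s b) holomorphic_on {s. (s, b) \<in> model}" for b :: complex
  proof -
    have sub: "{s. (s, b) \<in> model} \<subseteq> strip" using model_strip by force
    have o: "open {s. (s, b) \<in> model}"
    proof -
      have "{s. (s, b) \<in> model} = (\<lambda>s. (s, b)) -` model" by auto
      then show ?thesis using open_model by (simp only:) (intro open_vimage continuous_intros)
    qed
    show ?thesis unfolding g_def Phi_def fst_conv snd_conv
    proof (intro holomorphic_intros holomorphic2_on_pt[OF fh o] holomorphic_on_subset[OF jac_holomorphic sub]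
        holomorphic_on_subset[OF xs_holomorphic sub] holomorphic_on_subset[OF ys_holomorphic sub])
      fix s assume "s \<in> {s. (s, b) \<in> model}"
      then have "Phi (s, b) \<in> \<Omega>" by (intro Phi_in_\<Omega>) simp
      then show "pt (xs s) (ys s * exp (s / 2) * b) \<in> \<Omega>" by (simp add: Phi_def)
    qed simp
  qed
  have "continuous_on \<Omega> (\<lambda>z. (norm (f z))\<^sup>2)" by (intro continuous_intros fc)
  from integral_\<Omega>(1)[OF this] f2
  have "integrable (lborel \<Otimes>\<^sub>M lborel) (\<lambda>p. indicator model p *\<^sub>R ((norm (jac (fst p)))\<^sup>2 *\<^sub>R (norm (f (Phi p)))\<^sup>2))" by simp
  then show "integrable (lborel \<Otimes>\<^sub>M lborel) (\<lambda>p. indicator model p * (norm (g (fst p) (snd p)))\<^sup>2)"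
    by (simp add: g_def norm_mult power_mult_distrib)
qed

lemma integral_kernel_term:
  assumes f: "f \<in> bergman_space \<Omega>" and z: "z \<in> \<Omega>"
  shows "(LINT \<zeta>:\<Omega>|lborel. kernel_term j z \<zeta> * f \<zeta>)
    = taylor_coeff j (\<lambda>b. jac (scoord z) * f (Phi (scoord z, b))) * bcoord z ^ j / jac (scoord z)"
proof -
  have sz: "lo < Im (scoord z)" "Im (scoord z) < hi" using scoord(1)[OF z] by (auto simp: strip_def)
  define C where "C = bcoord z ^ j / (of_real (disc_moment j 1) * jac (scoord z))"
  define g where "g = (\<lambda>s b. jac s * f (Phi (s, b)))"
  note rp = model_reproducing(2)[where f = "\<lambda>s b. jac s * f (Phi (s, b))", OF pullback[OF f] sz, folded g_def]
  have fc: "continuous_on \<Omega> f"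
    using f by (auto simp: bergman_space_def intro: holomorphic2_on_imp_continuous_on)
  have cont: "continuous_on \<Omega> (\<lambda>\<zeta>. kernel_term j z \<zeta> * f \<zeta>)" by (intro continuous_intros kernel_term_continuous z fc)
  have e: "indicator model p *\<^sub>R ((norm (jac (fst p)))\<^sup>2 *\<^sub>R (kernel_term j z (Phi p) * f (Phi p)))
      = C * (indicator model p *\<^sub>R (cnj (snd p) ^ j * kern (Suc j) (scoord z - cnj (fst p)) * (jac (fst p) * f (Phi (fst p, snd p)))))" for p
  proof (cases "p \<in> model")
    case True
    have "(norm (jac (fst p)))\<^sup>2 *\<^sub>R (kernel_term j z (Phi p) * f (Phi p)) = (of_real ((norm (jac (fst p)))\<^sup>2) * kernel_term j z (Phi p)) * f (Phi p)"
      by (simp only: scaleR_conv_of_real mult.assoc)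
    also have "\<dots> = C * (cnj (snd p) ^ j * kern (Suc j) (scoord z - cnj (fst p)) * (jac (fst p) * f (Phi (fst p, snd p))))"
      unfolding kernel_term_Phi[OF z True] by (simp add: C_def mult_ac)
    finally show ?thesis using True by simp
  qed simp
  have "(LINT \<zeta>:\<Omega>|lborel. kernel_term j z \<zeta> * f \<zeta>)
      = (\<integral>p. C * (indicator model p *\<^sub>R (cnj (snd p) ^ j * kern (Suc j) (scoord z - cnj (fst p)) * (jac (fst p) * f (Phi (fst p, snd p))))) \<partial>(lborel \<Otimes>\<^sub>M lborel))"
    unfolding set_lebesgue_integral_def integral_\<Omega>(2)[OF cont] e ..
  also have "\<dots> = C * (disc_moment j 1 * taylor_coeff j (g (scoord z)))"
    by (simp only: integral_mult_right_zero rp g_def)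
  also have "\<dots> = taylor_coeff j (g (scoord z)) * bcoord z ^ j / jac (scoord z)"
    using disc_moment_pos[of 1 j] by (simp add: C_def)
  finally show ?thesis by (simp add: g_def)
qed

text \<open>The terms reproduce the summands of the Taylor series of \<open>jac (scoord z) * f (Phi (scoord z, b))\<close> in \<open>b\<close>.\<close>

lemma integral_kernel_term_sums:
  assumes f: "f \<in> bergman_space \<Omega>" and z: "z \<in> \<Omega>"
  shows "(\<lambda>j. LINT \<zeta>:\<Omega>|lborel. kernel_term j z \<zeta> * f \<zeta>) sums f z"
proof -
  have sz: "lo < Im (scoord z)" "Im (scoord z) < hi" using scoord(1)[OF z] by (auto simp: strip_def)
  have b: "norm (bcoord z) < sqrt (\<psi> (Im (scoord z)))"
    using coords_in_model[OF z] model_fibre[OF sz] by simp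
  have "(\<lambda>j. taylor_coeff j (\<lambda>b. jac (scoord z) * f (Phi (scoord z, b))) * bcoord z ^ j) sums (jac (scoord z) * f (Phi (scoord z, bcoord z)))"
    by (rule taylor_coeff_sums[OF pullback(2)[OF f sz] b])
  then have "(\<lambda>j. taylor_coeff j (\<lambda>b. jac (scoord z) * f (Phi (scoord z, b))) * bcoord z ^ j / jac (scoord z)) sums (jac (scoord z) * f z / jac (scoord z))"
    unfolding Phi_coords[OF z] by (rule sums_divide)
  then show ?thesis using jac_nz[OF scoord(1)[OF z]] by (simp add: integral_kernel_term[OF f z])
qed

text \<open>Apply \<open>integral_kernel_term_sums\<close> to the conjugate of the kernel itself: since each term lies in the Bergman
  space, its integral against the kernel is the value of the term.\<close>

lemma kernel_sums:
  assumes K: "is_bergman_kernel \<Omega> K" and z: "z \<in> \<Omega>" and \<zeta>: "\<zeta> \<in> \<Omega>"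
  shows "(\<lambda>j. kernel_term j z \<zeta>) sums K z \<zeta>"
proof -
  define f where "f = (\<lambda>w. cnj (K z w))"
  have f: "f \<in> bergman_space \<Omega>" using K z unfolding is_bergman_kernel_def f_def by blast
  have "(LINT w:\<Omega>|lborel. kernel_term j \<zeta> w * f w) = cnj (kernel_term j z \<zeta>)" for j
  proof -
    have rep: "\<And>f w. f \<in> bergman_space \<Omega> \<Longrightarrow> w \<in> \<Omega> \<Longrightarrow> (LINT \<zeta>:\<Omega>|lborel. K w \<zeta> * f \<zeta>) = f w"
      using K unfolding is_bergman_kernel_def by blast
    have "(LINT w:\<Omega>|lborel. K z w * cnj (kernel_term j \<zeta> w)) = cnj (kernel_term j \<zeta> z)"
      by (rule rep[OF kernel_term_bergman[OF \<zeta>] z])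
    then have "cnj (LINT w:\<Omega>|lborel. K z w * cnj (kernel_term j \<zeta> w)) = kernel_term j \<zeta> z" by simp
    moreover have "cnj (LINT w:\<Omega>|lborel. K z w * cnj (kernel_term j \<zeta> w)) = (LINT w:\<Omega>|lborel. kernel_term j \<zeta> w * f w)"
      unfolding set_lebesgue_integral_def Bochner_Integration.integral_cnj[symmetric]
      by (intro Bochner_Integration.integral_cong refl) (simp add: f_def mult.commute)
    ultimately show ?thesis by (simp add: cnj_kernel_term)
  qed
  with integral_kernel_term_sums[OF f \<zeta>] have "(\<lambda>j. cnj (kernel_term j z \<zeta>)) sums cnj (K z \<zeta>)" by (simp add: f_def)
  then show ?thesis by (simp add: sums_cnj)
qed

end

section \<open>Shifting the line of integration\<close>

context lens_angle
begin

text \<open>The margin \<open>2 * \<eta>\<close> for \<open>b0\<close> is split: one \<open>\<eta>\<close> pays for \<open>kernel_weight_bound\<close>, the other one leaves the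
  geometric factor \<open>sqrt (1 - \<eta>) ^ j\<close>.\<close>

lemma shifted_kern_bound:
  assumes c: "0 < c" "\<And>x. c * Fr (Suc j) x \<le> norm (F r \<theta> (Suc j) (of_real x - \<i> * of_real h))"
    and s: "(s, b) \<in> model" and s0: "lo < Im s0" "Im s0 < hi"
    and \<eta>: "0 < \<eta>" "(norm b0)\<^sup>2 + 2 * \<eta> \<le> \<psi> (Im s0)" and \<delta>: "\<delta> = \<eta> / (2 * (1 + r))"
  shows "norm ((b * cnj b0) ^ j * kern_at (Suc j) h (s - cnj s0))
    \<le> exp (h * (Re s - Re s0) / 2) / c * (4 / (\<delta> * \<eta>) * (\<integral>x. exp (- (\<delta> * \<bar>x\<bar> / 2)) \<partial>lborel)) * sqrt (1 - \<eta>) ^ j"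
proof -
  define v v0 :: real and \<tau> :: complex where "v = Im s" and "v0 = Im s0" and "\<tau> = s - cnj s0"
  have v: "lo < v" "v < hi" "(norm b)\<^sup>2 \<le> \<psi> v" using s by (auto simp: model_def v_def)
  have \<tau>: "Im \<tau> = v + v0" "Re \<tau> = Re s - Re s0" by (auto simp: \<tau>_def v_def v0_def)
  have e2: "2 * \<eta> \<le> \<psi> v0" using \<eta>(2) zero_le_power2[of "norm b0"] unfolding v0_def by linarith
  have \<psi>1: "\<psi> v0 \<le> 1" by (rule psi_le_1)
  have \<delta>0: "0 < \<delta>" using \<eta>(1) r_pos by (simp add: \<delta>)
  define E where "E = exp (h * (Re s - Re s0) / 2) / c"
  define B where "B = norm (b * cnj b0)"
  define w where "w = sqrt (\<psi> v * (\<psi> v0 - \<eta>))"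
  have E0: "0 \<le> E" using c by (simp add: E_def)
  have B: "B \<le> w * sqrt (1 - \<eta>)"
  proof -
    have "(norm b0)\<^sup>2 \<le> \<psi> v0 - 2 * \<eta>" using \<eta>(2) by (simp add: v0_def)
    also have "\<dots> \<le> (\<psi> v0 - \<eta>) * (1 - \<eta>)"
    proof -
      have "\<eta> * (\<psi> v0 - \<eta>) \<le> \<eta> * 1" using \<eta>(1) \<psi>1 by (intro mult_left_mono) auto
      then show ?thesis by (simp add: algebra_simps)
    qed
    finally have "(norm b)\<^sup>2 * (norm b0)\<^sup>2 \<le> \<psi> v * ((\<psi> v0 - \<eta>) * (1 - \<eta>))"
      by (intro mult_mono v(3)) (use v psi_pos[of v] in auto)
    then have "B\<^sup>2 \<le> \<psi> v * (\<psi> v0 - \<eta>) * (1 - \<eta>)" by (simp add: B_def norm_mult power_mult_distrib mult.assoc)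
    then have "B \<le> sqrt (\<psi> v * (\<psi> v0 - \<eta>) * (1 - \<eta>))" by (rule real_le_rsqrt)
    then show ?thesis by (simp add: w_def real_sqrt_mult)
  qed
  have B0: "0 \<le> B" by (simp add: B_def)
  have Bj: "B ^ j \<le> w ^ j * sqrt (1 - \<eta>) ^ j"
    using power_mono[OF B B0, of j] by (simp add: power_mult_distrib)
  define R where "R = 4 / (\<delta> * \<eta>)"
  have m0: "0 \<le> sqrt (1 - \<eta>) ^ j" using e2 \<psi>1 by (intro zero_le_power real_sqrt_ge_zero) auto
  define f where "f = (\<lambda>x::real. exp (\<i> * (of_real x - \<i> * of_real h) * \<tau> / 2) / F r \<theta> (Suc j) (of_real x - \<i> * of_real h))"
  have point: "norm ((b * cnj b0) ^ j * f x) \<le> E * R * sqrt (1 - \<eta>) ^ j * exp (- (\<delta> * \<bar>x\<bar> / 2))" for x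
  proof -
    have F0: "0 < Fr (Suc j) x" by (rule Fr_pos)
    have "norm ((b * cnj b0) ^ j * f x) = B ^ j * norm (f x)" by (simp add: B_def norm_mult norm_power)
    also have "\<dots> \<le> (w ^ j * sqrt (1 - \<eta>) ^ j) * (E * (exp (- (x * (Im \<tau> / 2))) / Fr (Suc j) x))"
    proof (rule mult_mono[OF Bj])
      show "norm (f x) \<le> E * (exp (- (x * (Im \<tau> / 2))) / Fr (Suc j) x)"
        using kern_integrand_bound[OF c, where \<tau> = \<tau> and x = x] by (simp add: f_def E_def \<tau>(2))
      show "0 \<le> w ^ j * sqrt (1 - \<eta>) ^ j" using Bj B0 by (meson order_trans zero_le_power)
    qed simp
    also have "\<dots> = E * sqrt (1 - \<eta>) ^ j * ((exp (- (x * (v + v0) / 2)) * w ^ j) / Fr (Suc j) x)"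
      by (simp add: \<tau>(1))
    also have "\<dots> \<le> E * sqrt (1 - \<eta>) ^ j * (R * exp (- (\<delta> * \<bar>x\<bar> / 2)))"
    proof (rule mult_left_mono)
      have "exp (- (x * (v + v0) / 2)) * w ^ j \<le> R * exp (- (\<delta> * \<bar>x\<bar> / 2)) * Fr (Suc j) x"
        unfolding w_def R_def using s0 by (intro kernel_weight_bound v(1,2) \<eta>(1) e2 \<delta>) (auto simp: v0_def)
      then show "(exp (- (x * (v + v0) / 2)) * w ^ j) / Fr (Suc j) x \<le> R * exp (- (\<delta> * \<bar>x\<bar> / 2))"
        using F0 by (simp add: divide_le_eq)
    qed (use E0 m0 in simp)
    finally show ?thesis by (simp add: mult_ac)
  qed
  have int: "integrable lborel (\<lambda>x. exp (- (\<delta> * \<bar>x\<bar> / 2)))" using integrable_exp_neg_abs[of "\<delta> / 2"] \<delta>0 by simp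
  have "norm (\<integral>x. (b * cnj b0) ^ j * f x \<partial>lborel) \<le> (\<integral>x. E * R * sqrt (1 - \<eta>) ^ j * exp (- (\<delta> * \<bar>x\<bar> / 2)) \<partial>lborel)"
  proof (rule Bochner_Integration.integral_norm_bound_integral)
    show "integrable lborel (\<lambda>x. (b * cnj b0) ^ j * f x)"
    proof (rule integrable_exp_dominated[of _ "\<delta> / 2"])
      show "(\<lambda>x. (b * cnj b0) ^ j * f x) \<in> borel_measurable borel"
        unfolding f_def by (intro borel_measurable_times borel_measurable_const kern_integrand_measurable)
      show "norm ((b * cnj b0) ^ j * f x) \<le> E * R * sqrt (1 - \<eta>) ^ j * exp (- (\<delta> / 2 * \<bar>x\<bar>))" for x
        using point[of x] by simp
    qed (use \<delta>0 in simp)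
  qed (use point in \<open>auto intro!: integrable_mult_right int\<close>)
  also have "\<dots> = E * (R * (\<integral>x. exp (- (\<delta> * \<bar>x\<bar> / 2)) \<partial>lborel)) * sqrt (1 - \<eta>) ^ j" by simp
  finally have I: "norm ((b * cnj b0) ^ j * (\<integral>x. f x \<partial>lborel)) \<le> E * (R * (\<integral>x. exp (- (\<delta> * \<bar>x\<bar> / 2)) \<partial>lborel)) * sqrt (1 - \<eta>) ^ j" by simp
  have "norm ((b * cnj b0) ^ j * kern_at (Suc j) h \<tau>) = norm ((b * cnj b0) ^ j * (\<integral>x. f x \<partial>lborel)) / (4 * pi)"
    by (simp add: kern_at_def f_def norm_mult norm_divide)
  also have "\<dots> \<le> norm ((b * cnj b0) ^ j * (\<integral>x. f x \<partial>lborel))"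
    using divide_left_mono[of 1 "4 * pi"] pi_gt3 by fastforce
  finally show ?thesis using I by (simp add: \<tau>_def E_def R_def)
qed

text \<open>The moments decay more slowly than the factor \<open>sqrt (1 - \<eta>) ^ j\<close>, so dividing by them leaves a convergent geometric series.\<close>

lemma shifted_series_bound:
  assumes nz: "\<And>(x::real) j. F r \<theta> (Suc j) (of_real x - \<i> * of_real h) \<noteq> 0" and \<eta>: "0 < \<eta>" "\<eta> < 1"
  shows "\<exists>C \<rho>. 0 < C \<and> 0 \<le> \<rho> \<and> \<rho> < 1 \<and> (\<forall>j s b s0 (b0 :: complex). (s, b) \<in> model \<longrightarrow> lo < Im s0 \<longrightarrow> Im s0 < hi \<longrightarrow>
     (norm b0)\<^sup>2 + 2 * \<eta> \<le> \<psi> (Im s0) \<longrightarrow>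
     norm ((b * cnj b0) ^ j * kern_at (Suc j) h (s - cnj s0)) / disc_moment j 1 \<le> C * exp (h * (Re s - Re s0) / 2) * \<rho> ^ j)"
proof -
  obtain c where c: "0 < c" "\<And>j x. c * Fr (Suc j) x \<le> norm (F r \<theta> (Suc j) (of_real x - \<i> * of_real h))"
    using F_norm_ge_on_line_uniform[OF nz] by blast
  define \<delta> where "\<delta> = \<eta> / (2 * (1 + r))"
  have \<delta>0: "0 < \<delta>" using \<eta>(1) r_pos by (simp add: \<delta>_def)
  \<comment> \<open>Any \<open>l\<close> with \<open>m < l\<^sup>2 < 1\<close> would do.\<close>
  define m l where "m = sqrt (1 - \<eta>)" and "l = sqrt ((1 + m) / 2)"
  have m: "0 < m" "m < 1" using \<eta> by (auto simp: m_def)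
  have l2: "l\<^sup>2 = (1 + m) / 2" using m by (simp add: l_def)
  have l: "0 < l" "l < 1" using m by (auto simp: l_def)
  obtain a where a: "0 < a" "\<And>j. a * l ^ (2 * j) \<le> disc_moment j 1" using disc_moment_lower[OF l] by blast
  define D where "D = 4 / (\<delta> * \<eta>) * (\<integral>x. exp (- (\<delta> * \<bar>x\<bar> / 2)) \<partial>lborel)"
  have D: "0 \<le> D" using \<delta>0 \<eta>(1) by (simp add: D_def)
  define \<rho> where "\<rho> = m / l\<^sup>2"
  have \<rho>: "0 \<le> \<rho>" "\<rho> < 1" using m by (auto simp: \<rho>_def l2 field_simps)
  show ?thesis
  proof (rule exI[of _ "D / (c * a) + 1"], rule exI[of _ \<rho>], intro conjI allI impI \<rho>)
    show "0 < D / (c * a) + 1" using D c(1) a(1) by (simp add: add_nonneg_pos)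
    fix j and s b s0 b0 :: complex
    assume A: "(s, b) \<in> model" "lo < Im s0" "Im s0 < hi" "(norm b0)\<^sup>2 + 2 * \<eta> \<le> \<psi> (Im s0)"
    define E where "E = exp (h * (Re s - Re s0) / 2)"
    have E: "0 \<le> E" by (simp add: E_def)
    define N where "N = norm ((b * cnj b0) ^ j * kern_at (Suc j) h (s - cnj s0))"
    have "N \<le> E / c * D * m ^ j"
      unfolding N_def E_def D_def m_def by (rule shifted_kern_bound[OF c A(1-3) \<eta>(1) A(4) \<delta>_def])
    then have "N / disc_moment j 1 \<le> (E / c * D * m ^ j) / (a * (l\<^sup>2) ^ j)"
      using a(2)[of j] a(1) l D c(1) m E
      by (intro frac_le) (auto simp: power_mult)
    also have "\<dots> = D / (c * a) * E * \<rho> ^ j" using l by (simp add: \<rho>_def power_divide mult_ac)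
    also have "\<dots> \<le> (D / (c * a) + 1) * E * \<rho> ^ j"
      using E \<rho> by (intro mult_right_mono) auto
    finally show "norm ((b * cnj b0) ^ j * kern_at (Suc j) h (s - cnj s0)) / disc_moment j 1
      \<le> (D / (c * a) + 1) * exp (h * (Re s - Re s0) / 2) * \<rho> ^ j" by (simp add: N_def E_def)
  qed
qed

end

context lens_domain
begin

text \<open>The contribution of one zero to the \<open>j\<close>-th term; the factor is \<open>2 pi i\<close> over \<open>4 pi\<close>, negative because the
  line moves downwards.\<close>

definition residue_term :: "nat \<Rightarrow> complex \<Rightarrow> complex ^ 2 \<Rightarrow> complex ^ 2 \<Rightarrow> complex" where
  "residue_term j \<xi> z \<zeta> = - (\<i> / 2) * ((bcoord z * cnj (bcoord \<zeta>)) ^ j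
     * residue (\<lambda>w. exp (\<i> * w * (scoord z - cnj (scoord \<zeta>)) / 2) / F r \<theta> (Suc j) w) \<xi>
     / (of_real (disc_moment j 1) * jac (scoord z) * cnj (jac (scoord \<zeta>))))"

definition shifted_term :: "real \<Rightarrow> nat \<Rightarrow> complex ^ 2 \<Rightarrow> complex ^ 2 \<Rightarrow> complex" where
  "shifted_term h j z \<zeta> = (bcoord z * cnj (bcoord \<zeta>)) ^ j * kern_at (Suc j) h (scoord z - cnj (scoord \<zeta>))
     / (of_real (disc_moment j 1) * jac (scoord z) * cnj (jac (scoord \<zeta>)))"

lemma kernel_term_shift:
  assumes h: "0 < h" and nz: "\<And>(x::real) j. F r \<theta> (Suc j) (of_real x - \<i> * of_real h) \<noteq> 0"
    and z: "z \<in> \<Omega>" and \<zeta>: "\<zeta> \<in> \<Omega>"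
  shows "kernel_term j z \<zeta> = shifted_term h j z \<zeta> + (\<Sum>\<xi> | (j, \<xi>) \<in> strip_zeros r \<theta> h. residue_term j \<xi> z \<zeta>)"
proof -
  have i: "lo < Im (scoord z - cnj (scoord \<zeta>)) / 2" "Im (scoord z - cnj (scoord \<zeta>)) / 2 < hi"
    using scoord(1)[OF z] scoord(1)[OF \<zeta>] by (auto simp: strip_def)
  have e: "{\<xi>. (j, \<xi>) \<in> strip_zeros r \<theta> h} = {\<xi>. F r \<theta> (Suc j) \<xi> = 0 \<and> - h < Im \<xi> \<and> Im \<xi> < - 0}"
    by (auto simp: strip_zeros_def)
  define A where "A = (bcoord z * cnj (bcoord \<zeta>)) ^ j / (of_real (disc_moment j 1) * jac (scoord z) * cnj (jac (scoord \<zeta>)))"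
  have nz0: "F r \<theta> (Suc j) (of_real x - \<i> * of_real 0) \<noteq> 0" for x using F_real_nz by simp
  note S = kern_shift[OF h zero_less_Suc nz0 nz i]
  have "kernel_term j z \<zeta> = A * kern (Suc j) (scoord z - cnj (scoord \<zeta>))" by (simp add: kernel_term_def A_def)
  also have "\<dots> = A * kern_at (Suc j) h (scoord z - cnj (scoord \<zeta>)) +
      A * (- (\<i> / 2) * (\<Sum>\<xi> | (j, \<xi>) \<in> strip_zeros r \<theta> h. residue (\<lambda>w. exp (\<i> * w * (scoord z - cnj (scoord \<zeta>)) / 2) / F r \<theta> (Suc j) w) \<xi>))"
    unfolding e S by (simp only: diff_conv_add_uminus distrib_left minus_mult_left)
  also have "A * (- (\<i> / 2) * (\<Sum>\<xi> | (j, \<xi>) \<in> strip_zeros r \<theta> h. residue (\<lambda>w. exp (\<i> * w * (scoord z - cnj (scoord \<zeta>)) / 2) / F r \<theta> (Suc j) w) \<xi>))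
      = (\<Sum>\<xi> | (j, \<xi>) \<in> strip_zeros r \<theta> h. residue_term j \<xi> z \<zeta>)"
    unfolding sum_distrib_left by (rule sum.cong) (auto simp: residue_term_def A_def mult_ac)
  finally show ?thesis by (simp add: shifted_term_def A_def)
qed

lemma kernel_remainder_sums:
  assumes K: "is_bergman_kernel \<Omega> K" and h: "0 < h"
    and nz: "\<And>(x::real) j. F r \<theta> (Suc j) (of_real x - \<i> * of_real h) \<noteq> 0"
    and z: "z \<in> \<Omega>" and \<zeta>: "\<zeta> \<in> \<Omega>"
  shows "(\<lambda>j. shifted_term h j z \<zeta>) sums (K z \<zeta> - (\<Sum>(j, \<xi>) \<in> strip_zeros r \<theta> h. residue_term j \<xi> z \<zeta>))"
proof -
  have fin: "finite (strip_zeros r \<theta> h)" using h by (intro finite_strip_zeros) simp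
  define R where "R = (\<lambda>j. \<Sum>\<xi> | (j, \<xi>) \<in> strip_zeros r \<theta> h. residue_term j \<xi> z \<zeta>)"
  define J where "J = fst ` strip_zeros r \<theta> h"
  have finJ: "finite J" using fin by (simp add: J_def)
  have "R sums (\<Sum>j\<in>J. R j)"
  proof (rule sums_finite[OF finJ])
    fix j assume "j \<notin> J"
    then have "{\<xi>. (j, \<xi>) \<in> strip_zeros r \<theta> h} = {}" by (force simp: J_def)
    then show "R j = 0" unfolding R_def by (simp only: sum.empty)
  qed
  also have "(\<Sum>j\<in>J. R j) = (\<Sum>(j, \<xi>) \<in> (SIGMA j:J. {\<xi>. (j, \<xi>) \<in> strip_zeros r \<theta> h}). residue_term j \<xi> z \<zeta>)"
    unfolding R_def
  proof (rule sum.Sigma[OF finJ], rule ballI)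
    fix j
    have "{\<xi>. (j, \<xi>) \<in> strip_zeros r \<theta> h} \<subseteq> snd ` strip_zeros r \<theta> h" by force
    then show "finite {\<xi>. (j, \<xi>) \<in> strip_zeros r \<theta> h}" using fin finite_surj by blast
  qed
  also have "(SIGMA j:J. {\<xi>. (j, \<xi>) \<in> strip_zeros r \<theta> h}) = strip_zeros r \<theta> h" by (force simp: J_def)
  finally have "(\<lambda>j. kernel_term j z \<zeta> - R j) sums (K z \<zeta> - (\<Sum>(j, \<xi>) \<in> strip_zeros r \<theta> h. residue_term j \<xi> z \<zeta>))"
    by (rule sums_diff[OF kernel_sums[OF K z \<zeta>]])
  moreover have "kernel_term j z \<zeta> - R j = shifted_term h j z \<zeta>" for j
    unfolding R_def kernel_term_shift[OF h nz z \<zeta>] by simp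
  ultimately show ?thesis by simp
qed

text \<open>On a compact set \<open>\<psi> (Im s0) - \<bar>b0\<bar>\<^sup>2\<close> is bounded below, which supplies the margin \<open>2 * \<eta>\<close>. The point \<open>z\<close> is not restricted.\<close>

lemma kernel_remainder_bound:
  assumes K: "is_bergman_kernel \<Omega> K" and h: "0 < h"
    and nz: "\<And>(x::real) j. F r \<theta> (Suc j) (of_real x - \<i> * of_real h) \<noteq> 0"
    and C: "compact C" "C \<subseteq> \<Omega>"
  shows "\<exists>M>0. \<forall>z\<in>\<Omega>. \<forall>\<zeta>\<in>C. norm (K z \<zeta> - (\<Sum>(j, \<xi>) \<in> strip_zeros r \<theta> h. residue_term j \<xi> z \<zeta>))
    \<le> M * exp (h * Re (scoord z) / 2) / norm (jac (scoord z))"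
proof (cases "C = {}")
  case False
  have cs: "continuous_on C scoord" and cb: "continuous_on C bcoord"
    using continuous_on_subset[OF holomorphic2_on_imp_continuous_on C(2)] holomorphic2_scoord holomorphic2_bcoord by blast+
  have cj: "continuous_on C (\<lambda>\<zeta>. jac (scoord \<zeta>))"
    by (rule continuous_on_subset[OF holomorphic2_on_imp_continuous_on[OF holomorphic2_of_scoord[OF jac_holomorphic]] C(2)])
  have strip: "lo < Im (scoord \<zeta>)" "Im (scoord \<zeta>) < hi" "jac (scoord \<zeta>) \<noteq> 0" if "\<zeta> \<in> C" for \<zeta>
    using scoord(1)[of \<zeta>] jac_nz that C(2) by (auto simp: strip_def)
  define g where "g = (\<lambda>\<zeta>. \<psi> (Im (scoord \<zeta>)) - (norm (bcoord \<zeta>))\<^sup>2)"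
  have "continuous_on C g" unfolding g_def
    by (intro continuous_intros continuous_on_compose2[OF continuous_psi, of C] cs cb) auto
  then obtain x where x: "x \<in> C" "\<And>\<zeta>. \<zeta> \<in> C \<Longrightarrow> g x \<le> g \<zeta>" using continuous_attains_inf[OF C(1) False] by blast
  define \<eta> where "\<eta> = g x / 2"
  have "0 < g x" using coords_in_model[of x] x(1) C(2) by (auto simp: model_def g_def)
  then have \<eta>0: "0 < \<eta>" by (simp add: \<eta>_def)
  have "g x \<le> 1" using psi_le_1[of "Im (scoord x)"] zero_le_power2[of "norm (bcoord x)"] by (simp only: g_def)
  then have \<eta>1: "\<eta> < 1" by (simp add: \<eta>_def)
  obtain D \<rho> where D: "0 < D" "0 \<le> \<rho>" "\<rho> < 1" "\<And>j s b s0 (b0 :: complex). (s, b) \<in> model \<Longrightarrow> lo < Im s0 \<Longrightarrow> Im s0 < hi \<Longrightarrow>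
     (norm b0)\<^sup>2 + 2 * \<eta> \<le> \<psi> (Im s0) \<Longrightarrow>
     norm ((b * cnj b0) ^ j * kern_at (Suc j) h (s - cnj s0)) / disc_moment j 1 \<le> D * exp (h * (Re s - Re s0) / 2) * \<rho> ^ j"
    using shifted_series_bound[OF nz \<eta>0 \<eta>1] by blast
  define k where "k = (\<lambda>\<zeta>. exp (- (h * Re (scoord \<zeta>) / 2)) / norm (jac (scoord \<zeta>)))"
  have "continuous_on C k" unfolding k_def by (intro continuous_intros cs cj) (use strip in auto)
  then obtain y where y: "y \<in> C" "\<And>\<zeta>. \<zeta> \<in> C \<Longrightarrow> k \<zeta> \<le> k y" using continuous_attains_sup[OF C(1) False] by blast
  have ky: "0 < k y" using strip(3)[OF y(1)] by (simp add: k_def)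
  show ?thesis
  proof (intro exI[of _ "D * k y / (1 - \<rho>)"] conjI ballI)
    show "0 < D * k y / (1 - \<rho>)" using D ky by simp
    fix z \<zeta> assume z: "z \<in> \<Omega>" and \<zeta>: "\<zeta> \<in> C"
    define G where "G = D * exp (h * Re (scoord z) / 2) * k y / norm (jac (scoord z))"
    have j\<zeta>: "0 < norm (jac (scoord \<zeta>))" using strip(3)[OF \<zeta>] by simp
    have bound: "norm (shifted_term h j z \<zeta>) \<le> G * \<rho> ^ j" for j
    proof -
      define N where "N = norm ((bcoord z * cnj (bcoord \<zeta>)) ^ j * kern_at (Suc j) h (scoord z - cnj (scoord \<zeta>)))"
      have "N / disc_moment j 1 \<le> D * exp (h * (Re (scoord z) - Re (scoord \<zeta>)) / 2) * \<rho> ^ j"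
        unfolding N_def using x(2)[OF \<zeta>] by (intro D(4) coords_in_model z strip \<zeta>) (simp add: g_def \<eta>_def field_simps)
      then have "N / disc_moment j 1 / (norm (jac (scoord z)) * norm (jac (scoord \<zeta>)))
        \<le> D * exp (h * (Re (scoord z) - Re (scoord \<zeta>)) / 2) * \<rho> ^ j / (norm (jac (scoord z)) * norm (jac (scoord \<zeta>)))"
        by (rule divide_right_mono) simp
      also have "\<dots> = D * exp (h * Re (scoord z) / 2) / norm (jac (scoord z)) * \<rho> ^ j * k \<zeta>"
      proof -
        have "exp (h * (Re (scoord z) - Re (scoord \<zeta>)) / 2) = exp (h * Re (scoord z) / 2) * exp (- (h * Re (scoord \<zeta>) / 2))"
          by (simp add: right_diff_distrib diff_divide_distrib flip: exp_add)
        then show ?thesis by (simp add: k_def)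
      qed
      also have "\<dots> \<le> D * exp (h * Re (scoord z) / 2) / norm (jac (scoord z)) * \<rho> ^ j * k y"
        using D by (intro mult_left_mono y(2) \<zeta>) auto
      also have "\<dots> = G * \<rho> ^ j" by (simp add: G_def)
      finally show ?thesis using disc_moment_pos[of 1 j]
        by (simp add: shifted_term_def N_def norm_mult norm_divide norm_power mult.assoc)
    qed
    have geo: "summable (\<lambda>j. G * \<rho> ^ j)" using D by (intro summable_mult summable_geometric) auto
    have ss: "summable (\<lambda>j. norm (shifted_term h j z \<zeta>))"
      by (rule summable_comparison_test'[OF geo, of 0]) (use bound in simp)
    have "norm (\<Sum>j. shifted_term h j z \<zeta>) \<le> (\<Sum>j. G * \<rho> ^ j)"
      using summable_norm[OF ss] suminf_le[OF bound ss geo] by linarith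
    also have "\<dots> = G / (1 - \<rho>)" using D by (simp add: suminf_mult suminf_geometric)
    finally show "norm (K z \<zeta> - (\<Sum>(j, \<xi>) \<in> strip_zeros r \<theta> h. residue_term j \<xi> z \<zeta>))
      \<le> D * k y / (1 - \<rho>) * exp (h * Re (scoord z) / 2) / norm (jac (scoord z))"
      using sums_unique[OF kernel_remainder_sums[OF K h nz z, of \<zeta>]] \<zeta> C(2) by (auto simp: G_def mult_ac)
  qed
qed (auto intro: exI[of _ 1])

end

section \<open>Asymptotics and branches\<close>

text \<open>The exponential of the difference is constant, so the difference takes values in a discrete set.\<close>

lemma continuous_log_branches_differ_by_constant:
  fixes f g :: "'a::topological_space \<Rightarrow> complex"
  assumes S: "connected S" and f: "continuous_on S f" and g: "continuous_on S g"
    and e: "\<And>z. z \<in> S \<Longrightarrow> exp (f z) = k * exp (g z)"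
  shows "\<exists>c. \<forall>z\<in>S. f z = g z + c"
proof -
  have "(\<lambda>z. f z - g z) constant_on S"
  proof (rule continuous_discrete_range_constant[OF S])
    show "continuous_on S (\<lambda>z. f z - g z)" by (intro continuous_intros f g)
    fix x assume x: "x \<in> S"
    have "2 * pi \<le> norm ((f y - g y) - (f x - g x))" if y: "y \<in> S" "f y - g y \<noteq> f x - g x" for y
    proof -
      have "exp (f w - g w) = k" if "w \<in> S" for w using e[OF that] by (simp add: exp_diff)
      then have "exp (f y - g y) = exp (f x - g x)" using x y by simp
      then obtain n :: int where n: "f y - g y = f x - g x + of_int (2 * n) * (of_real pi * \<i>)"
        by (auto simp: exp_eq)
      with y(2) have "n \<noteq> 0" by auto
      then have "1 \<le> \<bar>real_of_int n\<bar>" by linarith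
      then have "2 * pi * 1 \<le> 2 * pi * \<bar>real_of_int n\<bar>" by (intro mult_left_mono) auto
      moreover have "norm (of_int (2 * n) * (of_real pi * \<i>)) = 2 * pi * \<bar>real_of_int n\<bar>" by (simp add: norm_mult)
      moreover have "(f y - g y) - (f x - g x) = of_int (2 * n) * (of_real pi * \<i>)" using n by simp
      ultimately show ?thesis by simp
    qed
    then show "\<exists>e>0. \<forall>y. y \<in> S \<and> f y - g y \<noteq> f x - g x \<longrightarrow> e \<le> norm ((f y - g y) - (f x - g x))"
      by (intro exI[of _ "2 * pi"]) auto
  qed
  then obtain c where "\<And>z. z \<in> S \<Longrightarrow> f z - g z = c" unfolding constant_on_def by blast
  then show ?thesis by (intro exI[of _ c]) (metis add_diff_cancel_left' add_diff_eq diff_add_cancel)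
qed

lemma antiholomorphic2_on_imp_continuous_on:
  assumes "antiholomorphic2_on f S" shows "continuous_on S f"
proof -
  have "continuous_on S (\<lambda>z. cnj (cnj (f z)))"
    using assms by (intro continuous_on_cnj holomorphic2_on_imp_continuous_on) (simp add: antiholomorphic2_on_def)
  then show ?thesis by simp
qed

context lens_domain
begin

text \<open>With \<open>exp (Re s) = \<bar>kap\<bar> \<bar>x\<bar> / \<bar>x - cc\<bar>\<close> and \<open>\<bar>jac s\<bar>\<close> a multiple of \<open>\<bar>x\<bar> \<bar>x - cc\<bar>\<^sup>2 exp (Re s / 2)\<close>, the quotient is a
  multiple of \<open>\<bar>x\<bar> powr ((h - 1) / 2 - 1)\<close> times a power of \<open>\<bar>x - cc\<bar>\<close>, which is bounded near \<open>x = 0\<close>.\<close>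

lemma remainder_growth:
  assumes h: "0 < h"
  shows "\<exists>M>0. \<forall>\<^sub>F z in at q within \<Omega>. exp (h * Re (scoord z) / 2) / norm (jac (scoord z)) \<le> M * norm (xcoord z) powr ((h - 3) / 2)"
proof -
  define e where "e = (h + 3) / 2"
  define A where "A = (norm dd)\<^sup>2 * norm cc * norm kap powr ((h - 1) / 2)"
  have A: "0 < A" using dd_nz cc_nz kap_nz by (simp add: A_def)
  have c: "0 < norm cc / 2" using cc_nz by simp
  have "isCont xcoord q" unfolding xcoord_def[abs_def]
    by (intro continuous_at_compose[OF _ linear_continuous_at[OF bounded_linear_herm], unfolded o_def] continuous_intros)
  then have "(xcoord \<longlongrightarrow> xcoord q) (at q within \<Omega>)" by (auto simp: isCont_def intro: tendsto_within_subset)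
  moreover have "xcoord q = 0" by (simp add: xcoord_def herm_def)
  ultimately have "(xcoord \<longlongrightarrow> 0) (at q within \<Omega>)" by simp
  then have ev: "\<forall>\<^sub>F z in at q within \<Omega>. norm (xcoord z) < norm cc / 2"
    using tendstoD[OF _ c] by (fastforce simp: dist_norm)
  have evO: "\<forall>\<^sub>F z in at q within \<Omega>. z \<in> \<Omega>" by (simp add: eventually_at_filter)
  show ?thesis
  proof (intro exI[of _ "A / (norm cc / 2) powr e"] conjI)
    show "0 < A / (norm cc / 2) powr e" using A c by simp
    show "\<forall>\<^sub>F z in at q within \<Omega>. exp (h * Re (scoord z) / 2) / norm (jac (scoord z)) \<le> A / (norm cc / 2) powr e * norm (xcoord z) powr ((h - 3) / 2)"
      using ev evO
    proof eventually_elim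
      fix z assume near: "norm (xcoord z) < norm cc / 2" and z: "z \<in> \<Omega>"
      define x y where "x = norm (xcoord z)" and "y = norm (xcoord z - cc)"
      have x: "0 < x" using xs_nz[OF scoord(1)[OF z]] scoord(2)[OF z] by (simp add: x_def)
      have "norm cc \<le> norm (xcoord z) + norm (xcoord z - cc)"
        using norm_triangle_ineq4[of "xcoord z" "xcoord z - cc"] by simp
      then have yc: "norm cc / 2 \<le> y" using near unfolding y_def by linarith
      then have y: "0 < y" using c by linarith
      have Rs: "exp (Re (scoord z)) = norm kap * x / y"
        using scoord(3)[OF z] by (metis norm_exp_eq_Re norm_divide norm_mult x_def y_def)
      have ex: "exp (t * Re (scoord z)) = (norm kap * x / y) powr t" for t
        using kap_nz x y by (simp add: powr_def flip: Rs)
      have nj: "norm (jac (scoord z)) = x * y\<^sup>2 * exp (Re (scoord z) / 2) / ((norm dd)\<^sup>2 * norm cc)"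
        by (simp add: jac_def scoord[OF z] x_def y_def norm_mult norm_divide norm_power norm_exp_eq_Re)
      have "exp (h * Re (scoord z) / 2) / norm (jac (scoord z)) = (norm dd)\<^sup>2 * norm cc * exp ((h - 1) / 2 * Re (scoord z)) / (x * y\<^sup>2)"
      proof -
        have "(h - 1) / 2 * Re (scoord z) = h * Re (scoord z) / 2 - Re (scoord z) / 2" by (simp add: field_simps)
        then have "exp ((h - 1) / 2 * Re (scoord z)) = exp (h * Re (scoord z) / 2) / exp (Re (scoord z) / 2)"
          by (simp only: exp_diff)
        then show ?thesis by (simp add: nj mult_ac)
      qed
      also have "\<dots> = A * (x powr ((h - 1) / 2) / x) / (y powr ((h - 1) / 2) * y\<^sup>2)"
        unfolding ex A_def using x y by (simp add: powr_mult powr_divide mult_ac)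
      also have "x powr ((h - 1) / 2) / x = x powr ((h - 3) / 2)"
      proof -
        have "(h - 3) / 2 = (h - 1) / 2 - 1" by (simp add: field_simps)
        then show ?thesis using x by (simp only: powr_diff powr_one)
      qed
      also have "y powr ((h - 1) / 2) * y\<^sup>2 = y powr e"
      proof -
        have "e = (h - 1) / 2 + 2" by (simp add: e_def field_simps)
        then have "y powr e = y powr ((h - 1) / 2) * y powr 2" by (simp only: powr_add)
        then show ?thesis using y by (simp add: powr_numeral)
      qed
      also have "A * x powr ((h - 3) / 2) / y powr e \<le> A * x powr ((h - 3) / 2) / (norm cc / 2) powr e"
        using A c yc h by (intro divide_left_mono powr_mono2 mult_pos_pos) (auto simp: e_def x y)
      finally show "exp (h * Re (scoord z) / 2) / norm (jac (scoord z)) \<le> A / (norm cc / 2) powr e * norm (xcoord z) powr ((h - 3) / 2)"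
        by (simp add: x_def)
    qed
  qed
qed

text \<open>The part of a residue term that depends on \<open>z\<close>. The one that depends on \<open>\<zeta>\<close> is its conjugate at the
  conjugate exponent.\<close>

lemma bergman_factor_branches:
  assumes z: "z \<in> \<Omega>" and X: "exp L = xcoord z" and Y: "exp L' = xcoord z - cc" and s: "scoord z = L - L' + c"
  shows "bcoord z ^ j / jac (scoord z) * exp (\<i> * \<xi> / 2 * scoord z)
    = of_real ((norm dd)\<^sup>2) * cc * exp ((\<i> * \<xi> / 2 - (of_nat j + 1) / 2) * c)
      * (wcoord z ^ j / exp ((- (\<i> * \<xi> / 2) + (of_nat j + 3) / 2) * L) * exp ((- (\<i> * \<xi> / 2) - (of_nat j + 3) / 2) * L'))"
proof -
  have d: "complex_of_real ((norm dd)\<^sup>2) * cc \<noteq> 0" using dd_nz cc_nz by simp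
  have eL: "(exp L') ^ j = exp (of_nat j * L')" "(exp L')\<^sup>2 = exp (2 * L')"
      "(exp (scoord z / 2)) ^ j = exp (of_nat j * (scoord z / 2))"
    by (simp_all only: exp_of_nat_mult exp_double)
  have "bcoord z ^ j / jac (scoord z) * exp (\<i> * \<xi> / 2 * scoord z)
    = of_real ((norm dd)\<^sup>2) * cc * (wcoord z ^ j * (exp (\<i> * \<xi> / 2 * scoord z)
       / (exp (of_nat j * L') * exp (of_nat j * (scoord z / 2)) * (exp L * exp (2 * L') * exp (scoord z / 2)))))"
    unfolding bcoord_def jac_def scoord(2,4)[OF z] power_divide power_mult_distrib eL[symmetric] Y[symmetric]
    unfolding X[symmetric]
    using d by (simp add: mult_ac)
  also have "exp (\<i> * \<xi> / 2 * scoord z) / (exp (of_nat j * L') * exp (of_nat j * (scoord z / 2)) * (exp L * exp (2 * L') * exp (scoord z / 2)))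
    = exp (\<i> * \<xi> / 2 * scoord z - (of_nat j * L' + of_nat j * (scoord z / 2) + (L + 2 * L' + scoord z / 2)))"
    by (simp only: exp_diff exp_add)
  also have "\<i> * \<xi> / 2 * scoord z - (of_nat j * L' + of_nat j * (scoord z / 2) + (L + 2 * L' + scoord z / 2))
    = (\<i> * \<xi> / 2 - (of_nat j + 1) / 2) * c + (- ((- (\<i> * \<xi> / 2) + (of_nat j + 3) / 2) * L) + (- (\<i> * \<xi> / 2) - (of_nat j + 3) / 2) * L')"
    unfolding s by (simp add: field_simps)
  also have "exp \<dots> = exp ((\<i> * \<xi> / 2 - (of_nat j + 1) / 2) * c)
    * (exp ((- (\<i> * \<xi> / 2) - (of_nat j + 3) / 2) * L') / exp ((- (\<i> * \<xi> / 2) + (of_nat j + 3) / 2) * L))"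
    by (simp only: exp_add exp_minus) (simp add: field_simps)
  finally show ?thesis by (simp add: mult_ac)
qed

text \<open>With the branches, \<open>scoord z - cnj (scoord \<zeta>)\<close> equals \<open>\<Lambda> z \<zeta>\<close> up to an additive constant, so the polynomial in
  the residue becomes one in \<open>\<Lambda> z \<zeta>\<close>; all other constants are exponentials and do not vanish.\<close>

lemma residue_term_branches:
  assumes LX: "hol_log_branch \<Omega> xcoord LX" and LY: "hol_log_branch \<Omega> (\<lambda>z. xcoord z - cc) LY"
    and MX: "antihol_log_branch \<Omega> (\<lambda>z. cnj (xcoord z)) MX" and MY: "antihol_log_branch \<Omega> (\<lambda>z. cnj (xcoord z - cc)) MY"
    and Lz: "\<And>\<zeta>. \<zeta> \<in> \<Omega> \<Longrightarrow> hol_log_branch \<Omega> (\<lambda>z. (xcoord z * cnj (xcoord \<zeta> - cc)) / (cnj (xcoord \<zeta>) * (xcoord z - cc))) (\<lambda>z. \<Lambda> z \<zeta>)"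
    and L\<zeta>: "\<And>z. z \<in> \<Omega> \<Longrightarrow> antihol_log_branch \<Omega> (\<lambda>\<zeta>. (xcoord z * cnj (xcoord \<zeta> - cc)) / (cnj (xcoord \<zeta>) * (xcoord z - cc))) (\<lambda>\<zeta>. \<Lambda> z \<zeta>)"
    and \<xi>: "F r \<theta> (Suc j) \<xi> = 0"
  shows "\<exists>P. P \<noteq> 0 \<and> int (degree P) = zorder (F r \<theta> (Suc j)) \<xi> - 1 \<and> (\<forall>z\<in>\<Omega>. \<forall>\<zeta>\<in>\<Omega>. residue_term j \<xi> z \<zeta> =
      (wcoord z ^ j * cnj (wcoord \<zeta>) ^ j)
        / (bpow LX z (- (\<i> * \<xi> / 2) + (of_nat j + 3) / 2) * bpow MX \<zeta> (\<i> * \<xi> / 2 + (of_nat j + 3) / 2))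
        * bpow LY z (- (\<i> * \<xi> / 2) - (of_nat j + 3) / 2) * bpow MY \<zeta> (\<i> * \<xi> / 2 - (of_nat j + 3) / 2)
        * poly P (\<Lambda> z \<zeta>))"
proof -
  have conv: "connected \<Omega>" unfolding \<Omega>_def by (intro convex_connected convex_Int convex_ball)
  have cL: "continuous_on \<Omega> LX" "continuous_on \<Omega> LY" and eL: "\<And>z. z \<in> \<Omega> \<Longrightarrow> exp (LX z) = xcoord z" "\<And>z. z \<in> \<Omega> \<Longrightarrow> exp (LY z) = xcoord z - cc"
    using LX LY holomorphic2_on_imp_continuous_on unfolding hol_log_branch_def by blast+
  have cM: "continuous_on \<Omega> MX" "continuous_on \<Omega> MY" and eM: "\<And>z. z \<in> \<Omega> \<Longrightarrow> exp (MX z) = cnj (xcoord z)" "\<And>z. z \<in> \<Omega> \<Longrightarrow> exp (MY z) = cnj (xcoord z - cc)"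
    using MX MY antiholomorphic2_on_imp_continuous_on unfolding antihol_log_branch_def by blast+
  have cz: "continuous_on \<Omega> (\<lambda>z. \<Lambda> z \<zeta>)" if "\<zeta> \<in> \<Omega>" for \<zeta>
    using Lz[OF that] holomorphic2_on_imp_continuous_on unfolding hol_log_branch_def by blast
  have c\<zeta>: "continuous_on \<Omega> (\<lambda>\<zeta>. \<Lambda> z \<zeta>)" if "z \<in> \<Omega>" for z
    using L\<zeta>[OF that] antiholomorphic2_on_imp_continuous_on unfolding antihol_log_branch_def by blast
  have e\<Lambda>: "exp (\<Lambda> z \<zeta>) = exp (LX z - LY z + (MY \<zeta> - MX \<zeta>))" if "z \<in> \<Omega>" "\<zeta> \<in> \<Omega>" for z \<zeta>
  proof -
    have "exp (\<Lambda> z \<zeta>) = (xcoord z * cnj (xcoord \<zeta> - cc)) / (cnj (xcoord \<zeta>) * (xcoord z - cc))"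
      using Lz[OF that(2)] that(1) unfolding hol_log_branch_def by blast
    then show ?thesis using that by (simp add: exp_add exp_diff eL eM mult_ac)
  qed
  obtain c1 where c1: "\<And>z. z \<in> \<Omega> \<Longrightarrow> scoord z = LX z - LY z + c1"
    using continuous_log_branches_differ_by_constant[OF conv holomorphic2_on_imp_continuous_on[OF holomorphic2_scoord] continuous_on_diff[OF cL], of kap]
    by (auto simp: scoord(3) exp_diff eL)
  obtain c2 where c2: "\<And>z. z \<in> \<Omega> \<Longrightarrow> cnj (LX z) = MX z + c2"
    using continuous_log_branches_differ_by_constant[OF conv continuous_on_cnj[OF cL(1)] cM(1), of 1] by (auto simp: eL eM simp flip: exp_cnj)
  obtain c3 where c3: "\<And>z. z \<in> \<Omega> \<Longrightarrow> cnj (LY z) = MY z + c3"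
    using continuous_log_branches_differ_by_constant[OF conv continuous_on_cnj[OF cL(2)] cM(2), of 1] by (auto simp: eL eM simp flip: exp_cnj)
  \<comment> \<open>The constant does not depend on either variable: compare first in \<open>z\<close> for fixed \<open>\<zeta>\<close>, then in \<open>\<zeta>\<close> at a base point.\<close>
  have "\<exists>c4. \<forall>z\<in>\<Omega>. \<forall>\<zeta>\<in>\<Omega>. \<Lambda> z \<zeta> = LX z - LY z + (MY \<zeta> - MX \<zeta>) + c4"
  proof (cases "\<Omega> = {}")
    case False
    then obtain w where w: "w \<in> \<Omega>" by blast
    have "\<exists>c. \<forall>z\<in>\<Omega>. \<Lambda> z \<zeta> = LX z - LY z + (MY \<zeta> - MX \<zeta>) + c" if \<zeta>: "\<zeta> \<in> \<Omega>" for \<zeta>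
      by (rule continuous_log_branches_differ_by_constant[OF conv cz[OF \<zeta>], of _ 1]) (auto intro!: continuous_intros cL simp: e\<Lambda> \<zeta>)
    moreover have "\<exists>c. \<forall>\<zeta>\<in>\<Omega>. \<Lambda> w \<zeta> = LX w - LY w + (MY \<zeta> - MX \<zeta>) + c"
      by (rule continuous_log_branches_differ_by_constant[OF conv c\<zeta>[OF w], of _ 1]) (auto intro!: continuous_intros cM simp: e\<Lambda> w)
    then obtain c where c: "\<And>\<zeta>. \<zeta> \<in> \<Omega> \<Longrightarrow> \<Lambda> w \<zeta> = LX w - LY w + (MY \<zeta> - MX \<zeta>) + c" by blast
    ultimately have "\<Lambda> z \<zeta> = LX z - LY z + (MY \<zeta> - MX \<zeta>) + c" if "z \<in> \<Omega>" "\<zeta> \<in> \<Omega>" for z \<zeta>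
      using c[OF that(2)] that w by (metis add_left_cancel)
    then show ?thesis by blast
  qed simp
  then obtain c4 where c4: "\<And>z \<zeta>. z \<in> \<Omega> \<Longrightarrow> \<zeta> \<in> \<Omega> \<Longrightarrow> \<Lambda> z \<zeta> = LX z - LY z + (MY \<zeta> - MX \<zeta>) + c4" by blast
  define k where "k = c1 - cnj c1 - c2 + c3 - c4"
  have \<tau>: "scoord z - cnj (scoord \<zeta>) = \<Lambda> z \<zeta> + k" if "z \<in> \<Omega>" "\<zeta> \<in> \<Omega>" for z \<zeta>
    using that by (simp add: c1 c4 c2 c3 k_def)
  have hol: "F r \<theta> (Suc j) holomorphic_on UNIV" by (rule F_holomorphic)
  obtain Q where Q: "Q \<noteq> 0" "int (degree Q) = zorder (F r \<theta> (Suc j)) \<xi> - 1"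
      "\<And>c. residue (\<lambda>w. exp (c * w) / F r \<theta> (Suc j) w) \<xi> = exp (c * \<xi>) * poly Q c"
    using residue_exp_over_zero[OF hol \<xi> F_real_nz[of "Suc j" 0]] by blast
  define A where "A = of_real ((norm dd)\<^sup>2) * cc"
  define A1 where "A1 = A * exp ((\<i> * \<xi> / 2 - (of_nat j + 1) / 2) * c1)"
  define A2 where "A2 = cnj A * exp ((- (\<i> * \<xi> / 2) - (of_nat j + 1) / 2) * cnj c1)"
  define A3 where "A3 = 1 / exp ((\<i> * \<xi> / 2 + (of_nat j + 3) / 2) * c2) * exp ((\<i> * \<xi> / 2 - (of_nat j + 3) / 2) * c3)"
  define B where "B = - (\<i> / 2) / of_real (disc_moment j 1) * A1 * A2 * A3"
  have B: "B \<noteq> 0" using dd_nz cc_nz disc_moment_pos[of 1 j] by (simp add: B_def A_def A1_def A2_def A3_def)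
  define P where "P = smult B (pcompose Q [:\<i> * k / 2, \<i> / 2:])"
  have Pp: "poly P w = B * poly Q (\<i> * (w + k) / 2)" for w
    by (simp add: P_def poly_pcompose distrib_left add_divide_distrib mult.commute add.commute)
  have "degree P = degree Q" using B by (simp add: P_def degree_pcompose)
  moreover have "P \<noteq> 0"
    using B Q(1) by (simp add: P_def pcompose_eq_0_iff)
  moreover have "residue_term j \<xi> z \<zeta> =
      (wcoord z ^ j * cnj (wcoord \<zeta>) ^ j)
        / (bpow LX z (- (\<i> * \<xi> / 2) + (of_nat j + 3) / 2) * bpow MX \<zeta> (\<i> * \<xi> / 2 + (of_nat j + 3) / 2))
        * bpow LY z (- (\<i> * \<xi> / 2) - (of_nat j + 3) / 2) * bpow MY \<zeta> (\<i> * \<xi> / 2 - (of_nat j + 3) / 2)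
        * poly P (\<Lambda> z \<zeta>)" if z: "z \<in> \<Omega>" and \<zeta>: "\<zeta> \<in> \<Omega>" for z \<zeta>
  proof -
    define s t where "s = scoord z" and "t = scoord \<zeta>"
    have res: "residue (\<lambda>w. exp (\<i> * w * (s - cnj t) / 2) / F r \<theta> (Suc j) w) \<xi>
      = exp (\<i> * \<xi> / 2 * s) * exp (- (\<i> * \<xi> / 2) * cnj t) * poly Q (\<i> * (\<Lambda> z \<zeta> + k) / 2)"
    proof -
      have "residue (\<lambda>w. exp (\<i> * w * (s - cnj t) / 2) / F r \<theta> (Suc j) w) \<xi> = residue (\<lambda>w. exp (\<i> * (s - cnj t) / 2 * w) / F r \<theta> (Suc j) w) \<xi>"
        by (simp add: mult_ac)
      also have "\<dots> = exp (\<i> * (s - cnj t) / 2 * \<xi>) * poly Q (\<i> * (s - cnj t) / 2)" by (rule Q(3))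
      also have "exp (\<i> * (s - cnj t) / 2 * \<xi>) = exp (\<i> * \<xi> / 2 * s) * exp (- (\<i> * \<xi> / 2) * cnj t)"
        unfolding exp_add[symmetric] by (rule arg_cong[of _ _ exp]) (simp add: field_simps)
      finally show ?thesis using \<tau>[OF z \<zeta>] by (simp add: s_def t_def)
    qed
    have h1: "bcoord z ^ j / jac s * exp (\<i> * \<xi> / 2 * s) = A1 * (wcoord z ^ j / bpow LX z (- (\<i> * \<xi> / 2) + (of_nat j + 3) / 2) * bpow LY z (- (\<i> * \<xi> / 2) - (of_nat j + 3) / 2))"
      unfolding s_def A1_def A_def bpow_def by (rule bergman_factor_branches[OF z eL(1)[OF z] eL(2)[OF z] c1[OF z]])
    have "cnj (bcoord \<zeta> ^ j / jac t * exp (\<i> * cnj \<xi> / 2 * t)) = cnj (of_real ((norm dd)\<^sup>2) * cc * exp ((\<i> * cnj \<xi> / 2 - (of_nat j + 1) / 2) * c1)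
      * (wcoord \<zeta> ^ j / exp ((- (\<i> * cnj \<xi> / 2) + (of_nat j + 3) / 2) * LX \<zeta>) * exp ((- (\<i> * cnj \<xi> / 2) - (of_nat j + 3) / 2) * LY \<zeta>)))"
      unfolding t_def by (rule arg_cong[of _ _ cnj], rule bergman_factor_branches[OF \<zeta> eL(1)[OF \<zeta>] eL(2)[OF \<zeta>] c1[OF \<zeta>]])
    then have "cnj (bcoord \<zeta>) ^ j / cnj (jac t) * exp (- (\<i> * \<xi> / 2) * cnj t) = A2
      * (cnj (wcoord \<zeta>) ^ j / exp ((\<i> * \<xi> / 2 + (of_nat j + 3) / 2) * cnj (LX \<zeta>)) * exp ((\<i> * \<xi> / 2 - (of_nat j + 3) / 2) * cnj (LY \<zeta>)))"
      by (simp add: A2_def A_def exp_cnj add.commute)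
    also have "\<dots> = A2 * A3 * (cnj (wcoord \<zeta>) ^ j / bpow MX \<zeta> (\<i> * \<xi> / 2 + (of_nat j + 3) / 2) * bpow MY \<zeta> (\<i> * \<xi> / 2 - (of_nat j + 3) / 2))"
      unfolding c2[OF \<zeta>] c3[OF \<zeta>] distrib_left exp_add bpow_def A3_def by (simp add: mult_ac)
    finally have h2: "cnj (bcoord \<zeta>) ^ j / cnj (jac t) * exp (- (\<i> * \<xi> / 2) * cnj t)
      = A2 * A3 * (cnj (wcoord \<zeta>) ^ j / bpow MX \<zeta> (\<i> * \<xi> / 2 + (of_nat j + 3) / 2) * bpow MY \<zeta> (\<i> * \<xi> / 2 - (of_nat j + 3) / 2))" .
    have "residue_term j \<xi> z \<zeta> = - (\<i> / 2) / of_real (disc_moment j 1) * (bcoord z ^ j / jac s * exp (\<i> * \<xi> / 2 * s))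
        * (cnj (bcoord \<zeta>) ^ j / cnj (jac t) * exp (- (\<i> * \<xi> / 2) * cnj t)) * poly Q (\<i> * (\<Lambda> z \<zeta> + k) / 2)"
      unfolding residue_term_def s_def[symmetric] t_def[symmetric] res power_mult_distrib by (simp add: mult_ac)
    also have "\<dots> = (wcoord z ^ j * cnj (wcoord \<zeta>) ^ j)
        / (bpow LX z (- (\<i> * \<xi> / 2) + (of_nat j + 3) / 2) * bpow MX \<zeta> (\<i> * \<xi> / 2 + (of_nat j + 3) / 2))
        * bpow LY z (- (\<i> * \<xi> / 2) - (of_nat j + 3) / 2) * bpow MY \<zeta> (\<i> * \<xi> / 2 - (of_nat j + 3) / 2)
        * (B * poly Q (\<i> * (\<Lambda> z \<zeta> + k) / 2))"
      unfolding h1 h2 B_def by (simp add: divide_simps)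
    finally show ?thesis by (simp only: Pp)
  qed
  ultimately show ?thesis using Q(2) by (intro exI[of _ P]) simp
qed

end

section \<open>Tangent points and the expansion\<close>

lemma herm_inner: "inner v w = Re (herm v w)"
  by (simp add: inner_vec_def UNIV_2 herm_def inner_complex_def)

lemma max_complex_subspace_sphere: "max_complex_subspace (tangent_space_sphere c x) = {v. herm v (x - c) = 0}"
proof -
  have "((\<lambda>y. (norm (y - c))\<^sup>2) has_derivative (\<lambda>v. 2 * inner v (x - c))) (at x)"
    unfolding power2_norm_eq_inner by (auto intro!: derivative_eq_intros simp: inner_commute)
  then have "frechet_derivative (\<lambda>y. (norm (y - c))\<^sup>2) (at x) = (\<lambda>v. 2 * inner v (x - c))"
    by (rule frechet_derivative_at[symmetric])
  then have "tangent_space_sphere c x = {v. Re (herm v (x - c)) = 0}"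
    by (simp add: tangent_space_sphere_def herm_inner)
  then show ?thesis by (auto simp: max_complex_subspace_def herm_scale complex_eq_iff)
qed

text \<open>The complex tangent spaces are the orthogonal complements of \<open>q\<close> and \<open>q - a\<close>; they coincide only if these
  vectors are proportional.\<close>

lemma complex_tangent_point_collinear:
  assumes "complex_tangent_point 0 1 a r q"
  obtains \<mu> where "q - a = \<mu> *s q" "norm \<mu> = r" "norm q = 1"
proof -
  have q1: "norm q = 1" and qr: "norm (q - a) = r"
    and e: "{v. herm v (q - 0) = 0} = {v. herm v (q - a) = 0}"
    using assms by (auto simp: complex_tangent_point_def max_complex_subspace_sphere dist_norm norm_minus_commute)
  define w where "w = q - a"
  define v :: "complex ^ 2" where "v = vector [cnj (q $ 2), - cnj (q $ 1)]"
  have "herm v q = 0" by (simp add: v_def herm_def)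
  then have "herm v w = 0" using e by (auto simp: w_def)
  then have "cnj (q $ 2 * w $ 1 - q $ 1 * w $ 2) = 0" by (simp add: v_def herm_def)
  then have c: "q $ 2 * w $ 1 = q $ 1 * w $ 2" by (metis complex_cnj_zero_iff eq_iff_diff_eq_0)
  have "(norm (q $ 1))\<^sup>2 + (norm (q $ 2))\<^sup>2 = 1" using norm_vec2[of q] q1 by simp
  then have u: "q $ 1 * cnj (q $ 1) + q $ 2 * cnj (q $ 2) = 1"
    by (metis complex_norm_square of_real_1 of_real_add)
  have "w $ 1 = (w $ 1 * cnj (q $ 1) + w $ 2 * cnj (q $ 2)) * q $ 1"
    using c arg_cong[OF u, of "\<lambda>x. w $ 1 * x"] by algebra
  moreover have "w $ 2 = (w $ 1 * cnj (q $ 1) + w $ 2 * cnj (q $ 2)) * q $ 2"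
    using c arg_cong[OF u, of "\<lambda>x. w $ 2 * x"] by algebra
  ultimately have w: "w = (w $ 1 * cnj (q $ 1) + w $ 2 * cnj (q $ 2)) *s q" (is "_ = ?m *s q")
    unfolding vec_eq_iff forall_2 vector_smult_component by (rule conjI)
  have "norm (m *s q) = norm m" for m
  proof -
    have "(norm (m *s q))\<^sup>2 = (norm m)\<^sup>2 * ((norm (q $ 1))\<^sup>2 + (norm (q $ 2))\<^sup>2)"
      by (simp add: norm_vec2 norm_mult power_mult_distrib algebra_simps)
    then show ?thesis using \<open>(norm (q $ 1))\<^sup>2 + (norm (q $ 2))\<^sup>2 = 1\<close> by simp
  qed
  then have "norm ?m = r" using w qr by (metis w_def)
  then show ?thesis using that[of ?m] w q1 unfolding w_def by blast
qed

theorem theorem4p1: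
  fixes a p q :: "complex ^ 2" and r \<theta> h :: real
    and \<Omega> :: "(complex ^ 2) set"
    and K :: "complex ^ 2 \<Rightarrow> complex ^ 2 \<Rightarrow> complex"
    and X Y L\<^sub>X L\<^sub>Y M\<^sub>X M\<^sub>Y :: "complex ^ 2 \<Rightarrow> complex"
    and \<Lambda> :: "complex ^ 2 \<Rightarrow> complex ^ 2 \<Rightarrow> complex"
  assumes r_pos: "r > 0"
    and boundaries_meet: "sphere 0 1 \<inter> sphere a r \<noteq> {}"
    and transversal: "transversal_spheres 0 1 a r"
    and \<Omega>_def: "\<Omega> = ball 0 1 \<inter> ball a r"
    and q_tangent: "complex_tangent_point 0 1 a r q"
    and p_tangent: "complex_tangent_point 0 1 a r p"
    and p_other: "p \<noteq> q"
    and \<theta>_range: "- pi < \<theta>" "\<theta> < pi" "\<theta> \<noteq> 0"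
    and \<theta>_def: "p - a = (of_real r * exp (\<i> * of_real \<theta>)) *s p"
    and h_pos: "h > 0"
    and h_line: "\<And>(x::real) j. F r \<theta> (j + 1) (- of_real x - \<i> * of_real h) \<noteq> 0"
    and kernel: "is_bergman_kernel \<Omega> K"
    and X_def: "\<And>z. X z = herm (z - q) a"
    and Y_def: "\<And>z. Y z = herm (z - q) a - 2 * \<i> * of_real (r * sin \<theta>)"
    and branch_X: "hol_log_branch \<Omega> X L\<^sub>X"
    and branch_Y: "hol_log_branch \<Omega> Y L\<^sub>Y"
    and branch_cnj_X: "antihol_log_branch \<Omega> (\<lambda>\<zeta>. cnj (X \<zeta>)) M\<^sub>X"
    and branch_cnj_Y: "antihol_log_branch \<Omega> (\<lambda>\<zeta>. cnj (Y \<zeta>)) M\<^sub>Y"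
    and branch_quot_z: "\<And>\<zeta>. \<zeta> \<in> \<Omega> \<Longrightarrow>
          hol_log_branch \<Omega> (\<lambda>z. (X z * cnj (Y \<zeta>)) / (cnj (X \<zeta>) * Y z)) (\<lambda>z. \<Lambda> z \<zeta>)"
    and branch_quot_\<zeta>: "\<And>z. z \<in> \<Omega> \<Longrightarrow>
          antihol_log_branch \<Omega> (\<lambda>\<zeta>. (X z * cnj (Y \<zeta>)) / (cnj (X \<zeta>) * Y z)) (\<lambda>\<zeta>. \<Lambda> z \<zeta>)"
  shows "finite (strip_zeros r \<theta> h) \<and>
    (\<exists>P :: nat \<Rightarrow> complex \<Rightarrow> complex poly.
      (\<forall>(j, \<xi>) \<in> strip_zeros r \<theta> h.
          P j \<xi> \<noteq> 0 \<and> int (degree (P j \<xi>)) = zorder (F r \<theta> (j + 1)) \<xi> - 1) \<and>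
      (\<forall>C. compact C \<and> C \<subseteq> \<Omega> \<longrightarrow>
        (\<exists>M::real. \<forall>\<^sub>F z in at q within \<Omega>. \<forall>\<zeta>\<in>C.
          norm (K z \<zeta> -
            (\<Sum>(j, \<xi>) \<in> strip_zeros r \<theta> h.
                (herm (z - q) (tconj a) ^ j * cnj (herm (\<zeta> - q) (tconj a)) ^ j)
                / (bpow L\<^sub>X z (- (\<i> * \<xi> / 2) + (of_nat j + 3) / 2)
                   * bpow M\<^sub>X \<zeta> (\<i> * \<xi> / 2 + (of_nat j + 3) / 2))
                * bpow L\<^sub>Y z (- (\<i> * \<xi> / 2) - (of_nat j + 3) / 2)
                * bpow M\<^sub>Y \<zeta> (\<i> * \<xi> / 2 - (of_nat j + 3) / 2)
                * poly (P j \<xi>) (\<Lambda> z \<zeta>)))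
          \<le> M * norm (herm (z - q) a) powr ((h - 3) / 2))))"
proof -
  \<comment> \<open>The numbers \<open>\<mu>\<close> and \<open>1 - d\<close> give \<open>q - a\<close> and \<open>p - a\<close> as multiples of \<open>q\<close> and \<open>p\<close>. Comparing norms they agree up to conjugation, and equality would force \<open>p = q\<close>.\<close>
  obtain \<mu> where \<mu>: "q - a = \<mu> *s q" "norm \<mu> = r" and q1: "norm q = 1"
    using complex_tangent_point_collinear[OF q_tangent] .
  define d where "d = 1 - of_real r * exp (\<i> * of_real \<theta>)"
  have sin0: "sin \<theta> \<noteq> 0" using \<theta>_range by (metis abs_less_iff minus_less_iff sin_eq_0_pi)
  have Im_d: "Im d = - (r * sin \<theta>)" by (simp add: d_def Im_exp)
  have d0: "d \<noteq> 0" using Im_d sin0 r_pos by auto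
  have ap: "a = d *s p" using \<theta>_def by (simp add: d_def algebra_simps)
  have aq: "a = (1 - \<mu>) *s q" using \<mu>(1) by (simp add: algebra_simps)
  have p1: "norm p = 1" using complex_tangent_point_collinear[OF p_tangent] by blast
  have norm_smult: "norm (m *s (v :: complex ^ 2)) = norm m * norm v" for m v
  proof -
    have "(norm (m *s v))\<^sup>2 = (norm m * norm v)\<^sup>2"
      by (simp add: norm_vec2 norm_mult power_mult_distrib algebra_simps)
    then show ?thesis by simp
  qed
  have n1: "norm (1 - \<mu>) = norm d" using ap aq p1 q1 norm_smult by (metis mult.right_neutral)
  have n2: "norm \<mu> = norm (1 - d)" using \<mu>(2) r_pos by (simp add: d_def norm_mult)
  have re: "Re \<mu> = 1 - Re d" and im: "(Im \<mu>)\<^sup>2 = (Im d)\<^sup>2"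
  proof -
    have "(norm (1 - \<mu>))\<^sup>2 = (norm d)\<^sup>2" "(norm \<mu>)\<^sup>2 = (norm (1 - d))\<^sup>2" using n1 n2 by simp_all
    then have e: "(1 - Re \<mu>)\<^sup>2 + (Im \<mu>)\<^sup>2 = (Re d)\<^sup>2 + (Im d)\<^sup>2" "(Re \<mu>)\<^sup>2 + (Im \<mu>)\<^sup>2 = (1 - Re d)\<^sup>2 + (Im d)\<^sup>2"
      unfolding cmod_power2 by simp_all
    then show "Re \<mu> = 1 - Re d" by (simp add: power2_eq_square algebra_simps)
    with e(2) show "(Im \<mu>)\<^sup>2 = (Im d)\<^sup>2" by simp
  qed
  have "\<mu> \<noteq> 1 - d"
  proof
    assume "\<mu> = 1 - d"
    then have "1 - \<mu> = d" by simp
    then have "d *s p = d *s q" using ap aq by metis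
    then have "p = q" using d0 by auto
    then show False using p_other by contradiction
  qed
  then have "Im \<mu> = Im d" using re im by (auto simp: complex_eq_iff power2_eq_iff)
  then have "1 - \<mu> = cnj d" using re by (simp add: complex_eq_iff)
  then have a_eq: "a = cnj (1 - of_real r * exp (\<i> * of_real \<theta>)) *s q" using aq by (simp add: d_def)
  interpret lens: lens_domain r \<theta> a q
    by unfold_locales (use r_pos \<theta>_range q1 a_eq in auto)
  have O: "lens.\<Omega> = \<Omega>" unfolding lens.\<Omega>_def \<Omega>_def ..
  have X: "X = lens.xcoord" by (rule ext) (simp add: X_def lens.xcoord_def)
  have Y: "Y = (\<lambda>z. lens.xcoord z - lens.cc)" by (rule ext) (simp add: Y_def lens.xcoord_def lens.cc_def)
  have nz: "F r \<theta> (Suc j) (of_real x - \<i> * of_real h) \<noteq> 0" for x :: real and j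
    using h_line[of j "- x"] by simp
  define T where "T = (\<lambda>P j \<xi> z \<zeta>. (herm (z - q) (tconj a) ^ j * cnj (herm (\<zeta> - q) (tconj a)) ^ j)
      / (bpow L\<^sub>X z (- (\<i> * \<xi> / 2) + (of_nat j + 3) / 2) * bpow M\<^sub>X \<zeta> (\<i> * \<xi> / 2 + (of_nat j + 3) / 2))
      * bpow L\<^sub>Y z (- (\<i> * \<xi> / 2) - (of_nat j + 3) / 2) * bpow M\<^sub>Y \<zeta> (\<i> * \<xi> / 2 - (of_nat j + 3) / 2)
      * poly P (\<Lambda> z \<zeta>))"
  have "F r \<theta> (Suc j) \<xi> = 0 \<longrightarrow> (\<exists>P. P \<noteq> 0 \<and> int (degree P) = zorder (F r \<theta> (Suc j)) \<xi> - 1 \<and>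
      (\<forall>z\<in>\<Omega>. \<forall>\<zeta>\<in>\<Omega>. lens.residue_term j \<xi> z \<zeta> = T P j \<xi> z \<zeta>))" for j \<xi>
    unfolding T_def lens.wcoord_def[symmetric]
    by (rule impI, rule lens.residue_term_branches[unfolded O, OF branch_X[unfolded X] branch_Y[unfolded Y] branch_cnj_X[unfolded X]
        branch_cnj_Y[unfolded Y] branch_quot_z[unfolded X Y] branch_quot_\<zeta>[unfolded X Y]])
  then obtain P where P: "\<And>j \<xi>. F r \<theta> (Suc j) \<xi> = 0 \<Longrightarrow> P j \<xi> \<noteq> 0 \<and> int (degree (P j \<xi>)) = zorder (F r \<theta> (Suc j)) \<xi> - 1 \<and>
      (\<forall>z\<in>\<Omega>. \<forall>\<zeta>\<in>\<Omega>. lens.residue_term j \<xi> z \<zeta> = T (P j \<xi>) j \<xi> z \<zeta>)" by metis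
  have S: "(\<Sum>(j, \<xi>) \<in> strip_zeros r \<theta> h. T (P j \<xi>) j \<xi> z \<zeta>) = (\<Sum>(j, \<xi>) \<in> strip_zeros r \<theta> h. lens.residue_term j \<xi> z \<zeta>)"
    if "z \<in> \<Omega>" "\<zeta> \<in> \<Omega>" for z \<zeta>
    by (rule sum.cong[OF refl]) (use P that in \<open>auto simp: strip_zeros_def\<close>)
  have "finite (strip_zeros r \<theta> h) \<and>
    (\<exists>P. (\<forall>(j, \<xi>) \<in> strip_zeros r \<theta> h. P j \<xi> \<noteq> 0 \<and> int (degree (P j \<xi>)) = zorder (F r \<theta> (j + 1)) \<xi> - 1) \<and>
      (\<forall>C. compact C \<and> C \<subseteq> \<Omega> \<longrightarrow> (\<exists>M::real. \<forall>\<^sub>F z in at q within \<Omega>. \<forall>\<zeta>\<in>C.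
        norm (K z \<zeta> - (\<Sum>(j, \<xi>) \<in> strip_zeros r \<theta> h. T (P j \<xi>) j \<xi> z \<zeta>)) \<le> M * norm (herm (z - q) a) powr ((h - 3) / 2))))"
  proof (intro conjI exI[of _ P] allI impI)
    show "finite (strip_zeros r \<theta> h)" using h_pos by (intro lens.finite_strip_zeros) simp
    show "\<forall>(j, \<xi>)\<in>strip_zeros r \<theta> h. P j \<xi> \<noteq> 0 \<and> int (degree (P j \<xi>)) = zorder (F r \<theta> (j + 1)) \<xi> - 1"
      using P by (auto simp: strip_zeros_def)
    fix C assume "compact C \<and> C \<subseteq> \<Omega>"
    then have C: "compact C" "C \<subseteq> \<Omega>" by auto
    obtain M where M: "0 < M" "\<And>z \<zeta>. z \<in> \<Omega> \<Longrightarrow> \<zeta> \<in> C \<Longrightarrow> norm (K z \<zeta> - (\<Sum>(j, \<xi>) \<in> strip_zeros r \<theta> h. lens.residue_term j \<xi> z \<zeta>))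
        \<le> M * exp (h * Re (lens.scoord z) / 2) / norm (lens.jac (lens.scoord z))"
      using lens.kernel_remainder_bound[unfolded O, OF kernel h_pos nz C] by blast
    obtain M' where M': "0 < M'" "\<forall>\<^sub>F z in at q within \<Omega>. exp (h * Re (lens.scoord z) / 2) / norm (lens.jac (lens.scoord z))
        \<le> M' * norm (lens.xcoord z) powr ((h - 3) / 2)"
      using lens.remainder_growth[unfolded O, OF h_pos] by blast
    have "\<forall>\<^sub>F z in at q within \<Omega>. z \<in> \<Omega>" by (simp add: eventually_at_filter)
    with M'(2) have "\<forall>\<^sub>F z in at q within \<Omega>. \<forall>\<zeta>\<in>C. norm (K z \<zeta> - (\<Sum>(j, \<xi>) \<in> strip_zeros r \<theta> h. T (P j \<xi>) j \<xi> z \<zeta>))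
        \<le> M * M' * norm (herm (z - q) a) powr ((h - 3) / 2)"
    proof (eventually_elim, intro ballI)
      fix z \<zeta> assume g: "exp (h * Re (lens.scoord z) / 2) / norm (lens.jac (lens.scoord z)) \<le> M' * norm (lens.xcoord z) powr ((h - 3) / 2)"
        and z: "z \<in> \<Omega>" and \<zeta>: "\<zeta> \<in> C"
      have "norm (K z \<zeta> - (\<Sum>(j, \<xi>) \<in> strip_zeros r \<theta> h. T (P j \<xi>) j \<xi> z \<zeta>))
          \<le> M * (exp (h * Re (lens.scoord z) / 2) / norm (lens.jac (lens.scoord z)))"
        using M(2)[OF z \<zeta>] S[OF z, of \<zeta>] \<zeta> C(2) by auto
      also have "\<dots> \<le> M * (M' * norm (lens.xcoord z) powr ((h - 3) / 2))" using g M(1) by (intro mult_left_mono) auto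
      finally show "norm (K z \<zeta> - (\<Sum>(j, \<xi>) \<in> strip_zeros r \<theta> h. T (P j \<xi>) j \<xi> z \<zeta>)) \<le> M * M' * norm (herm (z - q) a) powr ((h - 3) / 2)"
        by (simp add: lens.xcoord_def mult.assoc)
    qed
    then show "\<exists>M. \<forall>\<^sub>F z in at q within \<Omega>. \<forall>\<zeta>\<in>C. norm (K z \<zeta> - (\<Sum>(j, \<xi>) \<in> strip_zeros r \<theta> h. T (P j \<xi>) j \<xi> z \<zeta>))
        \<le> M * norm (herm (z - q) a) powr ((h - 3) / 2)" by blast
  qed
  then show ?thesis unfolding T_def .
qed

end
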